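(* Let $0\le r\le p+1$. Let $P_{\mathcal V}=\prod_{\mathrm v\in\mathcal V}P_{\mathrm v}$ and $P_{\mathcal E}=\prod_{\mathrm e\in\mathcal E}P_{\mathrm e}$ be the products (compositions, in any order) of the local vertex-conforming projections $P_{\mathrm v}$ and of the local edge-conforming projections $P_{\mathrm e}$ built with moment order $r$, as defined in the context. Then the operator $$P^0 = P_{\mathcal E}P_{\mathcal V}: V^0_{\mathrm{pw}}\to V^0_{\mathrm{pw}}$$ is a projection onto the conforming space $V^0_h=V^0_{\mathrm{pw}}\cap H^1(\Omega)$, and it is moment-preserving of order $r$.
   Context: **Multipatch domain.** $\Omega\subset\mathbb R^2$ is an open bounded domain with Lipschitz boundary, $\Omega=\mathrm{int}\big(\bigcup_{k\in\mathcal K}\overline{\Omega_k}\big)$, $\mathcal K=\{1,\dots,K\}$, with patches $\Omega_k=F_k(\hat\Omega)$, $\hat\Omega=(0,1)^2$, where $F_k$ is a $C^1$-diffeomorphism (up to the boundary). The patches have pairwise disjoint interiors and are geometrically conforming: for $k_1\ne k_2$, $\overline{\Omega_{k_1}}\cap\overline{\Omega_{k_2}}$ is empty, a common vertex, or one complete common patch edge. Patch edges and vertices are the images under $F_k$ of the sides and corners of $[0,1]^2$; $\mathcal E$ and $\mathcal V$ are the sets of all patch edges and vertices. $\mathcal K(\mathrm e)=\{k:\mathrm e\subset\partial\Omega_k\}$, $\mathcal K(\mathrm v)=\{k:\mathrm v\in\partial\Omega_k\}$. An edge is interior if $\#\mathcal K(\mathrm e)=2$, otherwise a boundary edge. **Splines.**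 For each $k$, $\mathbb V^0_k$ is the space of splines on $[0,1]$ of degree $p\ge1$ with clamped knot vector $\Xi_k=(\xi^k_i)_{i=0}^{n_k+1+p}$ (end knots $0$ and $1$ of multiplicity $p+1$, interior distinct knots of multiplicity $m$, $1\le m\le p$, distinct knots uniformly spaced), so $\dim\mathbb V^0_k=n_k+1$, with B-spline basis $\lambda^k_0,\dots,\lambda^k_{n_k}$, which satisfies $\lambda^k_i(0)=\delta_{i,0}$, $\lambda^k_i(1)=\delta_{i,n_k}$. Set $\hat V^0_k=\mathbb V^0_k\otimes\mathbb V^0_k$, $\hat\Lambda^k_{\boldsymbol i}(\hat x)=\lambda^k_{i_1}(\hat x_1)\lambda^k_{i_2}(\hat x_2)$ for $\boldsymbol i\in\{0,\dots,n_k\}^2$, $\mathcal F^0_k(\hat\phi)=\hat\phi\circ F_k^{-1}$, $V^0_k=\mathcal F^0_k(\hat V^0_k)$. The broken space is $V^0_{\mathrm{pw}}=\{v\in L^2(\Omega):v|_{\Omega_k}\in V^0_k\ \forall k\in\mathcal K\}$, with basis $\Lambda^k_{\boldsymbol i}=\mathcal F^0_k(\hat\Lambda^k_{\boldsymbol i})$ on $\Omega_k$ and $0$ elsewhere. **Standing assumptions.** (i) $n_k>p+1$ for all $k$. (ii) $p$ and $m$ are the same on all patches, and each interior edge $\mathrm e$ is shared by two patches $\mathcal K(\mathrm e)=\{k^-,k^+\}$ (coarse, fine) such that every interval between consecutive distinct knots of $\Xi_{k^-}$ is subdivided into the same number of equal subintervals by the distinct knots of $\Xi_{k^+}$; hence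 $\mathbb V^0_{k^-}\subset\mathbb V^0_{k^+}$. **Moment preservation.** An operator $P:V^0_{\mathrm{pw}}\to V^0_{\mathrm{pw}}$ is moment-preserving of order $r\ge0$ if for all $u\in V^0_{\mathrm{pw}}$, $k\in\mathcal K$ and all polynomials $q\in\mathbb Q_{r-1,r-1}$ (degree $\le r-1$ in each variable) on $\hat\Omega$, $\int_{\hat\Omega}(\mathcal F^0_k)^{-1}((Pu)|_{\Omega_k})\,q=\int_{\hat\Omega}(\mathcal F^0_k)^{-1}(u|_{\Omega_k})\,q$. For $r=0$ the condition is empty. **Correction coefficients.** Let $\gamma^{1d}=(M^k)^{-1}b^k\in\mathbb R^r$ with $M^k=(\int_0^1\lambda^k_mq_j)_{1\le j,m\le r}$, $b^k=(\int_0^1\lambda^k_0q_j)_{1\le j\le r}$, $(q_j)_{j=1}^r$ a basis of the univariate polynomials of degree $\le r-1$; equivalently $\sum_{m=1}^r\gamma^{1d}_m\int_0^1\lambda^k_mq=\int_0^1\lambda^k_0q$ for all such $q$. Throughout, $\gamma^{1d}$ is taken to be the same vector for any two patches sharing a vertex, so $k$ is dropped. Set $\gamma_{\boldsymbol m}=\gamma^{1d}_{m_1}\gamma^{1d}_{m_2}$. If $r=0$ all sums over $1\le m\le r$ are empty. **Vertex operator.** Fix $\mathrm v\in\mathcal V$. On each $k\in\mathcal K(\mathrm v)$ index the basis functions (reversing $i_a\mapsto n_k-i_a$ where needed) so that $\Lambda^k_{\boldsymbol 0}$ is the one nonvanishing at $\mathrm v$. Let $\bar\Lambda^{\mathrm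 v}=\frac1{\#\mathcal K(\mathrm v)}\sum_{k'\in\mathcal K(\mathrm v)}\Lambda^{k'}_{\boldsymbol0}$. The linear operator $P_{\mathrm v}:V^0_{\mathrm{pw}}\to V^0_{\mathrm{pw}}$ maps, for $k\in\mathcal K(\mathrm v)$, $$\Lambda^k_{\boldsymbol0}\mapsto\bar\Lambda^{\mathrm v}+\sum_{m_1,m_2=1}^r\gamma_{\boldsymbol m}\Big(\Lambda^k_{\boldsymbol m}-\frac1{\#\mathcal K(\mathrm v)}\sum_{k'\in\mathcal K(\mathrm v)}\Lambda^{k'}_{\boldsymbol m}\Big),$$ and leaves all other basis functions unchanged. **Edge-local notation.** Fix an interior edge $\mathrm e$; write $\pm$ for $k^\pm$. Let $\Omega(\mathrm e)=\mathrm{int}(\overline{\Omega_-}\cup\overline{\Omega_+})$. There is a homeomorphism $F_{\mathrm e}:[0,1]\times[-1,1]\to\overline{\Omega(\mathrm e)}$, mapping $[0,1]\times\{0\}$ onto $\mathrm e$, whose restrictions to $[0,1]\times[-1,0]$ and $[0,1]\times[0,1]$ coincide with $F_{k^-}$ and $F_{k^+}$ up to affine coordinate changes (swaps, reflections, translations of the unit square). Coordinates are $(\hat x_\parallel,\hat x_\perp)$. Basis functions on $\Omega_\pm$ are re-indexed accordingly by $(j_1,j_2)$, $j_1$ parallel to the edge (same direction on both patches) and $j_2$ perpendicular with $j_2=0$ on the edge. Let $\lambda^-_{\perp,i}(\hat x_\perp)=\lambda^-_i(-\hat x_\perp)$ on $[-1,0]$ and $0$ on $(0,1]$; $\lambda^+_{\perp,i}(\hat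 x_\perp)=\lambda^+_i(\hat x_\perp)$ on $(0,1]$ and $0$ on $[-1,0]$. Then $\Lambda^\pm_{(j_1,j_2)}=\mathcal F^0_{\mathrm e}(\lambda^\pm_{j_1}\otimes\lambda^\pm_{\perp,j_2})$, with $\mathcal F^0_{\mathrm e}(\hat\phi)=\hat\phi\circ F_{\mathrm e}^{-1}$ patch-wise on $\Omega(\mathrm e)$, extended by $0$. Put $\bar\lambda^{\mathrm e}_\perp=\frac12(\lambda^-_{\perp,0}+\lambda^+_{\perp,0})$ and $C^{\mathrm e}=\frac12\sum_{m=1}^r\gamma^{1d}_m(\lambda^-_{\perp,m}-\lambda^+_{\perp,m})$. **Restriction.** Write $\hat\phi_i$ for the B-spline coefficients of $\hat\phi$ in the space under consideration. $\mathscr R:\mathbb V^0_+\to\mathbb V^0_-$ is $\mathscr R\hat\phi=\hat\phi_0\lambda^-_0+\hat\phi_{n_+}\lambda^-_{n_-}+\tilde{\mathcal T}\tilde{\mathscr R}\mathcal T\hat\phi$, where $\mathcal T\hat\phi=\hat\phi-\hat\phi_0\lambda^-_0-\hat\phi_{n_+}\lambda^-_{n_-}$ (for $\hat\phi\in\mathbb V^0_+$), $\tilde{\mathscr R}$ is the $L^2(0,1)$-projection onto $\mathbb V^0_-$, and for $\hat\phi\in\mathbb V^0_-$, $\tilde{\mathcal T}\hat\phi=\hat\phi-\hat\phi_0\lambda^-_0-\hat\phi_{n_-}\lambda^-_{n_-}+\hat\phi_0\sum_{i=1}^r\gamma^{1d}_i\lambda^-_i+\hat\phi_{n_-}\sum_{i=n_--r}^{n_--1}\gamma^{1d}_{n_--i}\lambda^-_i$.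 **Vertex splines.** For the vertex $\mathrm v$ of $\mathrm e$ at $j_1=0$: $\mu^+_{\mathrm v}=\sum_{m=1}^r\gamma^{1d}_m\lambda^+_m$, $\mu^-_{\mathrm v}=\lambda^-_0+\mathscr R(\mu^+_{\mathrm v}-\lambda^+_0)$. For the vertex at $j_1=n_\pm$: $\mu^+_{\mathrm v}=\sum_{m=1}^r\gamma^{1d}_m\lambda^+_{n_+-m}$, $\mu^-_{\mathrm v}=\lambda^-_{n_-}+\mathscr R(\mu^+_{\mathrm v}-\lambda^+_{n_+})$. **Edge operator.** $P_{\mathrm e}:V^0_{\mathrm{pw}}\to V^0_{\mathrm{pw}}$ is linear and maps - $\Lambda^-_{(j_1,0)}\mapsto\mathcal F^0_{\mathrm e}(\lambda^-_{j_1}\otimes(\bar\lambda^{\mathrm e}_\perp+C^{\mathrm e}))$ for $0<j_1<n_-$; - $\Lambda^-_{(j_1,0)}\mapsto\mathcal F^0_{\mathrm e}(\lambda^-_{j_1}\otimes\bar\lambda^{\mathrm e}_\perp+\mu^-_{\mathrm v}\otimes C^{\mathrm e})$ for $j_1\in\{0,n_-\}$, $\mathrm v$ the corresponding vertex; - $\Lambda^+_{(j_1,0)}\mapsto\mathcal F^0_{\mathrm e}(\mathscr R\lambda^+_{j_1}\otimes(\bar\lambda^{\mathrm e}_\perp-C^{\mathrm e}))$ for $0<j_1<n_+$; - $\Lambda^+_{(j_1,0)}\mapsto\mathcal F^0_{\mathrm e}(\mathscr R\lambda^+_{j_1}\otimes\bar\lambda^{\mathrm e}_\perp-\mathscr R\mu^+_{\mathrm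 v}\otimes C^{\mathrm e})$ for $j_1\in\{0,n_+\}$, $\mathrm v$ the corresponding vertex; - all other basis functions (on any patch) to themselves. For a boundary edge $\mathrm e$, $P_{\mathrm e}$ is the identity. *)

theory Defs
  imports "HOL-Analysis.Analysis" "HOL-Computational_Algebra.Polynomial"
begin

section \<open>Sobolev space and domains in the plane\<close>

definition L2_on :: "(real \<times> real) set \<Rightarrow> (real \<times> real \<Rightarrow> real) set" where
  "L2_on S = {u. set_borel_measurable lebesgue S u \<and> set_integrable lebesgue S (\<lambda>x. (u x)\<^sup>2)}"

primrec Ck :: "nat \<Rightarrow> ('a::euclidean_space \<Rightarrow> real) \<Rightarrow> bool" where
  "Ck 0 f \<longleftrightarrow> continuous_on UNIV f"
| "Ck (Suc n) f \<longleftrightarrow> (\<forall>x. f differentiable at x) \<and>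
     (\<forall>b\<in>Basis. Ck n (\<lambda>x. frechet_derivative f (at x) b))"

definition test_functions :: "(real \<times> real) set \<Rightarrow> (real \<times> real \<Rightarrow> real) set" where
  "test_functions S = {\<phi>. (\<forall>n. Ck n \<phi>) \<and> (\<exists>C. compact C \<and> C \<subseteq> S \<and> (\<forall>x. x \<notin> C \<longrightarrow> \<phi> x = 0))}"

definition weak_partial ::
    "(real \<times> real) set \<Rightarrow> real \<times> real \<Rightarrow> (real \<times> real \<Rightarrow> real) \<Rightarrow> (real \<times> real \<Rightarrow> real) \<Rightarrow> bool" where
  "weak_partial S b u g \<longleftrightarrow> (\<forall>\<phi>\<in>test_functions S.
     (LINT x:S|lebesgue. u x * frechet_derivative \<phi> (at x) b) = - (LINT x:S|lebesgue. g x * \<phi> x))"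

definition H1_on :: "(real \<times> real) set \<Rightarrow> (real \<times> real \<Rightarrow> real) set" where
  "H1_on S = {u \<in> L2_on S. \<forall>b\<in>Basis. \<exists>g\<in>L2_on S. weak_partial S b u g}"

text \<open>Locally, after an orthogonal change of coordinates, the domain is the strict epigraph of a
  Lipschitz function (so it lies on one side of its boundary).\<close>

definition lipschitz_boundary :: "(real \<times> real) set \<Rightarrow> bool" where
  "lipschitz_boundary S \<longleftrightarrow> (\<forall>x\<in>frontier S. \<exists>U (T :: real \<times> real \<Rightarrow> real \<times> real) (\<psi> :: real \<Rightarrow> real) L.
     open U \<and> x \<in> U \<and> orthogonal_transformation T \<and> L-lipschitz_on UNIV \<psi> \<and>
     S \<inter> U = {y \<in> U. snd (T y) > \<psi> (fst (T y))})"

definition C1_on :: "(real \<times> real) set \<Rightarrow> (real \<times> real \<Rightarrow> real \<times> real) \<Rightarrow> bool" where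
  "C1_on S f \<longleftrightarrow> (\<exists>f' :: real \<times> real \<Rightarrow> (real \<times> real) \<Rightarrow>\<^sub>L (real \<times> real).
     (\<forall>x\<in>S. (f has_derivative blinfun_apply (f' x)) (at x within S)) \<and> continuous_on S f')"

definition C1_diffeo_on :: "(real \<times> real) set \<Rightarrow> (real \<times> real \<Rightarrow> real \<times> real) \<Rightarrow> bool" where
  "C1_diffeo_on S f \<longleftrightarrow> inj_on f S \<and> C1_on S f \<and> C1_on (f ` S) (inv_into S f)"


section \<open>Multipatch data\<close>

text \<open>Patches are numbered \<open>1, \<dots>, npatch\<close>. The degree and the interior knot multiplicity are the same
  on all patches; as the distinct knots are uniformly spaced, the knot vector of patch \<open>k\<close> is
  determined by its number \<open>nint k\<close> of knot intervals.\<close>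

record multipatch =
  npatch :: nat
  geo :: "nat \<Rightarrow> real \<times> real \<Rightarrow> real \<times> real"
  sdeg :: nat
  mult :: nat
  nint :: "nat \<Rightarrow> nat"

definition sq_open :: "(real \<times> real) set" where
  "sq_open = {0<..<1} \<times> {0<..<1}"

definition sq_closed :: "(real \<times> real) set" where
  "sq_closed = {0..1} \<times> {0..1}"

definition patches :: "multipatch \<Rightarrow> nat set" where
  "patches D = {1..npatch D}"

definition patch :: "multipatch \<Rightarrow> nat \<Rightarrow> (real \<times> real) set" where
  "patch D k = geo D k ` sq_open"

definition Omega :: "multipatch \<Rightarrow> (real \<times> real) set" where
  "Omega D = interior (\<Union>k\<in>patches D. closure (patch D k))"

definition patch_edges :: "multipatch \<Rightarrow> nat \<Rightarrow> (real \<times> real) set set" where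
  "patch_edges D k = (`) (geo D k) ` {{0} \<times> {0..1}, {1} \<times> {0..1}, {0..1} \<times> {0}, {0..1} \<times> {1}}"

definition patch_vertices :: "multipatch \<Rightarrow> nat \<Rightarrow> (real \<times> real) set" where
  "patch_vertices D k = geo D k ` ({0, 1} \<times> {0, 1})"

definition edges :: "multipatch \<Rightarrow> (real \<times> real) set set" where
  "edges D = (\<Union>k\<in>patches D. patch_edges D k)"

definition vertices :: "multipatch \<Rightarrow> (real \<times> real) set" where
  "vertices D = (\<Union>k\<in>patches D. patch_vertices D k)"

definition edge_patches :: "multipatch \<Rightarrow> (real \<times> real) set \<Rightarrow> nat set" where
  "edge_patches D e = {k \<in> patches D. e \<subseteq> frontier (patch D k)}"

definition vertex_patches :: "multipatch \<Rightarrow> real \<times> real \<Rightarrow> nat set" where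
  "vertex_patches D v = {k \<in> patches D. v \<in> frontier (patch D k)}"

definition interior_edge :: "multipatch \<Rightarrow> (real \<times> real) set \<Rightarrow> bool" where
  "interior_edge D e \<longleftrightarrow> e \<in> edges D \<and> card (edge_patches D e) = 2"

definition multipatch_domain :: "multipatch \<Rightarrow> bool" where
  "multipatch_domain D \<longleftrightarrow>
     1 \<le> npatch D \<and>
     (\<forall>k\<in>patches D. C1_diffeo_on sq_closed (geo D k)) \<and>
     open (Omega D) \<and> connected (Omega D) \<and> bounded (Omega D) \<and> lipschitz_boundary (Omega D) \<and>
     disjoint_family_on (patch D) (patches D) \<and>
     (\<forall>k1\<in>patches D. \<forall>k2\<in>patches D. k1 \<noteq> k2 \<longrightarrow>
        (let J = closure (patch D k1) \<inter> closure (patch D k2) in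
           J = {} \<or>
           (\<exists>v \<in> patch_vertices D k1 \<inter> patch_vertices D k2. J = {v}) \<or>
           J \<in> patch_edges D k1 \<inter> patch_edges D k2))"


section \<open>Splines\<close>

text \<open>Largest basis index \<open>n\<^sub>k\<close>: the knot vector has \<open>2 (p + 1) + m (N\<^sub>k - 1) = n\<^sub>k + p + 2\<close> entries.\<close>

definition nmax :: "multipatch \<Rightarrow> nat \<Rightarrow> nat" where
  "nmax D k = sdeg D + mult D * (nint D k - 1)"

definition knot :: "multipatch \<Rightarrow> nat \<Rightarrow> nat \<Rightarrow> real" where
  "knot D k i =
     (if i \<le> sdeg D then 0
      else if i \<le> nmax D k then real (1 + (i - sdeg D - 1) div mult D) / real (nint D k)
      else 1)"

text \<open>Cox-de Boor recursion. The convention \<open>0 / 0 = 0\<close> is that of division in HOL; the last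
  nonempty knot interval is closed at the right end point \<open>1\<close>. The functions vanish
  outside \<open>[0, 1]\<close>.\<close>

fun bspline :: "(nat \<Rightarrow> real) \<Rightarrow> nat \<Rightarrow> nat \<Rightarrow> real \<Rightarrow> real" where
  "bspline \<xi> 0 i x =
     (if \<xi> i \<le> x \<and> x < \<xi> (Suc i) \<or> x = 1 \<and> \<xi> i < 1 \<and> \<xi> (Suc i) = 1 then 1 else 0)"
| "bspline \<xi> (Suc q) i x =
     (x - \<xi> i) / (\<xi> (i + q + 1) - \<xi> i) * bspline \<xi> q i x +
     (\<xi> (i + q + 2) - x) / (\<xi> (i + q + 2) - \<xi> (Suc i)) * bspline \<xi> q (Suc i) x"

definition lam :: "multipatch \<Rightarrow> nat \<Rightarrow> nat \<Rightarrow> real \<Rightarrow> real" where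
  "lam D k i = bspline (knot D k) (sdeg D) i"

definition splines :: "multipatch \<Rightarrow> nat \<Rightarrow> (real \<Rightarrow> real) set" where
  "splines D k = {\<phi>. \<exists>c. \<phi> = (\<lambda>x. \<Sum>i\<le>nmax D k. c i * lam D k i x)}"

text \<open>B-spline coefficients, for a member of \<open>splines D k\<close>.\<close>

definition bcoef :: "multipatch \<Rightarrow> nat \<Rightarrow> (real \<Rightarrow> real) \<Rightarrow> nat \<Rightarrow> real" where
  "bcoef D k \<phi> = (SOME c. \<phi> = (\<lambda>x. \<Sum>i\<le>nmax D k. c i * lam D k i x))"

definition tensor :: "(real \<Rightarrow> real) \<Rightarrow> (real \<Rightarrow> real) \<Rightarrow> real \<times> real \<Rightarrow> real" (infixr "\<otimes>\<^sub>t" 75) where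
  "(f \<otimes>\<^sub>t g) x = f (fst x) * g (snd x)"

definition tensor_splines :: "multipatch \<Rightarrow> nat \<Rightarrow> (real \<times> real \<Rightarrow> real) set" where
  "tensor_splines D k = {\<phi>. \<exists>c. \<phi> = (\<lambda>x. \<Sum>i\<le>nmax D k. \<Sum>j\<le>nmax D k.
      c i j * (lam D k i \<otimes>\<^sub>t lam D k j) x)}"

definition pushfwd :: "multipatch \<Rightarrow> nat \<Rightarrow> (real \<times> real \<Rightarrow> real) \<Rightarrow> real \<times> real \<Rightarrow> real" where
  "pushfwd D k \<phi> x = (if x \<in> patch D k then \<phi> (inv_into sq_closed (geo D k) x) else 0)"

definition Lam :: "multipatch \<Rightarrow> nat \<Rightarrow> nat \<times> nat \<Rightarrow> real \<times> real \<Rightarrow> real" where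
  "Lam D k i = pushfwd D k (lam D k (fst i) \<otimes>\<^sub>t lam D k (snd i))"

text \<open>Broken space. An \<open>L\<^sup>2\<close> class in this space is represented by its unique member that
  vanishes off the (open) patches and is a mapped spline at every point of each patch.\<close>

definition Vpw :: "multipatch \<Rightarrow> (real \<times> real \<Rightarrow> real) set" where
  "Vpw D = {v \<in> L2_on (Omega D).
     (\<forall>x. x \<notin> (\<Union>k\<in>patches D. patch D k) \<longrightarrow> v x = 0) \<and>
     (\<forall>k\<in>patches D. \<exists>\<phi>\<in>tensor_splines D k. \<forall>x\<in>patch D k. v x = pushfwd D k \<phi> x)}"

definition Vh :: "multipatch \<Rightarrow> (real \<times> real \<Rightarrow> real) set" where
  "Vh D = Vpw D \<inter> H1_on (Omega D)"

definition linear_op_on :: "('a \<Rightarrow> real) set \<Rightarrow> (('a \<Rightarrow> real) \<Rightarrow> 'a \<Rightarrow> real) \<Rightarrow> bool" where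
  "linear_op_on V P \<longleftrightarrow> (\<forall>u\<in>V. P u \<in> V) \<and>
     (\<forall>u\<in>V. \<forall>v\<in>V. \<forall>a b. P (\<lambda>x. a * u x + b * v x) = (\<lambda>x. a * P u x + b * P v x))"

definition projection_onto ::
    "('a \<Rightarrow> real) set \<Rightarrow> ('a \<Rightarrow> real) set \<Rightarrow> (('a \<Rightarrow> real) \<Rightarrow> 'a \<Rightarrow> real) \<Rightarrow> bool" where
  "projection_onto V W P \<longleftrightarrow> linear_op_on V P \<and> (\<forall>u\<in>V. P (P u) = P u) \<and> P ` V = W"

text \<open>For \<open>r = 0\<close> the only \<open>q\<close> is the zero function.\<close>

definition moment_preserving ::
    "multipatch \<Rightarrow> nat \<Rightarrow> ((real \<times> real \<Rightarrow> real) \<Rightarrow> real \<times> real \<Rightarrow> real) \<Rightarrow> bool" where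
  "moment_preserving D r P \<longleftrightarrow> (\<forall>u\<in>Vpw D. \<forall>k\<in>patches D. \<forall>c :: nat \<Rightarrow> nat \<Rightarrow> real.
     let q = (\<lambda>x. \<Sum>i<r. \<Sum>j<r. c i j * fst x ^ i * snd x ^ j) in
     (LINT x:sq_open|lborel. P u (geo D k x) * q x) = (LINT x:sq_open|lborel. u (geo D k x) * q x))"

text \<open>\<open>correction_coeffs D r \<gamma>\<close>: for every patch \<open>k\<close>, the vector \<open>(\<gamma> k 1, \<dots>, \<gamma> k r)\<close> solves
  the linear system \<open>M\<^sup>k \<gamma> = b\<^sup>k\<close> (tested with all polynomials of degree at most \<open>r - 1\<close>),
  and patches sharing a vertex have the same vector.\<close>

definition correction_coeffs :: "multipatch \<Rightarrow> nat \<Rightarrow> (nat \<Rightarrow> nat \<Rightarrow> real) \<Rightarrow> bool" where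
  "correction_coeffs D r \<gamma> \<longleftrightarrow>
     (\<forall>k\<in>patches D. \<forall>q :: real poly. degree q < r \<longrightarrow>
        (\<Sum>m=1..r. \<gamma> k m * (LINT x:{0..1}|lborel. lam D k m x * poly q x)) =
        (LINT x:{0..1}|lborel. lam D k 0 x * poly q x)) \<and>
     (\<forall>v\<in>vertices D. \<forall>k\<in>vertex_patches D v. \<forall>k'\<in>vertex_patches D v. \<forall>m\<in>{1..r}. \<gamma> k m = \<gamma> k' m)"


section \<open>Vertex operators\<close>

definition vLam :: "multipatch \<Rightarrow> real \<times> real \<Rightarrow> nat \<Rightarrow> nat \<times> nat \<Rightarrow> real \<times> real \<Rightarrow> real" where
  "vLam D v k i =
     (let c = inv_into sq_closed (geo D k) v; n = nmax D k
      in Lam D k (if fst c = 0 then fst i else n - fst i, if snd c = 0 then snd i else n - snd i))"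

definition vertex_avg :: "multipatch \<Rightarrow> real \<times> real \<Rightarrow> nat \<times> nat \<Rightarrow> real \<times> real \<Rightarrow> real" where
  "vertex_avg D v i x = (\<Sum>k\<in>vertex_patches D v. vLam D v k i x) / real (card (vertex_patches D v))"

definition vertex_operator :: "multipatch \<Rightarrow> nat \<Rightarrow> (nat \<Rightarrow> nat \<Rightarrow> real) \<Rightarrow> real \<times> real \<Rightarrow>
    ((real \<times> real \<Rightarrow> real) \<Rightarrow> real \<times> real \<Rightarrow> real) \<Rightarrow> bool" where
  "vertex_operator D r \<gamma> v P \<longleftrightarrow>
     linear_op_on (Vpw D) P \<and>
     (\<forall>k\<in>vertex_patches D v.
        P (vLam D v k (0, 0)) = (\<lambda>x. vertex_avg D v (0, 0) x +
           (\<Sum>m1=1..r. \<Sum>m2=1..r. \<gamma> k m1 * \<gamma> k m2 *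
              (vLam D v k (m1, m2) x - vertex_avg D v (m1, m2) x))) \<and>
        (\<forall>i \<in> {..nmax D k} \<times> {..nmax D k} - {(0, 0)}. P (vLam D v k i) = vLam D v k i)) \<and>
     (\<forall>k \<in> patches D - vertex_patches D v. \<forall>i \<in> {..nmax D k} \<times> {..nmax D k}.
        P (Lam D k i) = Lam D k i)"


section \<open>Edge operators\<close>

text \<open>The symmetries of the unit square, generated by the swap and the two reflections.\<close>

definition square_sym :: "bool \<times> bool \<times> bool \<Rightarrow> real \<times> real \<Rightarrow> real \<times> real" where
  "square_sym \<sigma> x =
     (let (sw, r1, r2) = \<sigma>; (a, b) = (if sw then (snd x, fst x) else x)
      in (if r1 then 1 - a else a, if r2 then 1 - b else b))"

definition edge_rect :: "(real \<times> real) set" where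
  "edge_rect = {0..1} \<times> {-1..1}"

text \<open>\<open>edge_frame D e km kp Fe\<close>: \<open>km\<close> and \<open>kp\<close> are an admissible choice of the coarse and the fine
  patch of the interior edge \<open>e\<close>, and \<open>Fe\<close> is an edge parametrization \<open>F\<^sub>e\<close>.\<close>

definition edge_frame :: "multipatch \<Rightarrow> (real \<times> real) set \<Rightarrow> nat \<Rightarrow> nat \<Rightarrow>
    (real \<times> real \<Rightarrow> real \<times> real) \<Rightarrow> bool" where
  "edge_frame D e km kp Fe \<longleftrightarrow>
     km \<noteq> kp \<and> edge_patches D e = {km, kp} \<and>
     (\<exists>s\<ge>1. nint D kp = s * nint D km) \<and>
     homeomorphism edge_rect
       (closure (interior (closure (patch D km) \<union> closure (patch D kp)))) Fe (inv_into edge_rect Fe) \<and>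
     Fe ` ({0..1} \<times> {0}) = e \<and>
     (\<exists>\<sigma>. \<forall>x \<in> {0..1} \<times> {-1..0}. Fe x = geo D km (square_sym \<sigma> (fst x, - snd x))) \<and>
     (\<exists>\<sigma>. \<forall>x \<in> {0..1} \<times> {0..1}. Fe x = geo D kp (square_sym \<sigma> x))"

definition spline_assumptions :: "multipatch \<Rightarrow> bool" where
  "spline_assumptions D \<longleftrightarrow>
     1 \<le> sdeg D \<and> 1 \<le> mult D \<and> mult D \<le> sdeg D \<and>
     (\<forall>k\<in>patches D. 1 \<le> nint D k \<and> nmax D k > sdeg D + 1) \<and>
     (\<forall>e. interior_edge D e \<longrightarrow> (\<exists>km kp Fe. edge_frame D e km kp Fe))"

definition edge_push :: "multipatch \<Rightarrow> nat \<Rightarrow> nat \<Rightarrow> (real \<times> real \<Rightarrow> real \<times> real) \<Rightarrow>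
    (real \<times> real \<Rightarrow> real) \<Rightarrow> real \<times> real \<Rightarrow> real" where
  "edge_push D km kp Fe \<phi> x =
     (if x \<in> patch D km \<union> patch D kp then \<phi> (inv_into edge_rect Fe x) else 0)"

definition perp_m :: "multipatch \<Rightarrow> nat \<Rightarrow> nat \<Rightarrow> real \<Rightarrow> real" where
  "perp_m D km i t = (if t \<in> {-1..0} then lam D km i (- t) else 0)"

definition perp_p :: "multipatch \<Rightarrow> nat \<Rightarrow> nat \<Rightarrow> real \<Rightarrow> real" where
  "perp_p D kp i t = (if t \<in> {0<..1} then lam D kp i t else 0)"

definition perp_avg :: "multipatch \<Rightarrow> nat \<Rightarrow> nat \<Rightarrow> real \<Rightarrow> real" where
  "perp_avg D km kp t = (perp_m D km 0 t + perp_p D kp 0 t) / 2"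

definition perp_corr :: "multipatch \<Rightarrow> nat \<Rightarrow> (nat \<Rightarrow> nat \<Rightarrow> real) \<Rightarrow> nat \<Rightarrow> nat \<Rightarrow> real \<Rightarrow> real" where
  "perp_corr D r \<gamma> km kp t = (\<Sum>m=1..r. \<gamma> km m * (perp_m D km m t - perp_p D kp m t)) / 2"

definition l2_proj :: "multipatch \<Rightarrow> nat \<Rightarrow> (real \<Rightarrow> real) \<Rightarrow> real \<Rightarrow> real" where
  "l2_proj D k \<phi> = (THE \<psi>. \<psi> \<in> splines D k \<and> (\<forall>\<eta>\<in>splines D k.
     (LINT x:{0..1}|lborel. \<psi> x * \<eta> x) = (LINT x:{0..1}|lborel. \<phi> x * \<eta> x)))"

definition strip_ends :: "multipatch \<Rightarrow> nat \<Rightarrow> nat \<Rightarrow> (real \<Rightarrow> real) \<Rightarrow> real \<Rightarrow> real" where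
  "strip_ends D km kp \<phi> x =
     \<phi> x - bcoef D kp \<phi> 0 * lam D km 0 x - bcoef D kp \<phi> (nmax D kp) * lam D km (nmax D km) x"

definition correct_ends :: "multipatch \<Rightarrow> nat \<Rightarrow> (nat \<Rightarrow> nat \<Rightarrow> real) \<Rightarrow> nat \<Rightarrow> (real \<Rightarrow> real) \<Rightarrow> real \<Rightarrow> real" where
  "correct_ends D r \<gamma> k \<phi> x =
     (let n = nmax D k; a = bcoef D k \<phi> 0; b = bcoef D k \<phi> n in
      \<phi> x - a * lam D k 0 x - b * lam D k n x
      + a * (\<Sum>i=1..r. \<gamma> k i * lam D k i x)
      + b * (\<Sum>i=n-r..n-1. \<gamma> k (n - i) * lam D k i x))"

definition restr :: "multipatch \<Rightarrow> nat \<Rightarrow> (nat \<Rightarrow> nat \<Rightarrow> real) \<Rightarrow> nat \<Rightarrow> nat \<Rightarrow> (real \<Rightarrow> real) \<Rightarrow> real \<Rightarrow> real" where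
  "restr D r \<gamma> km kp \<phi> x =
     bcoef D kp \<phi> 0 * lam D km 0 x + bcoef D kp \<phi> (nmax D kp) * lam D km (nmax D km) x
     + correct_ends D r \<gamma> km (l2_proj D km (strip_ends D km kp \<phi>)) x"

text \<open>The index \<open>i\<close> counted from the left end (\<open>\<not> b\<close>) or from the right end (\<open>b\<close>); the flag \<open>b\<close>
  selects the vertex at \<open>j\<^sub>1 = 0\<close> or at \<open>j\<^sub>1 = n\<close> of the edge.\<close>

definition end_idx :: "bool \<Rightarrow> nat \<Rightarrow> nat \<Rightarrow> nat" where
  "end_idx b n i = (if b then n - i else i)"

definition mu_p :: "multipatch \<Rightarrow> nat \<Rightarrow> (nat \<Rightarrow> nat \<Rightarrow> real) \<Rightarrow> nat \<Rightarrow> bool \<Rightarrow> real \<Rightarrow> real" where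
  "mu_p D r \<gamma> kp b x = (\<Sum>m=1..r. \<gamma> kp m * lam D kp (end_idx b (nmax D kp) m) x)"

definition mu_m :: "multipatch \<Rightarrow> nat \<Rightarrow> (nat \<Rightarrow> nat \<Rightarrow> real) \<Rightarrow> nat \<Rightarrow> nat \<Rightarrow> bool \<Rightarrow> real \<Rightarrow> real" where
  "mu_m D r \<gamma> km kp b x = lam D km (end_idx b (nmax D km) 0) x
     + restr D r \<gamma> km kp (\<lambda>y. mu_p D r \<gamma> kp b y - lam D kp (end_idx b (nmax D kp) 0) y) x"

definition edge_operator_for :: "multipatch \<Rightarrow> nat \<Rightarrow> (nat \<Rightarrow> nat \<Rightarrow> real) \<Rightarrow> nat \<Rightarrow> nat \<Rightarrow>
    (real \<times> real \<Rightarrow> real \<times> real) \<Rightarrow> ((real \<times> real \<Rightarrow> real) \<Rightarrow> real \<times> real \<Rightarrow> real) \<Rightarrow> bool" where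
  "edge_operator_for D r \<gamma> km kp Fe P \<longleftrightarrow>
     (let push = edge_push D km kp Fe;
          n\<^sub>m = nmax D km; n\<^sub>p = nmax D kp;
          A = perp_avg D km kp;
          C = perp_corr D r \<gamma> km kp;
          R = restr D r \<gamma> km kp
      in linear_op_on (Vpw D) P \<and>
         (\<forall>j\<in>{0<..<n\<^sub>m}. P (push (lam D km j \<otimes>\<^sub>t perp_m D km 0)) =
            push (lam D km j \<otimes>\<^sub>t (\<lambda>t. A t + C t))) \<and>
         (\<forall>b. P (push (lam D km (end_idx b n\<^sub>m 0) \<otimes>\<^sub>t perp_m D km 0)) =
            push (\<lambda>x. (lam D km (end_idx b n\<^sub>m 0) \<otimes>\<^sub>t A) x + (mu_m D r \<gamma> km kp b \<otimes>\<^sub>t C) x)) \<and>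
         (\<forall>j\<in>{0<..<n\<^sub>p}. P (push (lam D kp j \<otimes>\<^sub>t perp_p D kp 0)) =
            push (R (lam D kp j) \<otimes>\<^sub>t (\<lambda>t. A t - C t))) \<and>
         (\<forall>b. P (push (lam D kp (end_idx b n\<^sub>p 0) \<otimes>\<^sub>t perp_p D kp 0)) =
            push (\<lambda>x. (R (lam D kp (end_idx b n\<^sub>p 0)) \<otimes>\<^sub>t A) x - (R (mu_p D r \<gamma> kp b) \<otimes>\<^sub>t C) x)) \<and>
         (\<forall>j1\<in>{..n\<^sub>m}. \<forall>j2\<in>{1..n\<^sub>m}. P (push (lam D km j1 \<otimes>\<^sub>t perp_m D km j2)) =
            push (lam D km j1 \<otimes>\<^sub>t perp_m D km j2)) \<and>
         (\<forall>j1\<in>{..n\<^sub>p}. \<forall>j2\<in>{1..n\<^sub>p}. P (push (lam D kp j1 \<otimes>\<^sub>t perp_p D kp j2)) =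
            push (lam D kp j1 \<otimes>\<^sub>t perp_p D kp j2)) \<and>
         (\<forall>k \<in> patches D - {km, kp}. \<forall>i \<in> {..nmax D k} \<times> {..nmax D k}.
            P (Lam D k i) = Lam D k i))"

text \<open>The choice of \<open>F\<^sub>e\<close> (and, when both patches have the same knots, of the coarse one) is arbitrary.\<close>

definition edge_operator :: "multipatch \<Rightarrow> nat \<Rightarrow> (nat \<Rightarrow> nat \<Rightarrow> real) \<Rightarrow> (real \<times> real) set \<Rightarrow>
    ((real \<times> real \<Rightarrow> real) \<Rightarrow> real \<times> real \<Rightarrow> real) \<Rightarrow> bool" where
  "edge_operator D r \<gamma> e P \<longleftrightarrow>
     (if interior_edge D e
      then \<exists>km kp Fe. edge_frame D e km kp Fe \<and> edge_operator_for D r \<gamma> km kp Fe P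
      else \<forall>u\<in>Vpw D. P u = u)"

end

theory Submission
  imports Defs
begin

text \<open>
The theorem combines a description of the conforming space by traces with explicit formulas for the
local operators.

\<^item> \<^emph>\<open>Conformity is agreement of traces.\<close> Pulled back to the unit square, a broken function is a
tensor-product spline on each patch, hence Lipschitz up to the boundary. Such a function belongs to
\<open>H\<^sup>1(\<Omega>)\<close> iff the patchwise traces agree on every interior edge and at every vertex
(\<open>Vh_iff\<close>). If they agree, they define a function that is Lipschitz along every segment in \<open>\<Omega>\<close> and
differentiable off a null set, and its difference quotients converge to a weak gradient. Conversely, an
\<open>H\<^sup>1\<close> function cannot jump at a point \<open>x\<close> (\<open>H1_no_jump\<close>): passing from values near \<open>a\<close> to
values near \<open>b \<noteq> a\<close> between two discs of radius comparable to \<open>\<rho>\<close>, both at distance \<open>O(\<rho>)\<close> from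
\<open>x\<close>, takes an amount of Dirichlet energy that in two dimensions does not depend on \<open>\<rho>\<close>, whereas the energy
in a disc of radius \<open>O(\<rho>)\<close> about \<open>x\<close> tends to zero. This gives agreement on the edges. For the vertices
the Lipschitz boundary enters: small neighbourhoods of a vertex in \<open>\<Omega>\<close> stay connected when the vertex is
removed, so the patches at a vertex are linked by interior edges through it
(\<open>vertex_patches_linked\<close>).

\<^item> \<^emph>\<open>The local operators in closed form.\<close> A local operator fixes all basis functions but a few, so
\<open>P u - u\<close> depends on few data of \<open>u\<close>. Write \<open>\<mu> = \<gamma>\<^sub>1 \<lambda>\<^sub>1 + \<dots> + \<gamma>\<^sub>r \<lambda>\<^sub>r\<close>; the moments of
\<open>\<lambda>\<^sub>0 - \<mu>\<close> up to order \<open>r\<close> vanish by the choice of \<open>\<gamma>\<close>. In the corner coordinates of a patch at the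
vertex, the vertex operator adds
\<open>(mean of the vertex values - own vertex value) (\<lambda>\<^sub>0 \<otimes> \<lambda>\<^sub>0 - \<mu> \<otimes> \<mu>)\<close>
(\<open>vertex_operator_pull\<close>). Let \<open>t\<^sub>-\<close> and \<open>t\<^sub>+\<close> be the traces on an edge from the coarse and the fine
side, and let \<open>\<delta> = t\<^sub>- - R t\<^sub>+\<close> with the restriction \<open>R\<close>. If the values at both end points of the edge
agree, the edge operator adds \<open>- \<delta>/2 \<otimes> (\<lambda>\<^sub>0 - \<mu>)\<close> on the coarse side and
\<open>\<delta>/2 \<otimes> (\<lambda>\<^sub>0 - \<mu>) + (R t\<^sub>+ - t\<^sub>+) \<otimes> \<lambda>\<^sub>0\<close> on the fine side (\<open>pull_m\<close>, \<open>pull_p\<close>). The special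
images of the two end functions of an edge are made such that their contributions cancel in this case
(\<open>profiles_combine\<close>).

\<^item> \<^emph>\<open>Reading off the properties.\<close> Every correction is a sum of tensor products in which one factor has
vanishing moments; for \<open>R t\<^sub>+ - t\<^sub>+\<close> this is moment preservation by \<open>R\<close> (\<open>R_moments\<close>). The vertex correction is zero at the other corners, so the vertex
operators together make all vertex values agree. Afterwards the edge corrections vanish on all sides of the
two patches but the common one, because \<open>R\<close> preserves end values; hence an edge operator makes the
traces on its own edge agree and disturbs neither the vertices nor the other edges, in whichever order the
operators are applied. On a function whose traces agree already, \<open>R t\<^sub>+ = t\<^sub>+\<close> and all corrections
are zero. So the composition maps into the conforming space and is the identity there.
\<close>

section \<open>B-splines\<close>

text \<open>The Cox-de Boor recursion started from the indicator of the single knot interval with index \<open>\<mu>\<close>. It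
yields the polynomial that agrees with the B-spline on that interval, but makes sense on the whole line;
polynomial identities can thus be proved free of case distinctions on the position of \<open>x\<close>.\<close>

fun bspline_piece :: "(nat \<Rightarrow> real) \<Rightarrow> nat \<Rightarrow> nat \<Rightarrow> nat \<Rightarrow> real \<Rightarrow> real" where
  "bspline_piece \<xi> \<mu> 0 i x = (if i = \<mu> then 1 else 0)"
| "bspline_piece \<xi> \<mu> (Suc q) i x =
     (x - \<xi> i) / (\<xi> (i + q + 1) - \<xi> i) * bspline_piece \<xi> \<mu> q i x +
     (\<xi> (i + q + 2) - x) / (\<xi> (i + q + 2) - \<xi> (Suc i)) * bspline_piece \<xi> \<mu> q (Suc i) x"

lemma bspline_eq_piece:
  assumes "mono \<xi>" "\<And>j. \<xi> j \<le> 1" "\<xi> \<mu> \<le> x"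
    "x < \<xi> (Suc \<mu>) \<or> x = 1 \<and> \<xi> \<mu> < 1 \<and> \<xi> (Suc \<mu>) = 1"
  shows "bspline \<xi> q i x = bspline_piece \<xi> \<mu> q i x"
proof (induction q arbitrary: i)
  case 0
  have m: "a \<le> b \<Longrightarrow> \<xi> a \<le> \<xi> b" for a b using assms(1) by (auto simp: mono_def)
  consider "i < \<mu>" | "i = \<mu>" | "\<mu> < i" by linarith
  then show ?case
  proof cases
    case 1 then show ?thesis using m[of "Suc i" \<mu>] assms(2)[of "Suc \<mu>"] assms(3,4) by auto
  next
    case 2 then show ?thesis using assms(3,4) by auto
  next
    case 3 then show ?thesis using m[of "Suc \<mu>" i] assms(2)[of i] assms(2)[of "Suc i"] assms(3,4) by auto
  qed
qed simp

lemma bspline_outside: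
  assumes "\<And>j. 0 \<le> \<xi> j" "\<And>j. \<xi> j \<le> 1" "x \<notin> {0..1}"
  shows "bspline \<xi> q i x = 0"
proof (induction q arbitrary: i)
  case 0
  show ?case using assms(1)[of i] assms(2)[of "Suc i"] assms(3) by auto
qed simp

lemma bspline_piece_poly: "\<exists>P. \<forall>x. bspline_piece \<xi> \<mu> q i x = poly P x"
proof (induction q arbitrary: i)
  case 0
  show ?case by (rule exI[of _ "[:if i = \<mu> then 1 else 0:]"]) auto
next
  case (Suc q)
  obtain P where P: "\<And>x. bspline_piece \<xi> \<mu> q i x = poly P x" using Suc by blast
  obtain Q where Q: "\<And>x. bspline_piece \<xi> \<mu> q (Suc i) x = poly Q x" using Suc by blast
  show ?case
    by (rule exI[of _ "smult (1 / (\<xi> (i + q + 1) - \<xi> i)) [:- \<xi> i, 1:] * P +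
       smult (1 / (\<xi> (i + q + 2) - \<xi> (Suc i))) [:\<xi> (i + q + 2), -1:] * Q"])
      (simp add: P Q algebra_simps diff_divide_distrib add_divide_distrib)
qed

lemma bspline_piece_support:
  "bspline_piece \<xi> \<mu> q i x \<noteq> 0 \<Longrightarrow> i \<le> \<mu> \<and> \<mu> \<le> i + q"
proof (induction q arbitrary: i)
  case (Suc q)
  then have "bspline_piece \<xi> \<mu> q i x \<noteq> 0 \<or> bspline_piece \<xi> \<mu> q (Suc i) x \<noteq> 0" by auto
  then show ?case using Suc.IH[of i] Suc.IH[of "Suc i"] by auto
qed (auto split: if_splits)

lemma bspline_piece_at_right_end:
  assumes "\<And>j. \<mu> < j \<Longrightarrow> j \<le> \<mu> + q \<Longrightarrow> \<xi> j = z" "\<xi> \<mu> \<noteq> z"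
  shows "bspline_piece \<xi> \<mu> q i z = (if i = \<mu> then 1 else 0)"
  using assms(1)
proof (induction q arbitrary: i)
  case (Suc q)
  have IH: "bspline_piece \<xi> \<mu> q j z = (if j = \<mu> then 1 else 0)" for j
    by (rule Suc.IH) (auto intro: Suc.prems)
  have "\<xi> (\<mu> + q + 1) = z" using Suc.prems[of "\<mu> + q + 1"] by simp
  moreover have "\<xi> (Suc (i + q + 1)) = z" if "Suc i = \<mu>"
    using Suc.prems[of "Suc (i + q + 1)"] that by auto
  ultimately show ?case using assms(2) by (auto simp: IH)
qed simp

lemma bspline_piece_at_left_end:
  assumes "\<And>j. j \<le> \<mu> \<Longrightarrow> \<mu> < j + q \<Longrightarrow> \<xi> j = z" "\<xi> (Suc \<mu>) \<noteq> z"
  shows "bspline_piece \<xi> \<mu> q i z = (if i + q = \<mu> then 1 else 0)"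
  using assms(1)
proof (induction q arbitrary: i)
  case (Suc q)
  have IH: "bspline_piece \<xi> \<mu> q j z = (if j + q = \<mu> then 1 else 0)" for j
    by (rule Suc.IH) (auto intro: Suc.prems)
  have "\<xi> i = z" if "i + q = \<mu>" using Suc.prems[of i] that by auto
  moreover have "\<xi> (Suc i) = z" if "Suc i + q = \<mu>" using Suc.prems[of "Suc i"] that by auto
  moreover have "\<xi> (i + q + 2) \<noteq> z" if "Suc i + q = \<mu>" using assms(2) that by auto
  ultimately show ?case by (auto simp: IH)
qed simp

text \<open>At a knot \<open>z\<close> of multiplicity \<open>s \<le> q\<close> the pieces to the left and to the right take the same value,
because at degree \<open>s\<close> both reduce to the indicator of one index, and the recursion from degree \<open>s\<close> upwards
is the same for both. This is the continuity of B-splines.\<close>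

lemma bspline_piece_join:
  assumes "\<And>j. \<mu> < j \<Longrightarrow> j \<le> \<mu> + s \<Longrightarrow> \<xi> j = z" "\<xi> \<mu> \<noteq> z" "\<xi> (Suc (\<mu> + s)) \<noteq> z" "s \<le> q"
  shows "bspline_piece \<xi> \<mu> q i z = bspline_piece \<xi> (\<mu> + s) q i z"
  using assms(4)
proof (induction q arbitrary: i rule: dec_induct)
  case base
  have "bspline_piece \<xi> \<mu> s i z = (if i = \<mu> then 1 else 0)"
    by (rule bspline_piece_at_right_end) (use assms in auto)
  moreover have "bspline_piece \<xi> (\<mu> + s) s i z = (if i + s = \<mu> + s then 1 else 0)"
    by (rule bspline_piece_at_left_end) (use assms in auto)
  ultimately show ?case by auto
qed simp

lemma bspline_piece_reflect:
  assumes "\<And>j. j \<le> M + 1 \<Longrightarrow> \<xi> (M + 1 - j) = 1 - \<xi> j" "\<mu> \<le> M" "i + q \<le> M"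
  shows "bspline_piece \<xi> \<mu> q i (1 - x) = bspline_piece \<xi> (M - \<mu>) q (M - q - i) x"
  using assms(3)
proof (induction q arbitrary: i)
  case 0
  then show ?case using assms(2) by auto
next
  case (Suc q)
  define i' where "i' = M - Suc q - i"
  have 1: "bspline_piece \<xi> \<mu> q i (1 - x) = bspline_piece \<xi> (M - \<mu>) q (Suc i') x"
    using Suc.IH[of i] Suc.prems by (simp add: i'_def Suc_diff_le Suc_diff_Suc)
  have 2: "bspline_piece \<xi> \<mu> q (Suc i) (1 - x) = bspline_piece \<xi> (M - \<mu>) q i' x"
    using Suc.IH[of "Suc i"] Suc.prems by (simp add: i'_def)
  have e: "M + 1 - (i + q + 2) = i'" "M + 1 - (i + q + 1) = Suc i'" "M + 1 - Suc i = i' + q + 1" "M + 1 - i = i' + q + 2"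
    using Suc.prems unfolding i'_def by auto
  have k: "\<xi> i' = 1 - \<xi> (i + q + 2)" "\<xi> (Suc i') = 1 - \<xi> (i + q + 1)"
    "\<xi> (i' + q + 1) = 1 - \<xi> (Suc i)" "\<xi> (i' + q + 2) = 1 - \<xi> i"
    using assms(1)[of "i + q + 2"] assms(1)[of "i + q + 1"] assms(1)[of "Suc i"] assms(1)[of i] Suc.prems
    unfolding e by auto
  have e1: "(1 - x - \<xi> i) / (\<xi> (i + q + 1) - \<xi> i) = (\<xi> (i' + q + 2) - x) / (\<xi> (i' + q + 2) - \<xi> (Suc i'))"
    unfolding k by (simp add: algebra_simps)
  have e2: "(\<xi> (i + q + 2) - (1 - x)) / (\<xi> (i + q + 2) - \<xi> (Suc i)) = (x - \<xi> i') / (\<xi> (i' + q + 1) - \<xi> i')"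
    unfolding k by (simp add: algebra_simps)
  show ?case unfolding bspline_piece.simps e1 e2 1 2 i'_def[symmetric] by simp
qed

lemma affine_weights:
  fixes a b x B :: real
  assumes "b \<noteq> a"
  shows "(x - a) / (b - a) * B + (b - x) / (b - a) * B = B"
    and "(x - a) / (b - a) * B * b + (b - x) / (b - a) * B * a = x * B"
proof -
  have "b - a \<noteq> 0" using assms by simp
  note e = nonzero_divide_eq_eq[OF this]
  have "(x - a) / (b - a) * B + (b - x) / (b - a) * B = ((x - a) * B + (b - x) * B) / (b - a)"
    by (simp add: add_divide_distrib)
  also have "\<dots> = B" by (simp only: e) (simp add: algebra_simps)
  finally show "(x - a) / (b - a) * B + (b - x) / (b - a) * B = B" .
  have "(x - a) / (b - a) * B * b + (b - x) / (b - a) * B * a = ((x - a) * B * b + (b - x) * B * a) / (b - a)"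
    by (simp add: add_divide_distrib)
  also have "\<dots> = x * B" by (simp only: e) (simp add: algebra_simps)
  finally show "(x - a) / (b - a) * B * b + (b - x) / (b - a) * B * a = x * B" .
qed

text \<open>Marsden's identity on one knot interval: the dual polynomials \<open>\<Psi>\<^sub>i\<close> reproduce \<open>(y - x)\<^sup>q\<close>. Their
coefficients do not depend on the interval, which puts all polynomials of degree at most \<open>q\<close> into the
spline space. In the induction the two summands of the recursion carry the weights \<open>a\<close> and \<open>b\<close>, which
after an index shift meet at the same basis function and combine linear factors into \<open>y - x\<close>.\<close>

lemma marsden_identity:
  assumes "mono \<xi>" "\<xi> \<mu> < \<xi> (Suc \<mu>)" "q \<le> \<mu>"
  shows "(\<Sum>i\<le>\<mu>. smult (bspline_piece \<xi> \<mu> q i x) (\<Prod>j=1..q. [:- \<xi> (i + j), 1:])) = [:- x, 1:] ^ q"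
  using assms(3)
proof (induction q)
  case 0
  have "(\<Sum>i\<le>\<mu>. smult (bspline_piece \<xi> \<mu> 0 i x) (1::real poly)) = (\<Sum>i\<le>\<mu>. if i = \<mu> then 1 else 0)"
    by (intro sum.cong) auto
  then show ?case by simp
next
  case (Suc q)
  define B where "B i = bspline_piece \<xi> \<mu> q i x" for i
  define \<Psi> where "\<Psi> i = (\<Prod>j=1..q. [:- \<xi> (i + j), 1:])" for i
  define a where "a i = (x - \<xi> i) / (\<xi> (i + q + 1) - \<xi> i) * B i" for i
  define b where "b i = (\<xi> (i + q + 1) - x) / (\<xi> (i + q + 1) - \<xi> i) * B i" for i
  have \<Psi>1: "(\<Prod>j=1..Suc q. [:- \<xi> (i + j), 1:]) = [:- \<xi> (i + q + 1), 1:] * \<Psi> i" for i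
    by (simp add: \<Psi>_def)
  have \<Psi>2: "(\<Prod>j=1..Suc q. [:- \<xi> (i + j), 1:]) = [:- \<xi> (Suc i), 1:] * \<Psi> (Suc i)" for i
  proof -
    have "(\<Prod>j=1..Suc q. [:- \<xi> (i + j), 1:]) = [:- \<xi> (i + 1), 1:] * (\<Prod>j=Suc 1..Suc q. [:- \<xi> (i + j), 1:])"
      by (subst prod.atLeast_Suc_atMost) auto
    also have "(\<Prod>j=Suc 1..Suc q. [:- \<xi> (i + j), 1:]) = \<Psi> (Suc i)"
      unfolding \<Psi>_def by (subst prod.shift_bounds_cl_Suc_ivl) simp
    finally show ?thesis by simp
  qed
  \<comment> \<open>the local support removes the boundary terms of the index shift\<close>
  have B0: "B i = 0" if "i + q < \<mu> \<or> \<mu> < i" for i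
    unfolding B_def using bspline_piece_support[of \<xi> \<mu> q i x] that by linarith
  have "(\<Sum>i\<le>\<mu>. smult (bspline_piece \<xi> \<mu> (Suc q) i x) (\<Prod>j=1..Suc q. [:- \<xi> (i + j), 1:])) =
     (\<Sum>i\<le>\<mu>. smult (a i) ([:- \<xi> (i + q + 1), 1:] * \<Psi> i)) + (\<Sum>i\<le>\<mu>. smult (b (Suc i)) ([:- \<xi> (Suc i), 1:] * \<Psi> (Suc i)))"
    unfolding sum.distrib[symmetric]
  proof (intro sum.cong refl)
    fix i
    have "bspline_piece \<xi> \<mu> (Suc q) i x = a i + b (Suc i)" by (simp add: a_def b_def B_def)
    then show "smult (bspline_piece \<xi> \<mu> (Suc q) i x) (\<Prod>j=1..Suc q. [:- \<xi> (i + j), 1:]) =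
      smult (a i) ([:- \<xi> (i + q + 1), 1:] * \<Psi> i) + smult (b (Suc i)) ([:- \<xi> (Suc i), 1:] * \<Psi> (Suc i))"
      unfolding \<Psi>1[symmetric] \<Psi>2[symmetric] by (simp only: smult_add_left)
  qed
  also have "(\<Sum>i\<le>\<mu>. smult (b (Suc i)) ([:- \<xi> (Suc i), 1:] * \<Psi> (Suc i))) = (\<Sum>i\<le>\<mu>. smult (b i) ([:- \<xi> i, 1:] * \<Psi> i))"
  proof -
    have "(\<Sum>i\<le>\<mu>. smult (b (Suc i)) ([:- \<xi> (Suc i), 1:] * \<Psi> (Suc i))) = (\<Sum>i\<in>{Suc 0..Suc \<mu>}. smult (b i) ([:- \<xi> i, 1:] * \<Psi> i))"
      unfolding atMost_atLeast0 by (subst sum.shift_bounds_cl_Suc_ivl) simp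
    also have "\<dots> = (\<Sum>i\<le>Suc \<mu>. smult (b i) ([:- \<xi> i, 1:] * \<Psi> i))"
      by (rule sum.mono_neutral_left) (use B0[of 0] Suc.prems in \<open>auto simp: b_def not_less_eq_eq\<close>)
    also have "\<dots> = (\<Sum>i\<le>\<mu>. smult (b i) ([:- \<xi> i, 1:] * \<Psi> i))"
      using B0[of "Suc \<mu>"] by (simp add: b_def)
    finally show ?thesis .
  qed
  also have "(\<Sum>i\<le>\<mu>. smult (a i) ([:- \<xi> (i + q + 1), 1:] * \<Psi> i)) + (\<Sum>i\<le>\<mu>. smult (b i) ([:- \<xi> i, 1:] * \<Psi> i))
     = [:- x, 1:] * (\<Sum>i\<le>\<mu>. smult (B i) (\<Psi> i))"
    unfolding sum.distrib[symmetric] sum_distrib_left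
  proof (intro sum.cong refl)
    fix i
    show "smult (a i) ([:- \<xi> (i + q + 1), 1:] * \<Psi> i) + smult (b i) ([:- \<xi> i, 1:] * \<Psi> i) = [:- x, 1:] * smult (B i) (\<Psi> i)"
    proof (cases "B i = 0")
      case False
      then have "\<not> \<mu> < i" "\<not> i + q < \<mu>" using B0[of i] by blast+
      then have "\<xi> i \<le> \<xi> \<mu>" "\<xi> (Suc \<mu>) \<le> \<xi> (i + q + 1)"
        by (auto intro!: monoD[OF assms(1)])
      then have ne: "\<xi> (i + q + 1) - \<xi> i \<noteq> 0" using assms(2) by simp
      have "smult (a i) [:- \<xi> (i + q + 1), 1:] + smult (b i) [:- \<xi> i, 1:] = smult (B i) [:- x, 1:]"
      proof -
        have s: "a i + b i = B i" and t: "a i * \<xi> (i + q + 1) + b i * \<xi> i = x * B i"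
          using affine_weights[of "\<xi> (i + q + 1)" "\<xi> i" x "B i"] ne unfolding a_def b_def by auto
        show ?thesis using s t by (simp add: algebra_simps)
      qed
      moreover have "smult (a i) ([:- \<xi> (i + q + 1), 1:] * \<Psi> i) + smult (b i) ([:- \<xi> i, 1:] * \<Psi> i) =
        (smult (a i) [:- \<xi> (i + q + 1), 1:] + smult (b i) [:- \<xi> i, 1:]) * \<Psi> i"
        by (simp only: mult_smult_left distrib_right)
      ultimately show ?thesis by (simp only: mult_smult_left mult_smult_right)
    qed (simp add: a_def b_def)
  qed
  also have "(\<Sum>i\<le>\<mu>. smult (B i) (\<Psi> i)) = [:- x, 1:] ^ q"
    using Suc.IH Suc.prems by (simp add: B_def \<Psi>_def)
  finally show ?case by simp
qed

text \<open>The data of one patch that concern splines in one variable.\<close>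

locale spline_patch =
  fixes D :: multipatch and k :: nat
  assumes sdeg_ge1: "1 \<le> sdeg D" and mult_ge1: "1 \<le> mult D" and mult_le: "mult D \<le> sdeg D"
    and nint_ge1: "1 \<le> nint D k" and nmax_gt: "sdeg D + 1 < nmax D k"
begin

abbreviation "p \<equiv> sdeg D"
abbreviation "m \<equiv> mult D"
abbreviation "N \<equiv> nint D k"
abbreviation "n \<equiv> nmax D k"
abbreviation "\<xi> \<equiv> knot D k"
abbreviation "\<Lambda> \<equiv> lam D k"

lemma n_eq: "n = p + m * (N - 1)" by (simp add: nmax_def)

definition cell :: "nat \<Rightarrow> nat" where "cell l = p + m * l"

lemma knot_interior:
  assumes "p < i" "i \<le> n"
  obtains l where "Suc l < N" "p + m * l < i" "i \<le> p + m * l + m" "\<xi> i = real (Suc l) / real N"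
proof -
  \<comment> \<open>each interior distinct knot is repeated \<open>m\<close> times, starting at index \<open>p + 1\<close>\<close>
  define l where "l = (i - p - 1) div m"
  have "m * l \<le> i - p - 1" "i - p - 1 < m * l + m"
    using mult_ge1 unfolding l_def
    by (auto simp: times_div_less_eq_dividend) (metis One_nat_def dividend_less_times_div le_simps(3) diff_diff_left add.commute)
  then have *: "p + m * l < i" "i \<le> p + m * l + m" using assms(1) by linarith+
  then have "m * l < m * (N - 1)" using assms(2) n_eq by linarith
  then have "l < N - 1" by simp
  then have "Suc l < N" by simp
  moreover have "\<xi> i = real (Suc l) / real N" using assms by (simp add: knot_def l_def)
  ultimately show ?thesis using * that by blast
qed

lemma knot_range: "0 \<le> \<xi> i" "\<xi> i \<le> 1"
proof -
  consider "i \<le> p" | "p < i" "i \<le> n" | "n < i" by linarith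
  then have "0 \<le> \<xi> i \<and> \<xi> i \<le> 1"
  proof cases
    case 2 then show ?thesis by (elim knot_interior) auto
  next
    case 3 then show ?thesis using nmax_gt by (simp add: knot_def)
  qed (simp add: knot_def)
  then show "0 \<le> \<xi> i" "\<xi> i \<le> 1" by auto
qed

lemma knot_mono: "mono \<xi>"
proof (rule monoI)
  fix i j :: nat assume "i \<le> j"
  consider "i \<le> p" | "n < j" | "p < i" "j \<le> n" by linarith
  then show "\<xi> i \<le> \<xi> j"
  proof cases
    case 1 then show ?thesis using knot_range(1)[of j] by (simp add: knot_def)
  next
    case 2 then show ?thesis using knot_range(2)[of i] nmax_gt by (simp add: knot_def)
  next
    case 3
    then show ?thesis using \<open>i \<le> j\<close>
      by (auto simp: knot_def intro!: divide_right_mono div_le_mono)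
  qed
qed

lemma knot_block:
  assumes "Suc l < N" "1 \<le> j" "j \<le> m"
  shows "\<xi> (cell l + j) = real (Suc l) / real N"
proof -
  have "m * l + m \<le> m * (N - 1)" using assms(1)
    by (metis Suc_leI Suc_diff_1 assms(1) less_Suc_eq_le mult_Suc_right add.commute mult_le_mono2 gr_implies_not0 not_gr_zero)
  then have "cell l + j \<le> n" using assms(3) unfolding cell_def n_eq by linarith
  moreover have "(cell l + j - p - 1) div m = l"
  proof -
    have e: "cell l + j - p - 1 = (j - 1) + l * m" using assms(2) by (simp add: cell_def mult.commute)
    have "(j - 1) div m = 0" using assms by auto
    then show ?thesis unfolding e using assms(2,3) by (subst div_mult_self1) auto
  qed
  ultimately show ?thesis using assms(2) by (simp add: knot_def cell_def)
qed

lemma cell_left: "l < N \<Longrightarrow> \<xi> (cell l) = real l / real N"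
proof (cases l)
  case 0 then show ?thesis by (simp add: cell_def knot_def)
next
  case (Suc l')
  assume "l < N"
  then show ?thesis using knot_block[of l' m] mult_ge1 Suc by (simp add: cell_def algebra_simps)
qed

lemma cell_right: "l < N \<Longrightarrow> \<xi> (Suc (cell l)) = real (Suc l) / real N"
proof (cases "Suc l < N")
  case True then show ?thesis using knot_block[of l 1] mult_ge1 by simp
next
  case False
  assume "l < N"
  then have "Suc l = N" "cell l = n" using False by (auto simp: cell_def n_eq)
  then show ?thesis using nmax_gt by (simp add: knot_def)
qed

lemma cell_pos: "l < N \<Longrightarrow> \<xi> (cell l) < \<xi> (Suc (cell l))"
  using cell_left cell_right by (simp add: divide_strict_right_mono)

lemma cell_le: "l < N \<Longrightarrow> cell l \<le> n" by (auto simp: cell_def n_eq)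
lemma cell_last: "cell (N - 1) = n" by (simp add: cell_def n_eq)

lemma knot_reflect:
  assumes "i \<le> n + p + 1" shows "\<xi> (n + p + 1 - i) = 1 - \<xi> i"
proof -
  consider "i \<le> p" | "p < i" "i \<le> n" | "n < i" by linarith
  then show ?thesis
  proof cases
    case 1
    then have "n < n + p + 1 - i" by simp
    then show ?thesis using 1 nmax_gt by (simp add: knot_def)
  next
    case 3
    then have "n + p + 1 - i \<le> p" by simp
    then show ?thesis using 3 nmax_gt by (simp add: knot_def)
  next
    case 2
    then obtain l where l: "Suc l < N" "p + m * l < i" "i \<le> p + m * l + m" "\<xi> i = real (Suc l) / real N"
      by (rule knot_interior)
    define l' where "l' = N - 2 - l"
    have Nl: "N = l + l' + 2" using l(1) by (simp add: l'_def)
    have e: "n = p + m * l + m * l' + m" unfolding n_eq Nl by (simp add: algebra_simps)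
    define j where "j = n + p + 1 - i - cell l'"
    have "n + p + 1 - i = cell l' + j" "1 \<le> j" "j \<le> m"
      using l(2,3) by (auto simp: e j_def cell_def)
    then have "\<xi> (n + p + 1 - i) = real (Suc l') / real N" using knot_block[of l' j] Nl by simp
    then show ?thesis unfolding l(4) Nl by (simp add: field_simps)
  qed
qed

text \<open>Both end points of the cell are included: by continuity at the knots, neighbouring pieces agree at a
common end point.\<close>

lemma lam_eq_piece:
  assumes "l < N" "real l / real N \<le> x" "x \<le> real (Suc l) / real N"
  shows "\<Lambda> i x = bspline_piece \<xi> (cell l) p i x"
proof (cases "x < real (Suc l) / real N \<or> Suc l = N")
  case True
  then have "x < \<xi> (Suc (cell l)) \<or> x = 1 \<and> \<xi> (cell l) < 1 \<and> \<xi> (Suc (cell l)) = 1"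
    unfolding cell_left[OF assms(1)] cell_right[OF assms(1)] using assms by auto
  then show ?thesis unfolding lam_def
    by (intro bspline_eq_piece) (use assms knot_mono knot_range cell_left in auto)
next
  case False
  then have x: "x = real (Suc l) / real N" and l: "Suc l < N" using assms by auto
  have s: "cell l + m = cell (Suc l)" by (simp add: cell_def)
  have "\<Lambda> i x = bspline_piece \<xi> (cell (Suc l)) p i x" unfolding lam_def
    by (rule bspline_eq_piece) (use knot_mono knot_range cell_left[OF l] cell_right[OF l] l x in \<open>auto simp: divide_strict_right_mono\<close>)
  also have "\<dots> = bspline_piece \<xi> (cell l) p i x"
    unfolding s[symmetric]
  proof (rule bspline_piece_join[symmetric])
    fix j assume "cell l < j" "j \<le> cell l + m"
    then show "\<xi> j = x" using knot_block[of l "j - cell l"] l x by auto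
  next
    show "\<xi> (cell l) \<noteq> x" using cell_pos[OF assms(1)] cell_right[OF assms(1)] x by simp
    show "\<xi> (Suc (cell l + m)) \<noteq> x" using cell_pos[OF l] cell_left[OF l] x unfolding s by simp
  qed (rule mult_le)
  finally show ?thesis .
qed

lemma cell_cover:
  assumes "x \<in> {0..1}"
  obtains l where "l < N" "real l / real N \<le> x" "x \<le> real (Suc l) / real N"
proof (cases "x = 1")
  case True
  then show ?thesis using that[of "N - 1"] nint_ge1 by (auto simp: field_simps)
next
  case False
  have N0: "0 < real N" using nint_ge1 by simp
  define l where "l = nat \<lfloor>x * real N\<rfloor>"
  have l0: "0 \<le> x * real N" using assms by simp
  have "real l \<le> x * real N" "x * real N < real l + 1"
    using l0 by (simp_all add: l_def)
  moreover have "x * real N < real N" using False assms N0 by simp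
  ultimately have "l < N" "real l / real N \<le> x" "x \<le> real (Suc l) / real N"
    using N0 by (linarith, simp_all add: pos_divide_le_eq pos_le_divide_eq)
  then show ?thesis using that by blast
qed

lemma lam_outside: "x \<notin> {0..1} \<Longrightarrow> \<Lambda> i x = 0"
  unfolding lam_def by (rule bspline_outside) (use knot_range in auto)

lemma lam_0: "\<Lambda> i 0 = (if i = 0 then 1 else 0)"
proof -
  have "\<Lambda> i 0 = bspline_piece \<xi> (cell 0) p i 0" using nint_ge1 by (intro lam_eq_piece) auto
  also have "\<dots> = (if i + p = cell 0 then 1 else 0)"
    by (rule bspline_piece_at_left_end) (use cell_right[of 0] nint_ge1 in \<open>auto simp: cell_def knot_def\<close>)
  finally show ?thesis by (simp add: cell_def)
qed

lemma lam_1: "\<Lambda> i 1 = (if i = n then 1 else 0)"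
proof -
  have N: "N - 1 < N" "real (Suc (N - 1)) = real N" using nint_ge1 by auto
  have "\<Lambda> i 1 = bspline_piece \<xi> n p i 1" using nint_ge1
    by (subst cell_last[symmetric], intro lam_eq_piece) auto
  also have "\<dots> = (if i = n then 1 else 0)"
  proof (rule bspline_piece_at_right_end)
    show "\<xi> n \<noteq> 1" using cell_left[OF N(1)] nint_ge1 unfolding cell_last by (auto simp: field_simps)
  qed (use nmax_gt in \<open>auto simp: knot_def\<close>)
  finally show ?thesis .
qed

lemma lam_reflect:
  assumes "i \<le> n" shows "\<Lambda> (n - i) x = \<Lambda> i (1 - x)"
proof (cases "x \<in> {0..1}")
  case True
  then obtain l where l: "l < N" "real l / real N \<le> x" "x \<le> real (Suc l) / real N" by (rule cell_cover)
  define l' where "l' = N - 1 - l"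
  have N: "N = l + l' + 1" using l(1) by (simp add: l'_def)
  have "n + p - cell l = cell l'" by (simp add: cell_def n_eq N algebra_simps)
  moreover have "cell l' \<le> n" using N by (intro cell_le) auto
  moreover have "cell l \<le> n" using l(1) by (rule cell_le)
  ultimately have e: "n + p - cell l' = cell l" by (simp add: cell_def)
  have "\<Lambda> i (1 - x) = bspline_piece \<xi> (cell l') p i (1 - x)"
  proof (rule lam_eq_piece)
    have "real l' / real N = 1 - real (Suc l) / real N" "real (Suc l') / real N = 1 - real l / real N"
      using N by (simp_all add: field_simps)
    then show "real l' / real N \<le> 1 - x" "1 - x \<le> real (Suc l') / real N" using l by linarith+
  qed (use N in simp)
  also have "\<dots> = bspline_piece \<xi> (n + p - cell l') p (n + p - p - i) x"
    by (rule bspline_piece_reflect) (use knot_reflect \<open>cell l' \<le> n\<close> assms in auto)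
  also have "\<dots> = \<Lambda> (n - i) x" unfolding e using lam_eq_piece[OF l] by simp
  finally show ?thesis by simp
qed (use lam_outside in auto)

lemma lam_lipschitz: "\<exists>L. L-lipschitz_on {0..1} (\<Lambda> i)"
proof -
  have "\<exists>L. L-lipschitz_on {real l / real N..real (Suc l) / real N} (\<Lambda> i)" if l: "l < N" for l
  proof -
    obtain P where P: "\<And>x. bspline_piece \<xi> (cell l) p i x = poly P x" using bspline_piece_poly by metis
    let ?I = "{real l / real N..real (Suc l) / real N}"
    have "compact ((\<lambda>x. poly (pderiv P) x) ` ?I)" by (intro compact_continuous_image continuous_intros) auto
    then obtain B where B: "\<And>x. x \<in> ?I \<Longrightarrow> \<bar>poly (pderiv P) x\<bar> \<le> B"
      by (force dest!: compact_imp_bounded simp: bounded_iff)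
    have "(max B 0)-lipschitz_on ?I (poly P)"
    proof (rule bounded_derivative_imp_lipschitz)
      show "(poly P has_derivative (\<lambda>h. h * poly (pderiv P) x)) (at x within ?I)" for x
        using poly_DERIV[of P x] by (metis has_field_derivative_imp_has_derivative has_derivative_at_withinI mult_commute_abs)
      show "onorm (\<lambda>h. h * poly (pderiv P) x) \<le> max B 0" if "x \<in> ?I" for x
      proof (rule onorm_le)
        fix h show "norm (h * poly (pderiv P) x) \<le> max B 0 * norm h"
          using mult_left_mono[OF order_trans[OF B[OF that] max.cobounded1[of B 0]], of "\<bar>h\<bar>"]
            by (simp add: abs_mult mult.commute)
      qed
    qed auto
    then have "(max B 0)-lipschitz_on ?I (\<Lambda> i)"
      by (rule lipschitz_on_transform) (use lam_eq_piece[OF l] P in auto)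
    then show ?thesis by blast
  qed
  then obtain L where L: "\<And>l. l < N \<Longrightarrow> (L l)-lipschitz_on {real l / real N..real (Suc l) / real N} (\<Lambda> i)" by metis
  define M where "M = (\<Sum>l<N. L l)"
  have L0: "0 \<le> L l" if "l < N" for l using L[OF that] by (rule lipschitz_on_nonneg)
  have "M-lipschitz_on {0..1} (\<Lambda> i)"
  proof (rule lipschitz_on_closed_Union[where I = "{..<N}"])
    fix l assume l: "l \<in> {..<N}"
    have "L l \<le> M" unfolding M_def by (rule member_le_sum) (use l L0 in auto)
    then show "M-lipschitz_on {real l / real N..real (Suc l) / real N} (\<Lambda> i)"
      using L l lipschitz_on_le by blast
  next
    show "{0..1} \<subseteq> (\<Union>l\<in>{..<N}. {real l / real N..real (Suc l) / real N})"
    proof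
      fix x :: real assume "x \<in> {0..1}"
      then obtain l where "l < N" "real l / real N \<le> x" "x \<le> real (Suc l) / real N" by (rule cell_cover)
      then show "x \<in> (\<Union>l\<in>{..<N}. {real l / real N..real (Suc l) / real N})" by auto
    qed
  qed (auto simp: M_def L0 intro!: sum_nonneg)
  then show ?thesis by blast
qed

lemma lam_continuous: "continuous_on {0..1} (\<Lambda> i)"
  using lam_lipschitz lipschitz_on_continuous_on by blast

definition breaks :: "real set" where "breaks = (\<lambda>l. real l / real N) ` {..N}"

lemma finite_breaks: "finite breaks" by (simp add: breaks_def)

lemma lam_differentiable:
  assumes "x \<in> {0..1} - breaks" shows "\<Lambda> i differentiable (at x)"
proof -
  obtain l where l: "l < N" "real l / real N \<le> x" "x \<le> real (Suc l) / real N"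
    using assms by (blast elim: cell_cover)
  have "l \<in> {..N}" "Suc l \<in> {..N}" using l(1) by auto
  then have "x \<noteq> real l / real N" "x \<noteq> real (Suc l) / real N" using assms unfolding breaks_def by blast+
  then have x: "x \<in> {real l / real N<..<real (Suc l) / real N}" using l by auto
  obtain P where P: "\<And>x. bspline_piece \<xi> (cell l) p i x = poly P x" using bspline_piece_poly by metis
  have "(\<Lambda> i has_derivative (\<lambda>h. poly (pderiv P) x * h)) (at x)"
  proof (rule has_derivative_transform_within_open[OF _ _ x])
    show "(poly P has_derivative (\<lambda>h. poly (pderiv P) x * h)) (at x)"
      using poly_DERIV[of P x] by (simp add: has_field_derivative_def)
  qed (use lam_eq_piece[OF l(1)] P in auto)
  then show ?thesis by (auto simp: differentiable_def)
qed

text \<open>Compare the coefficients of \<open>y\<^sup>p\<^sup>-\<^sup>e\<close> in Marsden's identity. The resulting coefficients of \<open>x\<^sup>e\<close> are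
the same on all cells.\<close>

lemma monomial_in_span:
  assumes "e \<le> p"
  shows "\<exists>c. \<forall>x\<in>{0..1}. x ^ e = (\<Sum>i\<le>n. c i * \<Lambda> i x)"
proof (rule exI, rule ballI)
  fix x :: real assume "x \<in> {0..1}"
  then obtain l where l: "l < N" "real l / real N \<le> x" "x \<le> real (Suc l) / real N" by (rule cell_cover)
  let ?\<mu> = "cell l"
  let ?\<Psi> = "\<lambda>i. \<Prod>j=1..p. [:- \<xi> (i + j), 1:]"
  define a where "a = real (p choose e) * (- 1) ^ e"
  have a0: "a \<noteq> 0" using assms by (simp add: a_def)
  have "\<xi> ?\<mu> < \<xi> (Suc ?\<mu>)" using l(1) by (rule cell_pos)
  then have "coeff (\<Sum>i\<le>?\<mu>. smult (bspline_piece \<xi> ?\<mu> p i x) (?\<Psi> i)) (p - e) = coeff ([:- x, 1:] ^ p) (p - e)"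
    by (subst marsden_identity) (use knot_mono in \<open>auto simp: cell_def\<close>)
  also have "coeff ([:- x, 1:] ^ p) (p - e) = real (p choose e) * (- x) ^ e"
    using assms by (subst coeff_linear_poly_power) (auto simp: binomial_symmetric[symmetric])
  also have "\<dots> = a * x ^ e" by (simp add: a_def power_minus[of x])
  finally have "x ^ e = (\<Sum>i\<le>?\<mu>. bspline_piece \<xi> ?\<mu> p i x * coeff (?\<Psi> i) (p - e)) / a"
    using a0 by (simp add: coeff_sum)
  also have "(\<Sum>i\<le>?\<mu>. bspline_piece \<xi> ?\<mu> p i x * coeff (?\<Psi> i) (p - e)) =
     (\<Sum>i\<le>n. bspline_piece \<xi> ?\<mu> p i x * coeff (?\<Psi> i) (p - e))"
  proof (rule sum.mono_neutral_left)
    show "\<forall>i\<in>{..n} - {..?\<mu>}. bspline_piece \<xi> ?\<mu> p i x * coeff (?\<Psi> i) (p - e) = 0"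
      using bspline_piece_support by force
  qed (use cell_le[OF l(1)] in auto)
  also have "\<dots> / a = (\<Sum>i\<le>n. coeff (?\<Psi> i) (p - e) / a * \<Lambda> i x)"
    unfolding sum_divide_distrib by (intro sum.cong refl) (simp add: lam_eq_piece[OF l])
  finally show "x ^ e = (\<Sum>i\<le>n. coeff (\<Prod>j=1..p. [:- \<xi> (i + j), 1:]) (p - e) / (real (p choose e) * (- 1) ^ e) * \<Lambda> i x)"
    unfolding a_def .
qed

end

section \<open>Least-squares projection onto splines\<close>

definition ip :: "(real \<Rightarrow> real) \<Rightarrow> (real \<Rightarrow> real) \<Rightarrow> real" where
  "ip f g = (LINT x:{0..1}|lborel. f x * g x)"

lemma ip_commute: "ip f g = ip g f" by (simp add: ip_def mult.commute)

lemma ip_cong: "(\<And>x. x \<in> {0..1} \<Longrightarrow> f x = f' x) \<Longrightarrow> (\<And>x. x \<in> {0..1} \<Longrightarrow> g x = g' x) \<Longrightarrow> ip f g = ip f' g'"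
  unfolding ip_def by (intro set_lebesgue_integral_cong) auto

lemma ip_linear:
  assumes "continuous_on {0..1} f" "continuous_on {0..1} f'" "continuous_on {0..1} g"
  shows "ip (\<lambda>x. a * f x + b * f' x) g = a * ip f g + b * ip f' g"
proof -
  have "set_integrable lborel {0..1} (\<lambda>x. f x * g x)" "set_integrable lborel {0..1} (\<lambda>x. f' x * g x)"
    using assms by (auto intro!: borel_integrable_atLeastAtMost' continuous_intros)
  then have "(LINT x:{0..1}|lborel. a * (f x * g x) + b * (f' x * g x)) = a * ip f g + b * ip f' g"
    unfolding ip_def by (subst set_integral_add) auto
  then show ?thesis by (simp add: ip_def algebra_simps)
qed

lemma ip_diff:
  assumes "continuous_on {0..1} f" "continuous_on {0..1} f'" "continuous_on {0..1} g"
  shows "ip (\<lambda>x. f x - f' x) g = ip f g - ip f' g"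
  using ip_linear[OF assms, of 1 "-1"] by simp

lemma ip_sum:
  assumes "\<And>i. i \<in> I \<Longrightarrow> continuous_on {0..1} (f i)" "continuous_on {0..1} g" "finite I"
  shows "ip (\<lambda>x. \<Sum>i\<in>I. c i * f i x) g = (\<Sum>i\<in>I. c i * ip (f i) g)"
  using assms(3,1)
proof (induction I)
  case empty show ?case by (simp add: ip_def)
next
  case (insert i I)
  have "ip (\<lambda>x. c i * f i x + 1 * (\<Sum>i\<in>I. c i * f i x)) g = c i * ip (f i) g + 1 * ip (\<lambda>x. \<Sum>i\<in>I. c i * f i x) g"
    using insert by (intro ip_linear assms(2) continuous_intros) auto
  then show ?case using insert by simp
qed

lemma ip_self_eq_0:
  assumes "continuous_on {0..1} f" "ip f f = 0" "x \<in> {0..1}"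
  shows "f x = 0"
proof -
  have c: "continuous_on {0..1} (\<lambda>x. f x * f x)" using assms(1) by (intro continuous_intros)
  have "((\<lambda>x. f x * f x) has_integral (LINT x:{0..1}|lborel. f x * f x)) {0..1}"
    using set_borel_integral_eq_integral[OF borel_integrable_atLeastAtMost'[OF c]] by (simp add: integrable_integral)
  then have "((\<lambda>x. f x * f x) has_integral 0) (cbox 0 1)"
    using assms(2) unfolding ip_def cbox_interval by simp
  then have "f x * f x = 0"
    by (rule has_integral_0_cbox_imp_0[rotated 2]) (use c assms(3) in \<open>auto simp: box_real\<close>)
  then show ?thesis by simp
qed

text \<open>By induction: correct the best approximation from the first \<open>n\<close> functions along the residual \<open>g\<close> of the
next one. If \<open>ip g g = 0\<close>, then \<open>g\<close> vanishes on \<open>[0, 1]\<close> and there is nothing to correct.\<close>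

lemma exists_least_squares:
  assumes f: "\<And>i::nat. continuous_on {0..1} (f i)" and "continuous_on {0..1} \<phi>"
  shows "\<exists>c. \<forall>i<n. ip (\<lambda>x. \<phi> x - (\<Sum>j<n. c j * f j x)) (f i) = 0"
  using assms(2)
proof (induction n arbitrary: \<phi>)
  case (Suc n)
  obtain a where a: "\<And>i. i < n \<Longrightarrow> ip (\<lambda>x. f n x - (\<Sum>j<n. a j * f j x)) (f i) = 0" using Suc.IH[OF f] by blast
  obtain c where c: "\<And>i. i < n \<Longrightarrow> ip (\<lambda>x. \<phi> x - (\<Sum>j<n. c j * f j x)) (f i) = 0" using Suc by blast
  define g where "g x = f n x - (\<Sum>j<n. a j * f j x)" for x
  define h where "h x = \<phi> x - (\<Sum>j<n. c j * f j x)" for x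
  have cg: "continuous_on {0..1} g" unfolding g_def by (intro continuous_intros f)
  have ch: "continuous_on {0..1} h" unfolding h_def by (intro continuous_intros f Suc.prems)
  \<comment> \<open>if \<open>ip g g = 0\<close>, then \<open>t = 0\<close>, and no correction is made\<close>
  define t where "t = ip h g / ip g g"
  define d where "d j = (if j = n then t else c j - t * a j)" for j
  have e: "(\<lambda>x. \<phi> x - (\<Sum>j<Suc n. d j * f j x)) = (\<lambda>x. 1 * h x + (- t) * g x)"
  proof
    fix x
    have "(\<Sum>j<n. d j * f j x) = (\<Sum>j<n. c j * f j x - t * (a j * f j x))"
      by (intro sum.cong) (auto simp: d_def algebra_simps)
    then show "\<phi> x - (\<Sum>j<Suc n. d j * f j x) = 1 * h x + (- t) * g x"
      by (simp add: h_def g_def sum_subtractf sum_distrib_left[symmetric] d_def algebra_simps)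
  qed
  have hg: "ip (\<lambda>x. 1 * h x + (- t) * g x) (f i) = ip h (f i) - t * ip g (f i)" for i
    using ip_linear[OF ch cg f, of 1 "- t"] by simp
  have hgg: "ip h g - t * ip g g = 0"
  proof (cases "ip g g = 0")
    case True
    then have "ip h g = ip h (\<lambda>_. 0)" by (intro ip_cong) (use ip_self_eq_0[OF cg] in auto)
    then show ?thesis using True by (simp add: ip_def)
  qed (simp add: t_def)
  have fn: "ip \<psi> (f n) = ip \<psi> g" if c\<psi>: "continuous_on {0..1} \<psi>" and o: "\<And>i. i < n \<Longrightarrow> ip \<psi> (f i) = 0" for \<psi>
  proof -
    have "ip \<psi> (f n) = ip (\<lambda>x. 1 * g x + 1 * (\<Sum>j<n. a j * f j x)) \<psi>" unfolding g_def by (subst ip_commute) simp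
    also have "\<dots> = ip g \<psi> + (\<Sum>j<n. a j * ip (f j) \<psi>)"
      by (subst ip_linear) (auto intro!: continuous_intros cg c\<psi> f simp: ip_sum f c\<psi>)
    also have "(\<Sum>j<n. a j * ip (f j) \<psi>) = 0" by (intro sum.neutral) (use o ip_commute in auto)
    finally show ?thesis by (simp add: ip_commute)
  qed
  have "ip h (f i) - t * ip g (f i) = 0" if "i < Suc n" for i
  proof (cases "i = n")
    case True
    show ?thesis using hgg fn[OF ch] fn[OF cg] c a unfolding True h_def[symmetric] g_def[symmetric] by simp
  next
    case False
    then have "i < n" using that by simp
    then show ?thesis using c[of i] a[of i] unfolding h_def[symmetric] g_def[symmetric] by simp
  qed
  then show ?case unfolding hg[symmetric] e[symmetric] by (intro exI[of _ d]) blast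
qed simp

definition moments_vanish :: "nat \<Rightarrow> (real \<Rightarrow> real) \<Rightarrow> bool" where
  "moments_vanish r f \<longleftrightarrow> (\<forall>q :: real poly. degree q < r \<longrightarrow> ip f (poly q) = 0)"

lemma continuous_on_poly': "continuous_on S (poly (q :: real poly))"
  by (intro continuous_on_poly continuous_on_id)

text \<open>Reflection maps polynomials to polynomials of the same degree.\<close>

lemma moments_vanish_reflect:
  assumes "moments_vanish r f"
  shows "moments_vanish r (\<lambda>x. f (1 - x))"
  unfolding moments_vanish_def
proof (intro allI impI)
  fix q :: "real poly" assume q: "degree q < r"
  let ?q = "pcompose q [:1, -1:]"
  have "degree ?q < r" using q by (simp add: degree_pcompose)
  then have "ip f (poly ?q) = 0" using assms by (simp add: moments_vanish_def)
  then have 0: "(LINT x|lborel. indicator {0..1} x * (f x * poly q (1 - x))) = 0"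
    by (simp add: ip_def set_lebesgue_integral_def poly_pcompose)
  have "(LINT x|lborel. indicator {0..1} x * (f x * poly q (1 - x))) =
     (LINT x|lborel. indicator {0..1} (1 + (- 1) * x) * (f (1 + (- 1) * x) * poly q (1 - (1 + (- 1) * x))))"
    by (subst lborel_integral_real_affine[where c = "-1" and t = 1]) auto
  also have "\<dots> = (LINT x|lborel. indicator {0..1} x * (f (1 - x) * poly q x))"
    by (intro Bochner_Integration.integral_cong) (auto simp: indicator_def)
  finally show "ip (\<lambda>x. f (1 - x)) (poly q) = 0"
    using 0 by (simp add: ip_def set_lebesgue_integral_def)
qed

context spline_patch
begin

lemma splines_lam: "i \<le> n \<Longrightarrow> lam D k i \<in> splines D k"
  unfolding splines_def by (intro CollectI exI[of _ "\<lambda>j. if j = i then 1 else 0"]) (auto simp: if_distrib[of "\<lambda>c. c * _"] cong: if_cong)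

lemma splines_lincomb:
  assumes "\<phi> \<in> splines D k" "\<psi> \<in> splines D k"
  shows "(\<lambda>x. a * \<phi> x + b * \<psi> x) \<in> splines D k"
proof -
  obtain c d where "\<phi> = (\<lambda>x. \<Sum>i\<le>n. c i * lam D k i x)" "\<psi> = (\<lambda>x. \<Sum>i\<le>n. d i * lam D k i x)"
    using assms by (auto simp: splines_def)
  then show ?thesis unfolding splines_def
    by (intro CollectI exI[of _ "\<lambda>i. a * c i + b * d i"]) (auto simp: fun_eq_iff algebra_simps sum.distrib sum_distrib_left)
qed

lemma splines_add: "\<phi> \<in> splines D k \<Longrightarrow> \<psi> \<in> splines D k \<Longrightarrow> (\<lambda>x. \<phi> x + \<psi> x) \<in> splines D k"
  using splines_lincomb[of \<phi> \<psi> 1 1] by simp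
lemma splines_diff: "\<phi> \<in> splines D k \<Longrightarrow> \<psi> \<in> splines D k \<Longrightarrow> (\<lambda>x. \<phi> x - \<psi> x) \<in> splines D k"
  using splines_lincomb[of \<phi> \<psi> 1 "-1"] by simp
lemma splines_mult: "\<phi> \<in> splines D k \<Longrightarrow> (\<lambda>x. a * \<phi> x) \<in> splines D k"
  using splines_lincomb[of \<phi> \<phi> a 0] by simp
lemma splines_0: "(\<lambda>x. 0) \<in> splines D k"
  unfolding splines_def by (intro CollectI exI[of _ "\<lambda>_. 0"]) auto
lemma splines_sum: "(\<And>i. i \<in> I \<Longrightarrow> f i \<in> splines D k) \<Longrightarrow> (\<lambda>x. \<Sum>i\<in>I. f i x) \<in> splines D k"
  by (induction I rule: infinite_finite_induct) (auto simp: splines_0 splines_add)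

lemma splines_continuous: "\<phi> \<in> splines D k \<Longrightarrow> continuous_on {0..1} \<phi>"
  by (auto simp: splines_def intro!: continuous_intros lam_continuous)

lemma splines_outside: "\<phi> \<in> splines D k \<Longrightarrow> x \<notin> {0..1} \<Longrightarrow> \<phi> x = 0"
  using lam_outside by (auto simp: splines_def)

lemma sum_lam_0: "(\<Sum>i\<le>n. c i * lam D k i 0) = c 0"
  by (simp add: lam_0 if_distrib[of "(*) _"] cong: if_cong)
lemma sum_lam_1: "(\<Sum>i\<le>n. c i * lam D k i 1) = c n"
  by (simp add: lam_1 if_distrib[of "(*) _"] cong: if_cong)

text \<open>The first and the last coefficient are end values, hence independent of the representation.\<close>

lemma bcoef_ends:
  assumes "\<phi> \<in> splines D k"
  shows "bcoef D k \<phi> 0 = \<phi> 0" "bcoef D k \<phi> n = \<phi> 1"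
proof -
  have e: "\<phi> = (\<lambda>x. \<Sum>i\<le>n. bcoef D k \<phi> i * lam D k i x)"
    using someI_ex[of "\<lambda>c. \<phi> = (\<lambda>x. \<Sum>i\<le>n. c i * lam D k i x)"] assms
    unfolding bcoef_def splines_def by blast
  show "bcoef D k \<phi> 0 = \<phi> 0" by (subst (2) e) (simp only: sum_lam_0)
  show "bcoef D k \<phi> n = \<phi> 1" by (subst (2) e) (simp only: sum_lam_1)
qed

lemma l2_proj_eqI:
  assumes "\<psi> \<in> splines D k" "\<And>\<eta>. \<eta> \<in> splines D k \<Longrightarrow> ip \<psi> \<eta> = ip \<phi> \<eta>"
  shows "l2_proj D k \<phi> = \<psi>"
  unfolding l2_proj_def ip_def[symmetric]
proof (rule the_equality)
  fix \<psi>' assume h: "\<psi>' \<in> splines D k \<and> (\<forall>\<eta>\<in>splines D k. ip \<psi>' \<eta> = ip \<phi> \<eta>)"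
  let ?d = "\<lambda>x. \<psi>' x - \<psi> x"
  have d: "?d \<in> splines D k" using h assms(1) splines_diff by blast
  have c: "continuous_on {0..1} \<psi>'" "continuous_on {0..1} \<psi>" "continuous_on {0..1} ?d"
    using h assms(1) d splines_continuous by blast+
  have "ip ?d ?d = ip \<psi>' ?d - ip \<psi> ?d" using c by (intro ip_diff)
  also have "\<dots> = 0" using h assms(2)[OF d] d by simp
  finally have "ip ?d ?d = 0" .
  then have "?d x = 0" for x
    using ip_self_eq_0[OF c(3)] splines_outside[OF d] by blast
  then show "\<psi>' = \<psi>" by (auto simp: fun_eq_iff)
qed (use assms in auto)

lemma l2_proj:
  assumes "continuous_on {0..1} \<phi>"
  shows "l2_proj D k \<phi> \<in> splines D k" "\<eta> \<in> splines D k \<Longrightarrow> ip (l2_proj D k \<phi>) \<eta> = ip \<phi> \<eta>"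
proof -
  obtain c where c: "\<And>i. i < Suc n \<Longrightarrow> ip (\<lambda>x. \<phi> x - (\<Sum>j<Suc n. c j * lam D k j x)) (lam D k i) = 0"
    using exists_least_squares[of "lam D k" \<phi> "Suc n"] lam_continuous assms by blast
  define \<psi> where "\<psi> = (\<lambda>x. \<Sum>j\<le>n. c j * lam D k j x)"
  have \<psi>: "\<psi> \<in> splines D k" unfolding splines_def \<psi>_def by blast
  note c\<psi> = splines_continuous[OF \<psi>]
  have 1: "ip \<psi> (lam D k i) = ip \<phi> (lam D k i)" if "i \<le> n" for i
    using c[of i] that ip_diff[OF assms c\<psi> lam_continuous] unfolding \<psi>_def lessThan_Suc_atMost by simp
  have 2: "ip \<psi> \<eta> = ip \<phi> \<eta>" if \<eta>: "\<eta> \<in> splines D k" for \<eta>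
  proof -
    obtain d where d: "\<eta> = (\<lambda>x. \<Sum>i\<le>n. d i * lam D k i x)" using \<eta> by (auto simp: splines_def)
    have "ip \<psi> \<eta> = (\<Sum>i\<le>n. d i * ip (lam D k i) \<psi>)"
      unfolding d by (subst ip_commute, subst ip_sum) (auto simp: lam_continuous c\<psi>)
    also have "\<dots> = (\<Sum>i\<le>n. d i * ip (lam D k i) \<phi>)"
      by (intro sum.cong refl) (metis 1 ip_commute atMost_iff)
    also have "\<dots> = ip \<phi> \<eta>"
      unfolding d by (subst ip_commute, subst ip_sum) (auto simp: lam_continuous assms)
    finally show ?thesis .
  qed
  have "l2_proj D k \<phi> = \<psi>" by (rule l2_proj_eqI) (use \<psi> 2 in auto)
  then show "l2_proj D k \<phi> \<in> splines D k" "\<eta> \<in> splines D k \<Longrightarrow> ip (l2_proj D k \<phi>) \<eta> = ip \<phi> \<eta>"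
    using \<psi> 2 by auto
qed

lemma l2_proj_lincomb:
  assumes "continuous_on {0..1} \<phi>" "continuous_on {0..1} \<psi>"
  shows "l2_proj D k (\<lambda>x. a * \<phi> x + b * \<psi> x) = (\<lambda>x. a * l2_proj D k \<phi> x + b * l2_proj D k \<psi> x)"
  by (rule l2_proj_eqI)
     (use assms l2_proj in \<open>auto intro!: splines_lincomb simp: ip_linear splines_continuous\<close>)

lemma poly_in_splines:
  assumes "degree q \<le> p"
  obtains \<eta> where "\<eta> \<in> splines D k" "\<And>x. x \<in> {0..1} \<Longrightarrow> \<eta> x = poly q x"
proof -
  have "\<exists>\<eta>\<in>splines D k. \<forall>x\<in>{0..1}. \<eta> x = x ^ e" if "e \<le> p" for e
    using monomial_in_span[OF that] unfolding splines_def by fastforce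
  then obtain f where f: "\<And>e. e \<le> p \<Longrightarrow> f e \<in> splines D k" "\<And>e x. e \<le> p \<Longrightarrow> x \<in> {0..1} \<Longrightarrow> f e x = x ^ e" by metis
  show ?thesis
  proof
    show "(\<lambda>x. \<Sum>e\<le>degree q. coeff q e * f e x) \<in> splines D k"
      by (intro splines_sum splines_mult f) (use assms in auto)
    show "(\<Sum>e\<le>degree q. coeff q e * f e x) = poly q x" if "x \<in> {0..1}" for x
      unfolding poly_altdef by (intro sum.cong refl) (use assms f that in auto)
  qed
qed

end

section \<open>End corrections\<close>

text \<open>One patch together with a solution of the correction system for the left end.\<close>

locale spline_correction = spline_patch +
  fixes r :: nat and \<gamma> :: "nat \<Rightarrow> nat \<Rightarrow> real"
  assumes r_le: "r \<le> sdeg D + 1"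
    and correction: "\<And>q :: real poly. degree q < r \<Longrightarrow>
        (\<Sum>i=1..r. \<gamma> k i * (LINT x:{0..1}|lborel. lam D k i x * poly q x)) =
        (LINT x:{0..1}|lborel. lam D k 0 x * poly q x)"
begin

lemma r_less: "r < n" using r_le nmax_gt by linarith

abbreviation mu where "mu \<equiv> mu_p D r \<gamma> k"

lemma end_idx_le: "i \<le> n \<Longrightarrow> end_idx b n i \<le> n" by (auto simp: end_idx_def)

lemma mu_splines: "mu b \<in> splines D k"
  unfolding mu_p_def by (intro splines_sum splines_mult splines_lam end_idx_le) (use r_less in auto)

lemma mu_ends: "mu b 0 = 0" "mu b 1 = 0"
  using r_less by (auto simp: mu_p_def lam_0 lam_1 end_idx_def intro!: sum.neutral)

lemma mu_reflect: "mu True x = mu False (1 - x)"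
  unfolding mu_p_def by (intro sum.cong refl) (use r_less in \<open>auto simp: end_idx_def lam_reflect\<close>)

text \<open>For the left end this is the correction system; the right end is its mirror image, as the knots are
symmetric.\<close>

lemma end_moments: "moments_vanish r (\<lambda>x. lam D k (end_idx b n 0) x - mu b x)"
proof -
  have *: "moments_vanish r (\<lambda>x. lam D k 0 x - mu False x)"
    unfolding moments_vanish_def
  proof (intro allI impI)
    fix q :: "real poly" assume q: "degree q < r"
    have "ip (mu False) (poly q) = (\<Sum>i=1..r. \<gamma> k i * ip (lam D k i) (poly q))"
      unfolding mu_p_def end_idx_def by (subst ip_sum[symmetric]) (auto simp: lam_continuous continuous_on_poly')
    also have "\<dots> = ip (lam D k 0) (poly q)" unfolding ip_def by (rule correction[OF q])
    finally show "ip (\<lambda>x. lam D k 0 x - mu False x) (poly q) = 0"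
      by (subst ip_diff) (auto simp: lam_continuous continuous_on_poly' mu_splines splines_continuous)
  qed
  show ?thesis
  proof (cases b)
    case True
    have "lam D k n x = lam D k 0 (1 - x)" for x using lam_reflect[of 0 x] by simp
    then show ?thesis using moments_vanish_reflect[OF *] True by (simp add: end_idx_def mu_reflect)
  qed (use * in \<open>simp add: end_idx_def\<close>)
qed

lemma correct_ends_eq:
  assumes "\<phi> \<in> splines D k"
  shows "correct_ends D r \<gamma> k \<phi> x =
    \<phi> x - \<phi> 0 * (lam D k 0 x - mu False x) - \<phi> 1 * (lam D k n x - mu True x)"
proof -
  have "(\<Sum>i=n - r..n - 1. \<gamma> k (n - i) * lam D k i x) = (\<Sum>i=1..r. \<gamma> k i * lam D k (n - i) x)"
    by (rule sum.reindex_bij_witness[of _ "\<lambda>i. n - i" "\<lambda>i. n - i"]) (use r_less in auto)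
  then show ?thesis unfolding correct_ends_def Let_def bcoef_ends[OF assms]
    by (simp add: mu_p_def end_idx_def algebra_simps)
qed

end

section \<open>The restriction operator\<close>

locale spline_edge = cm: spline_correction D km r \<gamma> + cp: spline_correction D kp r \<gamma>
  for D km kp r \<gamma>
begin

abbreviation R where "R \<equiv> restr D r \<gamma> km kp"

text \<open>The part of a fine spline that is actually projected: the end functions subtracted are those of the
coarse space, so that the difference vanishes at both ends.\<close>

definition strip :: "(real \<Rightarrow> real) \<Rightarrow> real \<Rightarrow> real" where
  "strip \<phi> = (\<lambda>x. \<phi> x - \<phi> 0 * lam D km 0 x - \<phi> 1 * lam D km (nmax D km) x)"

lemma strip_continuous: "\<phi> \<in> splines D kp \<Longrightarrow> continuous_on {0..1} (strip \<phi>)"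
  unfolding strip_def by (intro continuous_intros cp.splines_continuous cm.lam_continuous)

abbreviation proj where "proj \<phi> \<equiv> l2_proj D km (strip \<phi>)"

lemma proj_splines: "\<phi> \<in> splines D kp \<Longrightarrow> proj \<phi> \<in> splines D km"
  by (rule cm.l2_proj) (rule strip_continuous)

lemma R_eq:
  assumes "\<phi> \<in> splines D kp"
  shows "R \<phi> = (\<lambda>x. \<phi> 0 * lam D km 0 x + \<phi> 1 * lam D km (nmax D km) x + (proj \<phi> x
     - proj \<phi> 0 * (lam D km 0 x - cm.mu False x) - proj \<phi> 1 * (lam D km (nmax D km) x - cm.mu True x)))"
proof -
  have "strip_ends D km kp \<phi> = strip \<phi>"
    unfolding strip_def strip_ends_def cp.bcoef_ends[OF assms] by (rule ext) simp
  then show ?thesis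
    by (intro ext) (simp add: restr_def cp.bcoef_ends[OF assms] cm.correct_ends_eq[OF proj_splines[OF assms]])
qed

lemma R_splines: "\<phi> \<in> splines D kp \<Longrightarrow> R \<phi> \<in> splines D km"
  by (simp add: R_eq) (intro cm.splines_add cm.splines_mult cm.splines_diff cm.splines_lam cm.mu_splines proj_splines; simp)

lemma R_ends:
  assumes "\<phi> \<in> splines D kp" shows "R \<phi> 0 = \<phi> 0" "R \<phi> 1 = \<phi> 1"
  using cm.r_less by (simp_all add: R_eq[OF assms] cm.lam_0 cm.lam_1 cm.mu_ends)

lemma R_lincomb:
  assumes "\<phi> \<in> splines D kp" "\<psi> \<in> splines D kp"
  shows "R (\<lambda>x. a * \<phi> x + b * \<psi> x) = (\<lambda>x. a * R \<phi> x + b * R \<psi> x)"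
proof -
  have "strip (\<lambda>x. a * \<phi> x + b * \<psi> x) = (\<lambda>x. a * strip \<phi> x + b * strip \<psi> x)"
    by (simp add: strip_def fun_eq_iff algebra_simps)
  then have "proj (\<lambda>x. a * \<phi> x + b * \<psi> x) = (\<lambda>x. a * proj \<phi> x + b * proj \<psi> x)"
    using cm.l2_proj_lincomb[OF strip_continuous[OF assms(1)] strip_continuous[OF assms(2)]] by simp
  then show ?thesis using assms
    by (simp add: R_eq cp.splines_lincomb fun_eq_iff algebra_simps)
qed

lemma R_0: "R (\<lambda>x. 0) = (\<lambda>x. 0)"
  using R_lincomb[OF cp.splines_0 cp.splines_0, of 0 0] by simp

lemma R_sum:
  assumes "finite I" "\<And>i. i \<in> I \<Longrightarrow> f i \<in> splines D kp"
  shows "R (\<lambda>x. \<Sum>i\<in>I. c i * f i x) = (\<lambda>x. \<Sum>i\<in>I. c i * R (f i) x)"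
  using assms
proof (induction I)
  case (insert i I)
  have "R (\<lambda>x. c i * f i x + 1 * (\<Sum>i\<in>I. c i * f i x)) = (\<lambda>x. c i * R (f i) x + 1 * R (\<lambda>x. \<Sum>i\<in>I. c i * f i x) x)"
    using insert by (intro R_lincomb cp.splines_sum cp.splines_mult) auto
  then show ?case using insert by simp
qed (simp add: R_0)

text \<open>For a coarse spline the stripped function is itself coarse and vanishes at both ends, so neither the
projection nor the end correction changes it.\<close>

lemma R_id:
  assumes "\<phi> \<in> splines D kp" "\<phi> \<in> splines D km"
  shows "R \<phi> = \<phi>"
proof -
  have s: "strip \<phi> \<in> splines D km" unfolding strip_def
    by (intro cm.splines_diff cm.splines_mult cm.splines_lam assms) auto
  then have "proj \<phi> = strip \<phi>" by (intro cm.l2_proj_eqI) auto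
  moreover have "strip \<phi> 0 = 0" "strip \<phi> 1 = 0" using cm.r_less by (auto simp: strip_def cm.lam_0 cm.lam_1)
  ultimately show ?thesis using assms by (simp add: R_eq fun_eq_iff) (simp add: strip_def)
qed

text \<open>The projection is orthogonal to the coarse splines and these contain all polynomials of degree below \<open>r\<close>,
which is where \<open>r \<le> p + 1\<close> is used; the end correction only adds multiples of functions with vanishing
moments.\<close>

lemma R_moments:
  assumes "\<phi> \<in> splines D kp"
  shows "moments_vanish r (\<lambda>x. R \<phi> x - \<phi> x)"
  unfolding moments_vanish_def
proof (intro allI impI)
  fix q :: "real poly" assume q: "degree q < r"
  note c = continuous_on_poly'[of _ q]
  have "degree q \<le> sdeg D" using q cm.r_le by linarith
  then obtain \<eta> where \<eta>: "\<eta> \<in> splines D km" "\<And>x. x \<in> {0..1} \<Longrightarrow> \<eta> x = poly q x"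
    by (rule cm.poly_in_splines) blast
  define E where "E b x = lam D km (end_idx b (nmax D km) 0) x - cm.mu b x" for b x
  have E: "ip (E b) (poly q) = 0" for b
    using cm.end_moments[of b] q unfolding E_def moments_vanish_def by blast
  have cE: "continuous_on {0..1} (E b)" for b
    unfolding E_def by (intro continuous_intros cm.lam_continuous cm.splines_continuous cm.mu_splines)
  have cp: "continuous_on {0..1} (proj \<phi>)" by (intro cm.splines_continuous proj_splines assms)
  note cs = strip_continuous[OF assms]
  have "R \<phi> x - \<phi> x = (proj \<phi> x - strip \<phi> x) - (proj \<phi> 0 * E False x + proj \<phi> 1 * E True x)" for x
    by (simp add: R_eq[OF assms] strip_def E_def end_idx_def algebra_simps)
  then have "ip (\<lambda>x. R \<phi> x - \<phi> x) (poly q) = ip (\<lambda>x. (proj \<phi> x - strip \<phi> x) - (proj \<phi> 0 * E False x + proj \<phi> 1 * E True x)) (poly q)"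
    by simp
  also have "\<dots> = ip (proj \<phi>) (poly q) - ip (strip \<phi>) (poly q)"
    by (subst ip_diff, intro continuous_intros cp cs, intro continuous_intros cE, rule c)
       (simp add: ip_diff[OF cp cs c] ip_linear[OF cE cE c] E)
  also have "ip (proj \<phi>) (poly q) = ip (proj \<phi>) \<eta>" by (rule ip_cong) (use \<eta> in auto)
  also have "\<dots> = ip (strip \<phi>) \<eta>" using cm.l2_proj(2)[OF cs \<eta>(1)] .
  also have "\<dots> = ip (strip \<phi>) (poly q)" by (rule ip_cong) (use \<eta> in auto)
  finally show "ip (\<lambda>x. R \<phi> x - \<phi> x) (poly q) = 0" by simp
qed

end

section \<open>Smooth bump functions\<close>

text \<open>A class of functions on the line, flat at zero, that is closed under differentiation.\<close>

definition flat :: "real poly \<Rightarrow> real \<Rightarrow> real" where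
  "flat P t = (if 0 < t then poly P (1 / t) * exp (- (1 / t)) else 0)"

lemma poly_times_exp_tendsto_0: "((\<lambda>s. poly P s * exp (- s)) \<longlongrightarrow> (0::real)) at_top"
proof -
  have "((\<lambda>s. \<Sum>i\<le>degree P. coeff P i * (s ^ i / exp s)) \<longlongrightarrow> (\<Sum>i\<le>degree P. coeff P i * 0)) at_top"
    by (intro tendsto_sum tendsto_mult tendsto_const tendsto_power_div_exp_0)
  then show ?thesis by (simp add: poly_altdef sum_distrib_right exp_minus divide_inverse mult.assoc)
qed

lemma flat_has_derivative:
  "(flat P has_real_derivative flat ([:0, 0, 1:] * (P - pderiv P)) t) (at t)"
proof -
  let ?Q = "[:0, 0, 1:] * (P - pderiv P)"
  consider "t > 0" | "t < 0" | "t = 0" by linarith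
  then show ?thesis
  proof cases
    case 1
    have i: "((\<lambda>t. 1 / t) has_real_derivative - (1 / t ^ 2)) (at t)"
      using 1 by (auto intro!: derivative_eq_intros simp: power2_eq_square)
    have "((\<lambda>t. poly P (1 / t) * exp (- (1 / t))) has_real_derivative
       poly (pderiv P) (1 / t) * - (1 / t ^ 2) * exp (- (1 / t)) + exp (- (1 / t)) * - (- (1 / t ^ 2)) * poly P (1 / t)) (at t)"
      by (intro DERIV_mult DERIV_chain2[OF poly_DERIV i] DERIV_chain2[OF DERIV_exp] DERIV_minus i)
    also have "poly (pderiv P) (1 / t) * - (1 / t ^ 2) * exp (- (1 / t)) + exp (- (1 / t)) * - (- (1 / t ^ 2)) * poly P (1 / t) = flat ?Q t"
      using 1 by (simp add: flat_def power2_eq_square left_diff_distrib right_diff_distrib)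
    finally show ?thesis
      by (rule has_field_derivative_transform_within_open[where S = "{0<..}"]) (use 1 in \<open>auto simp: flat_def\<close>)
  next
    case 2
    have "((\<lambda>t. 0) has_real_derivative flat ?Q t) (at t)"
      using 2 by (auto simp: flat_def)
    then show ?thesis
      by (rule has_field_derivative_transform_within_open[where S = "{..<0}"]) (use 2 in \<open>auto simp: flat_def\<close>)
  next
    case 3
    have r: "((\<lambda>h. flat P h / h) \<longlongrightarrow> 0) (at_right 0)"
    proof -
      have "((\<lambda>h. poly ([:0, 1:] * P) (inverse h) * exp (- inverse h)) \<longlongrightarrow> 0) (at_right 0)"
        by (rule filterlim_compose[OF poly_times_exp_tendsto_0 filterlim_inverse_at_top_right])
      then show ?thesis
        by (rule Lim_transform_eventually) (auto simp: eventually_at_filter flat_def inverse_eq_divide mult.commute)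
    qed
    have l: "((\<lambda>h. flat P h / h) \<longlongrightarrow> 0) (at_left 0)"
      by (rule Lim_transform_eventually[OF tendsto_const]) (auto simp: eventually_at_filter flat_def)
    have "((\<lambda>h. flat P h / h) \<longlongrightarrow> 0) (at 0)" using l r by (rule filterlim_split_at)
    then show ?thesis using 3 by (simp add: DERIV_def flat_def)
  qed
qed

primrec flat_poly :: "nat \<Rightarrow> real poly" where
  "flat_poly 0 = 1"
| "flat_poly (Suc i) = [:0, 0, 1:] * (flat_poly i - pderiv (flat_poly i))"

lemma Ck_lower: "Ck (Suc n) f \<Longrightarrow> Ck n f"
proof (induction n arbitrary: f)
  case 0
  then show ?case by (auto simp: continuous_on_eq_continuous_within intro!: differentiable_imp_continuous_within)
qed auto

lemma frechet_derivative_eq: "(f has_derivative f') (at x) \<Longrightarrow> frechet_derivative f (at x) = f'"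
  by (metis frechet_derivative_at)

lemma Ck_const: "Ck n (\<lambda>x. c)"
  by (induction n arbitrary: c) (auto simp: frechet_derivative_eq[OF has_derivative_const])

lemma Ck_add: "Ck n f \<Longrightarrow> Ck n g \<Longrightarrow> Ck n (\<lambda>x. f x + g x)"
proof (induction n arbitrary: f g)
  case (Suc n)
  have "frechet_derivative (\<lambda>x. f x + g x) (at x) = (\<lambda>h. frechet_derivative f (at x) h + frechet_derivative g (at x) h)" for x
    using Suc.prems by (intro frechet_derivative_eq has_derivative_add) (auto simp: frechet_derivative_works)
  then show ?case using Suc by (auto intro!: differentiable_add)
qed (auto intro: continuous_on_add)

lemma Ck_mult: "Ck n f \<Longrightarrow> Ck n g \<Longrightarrow> Ck n (\<lambda>x. f x * g x)"
proof (induction n arbitrary: f g)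
  case (Suc n)
  have "frechet_derivative (\<lambda>x. f x * g x) (at x) = (\<lambda>h. f x * frechet_derivative g (at x) h + frechet_derivative f (at x) h * g x)" for x
    using Suc.prems by (intro frechet_derivative_eq has_derivative_mult) (auto simp: frechet_derivative_works)
  then show ?case using Suc Ck_lower[OF Suc.prems(1)] Ck_lower[OF Suc.prems(2)]
    by (auto intro!: differentiable_mult Ck_add Suc.IH)
qed (auto intro: continuous_on_mult)

lemma Ck_prod: "(\<And>a. Ck n (f a)) \<Longrightarrow> Ck n (\<lambda>x. \<Prod>a\<in>A. f a x)"
proof (induction A rule: infinite_finite_induct)
  case (insert a A)
  have "Ck n (\<lambda>x. f a x * (\<Prod>a\<in>A. f a x))" by (rule Ck_mult) (rule insert.prems, rule insert.IH, rule insert.prems)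
  then show ?case by (simp only: prod.insert[OF insert.hyps])
qed (simp_all add: Ck_const)

text \<open>A family closed under differentiation, as a function of one direction, gives functions of class \<open>C\<^sup>n\<close> in
the plane.\<close>

lemma Ck_ridge:
  assumes "\<And>i t. (D i has_real_derivative D (Suc i) t) (at t)"
  shows "Ck n (\<lambda>x. D i (x \<bullet> a + d))"
proof (induction n arbitrary: i)
  case 0
  have "continuous_on UNIV (D i)" using assms DERIV_isCont continuous_at_imp_continuous_on by blast
  then have "continuous_on UNIV (D i \<circ> (\<lambda>x. x \<bullet> a + d))"
    by (intro continuous_on_compose continuous_intros) (auto elim: continuous_on_subset)
  then show ?case by (simp add: o_def)
next
  case (Suc n)
  have d: "((\<lambda>x. D i (x \<bullet> a + d)) has_derivative (\<lambda>h. (h \<bullet> a) * D (Suc i) (x \<bullet> a + d))) (at x)" for x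
  proof -
    have "((\<lambda>x. x \<bullet> a + d) has_derivative (\<lambda>h. h \<bullet> a)) (at x)" by (auto intro!: derivative_eq_intros)
    from DERIV_compose_FDERIV[OF assms this] show ?thesis .
  qed
  have "(\<lambda>x. D i (x \<bullet> a + d)) differentiable at x" for x using d unfolding differentiable_def by blast
  then show ?case using Suc by (simp add: frechet_derivative_eq[OF d] Ck_mult Ck_const)
qed

lemma flat_one_smooth: "Ck n (\<lambda>x. flat 1 (x \<bullet> a + d))"
proof -
  have "(flat (flat_poly i) has_real_derivative flat (flat_poly (Suc i)) t) (at t)" for i t
    by (simp only: flat_poly.simps flat_has_derivative)
  from Ck_ridge[of "\<lambda>i. flat (flat_poly i)", OF this, of n 0 a d] show ?thesis
    by (simp only: flat_poly.simps(1))
qed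

text \<open>A product of four ridge functions rather than a radial function: smoothness then follows from
differentiation in one variable.\<close>

definition bump :: "real \<times> real \<Rightarrow> real \<Rightarrow> real \<times> real \<Rightarrow> real" where
  "bump y \<sigma> x = (\<Prod>a\<in>{(1, 0), (-1, 0), (0, 1), (0, -1)}. flat 1 (1 / 2 + (x - y) \<bullet> a / \<sigma>))"

lemma flat_one_range: "0 \<le> flat 1 t" "flat 1 t \<le> 1" by (auto simp: flat_def)

lemma bump_range: "0 \<le> bump y \<sigma> x" "bump y \<sigma> x \<le> 1"
  unfolding bump_def by (intro prod_nonneg flat_one_range, intro prod_le_1 conjI flat_one_range)

lemma bump_smooth: "Ck n (bump y \<sigma>)"
proof -
  have "Ck n (\<lambda>x. flat 1 (1 / 2 + (x - y) \<bullet> a / \<sigma>))" for a :: "real \<times> real"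
  proof -
    have "x \<bullet> (a /\<^sub>R \<sigma>) + (1 / 2 - y \<bullet> a / \<sigma>) = 1 / 2 + (x - y) \<bullet> a / \<sigma>" for x
      by (simp only: inner_scaleR_right inner_diff_left divide_inverse left_diff_distrib mult.commute[of "inverse \<sigma>"])
    then show ?thesis using flat_one_smooth[of n "a /\<^sub>R \<sigma>" "1 / 2 - y \<bullet> a / \<sigma>"] by (simp only:)
  qed
  then show ?thesis unfolding bump_def[abs_def] by (rule Ck_prod)
qed

lemma bump_support:
  assumes "0 < \<sigma>" "bump y \<sigma> x \<noteq> 0"
  shows "dist y x < \<sigma>"
proof -
  have *: "0 < 1 / 2 + (x - y) \<bullet> a / \<sigma>" if "a \<in> {(1, 0), (-1, 0), (0, 1), (0, -1)}" for a
    using assms(2) that unfolding bump_def by (auto simp: flat_def split: if_splits)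
  have "\<bar>fst x - fst y\<bar> < \<sigma> / 2" "\<bar>snd x - snd y\<bar> < \<sigma> / 2"
    using *[of "(1, 0)"] *[of "(-1, 0)"] *[of "(0, 1)"] *[of "(0, -1)"] assms(1)
    by (auto simp: inner_prod_def field_simps abs_if)
  moreover have "norm (x - y) \<le> norm (fst (x - y)) + norm (snd (x - y))"
    by (metis norm_Pair_le prod.collapse)
  ultimately show ?thesis by (simp add: dist_norm norm_minus_commute)
qed

lemma bump_lower:
  assumes "0 < \<sigma>" "\<bar>fst x - fst y\<bar> \<le> \<sigma> / 4" "\<bar>snd x - snd y\<bar> \<le> \<sigma> / 4"
  shows "exp (-16) \<le> bump y \<sigma> x"
proof -
  have f: "exp (-4) \<le> flat 1 t" if "1 / 4 \<le> t" for t
    using that by (auto simp: flat_def field_simps)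
  have "(\<Prod>a\<in>{(1::real, 0::real), (-1, 0), (0, 1), (0, -1)}. exp (-4 :: real)) \<le> bump y \<sigma> x"
    unfolding bump_def
  proof (intro prod_mono conjI f)
    fix a :: "real \<times> real" assume "a \<in> {(1, 0), (-1, 0), (0, 1), (0, -1)}"
    then show "1 / 4 \<le> 1 / 2 + (x - y) \<bullet> a / \<sigma>" using assms by (auto simp: inner_prod_def field_simps abs_if split: if_splits)
  qed auto
  also have "(\<Prod>a\<in>{(1::real, 0::real), (-1, 0), (0, 1), (0, -1)}. exp (-4 :: real)) = exp (-16)"
    by (simp flip: exp_add)
  finally show ?thesis .
qed

lemma bump_translate: "bump y \<sigma> (x - d) = bump (y + d) \<sigma> x"
proof -
  have "x - d - y = x - (y + d)" by simp
  then show ?thesis by (simp only: bump_def)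
qed

lemma bump_test_function:
  assumes "0 < \<sigma>" "cball y \<sigma> \<subseteq> S"
  shows "bump y \<sigma> \<in> test_functions S"
proof -
  have "bump y \<sigma> x = 0" if "x \<notin> cball y \<sigma>" for x
    using bump_support[OF assms(1), of y x] that by (cases "bump y \<sigma> x = 0") auto
  then show ?thesis unfolding test_functions_def
    by (intro CollectI conjI allI bump_smooth exI[of _ "cball y \<sigma>"]) (use assms(2) in simp_all)
qed

lemma test_functions_D:
  assumes "\<phi> \<in> test_functions S"
  shows "\<phi> differentiable at x" "continuous_on UNIV \<phi>"
    "b \<in> Basis \<Longrightarrow> continuous_on UNIV (\<lambda>x. frechet_derivative \<phi> (at x) b)"
proof -
  have "Ck n \<phi>" for n using assms unfolding test_functions_def by blast
  from this[of 0] this[of "Suc 0"] have "Ck 0 \<phi>" "Ck (Suc 0) \<phi>" .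
  then show "\<phi> differentiable at x" "continuous_on UNIV \<phi>"
    "b \<in> Basis \<Longrightarrow> continuous_on UNIV (\<lambda>x. frechet_derivative \<phi> (at x) b)"
    unfolding Ck.simps by blast+
qed

lemma test_functions_support:
  assumes "\<phi> \<in> test_functions S"
  shows "\<exists>C. compact C \<and> C \<subseteq> S \<and> (\<forall>x. x \<notin> C \<longrightarrow> \<phi> x = 0 \<and> frechet_derivative \<phi> (at x) = (\<lambda>h. 0))"
proof -
  obtain C where C: "compact C" "C \<subseteq> S" "\<And>x. x \<notin> C \<Longrightarrow> \<phi> x = 0"
    using assms by (auto simp: test_functions_def)
  have "frechet_derivative \<phi> (at x) = (\<lambda>h. 0)" if x: "x \<notin> C" for x
  proof (rule frechet_derivative_eq, rule has_derivative_transform_within_open)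
    show "((\<lambda>x. 0) has_derivative (\<lambda>h. 0)) (at x)" by simp
    show "open (- C)" using C(1) compact_imp_closed by blast
  qed (use x C(3) in auto)
  then show ?thesis using C by blast
qed

lemma frechet_derivative_pair:
  fixes \<phi> :: "real \<times> real \<Rightarrow> real"
  assumes "\<phi> differentiable at x"
  shows "frechet_derivative \<phi> (at x) d =
    fst d * frechet_derivative \<phi> (at x) (1, 0) + snd d * frechet_derivative \<phi> (at x) (0, 1)"
proof -
  have l: "linear (frechet_derivative \<phi> (at x))" using assms by (rule linear_frechet_derivative)
  have "d = fst d *\<^sub>R (1, 0) + snd d *\<^sub>R (0, 1)" by (cases d) simp
  then have "frechet_derivative \<phi> (at x) d = frechet_derivative \<phi> (at x) (fst d *\<^sub>R (1, 0) + snd d *\<^sub>R (0, 1))" by (rule arg_cong)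
  then show ?thesis by (simp only: linear_add[OF l] linear_scale[OF l]) simp
qed

lemma test_functions_bounded:
  assumes "\<phi> \<in> test_functions S"
  obtains M where "0 \<le> M" "\<And>x. \<bar>\<phi> x\<bar> \<le> M" "\<And>x d. \<bar>frechet_derivative \<phi> (at x) d\<bar> \<le> M * norm d"
    "\<And>x y. \<bar>\<phi> x - \<phi> y\<bar> \<le> M * norm (x - y)"
proof -
  obtain C where C: "compact C" "C \<subseteq> S" "\<And>x. x \<notin> C \<Longrightarrow> \<phi> x = 0" "\<And>x. x \<notin> C \<Longrightarrow> frechet_derivative \<phi> (at x) = (\<lambda>h. 0)"
    using test_functions_support[OF assms] by metis
  have bd: "\<exists>B. \<forall>x. \<bar>f x\<bar> \<le> B" if f: "continuous_on UNIV f" "\<And>x. x \<notin> C \<Longrightarrow> f x = 0" for f :: "real \<times> real \<Rightarrow> real"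
  proof -
    have "compact (f ` C)" using C(1) f(1) compact_continuous_image continuous_on_subset by blast
    then obtain B where B: "\<And>x. x \<in> C \<Longrightarrow> \<bar>f x\<bar> \<le> B" by (force dest!: compact_imp_bounded simp: bounded_iff)
    have "\<bar>f x\<bar> \<le> max B 0" for x using B[of x] f(2)[of x] by (cases "x \<in> C") auto
    then show ?thesis by blast
  qed
  obtain B0 where B0: "\<And>x. \<bar>\<phi> x\<bar> \<le> B0" using bd[OF test_functions_D(2)[OF assms] C(3)] by blast
  obtain B1 where B1: "\<And>x. \<bar>frechet_derivative \<phi> (at x) (1, 0)\<bar> \<le> B1"
    using bd[OF test_functions_D(3)[OF assms, of "(1, 0)"]] C(4) by (auto simp: Basis_prod_def)
  obtain B2 where B2: "\<And>x. \<bar>frechet_derivative \<phi> (at x) (0, 1)\<bar> \<le> B2"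
    using bd[OF test_functions_D(3)[OF assms, of "(0, 1)"]] C(4) by (auto simp: Basis_prod_def)
  define M where "M = B0 + B1 + B2"
  have B: "0 \<le> B0" "0 \<le> B1" "0 \<le> B2" using B0[of 0] B1[of 0] B2[of 0] by linarith+
  have M: "0 \<le> M" "B0 \<le> M" using B by (auto simp: M_def)
  have der: "\<bar>frechet_derivative \<phi> (at x) d\<bar> \<le> M * norm d" for x d
  proof -
    have "\<bar>fst d\<bar> \<le> norm d" "\<bar>snd d\<bar> \<le> norm d"
      using norm_fst_le[where x = "fst d" and y = "snd d"] norm_snd_le[where x = "fst d" and y = "snd d"] by simp_all
    then have "\<bar>fst d * frechet_derivative \<phi> (at x) (1, 0)\<bar> \<le> norm d * B1" "\<bar>snd d * frechet_derivative \<phi> (at x) (0, 1)\<bar> \<le> norm d * B2"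

      unfolding abs_mult by (intro mult_mono B1 B2 norm_ge_zero abs_ge_zero; simp)+
    then have "\<bar>frechet_derivative \<phi> (at x) d\<bar> \<le> norm d * B1 + norm d * B2"
      using frechet_derivative_pair[OF test_functions_D(1)[OF assms], of x d] by linarith
    also have "\<dots> \<le> M * norm d" using mult_right_mono[OF B(1), of "norm d"] by (simp add: M_def algebra_simps)
    finally show ?thesis .
  qed
  have "\<bar>\<phi> x - \<phi> y\<bar> \<le> M * norm (x - y)" for x y
  proof -
    have "norm (\<phi> x - \<phi> y) \<le> M * norm (x - y)"
    proof (rule differentiable_bound)
      show "(\<phi> has_derivative frechet_derivative \<phi> (at z)) (at z within UNIV)" for z
        using test_functions_D(1)[OF assms] by (simp add: frechet_derivative_works)
      show "onorm (frechet_derivative \<phi> (at z)) \<le> M" for z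
        by (rule onorm_le) (use der in auto)
    qed auto
    then show ?thesis by simp
  qed
  moreover have "\<bar>\<phi> x\<bar> \<le> M" for x using B0[of x] M(2) by linarith
  ultimately show ?thesis by (intro that[of M] M(1) der)
qed

section \<open>Weak derivatives by difference quotients\<close>

lemma borel_imp_lebesgue_measurable:
  fixes f :: "real \<times> real \<Rightarrow> real"
  shows "f \<in> borel_measurable borel \<Longrightarrow> f \<in> borel_measurable lebesgue"
  by (intro measurable_completion) simp

lemma continuous_imp_lebesgue_measurable:
  fixes f :: "real \<times> real \<Rightarrow> real"
  shows "continuous_on UNIV f \<Longrightarrow> f \<in> borel_measurable lebesgue"
  by (intro borel_imp_lebesgue_measurable borel_measurable_continuous_onI)

lemma bounded_imp_finite_lebesgue:
  fixes S :: "(real \<times> real) set"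
  shows "bounded S \<Longrightarrow> S \<in> sets lebesgue \<Longrightarrow> emeasure lebesgue S < \<infinity>"
  using bounded_set_imp_lmeasurable[of S] unfolding fmeasurable_def infinity_ennreal_def by blast

lemma difference_quotient_tendsto:
  fixes \<phi> :: "real \<times> real \<Rightarrow> real"
  assumes "\<phi> differentiable at x" "h \<longlonglongrightarrow> 0" "\<And>n. h n \<noteq> 0"
  shows "(\<lambda>n. (\<phi> (x + h n *\<^sub>R d) - \<phi> x) / h n) \<longlonglongrightarrow> frechet_derivative \<phi> (at x) d"
proof -
  have "(\<phi> has_derivative frechet_derivative \<phi> (at x)) (at x)" using assms(1) by (simp add: frechet_derivative_works)
  then have "((\<lambda>t. \<phi> (x + t *\<^sub>R d)) has_real_derivative frechet_derivative \<phi> (at x) d) (at 0)"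
  proof -
    have 1: "((\<lambda>t::real. x + t *\<^sub>R d) has_derivative (\<lambda>t. t *\<^sub>R d)) (at 0)" by (auto intro!: derivative_eq_intros)
    have 2: "(\<phi> has_derivative frechet_derivative \<phi> (at x)) (at (x + 0 *\<^sub>R d))"
      using assms(1) by (simp add: frechet_derivative_works)
    have "((\<lambda>t. \<phi> (x + t *\<^sub>R d)) has_derivative (\<lambda>t. frechet_derivative \<phi> (at x) (t *\<^sub>R d))) (at 0)"
      by (rule has_derivative_compose[OF 1 2])
    moreover have "frechet_derivative \<phi> (at x) (t *\<^sub>R d) = t * frechet_derivative \<phi> (at x) d" for t
      using linear_scale[OF linear_frechet_derivative[OF assms(1)]] by simp
    ultimately show ?thesis by (simp add: has_field_derivative_def mult_commute_abs)
  qed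
  then have "((\<lambda>t. (\<phi> (x + t *\<^sub>R d) - \<phi> x) / t) \<longlongrightarrow> frechet_derivative \<phi> (at x) d) (at 0)"
    by (simp add: DERIV_def)
  then show ?thesis
    by (rule filterlim_compose) (use assms(2,3) in \<open>auto simp: filterlim_at\<close>)
qed

lemma integral_difference_quotient_tendsto:
  assumes U: "integrable lebesgue U" and \<phi>: "\<phi> \<in> test_functions S"
    and h: "h \<longlonglongrightarrow> 0" "\<And>n. h n \<noteq> 0"
  shows "(\<lambda>n. (LINT x|lebesgue. U x * ((\<phi> (x + h n *\<^sub>R d) - \<phi> x) / h n))) \<longlonglongrightarrow>
     (LINT x|lebesgue. U x * frechet_derivative \<phi> (at x) d)"
proof -
  obtain M where M: "0 \<le> M" "\<And>x y. \<bar>\<phi> x - \<phi> y\<bar> \<le> M * norm (x - y)" using test_functions_bounded[OF \<phi>] by metis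
  have c: "continuous_on UNIV \<phi>" using \<phi> by (rule test_functions_D)
  have m: "\<phi> \<in> borel_measurable lebesgue" using c by (rule continuous_imp_lebesgue_measurable)
  have m': "(\<lambda>x. \<phi> (x + a)) \<in> borel_measurable lebesgue" for a
  proof -
    have "continuous_on UNIV (\<lambda>x. \<phi> (x + a))" by (intro continuous_on_compose2[OF c] continuous_intros) auto
    then show ?thesis by (rule continuous_imp_lebesgue_measurable)
  qed
  have mU: "U \<in> borel_measurable lebesgue" using U by auto
  have mq: "(\<lambda>x. U x * ((\<phi> (x + h n *\<^sub>R d) - \<phi> x) / h n)) \<in> borel_measurable lebesgue" for n
    using m m' mU by auto
  have lim: "(\<lambda>n. U x * ((\<phi> (x + h n *\<^sub>R d) - \<phi> x) / h n)) \<longlonglongrightarrow> U x * frechet_derivative \<phi> (at x) d" for x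
    by (intro tendsto_mult tendsto_const difference_quotient_tendsto test_functions_D[OF \<phi>] h)
  show ?thesis
  proof (rule integral_dominated_convergence[where w = "\<lambda>x. \<bar>U x\<bar> * (M * norm d)"])
    show "(\<lambda>x. U x * frechet_derivative \<phi> (at x) d) \<in> borel_measurable lebesgue"
      using mq lim by (rule borel_measurable_LIMSEQ_metric)
    show "integrable lebesgue (\<lambda>x. \<bar>U x\<bar> * (M * norm d))" using U by auto
    show "AE x in lebesgue. norm (U x * ((\<phi> (x + h n *\<^sub>R d) - \<phi> x) / h n)) \<le> \<bar>U x\<bar> * (M * norm d)" for n
    proof (intro always_eventually allI)
      fix x
      have "\<bar>\<phi> (x + h n *\<^sub>R d) - \<phi> x\<bar> \<le> M * norm d * \<bar>h n\<bar>"
        using M(2)[of "x + h n *\<^sub>R d" x] by (simp add: mult_ac)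
      then have "\<bar>(\<phi> (x + h n *\<^sub>R d) - \<phi> x) / h n\<bar> \<le> M * norm d"
        using h(2)[of n] by (simp add: pos_divide_le_eq)
      then show "norm (U x * ((\<phi> (x + h n *\<^sub>R d) - \<phi> x) / h n)) \<le> \<bar>U x\<bar> * (M * norm d)"
        unfolding real_norm_def abs_mult[of "U x"] by (rule mult_left_mono) simp
    qed
  qed (use mq lim in auto)
qed

lemma integral_translate:
  fixes f :: "real \<times> real \<Rightarrow> real"
  assumes "f \<in> borel_measurable borel"
  shows "(LINT x|lebesgue. f (x + a)) = (LINT x|lebesgue. f x)"
proof -
  have "(LINT x|lborel. f x) = (LINT x|distr lborel borel ((+) a). f x)" by (simp add: lborel_distr_plus)
  also have "\<dots> = (LINT x|lborel. f (a + x))" by (rule integral_distr) (use assms in auto)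
  finally show ?thesis using assms by (subst (1 2) integral_completion) (auto simp: add.commute)
qed

lemma bounded_imp_integrable:
  fixes f :: "real \<times> real \<Rightarrow> real"
  assumes "f \<in> borel_measurable lebesgue" "bounded S" "S \<in> sets lebesgue" "\<And>x. \<bar>f x\<bar> \<le> B" "\<And>x. x \<notin> S \<Longrightarrow> f x = 0"
  shows "integrable lebesgue f"
proof (rule integrableI_bounded_set[where A = S and B = B])
  show "emeasure lebesgue S < \<infinity>" using assms(2,3) by (rule bounded_imp_finite_lebesgue)
qed (use assms in auto)

text \<open>Shift a difference quotient from \<open>w\<close> to the test function and pass to the limit on both sides. The
quotients of \<open>w\<close> are bounded near the support of the test function, by the Lipschitz estimate along
segments in \<open>S\<close>, so dominated convergence applies.\<close>

lemma weak_partial_if_lipschitz: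
  fixes w :: "real \<times> real \<Rightarrow> real"
  assumes S: "open S" "bounded S" and w: "w \<in> borel_measurable borel" "\<And>x. x \<notin> S \<Longrightarrow> w x = 0" "\<And>x. \<bar>w x\<bar> \<le> B"
    and L: "\<And>x y. closed_segment x y \<subseteq> S \<Longrightarrow> \<bar>w x - w y\<bar> \<le> L * norm (x - y)"
    and conv: "AE x in lebesgue. x \<in> S \<longrightarrow>
       convergent (\<lambda>n. (w (x + inverse (real (Suc n)) *\<^sub>R b) - w x) / inverse (real (Suc n)))"
  shows "\<exists>g\<in>L2_on S. weak_partial S b w g"
proof -
  define h where "h n = inverse (real (Suc n))" for n
  have h: "h \<longlonglongrightarrow> 0" "\<And>n. h n \<noteq> 0" "\<And>n. 0 < h n" unfolding h_def using LIMSEQ_inverse_real_of_nat by auto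
  \<comment> \<open>difference quotients; their pointwise limit is the candidate for the weak derivative\<close>
  define q where "q n x = (w (x + h n *\<^sub>R b) - w x) / h n" for n x
  define g where "g x = lim (\<lambda>n. q n x)" for x
  have mw: "(\<lambda>x. w (x + a)) \<in> borel_measurable borel" for a using w(1) by measurable
  have mq: "q n \<in> borel_measurable borel" for n unfolding q_def using w(1) mw by measurable
  have mg: "g \<in> borel_measurable borel" unfolding g_def using mq by (rule borel_measurable_lim_metric)
  have lim: "AE x in lebesgue. x \<in> S \<longrightarrow> (\<lambda>n. q n x) \<longlonglongrightarrow> g x"
    using conv by eventually_elim (auto simp: q_def g_def h_def convergent_LIMSEQ_iff)
  have near: "\<exists>e>0. \<forall>x\<in>C. \<forall>y. dist x y < e \<longrightarrow> closed_segment x y \<subseteq> S" if C: "compact C" "C \<subseteq> S" for C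
  proof (cases "C = {}")
    case False
    obtain e where e: "e > 0" "(\<Union>x\<in>C. ball x e) \<subseteq> S"
      using compact_subset_open_imp_ball_epsilon_subset[OF C(1) S(1) C(2)] by blast
    have "closed_segment x y \<subseteq> S" if "x \<in> C" "dist x y < e" for x y
    proof -
      have "closed_segment x y \<subseteq> ball x e" by (rule closed_segment_subset) (use that e(1) in auto)
      then show ?thesis using e(2) that(1) by blast
    qed
    then show ?thesis using e(1) by blast
  qed (auto intro: exI[of _ 1])
  have qb: "\<forall>\<^sub>F n in sequentially. \<forall>x\<in>C. \<bar>q n x\<bar> \<le> L * norm b" if C: "compact C" "C \<subseteq> S" for C
  proof -
    obtain e where e: "e > 0" "\<And>x y. x \<in> C \<Longrightarrow> dist x y < e \<Longrightarrow> closed_segment x y \<subseteq> S" using near[OF C] by blast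
    have "(\<lambda>n. h n * norm b) \<longlonglongrightarrow> 0 * norm b" by (intro tendsto_intros h)
    then have "\<forall>\<^sub>F n in sequentially. h n * norm b < e" using e(1) by (auto dest: order_tendstoD(2))
    then show ?thesis
    proof eventually_elim
      case (elim n)
      show ?case
      proof
        fix x assume "x \<in> C"
        then have "closed_segment x (x + h n *\<^sub>R b) \<subseteq> S" using e(2)[of x "x + h n *\<^sub>R b"] elim h(3)[of n] by (simp add: dist_norm)
        then have "\<bar>w (x + h n *\<^sub>R b) - w x\<bar> \<le> L * norm b * h n"
          using L[of x "x + h n *\<^sub>R b"] h(3)[of n] by (simp add: abs_minus_commute mult_ac)
        then show "\<bar>q n x\<bar> \<le> L * norm b" using h(3)[of n] by (simp add: q_def pos_divide_le_eq)
      qed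
    qed
  qed
  have gb: "AE x in lebesgue. x \<in> S \<longrightarrow> \<bar>g x\<bar> \<le> L * norm b"
    using lim
  proof eventually_elim
    case (elim x)
    show ?case
    proof
      assume x: "x \<in> S"
      have "\<forall>\<^sub>F n in sequentially. \<bar>q n x\<bar> \<le> L * norm b" using qb[of "{x}"] x by simp
      then show "\<bar>g x\<bar> \<le> L * norm b"
        using elim x by (intro tendsto_upperbound[OF tendsto_rabs]) auto
    qed
  qed
  have SL: "S \<in> sets lebesgue" "S \<in> sets borel" using S(1) by auto
  have fin: "emeasure lebesgue S < \<infinity>" using S(2) SL(1) by (rule bounded_imp_finite_lebesgue)
  have mgL: "g \<in> borel_measurable lebesgue" using mg by (intro borel_imp_lebesgue_measurable) simp
  have "g \<in> L2_on S"
    unfolding L2_on_def set_integrable_def set_borel_measurable_def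
  proof (intro CollectI conjI)
    show "(\<lambda>x. indicat_real S x *\<^sub>R g x) \<in> borel_measurable lebesgue" using mgL SL by measurable
    show "integrable lebesgue (\<lambda>x. indicat_real S x *\<^sub>R (g x)\<^sup>2)"
    proof (rule integrableI_bounded_set[where A = S and B = "(L * norm b)\<^sup>2"])
      show "(\<lambda>x. indicat_real S x *\<^sub>R (g x)\<^sup>2) \<in> borel_measurable lebesgue" using mgL SL by measurable
      show "AE x\<in>S in lebesgue. norm (indicat_real S x *\<^sub>R (g x)\<^sup>2) \<le> (L * norm b)\<^sup>2"
        using gb by eventually_elim (auto simp: power2_le_iff_abs_le intro!: abs_le_square_iff[THEN iffD1] split: split_indicator)
    qed (use SL fin in auto)
  qed
  moreover have "weak_partial S b w g"
    unfolding weak_partial_def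
  proof
    fix \<phi> assume \<phi>: "\<phi> \<in> test_functions S"
    obtain C where C: "compact C" "C \<subseteq> S" "\<And>x. x \<notin> C \<Longrightarrow> \<phi> x = 0" using test_functions_support[OF \<phi>] by metis
    obtain M where M: "0 \<le> M" "\<And>x. \<bar>\<phi> x\<bar> \<le> M" using test_functions_bounded[OF \<phi>] by metis
    have c\<phi>: "continuous_on UNIV \<phi>" using \<phi> by (rule test_functions_D)
    have m\<phi>: "\<phi> \<in> borel_measurable borel" using c\<phi> by (rule borel_measurable_continuous_onI)
    have m\<phi>': "(\<lambda>x. \<phi> (x + a)) \<in> borel_measurable borel" for a using m\<phi> by measurable
    have iw: "integrable lebesgue w"
      by (rule bounded_imp_integrable[OF _ S(2) SL(1) w(3) w(2)]) (use w(1) in \<open>auto intro: borel_imp_lebesgue_measurable\<close>)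
    have w\<phi>: "integrable lebesgue (\<lambda>x. w x * \<phi> (x + a))" for a
    proof (rule bounded_imp_integrable[OF _ S(2) SL(1), where B = "B * M"])
      show "(\<lambda>x. w x * \<phi> (x + a)) \<in> borel_measurable lebesgue"
        using w(1) m\<phi>' by (intro borel_imp_lebesgue_measurable) auto
      show "\<bar>w x * \<phi> (x + a)\<bar> \<le> B * M" for x
        unfolding abs_mult using w(3)[of x] by (intro mult_mono M w) auto
    qed (use w(2) in auto)
    have eq: "(LINT x|lebesgue. w x * ((\<phi> (x + (- h n) *\<^sub>R b) - \<phi> x) / (- h n))) = - (LINT x|lebesgue. q n x * \<phi> x)" for n
    proof -
      have sh: "(LINT x|lebesgue. w x * \<phi> (x - h n *\<^sub>R b)) = (LINT x|lebesgue. w (x + h n *\<^sub>R b) * \<phi> x)"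
        using integral_translate[of "\<lambda>x. w x * \<phi> (x - h n *\<^sub>R b)" "h n *\<^sub>R b"] w(1) m\<phi>'[of "- h n *\<^sub>R b"] by simp
      have i2: "integrable lebesgue (\<lambda>x. w (x + h n *\<^sub>R b) * \<phi> x)"
      proof (rule bounded_imp_integrable[where B = "B * M" and S = C])
        show "(\<lambda>x. w (x + h n *\<^sub>R b) * \<phi> x) \<in> borel_measurable lebesgue"
          using mw m\<phi> by (intro borel_imp_lebesgue_measurable) auto
        show "\<bar>w (x + h n *\<^sub>R b) * \<phi> x\<bar> \<le> B * M" for x
          unfolding abs_mult using w(3)[of "x + h n *\<^sub>R b"] by (intro mult_mono M w) auto
      qed (use C in \<open>auto intro: compact_imp_bounded lmeasurable_compact fmeasurableD\<close>)
      have "(LINT x|lebesgue. w x * ((\<phi> (x + (- h n) *\<^sub>R b) - \<phi> x) / (- h n))) =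
        (LINT x|lebesgue. (w x * \<phi> x - w x * \<phi> (x - h n *\<^sub>R b)) / h n)"
        by (intro Bochner_Integration.integral_cong) (auto simp: algebra_simps diff_divide_distrib)
      also have "\<dots> = ((LINT x|lebesgue. w x * \<phi> x) - (LINT x|lebesgue. w x * \<phi> (x - h n *\<^sub>R b))) / h n"
        using w\<phi>[of 0] w\<phi>[of "- h n *\<^sub>R b"] by simp
      also have "\<dots> = ((LINT x|lebesgue. w x * \<phi> x) - (LINT x|lebesgue. w (x + h n *\<^sub>R b) * \<phi> x)) / h n" by (simp only: sh)
      also have "\<dots> = (LINT x|lebesgue. (w x * \<phi> x - w (x + h n *\<^sub>R b) * \<phi> x) / h n)"
        using w\<phi>[of 0] i2 by simp
      also have "\<dots> = (LINT x|lebesgue. - (q n x * \<phi> x))"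
        by (intro Bochner_Integration.integral_cong) (auto simp: q_def diff_divide_distrib left_diff_distrib)
      finally show ?thesis by simp
    qed
    have "(\<lambda>n. (LINT x|lebesgue. w x * ((\<phi> (x + (- h n) *\<^sub>R b) - \<phi> x) / (- h n)))) \<longlonglongrightarrow> (LINT x|lebesgue. w x * frechet_derivative \<phi> (at x) b)"
      by (rule integral_difference_quotient_tendsto[OF iw \<phi>]) (use h tendsto_minus[OF h(1)] in auto)
    moreover have "(\<lambda>n. - (LINT x|lebesgue. q n x * \<phi> x)) \<longlonglongrightarrow> - (LINT x|lebesgue. g x * \<phi> x)"
    proof (rule tendsto_minus)
      obtain n0 where n0: "\<And>n x. n \<ge> n0 \<Longrightarrow> x \<in> C \<Longrightarrow> \<bar>q n x\<bar> \<le> L * norm b"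
        using qb[OF C(1,2)] unfolding eventually_sequentially by blast
      have "(\<lambda>n. (LINT x|lebesgue. q (n + n0) x * \<phi> x)) \<longlonglongrightarrow> (LINT x|lebesgue. g x * \<phi> x)"
      proof (rule integral_dominated_convergence[where w = "\<lambda>x. L * norm b * \<bar>\<phi> x\<bar>"])
        show "(\<lambda>x. g x * \<phi> x) \<in> borel_measurable lebesgue" using mg m\<phi> by (intro borel_imp_lebesgue_measurable) auto
        show "(\<lambda>x. q (n + n0) x * \<phi> x) \<in> borel_measurable lebesgue" for n using mq m\<phi> by (intro borel_imp_lebesgue_measurable) auto
        have "integrable lebesgue \<phi>"
          by (rule bounded_imp_integrable[where B = M and S = C]) (use C M m\<phi> in \<open>auto intro: compact_imp_bounded lmeasurable_compact fmeasurableD borel_imp_lebesgue_measurable\<close>)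
        then show "integrable lebesgue (\<lambda>x. L * norm b * \<bar>\<phi> x\<bar>)" by auto
        show "AE x in lebesgue. (\<lambda>n. q (n + n0) x * \<phi> x) \<longlonglongrightarrow> g x * \<phi> x"
          using lim
        proof eventually_elim
          case (elim x)
          show ?case
          proof (cases "x \<in> C")
            case True
            then have "(\<lambda>n. q n x) \<longlonglongrightarrow> g x" using elim C(2) by blast
            then show ?thesis by (intro tendsto_mult tendsto_const) (rule LIMSEQ_ignore_initial_segment)
          qed (simp add: C(3))
        qed
        show "AE x in lebesgue. norm (q (n + n0) x * \<phi> x) \<le> L * norm b * \<bar>\<phi> x\<bar>" for n
        proof (intro always_eventually allI)
          fix x show "norm (q (n + n0) x * \<phi> x) \<le> L * norm b * \<bar>\<phi> x\<bar>"
            using n0[of "n + n0" x] C(3)[of x] by (cases "x \<in> C") (auto simp: abs_mult mult_right_mono)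
        qed
      qed
      then show "(\<lambda>n. (LINT x|lebesgue. q n x * \<phi> x)) \<longlonglongrightarrow> (LINT x|lebesgue. g x * \<phi> x)" by (rule LIMSEQ_offset)
    qed
    ultimately have "(LINT x|lebesgue. w x * frechet_derivative \<phi> (at x) b) = - (LINT x|lebesgue. g x * \<phi> x)"
      unfolding eq using LIMSEQ_unique by blast
    moreover have "(LINT x:S|lebesgue. w x * frechet_derivative \<phi> (at x) b) = (LINT x|lebesgue. w x * frechet_derivative \<phi> (at x) b)"
      unfolding set_lebesgue_integral_def using w(2)
      by (intro Bochner_Integration.integral_cong) (auto simp: indicator_def)
    moreover have "(LINT x:S|lebesgue. g x * \<phi> x) = (LINT x|lebesgue. g x * \<phi> x)"
      unfolding set_lebesgue_integral_def using C(2,3)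
      by (intro Bochner_Integration.integral_cong) (auto simp: indicator_def)
    ultimately show "(LINT x:S|lebesgue. w x * frechet_derivative \<phi> (at x) b) = - (LINT x:S|lebesgue. g x * \<phi> x)" by simp
  qed
  ultimately show ?thesis by blast
qed

section \<open>Sobolev functions do not jump\<close>

lemma integrable_from_L2_on:
  assumes "g \<in> L2_on S" "bounded S" "S \<in> sets lebesgue"
  shows "integrable lebesgue (\<lambda>x. indicat_real S x * g x)" "integrable lebesgue (\<lambda>x. indicat_real S x * (g x)\<^sup>2)"
proof -
  show 2: "integrable lebesgue (\<lambda>x. indicat_real S x * (g x)\<^sup>2)"
    using assms(1) by (simp add: L2_on_def set_integrable_def)
  have m: "(\<lambda>x. indicat_real S x * g x) \<in> borel_measurable lebesgue"
    using assms(1) by (simp add: L2_on_def set_borel_measurable_def)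
  have 1: "integrable lebesgue (indicat_real S)"
    using bounded_imp_finite_lebesgue[OF assms(2,3)] assms(3) by simp
  show "integrable lebesgue (\<lambda>x. indicat_real S x * g x)"
  proof (rule Bochner_Integration.integrable_bound[OF Bochner_Integration.integrable_add[OF 1 2] m])
    show "AE x in lebesgue. norm (indicat_real S x * g x) \<le> norm (indicat_real S x + indicat_real S x * (g x)\<^sup>2)"
    proof (intro always_eventually allI)
      fix x
      have "\<bar>g x\<bar> \<le> 1 + (g x)\<^sup>2"
        using zero_le_power2[of "\<bar>g x\<bar> - 1"] by (simp add: power2_diff)
      then show "norm (indicat_real S x * g x) \<le> norm (indicat_real S x + indicat_real S x * (g x)\<^sup>2)"
        by (auto simp: indicator_def)
    qed
  qed
qed

lemma bump_integrable:
  assumes "0 < \<sigma>" shows "integrable lebesgue (bump y \<sigma>)"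
proof (rule bounded_imp_integrable[where B = 1 and S = "cball y \<sigma>"])
  show "bump y \<sigma> \<in> borel_measurable lebesgue"
    using test_functions_D(2)[OF bump_test_function[OF assms subset_UNIV]] by (rule continuous_imp_lebesgue_measurable)
  show "\<bar>bump y \<sigma> x\<bar> \<le> 1" for x using bump_range[of y \<sigma> x] by simp
  show "bump y \<sigma> x = 0" if "x \<notin> cball y \<sigma>" for x
    using bump_support[OF assms, of y x] that by (cases "bump y \<sigma> x = 0") auto
qed (auto intro: lmeasurable_cball fmeasurableD)

lemma bump_integral_translate: "(LINT x|lebesgue. bump (y + d) \<sigma> x) = (LINT x|lebesgue. bump y \<sigma> x)"
proof -
  have "continuous_on UNIV (bump (y + d) \<sigma>)"
    using bump_smooth[of 0 "y + d" \<sigma>] by simp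
  then have "(LINT x|lebesgue. bump (y + d) \<sigma> (x + d)) = (LINT x|lebesgue. bump (y + d) \<sigma> x)"
    by (intro integral_translate borel_measurable_continuous_onI)
  moreover have "bump (y + d) \<sigma> (x + d) = bump y \<sigma> x" for x
    using bump_translate[of y \<sigma> "x + d" d] by simp
  ultimately show ?thesis by simp
qed

lemma measure_square:
  "0 \<le> a \<Longrightarrow> measure lebesgue (cbox (y - (a, a)) (y + (a, a)) :: (real \<times> real) set) = (2 * a) * (2 * a)"
  by (cases y) (simp add: content_Pair)

lemma abs_fst_le: "\<bar>fst z\<bar> \<le> norm (z :: real \<times> real)" and abs_snd_le: "\<bar>snd z\<bar> \<le> norm (z :: real \<times> real)"
  using norm_fst_le[where x = "fst z" and y = "snd z"] norm_snd_le[where x = "fst z" and y = "snd z"] by simp_all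

lemma mem_square:
  fixes x y :: "real \<times> real"
  shows "x \<in> cbox (y - (a, a)) (y + (a, a)) \<longleftrightarrow> \<bar>fst x - fst y\<bar> \<le> a \<and> \<bar>snd x - snd y\<bar> \<le> a"
proof -
  obtain x1 x2 y1 y2 where e: "x = (x1, x2)" "y = (y1, y2)" by (cases x, cases y)
  have "x \<in> cbox (y - (a, a)) (y + (a, a)) \<longleftrightarrow> (y1 - a \<le> x1 \<and> x1 \<le> y1 + a) \<and> (y2 - a \<le> x2 \<and> x2 \<le> y2 + a)"
    unfolding e by (simp add: cbox_Pair_eq)
  then show ?thesis unfolding e fst_conv snd_conv by linarith
qed

lemma bump_integral_lower:
  assumes "0 < \<sigma>" shows "exp (-16) * (\<sigma>\<^sup>2 / 4) \<le> (LINT x|lebesgue. bump y \<sigma> x)"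
proof -
  let ?Q = "cbox (y - (\<sigma> / 4, \<sigma> / 4)) (y + (\<sigma> / 4, \<sigma> / 4))"
  have Q: "?Q \<in> lmeasurable" by (rule lmeasurable_cbox)
  have "measure lebesgue ?Q = (\<sigma> / 2) * (\<sigma> / 2)"
    using measure_square[of "\<sigma> / 4" y] assms by simp
  then have "exp (-16) * (\<sigma>\<^sup>2 / 4) = (LINT x|lebesgue. exp (-16) * indicat_real ?Q x)"
    using Q by (simp add: power2_eq_square)
  also have "\<dots> \<le> (LINT x|lebesgue. bump y \<sigma> x)"
  proof (rule integral_mono)
    show "integrable lebesgue (\<lambda>x. exp (-16) * indicat_real ?Q x)" using Q by (intro integrable_mult_right) (simp add: fmeasurable_def)
    show "exp (-16) * indicat_real ?Q x \<le> bump y \<sigma> x" for x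
    proof (cases "x \<in> ?Q")
      case True
      then have "\<bar>fst x - fst y\<bar> \<le> \<sigma> / 4" "\<bar>snd x - snd y\<bar> \<le> \<sigma> / 4"
        unfolding mem_square by blast+
      then show ?thesis using bump_lower[OF assms] True by simp
    qed (use bump_range[of y \<sigma> x] in simp)
  qed (rule bump_integrable[OF assms])
  finally show ?thesis .
qed

lemma integral_near_value:
  assumes "integrable lebesgue U" "0 < \<sigma>" "\<And>x. dist y x < \<sigma> \<Longrightarrow> \<bar>U x - a\<bar> \<le> \<delta>"
  shows "\<bar>(LINT x|lebesgue. U x * bump y \<sigma> x) - a * (LINT x|lebesgue. bump y \<sigma> x)\<bar> \<le> \<delta> * (LINT x|lebesgue. bump y \<sigma> x)"
proof -
  note b = bump_integrable[OF assms(2), of y]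
  have Ub: "integrable lebesgue (\<lambda>x. U x * bump y \<sigma> x)"
  proof (rule Bochner_Integration.integrable_bound[OF assms(1)])
    show "(\<lambda>x. U x * bump y \<sigma> x) \<in> borel_measurable lebesgue" using assms(1) b by auto
    show "AE x in lebesgue. norm (U x * bump y \<sigma> x) \<le> norm (U x)"
      using bump_range[of y \<sigma>] by (intro always_eventually allI) (auto simp: abs_mult mult_left_le)
  qed
  have "(LINT x|lebesgue. U x * bump y \<sigma> x) - a * (LINT x|lebesgue. bump y \<sigma> x) = (LINT x|lebesgue. (U x - a) * bump y \<sigma> x)"
    using Ub b by (simp add: left_diff_distrib)
  also have "\<bar>\<dots>\<bar> \<le> (LINT x|lebesgue. \<delta> * bump y \<sigma> x)"
  proof -
    have "norm (LINT x|lebesgue. (U x - a) * bump y \<sigma> x) \<le> (LINT x|lebesgue. \<delta> * bump y \<sigma> x)"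
    proof (rule Bochner_Integration.integral_norm_bound_integral)
      show "integrable lebesgue (\<lambda>x. (U x - a) * bump y \<sigma> x)" using Ub b by (simp add: left_diff_distrib)
      show "integrable lebesgue (\<lambda>x. \<delta> * bump y \<sigma> x)" using b by simp
      fix x
      show "norm ((U x - a) * bump y \<sigma> x) \<le> \<delta> * bump y \<sigma> x"
      proof (cases "bump y \<sigma> x = 0")
        case False
        then have "\<bar>U x - a\<bar> \<le> \<delta>" using bump_support[OF assms(2)] assms(3) by blast
        then show ?thesis using bump_range[of y \<sigma> x] by (simp add: abs_mult mult_right_mono)
      qed simp
    qed
    then show ?thesis by simp
  qed
  also have "(LINT x|lebesgue. \<delta> * bump y \<sigma> x) = \<delta> * (LINT x|lebesgue. bump y \<sigma> x)" by simp
  finally show ?thesis .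
qed

lemma H1_on_D:
  assumes "u \<in> H1_on S"
  shows "u \<in> L2_on S \<and> (\<exists>g1\<in>L2_on S. \<exists>g2\<in>L2_on S. \<forall>\<phi>\<in>test_functions S. \<forall>d.
     integrable lebesgue (\<lambda>x. indicat_real S x * u x) \<longrightarrow>
       (LINT x|lebesgue. (indicat_real S x * u x) * frechet_derivative \<phi> (at x) d) =
        - (fst d * (LINT x:S|lebesgue. g1 x * \<phi> x) + snd d * (LINT x:S|lebesgue. g2 x * \<phi> x)))"
proof -
  have u: "u \<in> L2_on S" and e: "\<And>b. b \<in> Basis \<Longrightarrow> \<exists>g\<in>L2_on S. weak_partial S b u g"
    using assms unfolding H1_on_def by blast+
  have "(1::real, 0::real) \<in> Basis" "(0::real, 1::real) \<in> Basis" by (auto simp: Basis_prod_def)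
  from e[OF this(1)] e[OF this(2)] obtain g1 g2 where g: "g1 \<in> L2_on S" "weak_partial S (1, 0) u g1" "g2 \<in> L2_on S" "weak_partial S (0, 1) u g2"
    by blast
  show ?thesis
  proof (rule conjI[OF u], rule bexI[OF _ g(1)], rule bexI[OF _ g(3)], intro ballI allI impI)
    fix \<phi> and d :: "real \<times> real"
    assume \<phi>: "\<phi> \<in> test_functions S" and iu: "integrable lebesgue (\<lambda>x. indicat_real S x * u x)"
    obtain M where M: "0 \<le> M" "\<And>x d. \<bar>frechet_derivative \<phi> (at x) d\<bar> \<le> M * norm d" using test_functions_bounded[OF \<phi>] by metis
    have i: "integrable lebesgue (\<lambda>x. (indicat_real S x * u x) * frechet_derivative \<phi> (at x) b)" if b: "b \<in> Basis" for b
    proof (rule Bochner_Integration.integrable_bound[where f = "\<lambda>x. (indicat_real S x * u x) * (M * norm b)"])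
      show "integrable lebesgue (\<lambda>x. (indicat_real S x * u x) * (M * norm b))" using iu by (rule integrable_mult_left)
      show "(\<lambda>x. (indicat_real S x * u x) * frechet_derivative \<phi> (at x) b) \<in> borel_measurable lebesgue"
        by (rule borel_measurable_times[OF borel_measurable_integrable[OF iu] continuous_imp_lebesgue_measurable[OF test_functions_D(3)[OF \<phi> b]]])
      show "AE x in lebesgue. norm ((indicat_real S x * u x) * frechet_derivative \<phi> (at x) b) \<le> norm ((indicat_real S x * u x) * (M * norm b))"
        unfolding norm_mult using M by (intro always_eventually allI mult_left_mono) auto
    qed
    have 1: "(LINT x|lebesgue. (indicat_real S x * u x) * frechet_derivative \<phi> (at x) (1, 0)) = - (LINT x:S|lebesgue. g1 x * \<phi> x)"
      using g(2) \<phi> unfolding weak_partial_def set_lebesgue_integral_def by (simp add: mult.assoc)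
    have 2: "(LINT x|lebesgue. (indicat_real S x * u x) * frechet_derivative \<phi> (at x) (0, 1)) = - (LINT x:S|lebesgue. g2 x * \<phi> x)"
      using g(4) \<phi> unfolding weak_partial_def set_lebesgue_integral_def by (simp add: mult.assoc)
    have "(LINT x|lebesgue. (indicat_real S x * u x) * frechet_derivative \<phi> (at x) d) =
      (LINT x|lebesgue. fst d * ((indicat_real S x * u x) * frechet_derivative \<phi> (at x) (1, 0)) + snd d * ((indicat_real S x * u x) * frechet_derivative \<phi> (at x) (0, 1)))"
    proof (intro Bochner_Integration.integral_cong refl)
      fix x
      show "(indicat_real S x * u x) * frechet_derivative \<phi> (at x) d = fst d * ((indicat_real S x * u x) * frechet_derivative \<phi> (at x) (1, 0)) + snd d * ((indicat_real S x * u x) * frechet_derivative \<phi> (at x) (0, 1))"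
        using frechet_derivative_pair[OF test_functions_D(1)[OF \<phi>], of x d] by (simp only: distrib_left mult.left_commute)
    qed
    also have "\<dots> = - (fst d * (LINT x:S|lebesgue. g1 x * \<phi> x) + snd d * (LINT x:S|lebesgue. g2 x * \<phi> x))"
      using i[of "(1, 0)"] i[of "(0, 1)"] by (simp add: Basis_prod_def 1 2)
    finally show "(LINT x|lebesgue. (indicat_real S x * u x) * frechet_derivative \<phi> (at x) d) =
        - (fst d * (LINT x:S|lebesgue. g1 x * \<phi> x) + snd d * (LINT x:S|lebesgue. g2 x * \<phi> x))" .
  qed
qed

text \<open>Young's inequality with the free weight \<open>t\<close>.\<close>

lemma weak_derivative_bound:
  assumes "g \<in> L2_on S" "bounded S" "S \<in> sets lebesgue" "0 < \<sigma>" "0 < t"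
    and N: "ball y \<sigma> \<subseteq> N" "N \<subseteq> S" "N \<in> sets lebesgue" and m: "measure lebesgue N \<le> A"
  shows "set_integrable lebesgue S (\<lambda>x. g x * bump y \<sigma> x)"
    and "\<bar>LINT x:S|lebesgue. g x * bump y \<sigma> x\<bar> \<le> t * A + (LINT x|lebesgue. indicat_real N x * (g x)\<^sup>2) / t"
proof -
  note gi = integrable_from_L2_on[OF assms(1-3)]
  have mb: "bump y \<sigma> \<in> borel_measurable lebesgue" using bump_integrable[OF assms(4)] by auto
  have i: "integrable lebesgue (\<lambda>x. indicat_real S x * g x * bump y \<sigma> x)"
  proof (rule Bochner_Integration.integrable_bound[OF gi(1)])
    show "(\<lambda>x. indicat_real S x * g x * bump y \<sigma> x) \<in> borel_measurable lebesgue" using gi(1) mb by auto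
    show "AE x in lebesgue. norm (indicat_real S x * g x * bump y \<sigma> x) \<le> norm (indicat_real S x * g x)"
      using bump_range[of y \<sigma>] unfolding norm_mult[of _ "bump y \<sigma> _"] by (intro always_eventually allI mult_left_le) auto
  qed
  then show "set_integrable lebesgue S (\<lambda>x. g x * bump y \<sigma> x)" by (simp add: set_integrable_def mult.assoc)
  have bN: "emeasure lebesgue N < \<infinity>" using assms(2) N by (intro bounded_imp_finite_lebesgue) (auto intro: bounded_subset)
  have gN: "integrable lebesgue (\<lambda>x. indicat_real N x * (g x)\<^sup>2)"
  proof -
    have "integrable lebesgue (\<lambda>x. indicat_real N x * (indicat_real S x * (g x)\<^sup>2))"
      using integrable_mult_indicator[OF N(3) gi(2)] by simp
    moreover have "indicat_real N x * (indicat_real S x * (g x)\<^sup>2) = indicat_real N x * (g x)\<^sup>2" for x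
      using N(2) by (auto simp: indicator_def)
    ultimately show ?thesis by simp
  qed
  have iN: "integrable lebesgue (indicat_real N)" using bN N(3) by simp
  have "norm (LINT x|lebesgue. indicat_real S x * g x * bump y \<sigma> x) \<le> (LINT x|lebesgue. t * indicat_real N x + (indicat_real N x * (g x)\<^sup>2) / t)"
  proof (rule Bochner_Integration.integral_norm_bound_integral[OF i])
    show "integrable lebesgue (\<lambda>x. t * indicat_real N x + (indicat_real N x * (g x)\<^sup>2) / t)"
      using iN gN by simp
    fix x
    show "norm (indicat_real S x * g x * bump y \<sigma> x) \<le> t * indicat_real N x + (indicat_real N x * (g x)\<^sup>2) / t"
    proof (cases "bump y \<sigma> x = 0")
      case False
      then have "x \<in> ball y \<sigma>" unfolding mem_ball by (rule bump_support[OF assms(4)])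
      then have x: "x \<in> N" "x \<in> S" using N by blast+
      have "\<bar>g x\<bar> \<le> t + (g x)\<^sup>2 / t"
      proof -
        have "0 \<le> (\<bar>g x\<bar> - t)\<^sup>2 + t * \<bar>g x\<bar>" using assms(5) by simp
        then have "t * \<bar>g x\<bar> \<le> t\<^sup>2 + (g x)\<^sup>2" by (simp add: power2_diff algebra_simps)
        then show ?thesis using assms(5) by (simp add: field_simps power2_eq_square)
      qed
      moreover have "\<bar>g x\<bar> * bump y \<sigma> x \<le> \<bar>g x\<bar>" using bump_range[of y \<sigma> x] by (simp add: mult_left_le)
      ultimately show ?thesis using x bump_range[of y \<sigma> x] by (simp add: abs_mult)
    qed (use assms(5) in simp)
  qed
  also have "\<dots> = t * measure lebesgue N + (LINT x|lebesgue. indicat_real N x * (g x)\<^sup>2) / t"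
    using iN gN N(3) by simp
  also have "\<dots> \<le> t * A + (LINT x|lebesgue. indicat_real N x * (g x)\<^sup>2) / t"
    using m assms(5) by simp
  finally show "\<bar>LINT x:S|lebesgue. g x * bump y \<sigma> x\<bar> \<le> t * A + (LINT x|lebesgue. indicat_real N x * (g x)\<^sup>2) / t"
    by (simp add: set_lebesgue_integral_def mult.assoc)
qed

lemma measure_ball_le: "0 \<le> \<rho> \<Longrightarrow> measure lebesgue (ball (x :: real \<times> real) \<rho>) \<le> 4 * \<rho>\<^sup>2"
proof -
  assume r: "0 \<le> \<rho>"
  let ?Q = "cbox (x - (\<rho>, \<rho>)) (x + (\<rho>, \<rho>))"
  have "ball x \<rho> \<subseteq> ?Q"
  proof
    fix z assume "z \<in> ball x \<rho>"
    then have "norm (x - z) < \<rho>" by (simp add: dist_norm)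
    moreover have "\<bar>fst (x - z)\<bar> \<le> norm (x - z)" "\<bar>snd (x - z)\<bar> \<le> norm (x - z)"
      by (rule abs_fst_le, rule abs_snd_le)
    ultimately show "z \<in> ?Q" by (cases x; cases z) (auto simp: cbox_Pair_eq)
  qed
  then have "measure lebesgue (ball x \<rho>) \<le> measure lebesgue ?Q"
    by (intro measure_mono_fmeasurable) auto
  also have "\<dots> = 4 * \<rho>\<^sup>2"
    using measure_square[OF r, of x] by (simp add: power2_eq_square)
  finally show ?thesis .
qed

lemma small_ball_integral_tendsto_0:
  fixes x0 :: "real \<times> real"
  assumes "integrable lebesgue G" "\<rho> \<longlonglongrightarrow> 0"
  shows "(\<lambda>n. LINT x|lebesgue. indicat_real (ball x0 (\<rho> n)) x * G x) \<longlonglongrightarrow> (0::real)"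
proof -
  have "(\<lambda>n. LINT x|lebesgue. indicat_real (ball x0 (\<rho> n)) x * G x) \<longlonglongrightarrow> (LINT x :: real \<times> real|lebesgue. (0::real))"
  proof (rule integral_dominated_convergence[where w = "\<lambda>x. \<bar>G x\<bar>"])
    show "(\<lambda>x. indicat_real (ball x0 (\<rho> n)) x * G x) \<in> borel_measurable lebesgue" for n
      by (intro borel_measurable_times borel_measurable_indicator borel_measurable_integrable[OF assms(1)]) auto
    show "integrable lebesgue (\<lambda>x. \<bar>G x\<bar>)" using assms(1) by auto
    have "{x0} \<in> null_sets lebesgue" using negligible_sing[of x0] by (simp add: negligible_iff_null_sets)
    then have "AE x in lebesgue. x \<noteq> x0" using AE_not_in by fastforce
    then show "AE x in lebesgue. (\<lambda>n. indicat_real (ball x0 (\<rho> n)) x * G x) \<longlonglongrightarrow> 0"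
    proof eventually_elim
      case (elim x)
      then have "0 < dist x0 x" by auto
      then have "\<forall>\<^sub>F n in sequentially. \<rho> n < dist x0 x" by (rule order_tendstoD(2)[OF assms(2)])
      then have "\<forall>\<^sub>F n in sequentially. indicat_real (ball x0 (\<rho> n)) x * G x = 0"
        by eventually_elim auto
      then show ?case by (rule tendsto_eventually)
    qed
  qed (auto simp: indicator_def)
  then show ?thesis by simp
qed

text \<open>Slide a bump of radius \<open>\<sigma> = c \<rho>\<close> from \<open>y1\<close> to \<open>y2\<close>. The weighted mean of \<open>u\<close> moves from about \<open>a1\<close> to
about \<open>a2\<close>; its derivative along the way is an integral of the weak gradient against the bump. After
division by the mass of the bump, which is of order \<open>\<rho>\<^sup>2\<close>, the total change is bounded by a multiple of
\<open>\<tau> + E \<rho> / \<tau>\<close> with a free parameter \<open>\<tau>\<close>, where \<open>E \<rho>\<close> is the energy in a disc of radius of order \<open>\<rho>\<close>.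
Letting first \<open>\<rho>\<close> and then \<open>\<tau>\<close> tend to zero gives the claim.\<close>

lemma H1_no_jump:
  fixes u :: "real \<times> real \<Rightarrow> real"
  assumes S: "open S" "bounded S" and u: "u \<in> H1_on S" and x0: "x0 \<in> S"
    and c: "0 < c" and C: "0 \<le> C" and \<rho>0: "0 < \<rho>0"
    and ex: "\<And>\<rho>. 0 < \<rho> \<Longrightarrow> \<rho> < \<rho>0 \<Longrightarrow> \<exists>y1 y2. norm (y1 - x0) \<le> C * \<rho> \<and> norm (y2 - x0) \<le> C * \<rho> \<and>
       (\<forall>x\<in>ball y1 (c * \<rho>). \<bar>u x - a1\<bar> \<le> L * \<rho>) \<and> (\<forall>x\<in>ball y2 (c * \<rho>). \<bar>u x - a2\<bar> \<le> L * \<rho>)"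
  shows "a1 = a2"
proof -
  have SL: "S \<in> sets lebesgue" using S(1) by auto
  obtain g1 g2 where u2: "u \<in> L2_on S" and g: "g1 \<in> L2_on S" "g2 \<in> L2_on S" and
    weak: "\<forall>\<phi>\<in>test_functions S. \<forall>d. integrable lebesgue (\<lambda>x. indicat_real S x * u x) \<longrightarrow>
       (LINT x|lebesgue. (indicat_real S x * u x) * frechet_derivative \<phi> (at x) d) =
        - (fst d * (LINT x:S|lebesgue. g1 x * \<phi> x) + snd d * (LINT x:S|lebesgue. g2 x * \<phi> x))"
    using H1_on_D[OF u] by blast
  define U where "U x = indicat_real S x * u x" for x
  have iU: "integrable lebesgue U" unfolding U_def using integrable_from_L2_on(1)[OF u2 S(2) SL] .
  define G where "G x = indicat_real S x * (g1 x)\<^sup>2 + indicat_real S x * (g2 x)\<^sup>2" for x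
  have iG: "integrable lebesgue G" unfolding G_def
    using integrable_from_L2_on(2)[OF g(1) S(2) SL] integrable_from_L2_on(2)[OF g(2) S(2) SL] by simp
  define Rc where "Rc = C + c"
  have Rc: "0 < Rc" using c C by (simp add: Rc_def)
  obtain e where e: "0 < e" "ball x0 e \<subseteq> S" using S(1) x0 by (auto simp: open_contains_ball)
  define E where "E \<rho> = (LINT x|lebesgue. indicat_real (ball x0 (Rc * \<rho>)) x * G x)" for \<rho>
  have main: "\<bar>a1 - a2\<bar> \<le> 2 * L * \<rho> + (8 * C / (exp (-16) * c\<^sup>2)) * (8 * \<tau> * Rc\<^sup>2 + E \<rho> / \<tau>)"
    if \<rho>: "0 < \<rho>" "\<rho> < \<rho>0" "Rc * \<rho> < e" and \<tau>: "0 < \<tau>" for \<rho> \<tau>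
  proof -
    obtain y1 y2 where y: "norm (y1 - x0) \<le> C * \<rho>" "norm (y2 - x0) \<le> C * \<rho>"
      "\<And>x. x \<in> ball y1 (c * \<rho>) \<Longrightarrow> \<bar>u x - a1\<bar> \<le> L * \<rho>" "\<And>x. x \<in> ball y2 (c * \<rho>) \<Longrightarrow> \<bar>u x - a2\<bar> \<le> L * \<rho>"
      using ex[OF \<rho>(1,2)] by blast
    define \<sigma> where "\<sigma> = c * \<rho>"
    have \<sigma>: "0 < \<sigma>" using c \<rho>(1) by (simp add: \<sigma>_def)
    define d where "d = y2 - y1"
    define N where "N = ball x0 (Rc * \<rho>)"
    have NS: "N \<subseteq> S" using e(2) \<rho>(3) unfolding N_def by (meson dual_order.trans less_imp_le subset_ball)
    have NL: "N \<in> sets lebesgue" by (simp add: N_def)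
    have mN: "measure lebesgue N \<le> 4 * (Rc * \<rho>)\<^sup>2" unfolding N_def using Rc \<rho>(1) by (intro measure_ball_le) simp
    have yN: "ball (y1 + s *\<^sub>R d) \<sigma> \<subseteq> N" "norm (y1 + s *\<^sub>R d - x0) \<le> C * \<rho>" if s: "0 \<le> s" "s \<le> 1" for s
    proof -
      have "y1 + s *\<^sub>R d - x0 = (1 - s) *\<^sub>R (y1 - x0) + s *\<^sub>R (y2 - x0)" by (simp add: d_def algebra_simps)
      also have "norm \<dots> \<le> (1 - s) * norm (y1 - x0) + s * norm (y2 - x0)"
        using s norm_triangle_ineq[of "(1 - s) *\<^sub>R (y1 - x0)" "s *\<^sub>R (y2 - x0)"] by simp
      also have "\<dots> \<le> (1 - s) * (C * \<rho>) + s * (C * \<rho>)" using s y by (intro add_mono mult_left_mono) auto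
      finally show n: "norm (y1 + s *\<^sub>R d - x0) \<le> C * \<rho>" by (simp add: algebra_simps)
      show "ball (y1 + s *\<^sub>R d) \<sigma> \<subseteq> N"
      proof
        fix z assume "z \<in> ball (y1 + s *\<^sub>R d) \<sigma>"
        then have "norm (z - (y1 + s *\<^sub>R d)) < \<sigma>" by (simp add: dist_norm norm_minus_commute)
        then have "norm (z - x0) < \<sigma> + C * \<rho>"
          using n norm_triangle_ineq[of "z - (y1 + s *\<^sub>R d)" "y1 + s *\<^sub>R d - x0"] by simp
        then show "z \<in> N" by (simp add: N_def Rc_def \<sigma>_def dist_norm norm_minus_commute algebra_simps)
      qed
    qed
    have cbN: "bump (y1 + s *\<^sub>R d) \<sigma> \<in> test_functions S" if s: "0 \<le> s" "s \<le> 1" for s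
    proof (rule bump_test_function[OF \<sigma>])
      show "cball (y1 + s *\<^sub>R d) \<sigma> \<subseteq> S"
      proof
        fix z assume "z \<in> cball (y1 + s *\<^sub>R d) \<sigma>"
        then have "norm (z - (y1 + s *\<^sub>R d)) \<le> \<sigma>" by (simp add: dist_norm norm_minus_commute)
        then have "norm (z - x0) \<le> \<sigma> + C * \<rho>"
          using yN(2)[OF s] norm_triangle_ineq[of "z - (y1 + s *\<^sub>R d)" "y1 + s *\<^sub>R d - x0"] by simp
        then have "norm (z - x0) < e" using \<rho>(3) by (simp add: Rc_def \<sigma>_def algebra_simps)
        then show "z \<in> S" using e(2) by (auto simp: dist_norm norm_minus_commute subset_eq)
      qed
    qed
    have nd: "norm d \<le> 2 * C * \<rho>"
      using y(1,2) norm_triangle_ineq4[of "y2 - x0" "y1 - x0"] by (simp add: d_def)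
    \<comment> \<open>the bump at position \<open>s\<close> of its way from \<open>y1\<close> to \<open>y2\<close>\<close>
    define K where "K s = (LINT x|lebesgue. U x * bump (y1 + s *\<^sub>R d) \<sigma> x)" for s
    define K' where "K' s = (LINT x|lebesgue. U x * frechet_derivative (bump (y1 + s *\<^sub>R d) \<sigma>) (at x) (- d))" for s
    define B where "B = (LINT x|lebesgue. indicat_real N x * (g1 x)\<^sup>2) + (LINT x|lebesgue. indicat_real N x * (g2 x)\<^sup>2)"
    have BE: "B = E \<rho>"
    proof -
      have i: "integrable lebesgue (\<lambda>x. indicat_real N x * (g x)\<^sup>2)" if "g \<in> L2_on S" for g
      proof -
        have "integrable lebesgue (\<lambda>x. indicat_real N x * (indicat_real S x * (g x)\<^sup>2))"
          using integrable_mult_indicator[OF NL integrable_from_L2_on(2)[OF that S(2) SL]] by simp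
        moreover have "indicat_real N x * (indicat_real S x * (g x)\<^sup>2) = indicat_real N x * (g x)\<^sup>2" for x
          using NS by (auto simp: indicator_def)
        ultimately show ?thesis by simp
      qed
      have "B = (LINT x|lebesgue. indicat_real N x * (g1 x)\<^sup>2 + indicat_real N x * (g2 x)\<^sup>2)"
        unfolding B_def using i g by simp
      also have "\<dots> = E \<rho>" unfolding E_def G_def N_def[symmetric] using NS
        by (intro Bochner_Integration.integral_cong) (auto simp: indicator_def)
      finally show ?thesis .
    qed
    have iUb: "integrable lebesgue (\<lambda>x. U x * bump y \<sigma> x)" for y
    proof (rule Bochner_Integration.integrable_bound[OF iU])
      show "(\<lambda>x. U x * bump y \<sigma> x) \<in> borel_measurable lebesgue" using iU bump_integrable[OF \<sigma>, of y] by auto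
      show "AE x in lebesgue. norm (U x * bump y \<sigma> x) \<le> norm (U x)"
        using bump_range[of y \<sigma>] by (intro always_eventually allI) (auto simp: abs_mult mult_left_le)
    qed
    have der: "(K has_real_derivative K' s) (at s)" for s
    proof -
      have t: "bump (y1 + s *\<^sub>R d) \<sigma> \<in> test_functions UNIV" by (rule bump_test_function[OF \<sigma>]) simp
      have "((\<lambda>h. (K (s + h) - K s) / h) \<longlongrightarrow> K' s) (at 0)"
        unfolding tendsto_at_iff_sequentially
      proof (intro allI impI)
        fix h :: "nat \<Rightarrow> real" assume h: "\<forall>i. h i \<in> UNIV - {0}" "h \<longlonglongrightarrow> 0"
        have e: "(K (s + h n) - K s) / h n = (LINT x|lebesgue. U x * ((bump (y1 + s *\<^sub>R d) \<sigma> (x + h n *\<^sub>R (- d)) - bump (y1 + s *\<^sub>R d) \<sigma> x) / h n))" for n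
        proof -
          have "bump (y1 + s *\<^sub>R d) \<sigma> (x + h n *\<^sub>R (- d)) = bump (y1 + (s + h n) *\<^sub>R d) \<sigma> x" for x
            using bump_translate[of "y1 + s *\<^sub>R d" \<sigma> x "h n *\<^sub>R d"] by (simp add: algebra_simps)
          then have "(LINT x|lebesgue. U x * ((bump (y1 + s *\<^sub>R d) \<sigma> (x + h n *\<^sub>R (- d)) - bump (y1 + s *\<^sub>R d) \<sigma> x) / h n)) =
            (LINT x|lebesgue. (U x * bump (y1 + (s + h n) *\<^sub>R d) \<sigma> x - U x * bump (y1 + s *\<^sub>R d) \<sigma> x) / h n)"
            by (simp add: right_diff_distrib diff_divide_distrib)
          also have "\<dots> = (K (s + h n) - K s) / h n" unfolding K_def using iUb by simp
          finally show ?thesis by (rule sym)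
        qed
        have "(\<lambda>n. (LINT x|lebesgue. U x * ((bump (y1 + s *\<^sub>R d) \<sigma> (x + h n *\<^sub>R (- d)) - bump (y1 + s *\<^sub>R d) \<sigma> x) / h n))) \<longlonglongrightarrow> K' s"
          unfolding K'_def by (rule integral_difference_quotient_tendsto[OF iU t h(2)]) (use h(1) in auto)
        then show "((\<lambda>h. (K (s + h) - K s) / h) \<circ> h) \<longlonglongrightarrow> K' s"
          unfolding o_def e .
      qed
      then show ?thesis by (simp add: DERIV_def)
    qed
    \<comment> \<open>this weight balances the area of the disc, of order \<open>\<rho>\<^sup>2\<close>, against the energy\<close>
    define t where "t = \<tau> / \<rho>"
    have t0: "0 < t" using \<tau> \<rho> by (simp add: t_def)
    have K'b: "\<bar>K' s\<bar> \<le> 2 * C * \<rho> * (t * (8 * (Rc * \<rho>)\<^sup>2) + B / t)" if s: "0 \<le> s" "s \<le> 1" for s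
    proof -
      note b1 = weak_derivative_bound[OF g(1) S(2) SL \<sigma> t0 yN(1)[OF s] NS NL mN]
      note b2 = weak_derivative_bound[OF g(2) S(2) SL \<sigma> t0 yN(1)[OF s] NS NL mN]
      let ?I1 = "LINT x:S|lebesgue. g1 x * bump (y1 + s *\<^sub>R d) \<sigma> x"
      let ?I2 = "LINT x:S|lebesgue. g2 x * bump (y1 + s *\<^sub>R d) \<sigma> x"
      have "K' s = - (fst (- d) * ?I1 + snd (- d) * ?I2)"
        unfolding K'_def U_def by (rule weak[rule_format, OF cbN[OF s] iU[unfolded U_def]])
      then have "K' s = fst d * ?I1 + snd d * ?I2" by simp
      then have "\<bar>K' s\<bar> \<le> \<bar>fst d\<bar> * \<bar>?I1\<bar> + \<bar>snd d\<bar> * \<bar>?I2\<bar>"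
        using abs_triangle_ineq[of "fst d * ?I1" "snd d * ?I2"] by (simp only: abs_mult)
      also have "\<dots> \<le> norm d * \<bar>?I1\<bar> + norm d * \<bar>?I2\<bar>"
        by (intro add_mono mult_right_mono abs_fst_le abs_snd_le) auto
      also have "\<dots> = norm d * (\<bar>?I1\<bar> + \<bar>?I2\<bar>)" by (simp add: distrib_left)
      also have "\<dots> \<le> 2 * C * \<rho> * (t * (8 * (Rc * \<rho>)\<^sup>2) + B / t)"
      proof (rule mult_mono[OF nd])
        show "\<bar>?I1\<bar> + \<bar>?I2\<bar> \<le> t * (8 * (Rc * \<rho>)\<^sup>2) + B / t"
          using b1(2) b2(2) unfolding B_def by (simp add: add_divide_distrib)
      qed (use C \<rho>(1) in auto)
      finally show ?thesis .
    qed
    obtain z where "0 < z" "z < 1" "K 1 - K 0 = (1 - 0) * K' z" using MVT2[of 0 1 K K'] der by auto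
    then have KK: "\<bar>K 1 - K 0\<bar> \<le> 2 * C * \<rho> * (t * (8 * (Rc * \<rho>)\<^sup>2) + B / t)" using K'b[of z] by simp
    define J where "J = (LINT x|lebesgue. bump y1 \<sigma> x)"
    have J2: "(LINT x|lebesgue. bump y2 \<sigma> x) = J" unfolding J_def using bump_integral_translate[of y1 d \<sigma>] by (simp add: d_def)
    have Jl: "exp (-16) * (\<sigma>\<^sup>2 / 4) \<le> J" unfolding J_def by (rule bump_integral_lower[OF \<sigma>])
    have pos: "0 < exp (-16) * (\<sigma>\<^sup>2 / 4)" using \<sigma> by simp
    have J0: "0 < J" using Jl pos by linarith
    have inS: "x \<in> S" if "dist y1 x < \<sigma> \<or> dist y2 x < \<sigma>" for x
      using yN(1)[of 0] yN(1)[of 1] NS that by (auto simp: d_def)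
    have n1: "\<bar>K 0 - a1 * J\<bar> \<le> L * \<rho> * J"
      using integral_near_value[OF iU \<sigma>, of y1 a1 "L * \<rho>"] y(3) inS unfolding K_def J_def by (simp add: \<sigma>_def U_def)
    have n2: "\<bar>K 1 - a2 * J\<bar> \<le> L * \<rho> * J"
      using integral_near_value[OF iU \<sigma>, of y2 a2 "L * \<rho>"] y(4) inS unfolding K_def J2 by (simp add: \<sigma>_def U_def d_def)
    have Y: "t * (8 * (Rc * \<rho>)\<^sup>2) + B / t = \<rho> * (8 * \<tau> * Rc\<^sup>2 + E \<rho> / \<tau>)"
      using \<rho>(1) \<tau> unfolding BE t_def by (simp add: field_simps power2_eq_square)
    have Epos: "0 \<le> E \<rho>" unfolding E_def G_def by (intro Bochner_Integration.integral_nonneg) simp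
    have "\<bar>(a1 - a2) * J\<bar> \<le> 2 * L * \<rho> * J + 2 * C * \<rho> * (\<rho> * (8 * \<tau> * Rc\<^sup>2 + E \<rho> / \<tau>))"
      using n1 n2 KK unfolding Y by (simp add: left_diff_distrib)
    then have "\<bar>a1 - a2\<bar> * J \<le> 2 * L * \<rho> * J + 2 * C * \<rho> * (\<rho> * (8 * \<tau> * Rc\<^sup>2 + E \<rho> / \<tau>))"
      using J0 by (simp add: abs_mult)
    then have "\<bar>a1 - a2\<bar> \<le> 2 * L * \<rho> + 2 * C * \<rho> * (\<rho> * (8 * \<tau> * Rc\<^sup>2 + E \<rho> / \<tau>)) / J"
      using J0 by (simp add: field_simps)
    also have "2 * C * \<rho> * (\<rho> * (8 * \<tau> * Rc\<^sup>2 + E \<rho> / \<tau>)) / J \<le> 2 * C * \<rho> * (\<rho> * (8 * \<tau> * Rc\<^sup>2 + E \<rho> / \<tau>)) / (exp (-16) * (\<sigma>\<^sup>2 / 4))"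
      using C \<rho>(1) \<tau> Epos Jl pos J0 by (intro divide_left_mono mult_nonneg_nonneg add_nonneg_nonneg divide_nonneg_nonneg mult_pos_pos) auto
    also have "\<dots> = (8 * C / (exp (-16) * c\<^sup>2)) * (8 * \<tau> * Rc\<^sup>2 + E \<rho> / \<tau>)"
      using \<rho>(1) c by (simp add: \<sigma>_def power_mult_distrib power2_eq_square)
    finally show ?thesis by simp
  qed
  define M where "M = 8 * C / (exp (-16) * c\<^sup>2)"
  have lim: "\<bar>a1 - a2\<bar> \<le> M * (8 * \<tau> * Rc\<^sup>2)" if \<tau>: "0 < \<tau>" for \<tau>
  proof -
    define \<rho> where "\<rho> n = inverse (real (Suc n))" for n
    have \<rho>: "\<rho> \<longlonglongrightarrow> 0" "\<And>n. 0 < \<rho> n" unfolding \<rho>_def using LIMSEQ_inverse_real_of_nat by auto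
    have R\<rho>: "(\<lambda>n. Rc * \<rho> n) \<longlonglongrightarrow> 0" using tendsto_mult_right_zero[OF \<rho>(1)] .
    have "(\<lambda>n. 2 * L * \<rho> n + M * (8 * \<tau> * Rc\<^sup>2 + E (\<rho> n) / \<tau>)) \<longlonglongrightarrow> 2 * L * 0 + M * (8 * \<tau> * Rc\<^sup>2 + 0 / \<tau>)"
      by (intro tendsto_intros \<rho>) (use \<tau> small_ball_integral_tendsto_0[OF iG R\<rho>, of x0] in \<open>auto simp: E_def\<close>)
    moreover have "\<forall>\<^sub>F n in sequentially. \<bar>a1 - a2\<bar> \<le> 2 * L * \<rho> n + M * (8 * \<tau> * Rc\<^sup>2 + E (\<rho> n) / \<tau>)"
      using order_tendstoD(2)[OF \<rho>(1) \<rho>0] order_tendstoD(2)[OF R\<rho> e(1)]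
      by eventually_elim (use main \<rho>(2) \<tau> in \<open>simp add: M_def\<close>)
    ultimately show ?thesis using tendsto_lowerbound by fastforce
  qed
  have "((\<lambda>\<tau>. M * (8 * \<tau> * Rc\<^sup>2)) \<longlongrightarrow> M * (8 * 0 * Rc\<^sup>2)) (at_right 0)" by (intro tendsto_intros)
  then have "\<bar>a1 - a2\<bar> \<le> M * (8 * 0 * Rc\<^sup>2)"
    by (rule tendsto_lowerbound) (auto simp: eventually_at_right_less lim eventually_at_filter)
  then show ?thesis by simp
qed

section \<open>C1 images of the unit square\<close>

lemma sq_closed_cbox: "sq_closed = cbox (0, 0) (1, 1)"
  by (auto simp: sq_closed_def cbox_Pair_eq)

lemma sq_open_box: "sq_open = box (0, 0) (1, 1)"
  by (auto simp: sq_open_def mem_box Basis_prod_def)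

lemma sq_basic: "compact sq_closed" "convex sq_closed" "open sq_open" "sq_open \<subseteq> sq_closed" "closure sq_open = sq_closed"
proof -
  have ne: "box (0, 0) (1::real, 1::real) \<noteq> {}"
    unfolding sq_open_box[symmetric] sq_open_def by (auto intro!: exI[of _ "1/2 :: real"])
  show "closure sq_open = sq_closed" unfolding sq_open_box sq_closed_cbox by (rule closure_box[OF ne])
qed (auto simp: sq_closed_cbox sq_open_box box_subset_cbox)

lemma sq_boundary: "x \<in> sq_closed - sq_open \<longleftrightarrow> x \<in> sq_closed \<and> (fst x \<in> {0, 1} \<or> snd x \<in> {0, 1})"
  by (auto simp: sq_closed_def sq_open_def)

lemma line_into_unit_interval:
  fixes a b :: real
  assumes "0 < a \<and> a < 1 \<or> a = 0 \<and> 0 < b \<or> a = 1 \<and> b < 0"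
  shows "\<exists>\<kappa>>0. \<exists>T>0. \<forall>t s. 0 < t \<and> t < T \<and> \<bar>s - (a + t * b)\<bar> < \<kappa> * t \<longrightarrow> 0 < s \<and> s < 1"
  using assms
proof (elim disjE conjE)
  assume a: "0 < a" "a < 1"
  define T where "T = min a (1 - a) / (\<bar>b\<bar> + 1)"
  have T: "T > 0" using a by (simp add: T_def)
  have *: "0 < s \<and> s < 1" if t: "0 < t" "t < T" "\<bar>s - (a + t * b)\<bar> < 1 * t" for t s
  proof -
    have "t * (\<bar>b\<bar> + 1) < min a (1 - a)" using t(2) unfolding T_def by (simp add: pos_less_divide_eq)
    moreover have "\<bar>t * b\<bar> = t * \<bar>b\<bar>" using t(1) by (simp add: abs_mult)
    ultimately have "\<bar>t * b\<bar> + t < a" "\<bar>t * b\<bar> + t < 1 - a" by (simp_all add: distrib_left)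
    then show ?thesis using t(3) by linarith
  qed
  show ?thesis by (rule exI[of _ 1], rule conjI, simp, rule exI[of _ T], rule conjI, rule T, use * in blast)
next
  assume "a = 0" "0 < b"
  have *: "0 < s \<and> s < 1" if t: "0 < t" "t < 1 / (2 * b)" "\<bar>s - (a + t * b)\<bar> < b * t" for t s
  proof -
    have "2 * (t * b) < 1" using t(2) \<open>0 < b\<close> by (simp add: field_simps)
    then show ?thesis using t(3) \<open>a = 0\<close> unfolding mult.commute[of b] abs_less_iff by linarith
  qed
  show ?thesis by (rule exI[of _ b], rule conjI, rule \<open>0 < b\<close>, rule exI[of _ "1 / (2 * b)"], rule conjI, use \<open>0 < b\<close> in simp, use * in blast)
next
  assume "a = 1" "b < 0"
  have *: "0 < s \<and> s < 1" if t: "0 < t" "t < 1 / (2 * (- b))" "\<bar>s - (a + t * b)\<bar> < (- b) * t" for t s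
  proof -
    have "- (2 * (t * b)) < 1" using t(2) \<open>b < 0\<close> by (simp add: field_simps)
    moreover have "(- b) * t = - (t * b)" by simp
    ultimately show ?thesis using t(3) \<open>a = 1\<close> unfolding abs_less_iff by linarith
  qed
  have "0 < - b" using \<open>b < 0\<close> by simp
  show ?thesis by (rule exI[of _ "- b"], rule conjI, rule \<open>0 < - b\<close>, rule exI[of _ "1 / (2 * (- b))"], rule conjI, use \<open>0 < - b\<close> in \<open>simp add: divide_neg_neg\<close>, use * in blast)
qed

text \<open>A boundary point that is not a corner lies on one side only, and \<open>\<nu>\<close> is the inner normal of that side.\<close>

lemma inward_cone:
  assumes "p \<in> sq_closed - sq_open" "p \<notin> {0, 1} \<times> {0, 1}"
  shows "\<exists>\<nu>::real \<times> real. \<nu> \<noteq> 0 \<and> (\<forall>q. 0 < \<nu> \<bullet> q \<longrightarrow>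
     (\<exists>\<kappa>>0. \<exists>T>0. \<forall>t. 0 < t \<and> t < T \<longrightarrow> ball (p + t *\<^sub>R q) (\<kappa> * t) \<subseteq> sq_open))"
proof -
  obtain p1 p2 where p: "p = (p1, p2)" by (cases p)
  have r: "0 \<le> p1" "p1 \<le> 1" "0 \<le> p2" "p2 \<le> 1" using assms(1) by (auto simp: p sq_closed_def)
  define \<nu> :: "real \<times> real" where "\<nu> = (if p1 = 0 then (1, 0) else if p1 = 1 then (-1, 0) else if p2 = 0 then (0, 1) else (0, -1))"
  show ?thesis
  proof (intro exI[of _ \<nu>] conjI allI impI)
    show "\<nu> \<noteq> 0" by (auto simp: \<nu>_def zero_prod_def)
    fix q assume q: "0 < \<nu> \<bullet> q"
    obtain q1 q2 where qq: "q = (q1, q2)" by (cases q)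
    have "p1 \<in> {0, 1} \<or> p2 \<in> {0, 1}" "\<not> (p1 \<in> {0, 1} \<and> p2 \<in> {0, 1})" using assms sq_boundary[of p] by (auto simp: p)
    then have c1: "0 < p1 \<and> p1 < 1 \<or> p1 = 0 \<and> 0 < q1 \<or> p1 = 1 \<and> q1 < 0"
      and c2: "0 < p2 \<and> p2 < 1 \<or> p2 = 0 \<and> 0 < q2 \<or> p2 = 1 \<and> q2 < 0"
      using r q by (auto simp: \<nu>_def qq split: if_splits)
    obtain k1 T1 where 1: "k1 > 0" "T1 > 0" "\<And>t s. 0 < t \<Longrightarrow> t < T1 \<Longrightarrow> \<bar>s - (p1 + t * q1)\<bar> < k1 * t \<Longrightarrow> 0 < s \<and> s < 1"
      using line_into_unit_interval[OF c1] by blast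
    obtain k2 T2 where 2: "k2 > 0" "T2 > 0" "\<And>t s. 0 < t \<Longrightarrow> t < T2 \<Longrightarrow> \<bar>s - (p2 + t * q2)\<bar> < k2 * t \<Longrightarrow> 0 < s \<and> s < 1"
      using line_into_unit_interval[OF c2] by blast
    have *: "ball (p + t *\<^sub>R q) (min k1 k2 * t) \<subseteq> sq_open" if t: "0 < t" "t < min T1 T2" for t
      proof
        fix z assume z: "z \<in> ball (p + t *\<^sub>R q) (min k1 k2 * t)"
        obtain z1 z2 where zz: "z = (z1, z2)" by (cases z)
        have "dist z1 (p1 + t * q1) \<le> dist z (p + t *\<^sub>R q)" "dist z2 (p2 + t * q2) \<le> dist z (p + t *\<^sub>R q)"
          using dist_fst_le[of z "p + t *\<^sub>R q"] dist_snd_le[of z "p + t *\<^sub>R q"] by (simp_all add: zz p qq)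
        moreover have "dist z (p + t *\<^sub>R q) < min k1 k2 * t" using z by (simp add: dist_commute)
        moreover have "min k1 k2 * t \<le> k1 * t" "min k1 k2 * t \<le> k2 * t" using t(1) by (auto intro: mult_right_mono)
        ultimately have "\<bar>z1 - (p1 + t * q1)\<bar> < k1 * t" "\<bar>z2 - (p2 + t * q2)\<bar> < k2 * t" by (auto simp: dist_real_def)
        then show "z \<in> sq_open" using 1(3)[of t z1] 2(3)[of t z2] t by (auto simp: zz sq_open_def)
      qed
    have "0 < min k1 k2" "0 < min T1 T2" using 1(1,2) 2(1,2) by simp_all
    then show "\<exists>\<kappa>>0. \<exists>T>0. \<forall>t. 0 < t \<and> t < T \<longrightarrow> ball (p + t *\<^sub>R q) (\<kappa> * t) \<subseteq> sq_open"
      using * by blast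
  qed
qed

lemma opposite_if_no_common_half_plane:
  fixes a b :: "'a :: real_inner"
  assumes "a \<noteq> 0" "b \<noteq> 0" "\<not> (\<exists>d. 0 < a \<bullet> d \<and> 0 < b \<bullet> d)"
  shows "b /\<^sub>R norm b = - (a /\<^sub>R norm a)"
proof -
  define u v where "u = a /\<^sub>R norm a" and "v = b /\<^sub>R norm b"
  have n: "u \<bullet> u = 1" "v \<bullet> v = 1" using assms(1,2) by (simp_all add: u_def v_def dot_square_norm power2_eq_square)
  have e: "a = norm a *\<^sub>R u" "b = norm b *\<^sub>R v" using assms(1,2) by (simp_all add: u_def v_def)
  have "a \<bullet> (u + v) = norm a * (1 + u \<bullet> v)" by (subst e(1)) (simp add: inner_add_right n distrib_left)
  moreover have "b \<bullet> (u + v) = norm b * (1 + u \<bullet> v)" by (subst e(2)) (simp add: inner_add_right n inner_commute distrib_left)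
  ultimately have "\<not> 0 < 1 + u \<bullet> v" using assms by (metis mult_pos_pos zero_less_norm_iff)
  then have "(u + v) \<bullet> (u + v) \<le> 0" by (simp add: inner_add_left inner_add_right n inner_commute)
  then have "u + v = 0" by (metis inner_ge_zero inner_eq_zero_iff order_antisym)
  then show ?thesis unfolding u_def v_def by (simp add: add_eq_0_iff)
qed

text \<open>Open half planes through a common point are disjoint only if they are opposite, and three of them cannot
be pairwise opposite.\<close>

lemma three_half_planes_meet:
  fixes a b c :: "'a :: real_inner"
  assumes "a \<noteq> 0" "b \<noteq> 0" "c \<noteq> 0"
  shows "(\<exists>d. 0 < a \<bullet> d \<and> 0 < b \<bullet> d) \<or> (\<exists>d. 0 < a \<bullet> d \<and> 0 < c \<bullet> d) \<or> (\<exists>d. 0 < b \<bullet> d \<and> 0 < c \<bullet> d)"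
proof (rule ccontr)
  assume "\<not> ?thesis"
  then have "b /\<^sub>R norm b = - (a /\<^sub>R norm a)" "c /\<^sub>R norm c = - (a /\<^sub>R norm a)" "c /\<^sub>R norm c = - (b /\<^sub>R norm b)"
    using assms by (auto intro!: opposite_if_no_common_half_plane)
  then have "a /\<^sub>R norm a = - (a /\<^sub>R norm a)" by simp
  from arg_cong[OF this, of "\<lambda>u. u \<bullet> a"] have "a \<bullet> a = 0" using assms(1) by simp
  then show False using assms(1) by simp
qed

locale patch_map =
  fixes F :: "real \<times> real \<Rightarrow> real \<times> real"
  assumes diffeo: "C1_diffeo_on sq_closed F"
begin

definition G where "G = inv_into sq_closed F"

lemma F_C1: "C1_on sq_closed F" and G_C1: "C1_on (F ` sq_closed) G"
  using diffeo by (simp_all add: C1_diffeo_on_def G_def)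

lemma F_inj: "inj_on F sq_closed" using diffeo by (simp add: C1_diffeo_on_def)

lemma G_F [simp]: "x \<in> sq_closed \<Longrightarrow> G (F x) = x" by (simp add: G_def F_inj)
lemma F_G: "y \<in> F ` sq_closed \<Longrightarrow> F (G y) = y" by (simp add: G_def f_inv_into_f)
lemma G_in: "y \<in> F ` sq_closed \<Longrightarrow> G y \<in> sq_closed" by (simp add: G_def inv_into_into)

definition F' where "F' = (SOME f' :: real \<times> real \<Rightarrow> (real \<times> real) \<Rightarrow>\<^sub>L (real \<times> real).
  (\<forall>x\<in>sq_closed. (F has_derivative blinfun_apply (f' x)) (at x within sq_closed)) \<and> continuous_on sq_closed f')"

lemma F': "x \<in> sq_closed \<Longrightarrow> (F has_derivative blinfun_apply (F' x)) (at x within sq_closed)" "continuous_on sq_closed F'"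
proof -
  have "\<exists>f' :: real \<times> real \<Rightarrow> (real \<times> real) \<Rightarrow>\<^sub>L (real \<times> real).
  (\<forall>x\<in>sq_closed. (F has_derivative blinfun_apply (f' x)) (at x within sq_closed)) \<and> continuous_on sq_closed f'"
    using F_C1 unfolding C1_on_def .
  from someI_ex[OF this, folded F'_def]
  show "x \<in> sq_closed \<Longrightarrow> (F has_derivative blinfun_apply (F' x)) (at x within sq_closed)" "continuous_on (sq_closed) F'" by auto
qed

lemma F_continuous: "continuous_on sq_closed F"
  by (rule has_derivative_continuous_on, rule F'(1))

definition G' where "G' = (SOME f' :: real \<times> real \<Rightarrow> (real \<times> real) \<Rightarrow>\<^sub>L (real \<times> real).
  (\<forall>x\<in>F ` sq_closed. (G has_derivative blinfun_apply (f' x)) (at x within F ` sq_closed)) \<and> continuous_on (F ` sq_closed) f')"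

lemma G': "x \<in> F ` sq_closed \<Longrightarrow> (G has_derivative blinfun_apply (G' x)) (at x within F ` sq_closed)" "continuous_on (F ` sq_closed) G'"
proof -
  have "\<exists>f' :: real \<times> real \<Rightarrow> (real \<times> real) \<Rightarrow>\<^sub>L (real \<times> real).
  (\<forall>x\<in>F ` sq_closed. (G has_derivative blinfun_apply (f' x)) (at x within F ` sq_closed)) \<and> continuous_on (F ` sq_closed) f'"
    using G_C1 unfolding C1_on_def .
  from someI_ex[OF this, folded G'_def]
  show "x \<in> F ` sq_closed \<Longrightarrow> (G has_derivative blinfun_apply (G' x)) (at x within F ` sq_closed)" "continuous_on (F ` sq_closed) G'" by auto
qed

lemma G_continuous: "continuous_on (F ` sq_closed) G"
  by (rule has_derivative_continuous_on, rule G'(1))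

lemma compact_image: "compact (F ` sq_closed)"
  using F_continuous sq_basic(1) by (rule compact_continuous_image)

lemma G'_F':
  assumes "p \<in> sq_closed" shows "G' (F p) (F' p v) = v"
proof -
  have "(G \<circ> F has_derivative blinfun_apply (G' (F p)) \<circ> blinfun_apply (F' p)) (at p within sq_closed)"
    by (rule diff_chain_within[OF F'(1)[OF assms] G'(1)]) (use assms in auto)
  then have 1: "((\<lambda>x. x) has_derivative blinfun_apply (G' (F p)) \<circ> blinfun_apply (F' p)) (at p within cbox (0, 0) (1, 1))"
    unfolding sq_closed_cbox[symmetric]
    by (rule has_derivative_transform_within[where d = 1]) (use assms in auto)
  have 2: "((\<lambda>x. x) has_derivative (\<lambda>x. x)) (at p within cbox (0, 0) (1, 1))" by (rule has_derivative_ident)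
  have "blinfun_apply (G' (F p)) \<circ> blinfun_apply (F' p) = (\<lambda>x. x)"
    by (rule frechet_derivative_unique_within_closed_interval[OF _ _ 1 2])
       (use assms in \<open>auto simp: sq_closed_cbox Basis_prod_def\<close>)
  then show ?thesis by (metis comp_apply)
qed

lemma F'_G':
  assumes "p \<in> sq_closed" shows "F' p (G' (F p) v) = v"
proof -
  have l: "linear (blinfun_apply (F' p))" "linear (blinfun_apply (G' (F p)))"
    by (intro bounded_linear.linear blinfun.bounded_linear_right)+
  have "blinfun_apply (G' (F p)) \<circ> blinfun_apply (F' p) = id" using G'_F'[OF assms] by (auto simp: fun_eq_iff)
  then have "blinfun_apply (F' p) \<circ> blinfun_apply (G' (F p)) = id" using linear_inverse_left[OF l] by simp
  then show ?thesis by (metis comp_apply id_apply)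
qed

lemma G'_bound: "\<exists>K>0. \<forall>y\<in>F ` sq_closed. norm (G' y) \<le> K"
proof -
  have "compact (G' ` (F ` sq_closed))" using G'(2) compact_image by (rule compact_continuous_image)
  then obtain K where K: "\<And>y. y \<in> F ` sq_closed \<Longrightarrow> norm (G' y) \<le> K" by (force dest!: compact_imp_bounded simp: bounded_iff)
  have "norm (G' y) \<le> max K 1" if "y \<in> F ` sq_closed" for y using K[OF that] by linarith
  then show ?thesis by (intro exI[of _ "max K 1"]) auto
qed

lemma F_lipschitz: "\<exists>M>0. \<forall>x\<in>sq_closed. \<forall>y\<in>sq_closed. norm (F x - F y) \<le> M * norm (x - y)"
proof -
  have "compact (F' ` sq_closed)" using F'(2) sq_basic(1) by (rule compact_continuous_image)
  then obtain K where K: "\<And>y. y \<in> sq_closed \<Longrightarrow> norm (F' y) \<le> K" by (force dest!: compact_imp_bounded simp: bounded_iff)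
  have "norm (F x - F y) \<le> max K 1 * norm (x - y)" if "x \<in> sq_closed" "y \<in> sq_closed" for x y
    by (rule differentiable_bound[OF sq_basic(2) F'(1)]) (use K that in \<open>auto simp: norm_blinfun.rep_eq[symmetric] le_max_iff_disj\<close>)
  then show ?thesis by (intro exI[of _ "max K 1"]) auto
qed

text \<open>Near the diagonal the derivative dominates: it is bounded below because the inverse has a bounded
derivative, and it is uniformly continuous. Away from the diagonal injectivity and compactness suffice.\<close>

lemma F_expanding: "\<exists>c>0. \<forall>x\<in>sq_closed. \<forall>y\<in>sq_closed. c * norm (x - y) \<le> norm (F x - F y)"
proof -
  obtain K where K: "K > 0" "\<And>y. y \<in> F ` sq_closed \<Longrightarrow> norm (G' y) \<le> K" using G'_bound by blast
  have low: "norm v \<le> K * norm (F' p v)" if "p \<in> sq_closed" for p v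
  proof -
    have "norm v = norm (G' (F p) (F' p v))" using G'_F'[OF that] by simp
    also have "\<dots> \<le> norm (G' (F p)) * norm (F' p v)" by (rule norm_blinfun)
    also have "\<dots> \<le> K * norm (F' p v)" using K(2)[of "F p"] that by (intro mult_right_mono) auto
    finally show ?thesis .
  qed
  have "uniformly_continuous_on sq_closed F'" using F'(2) sq_basic(1) by (rule compact_uniformly_continuous)
  then obtain \<delta> where \<delta>: "\<delta> > 0" "\<And>x y. x \<in> sq_closed \<Longrightarrow> y \<in> sq_closed \<Longrightarrow> dist y x < \<delta> \<Longrightarrow> dist (F' y) (F' x) < 1 / (2 * K)"
    unfolding uniformly_continuous_on_def using K(1) by (metis zero_less_divide_1_iff zero_less_mult_iff zero_less_numeral)
  have near: "1 / (2 * K) * norm (x - y) \<le> norm (F x - F y)" if xy: "x \<in> sq_closed" "y \<in> sq_closed" "dist y x < \<delta>" for x y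
  proof -
    have seg: "x + t *\<^sub>R (y - x) \<in> sq_closed" if "t \<in> {0..1}" for t
    proof -
      have "x + t *\<^sub>R (y - x) = (1 - t) *\<^sub>R x + t *\<^sub>R y" by (simp add: algebra_simps)
      then show ?thesis using sq_basic(2) xy that by (auto simp: convex_alt)
    qed
    have "norm (F y - F x - F' x (y - x)) \<le> norm (y - x) * (1 / (2 * K))"
    proof (rule differentiable_bound_linearization[where S = "closed_segment x y" and f' = "\<lambda>z. blinfun_apply (F' z)"])
      show "x + t *\<^sub>R (y - x) \<in> closed_segment x y" if "t \<in> {0..1}" for t
      proof -
        have "x + t *\<^sub>R (y - x) = (1 - t) *\<^sub>R x + t *\<^sub>R y" by (simp add: algebra_simps)
        then show ?thesis using that by (auto simp: closed_segment_def)
      qed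
      have sub: "closed_segment x y \<subseteq> sq_closed" using xy sq_basic(2) by (simp add: closed_segment_subset)
      show "(F has_derivative blinfun_apply (F' z)) (at z within closed_segment x y)" if "z \<in> closed_segment x y" for z
        using has_derivative_subset[OF F'(1) sub] sub that by blast
      show "onorm (blinfun_apply (F' z) - blinfun_apply (F' x)) \<le> 1 / (2 * K)" if z: "z \<in> closed_segment x y" for z
      proof -
        have "dist z x \<le> dist y x" using z by (metis dist_commute segment_bound1 dist_norm norm_minus_commute)
        then have "dist (F' z) (F' x) < 1 / (2 * K)" using \<delta>(2)[OF xy(1), of z] sub z xy(3) by auto
        moreover have "norm (F' z - F' x) = onorm (blinfun_apply (F' z) - blinfun_apply (F' x))"
          by (simp add: norm_blinfun.rep_eq minus_blinfun.rep_eq fun_diff_def)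
        ultimately show ?thesis by (simp add: dist_norm)
      qed
    qed auto
    moreover have "norm (F' x (y - x)) - norm (F y - F x - F' x (y - x)) \<le> norm (F y - F x)"
      using norm_triangle_ineq2[of "F' x (y - x)" "F' x (y - x) - (F y - F x)"] by (simp add: norm_minus_commute)
    moreover have "norm (y - x) / K \<le> norm (F' x (y - x))" using low[OF xy(1), of "y - x"] K(1) by (simp add: field_simps)
    moreover have "norm (y - x) / K = 2 * (norm (y - x) * (1 / (2 * K)))" by simp
    ultimately have "norm (y - x) * (1 / (2 * K)) \<le> norm (F y - F x)" by linarith
    then show ?thesis by (simp add: norm_minus_commute)
  qed
  let ?S = "{z \<in> sq_closed \<times> sq_closed. \<delta> \<le> dist (snd z) (fst z)}"
  have cS: "compact ?S"
  proof -
    have "?S = (sq_closed \<times> sq_closed) \<inter> {z. \<delta> \<le> dist (snd z) (fst z)}" by auto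
    moreover have "closed {z :: (real \<times> real) \<times> (real \<times> real). \<delta> \<le> dist (snd z) (fst z)}" by (intro closed_Collect_le continuous_intros)
    ultimately show ?thesis using sq_basic(1) by (auto intro: compact_Int_closed compact_Times)
  qed
  have "\<exists>m>0. \<forall>z\<in>?S. m \<le> norm (F (fst z) - F (snd z))"
  proof (cases "?S = {}")
    case False
    have "continuous_on ?S (\<lambda>z. norm (F (fst z) - F (snd z)))"
      by (intro continuous_intros continuous_on_compose2[OF F_continuous]) auto
    from continuous_attains_inf[OF cS False this] obtain z where z: "z \<in> ?S" "\<And>y. y \<in> ?S \<Longrightarrow> norm (F (fst z) - F (snd z)) \<le> norm (F (fst y) - F (snd y))" by blast
    have "fst z \<noteq> snd z" using z(1) \<delta>(1) by auto
    then have "F (fst z) \<noteq> F (snd z)" using z(1) F_inj by (auto dest: inj_onD)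
    then show ?thesis using z(2) by (intro exI[of _ "norm (F (fst z) - F (snd z))"]) auto
  qed (intro exI[of _ 1], simp only: ball_simps, simp)
  then obtain m where m: "m > 0" "\<And>z. z \<in> ?S \<Longrightarrow> m \<le> norm (F (fst z) - F (snd z))" by blast
  have far: "m / 2 * norm (x - y) \<le> norm (F x - F y)" if xy: "x \<in> sq_closed" "y \<in> sq_closed" "\<not> dist y x < \<delta>" for x y
  proof -
    have "norm (x - y) \<le> norm (fst (x - y)) + norm (snd (x - y))" by (metis norm_Pair_le prod.collapse)
    also have "\<dots> \<le> 2" using xy(1,2) by (auto simp: sq_closed_def)
    finally have "m / 2 * norm (x - y) \<le> m / 2 * 2" using m(1) by (intro mult_left_mono) auto
    also have "\<dots> \<le> norm (F x - F y)" using m(2)[of "(x, y)"] xy by simp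
    finally show ?thesis .
  qed
  define c where "c = min (1 / (2 * K)) (m / 2)"
  have "c > 0" using K(1) m(1) by (simp add: c_def)
  moreover have "c * norm (x - y) \<le> norm (F x - F y)" if "x \<in> sq_closed" "y \<in> sq_closed" for x y
  proof -
    have "c * norm (x - y) \<le> 1 / (2 * K) * norm (x - y)" "c * norm (x - y) \<le> m / 2 * norm (x - y)"
      unfolding c_def by (intro mult_right_mono min.cobounded1 norm_ge_zero, intro mult_right_mono min.cobounded2 norm_ge_zero)
    then show ?thesis using near[OF that] far[OF that] by (meson order_trans)
  qed
  ultimately show ?thesis by blast
qed

definition c where "c = (SOME c. c > 0 \<and> (\<forall>x\<in>sq_closed. \<forall>y\<in>sq_closed. c * norm (x - y) \<le> norm (F x - F y)))"

lemma c: "0 < c" "x \<in> sq_closed \<Longrightarrow> y \<in> sq_closed \<Longrightarrow> c * norm (x - y) \<le> norm (F x - F y)"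
  using someI_ex[OF F_expanding, folded c_def] by auto

lemma open_image: "open T \<Longrightarrow> T \<subseteq> sq_open \<Longrightarrow> open (F ` T)"
  by (intro invariance_of_domain) (use sq_basic(4) F_continuous F_inj in \<open>auto intro: continuous_on_subset inj_on_subset\<close>)

lemma closure_image: "closure (F ` sq_open) = F ` sq_closed"
proof
  show "closure (F ` sq_open) \<subseteq> F ` sq_closed"
    using compact_image sq_basic(4) by (intro closure_minimal compact_imp_closed) auto
  have "F ` closure sq_open \<subseteq> closure (F ` sq_open)"
    by (rule image_closure_subset) (use F_continuous sq_basic(5) closure_subset[of "F ` sq_open"] in auto)
  then show "F ` sq_closed \<subseteq> closure (F ` sq_open)" using sq_basic(5) by simp
qed

lemma frontier_image: "frontier (F ` sq_open) = F ` (sq_closed - sq_open)"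
  using open_image[OF sq_basic(3)] F_inj sq_basic(4)
  by (auto simp: frontier_def closure_image interior_open inj_on_image_set_diff[symmetric] inj_on_def)

lemma negligible_image:
  assumes "negligible T" "T \<subseteq> sq_closed" shows "negligible (F ` T)"
proof -
  obtain M where M: "\<And>x y. x \<in> sq_closed \<Longrightarrow> y \<in> sq_closed \<Longrightarrow> norm (F x - F y) \<le> M * norm (x - y)" using F_lipschitz by blast
  show ?thesis
  proof (rule negligible_locally_Lipschitz_image[OF order_refl assms(1)])
    fix x assume "x \<in> T"
    then show "\<exists>U B. open U \<and> x \<in> U \<and> (\<forall>y\<in>T \<inter> U. norm (F y - F x) \<le> B * norm (y - x))"
      using M assms(2) by (intro exI[of _ UNIV] exI[of _ M] conjI ballI) blast+
  qed
qed

text \<open>Otherwise the ball, being connected, would contain a frontier point of the image; such a point comes from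
the sphere of radius \<open>\<rho>\<close>, whose image is too far from \<open>F q\<close> by the expansion estimate.\<close>

lemma ball_subset_image:
  assumes "ball q \<rho> \<subseteq> sq_open" "0 < \<rho>"
  shows "ball (F q) (c * \<rho>) \<subseteq> F ` ball q \<rho>"
proof (rule ccontr)
  assume n: "\<not> ?thesis"
  let ?V = "F ` ball q \<rho>"
  have cb: "cball q \<rho> \<subseteq> sq_closed"
    using closure_mono[OF assms(1)] assms(2) sq_basic(5) by simp
  have q: "q \<in> sq_closed" using cb assms(2) by auto
  have "F q \<in> ball (F q) (c * \<rho>)" "F q \<in> ?V" using assms(2) c(1) by simp_all
  then have "ball (F q) (c * \<rho>) \<inter> ?V \<noteq> {}" by blast
  moreover have "ball (F q) (c * \<rho>) - ?V \<noteq> {}" using n by blast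
  ultimately obtain z where z: "z \<in> ball (F q) (c * \<rho>)" "z \<in> frontier ?V"
    using connected_Int_frontier[OF connected_ball] by blast
  have "closure ?V \<subseteq> F ` cball q \<rho>"
  proof (rule closure_minimal)
    show "closed (F ` cball q \<rho>)" using F_continuous cb
      by (intro compact_imp_closed compact_continuous_image) (auto intro: continuous_on_subset)
  qed auto
  then obtain x where x: "x \<in> cball q \<rho>" "z = F x" using z(2) by (auto simp: frontier_def)
  have "z \<notin> ?V" using z(2) open_image[OF open_ball assms(1)] by (auto simp: frontier_def interior_open)
  then have "dist q x = \<rho>" using x by auto
  then have "c * \<rho> \<le> norm (F q - F x)" using c(2)[OF q, of x] x(1) cb by (auto simp: dist_norm)
  then show False using z(1) x(2) by (simp add: dist_norm)
qed

text \<open>The image of the square contains short segments in all directions of an open half plane, since near a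
noncorner boundary point the square does and the map is close to its invertible derivative there.\<close>

lemma image_contains_cone:
  assumes "p \<in> sq_closed - sq_open" "p \<notin> {0, 1} \<times> {0, 1}"
  shows "\<exists>w. w \<noteq> 0 \<and> (\<forall>d. 0 < w \<bullet> d \<longrightarrow> (\<exists>T>0. \<forall>t. 0 < t \<and> t < T \<longrightarrow> F p + t *\<^sub>R d \<in> F ` sq_open))"
proof -
  obtain \<nu> :: "real \<times> real" where \<nu>: "\<nu> \<noteq> 0" "\<And>q. 0 < \<nu> \<bullet> q \<Longrightarrow>
     \<exists>\<kappa>>0. \<exists>T>0. \<forall>t. 0 < t \<and> t < T \<longrightarrow> ball (p + t *\<^sub>R q) (\<kappa> * t) \<subseteq> sq_open"
    using inward_cone[OF assms] by blast
  have p: "p \<in> sq_closed" using assms(1) by blast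
  let ?B = "blinfun_apply (G' (F p))"
  \<comment> \<open>the normal transforms with the adjoint of the inverse derivative\<close>
  define w where "w = adjoint ?B \<nu>"
  have w: "w \<bullet> d = \<nu> \<bullet> ?B d" for d
    using adjoint_works[OF bounded_linear.linear[OF blinfun.bounded_linear_right], of d "G' (F p)" \<nu>] by (simp add: w_def inner_commute)
  have "w \<bullet> F' p \<nu> = \<nu> \<bullet> \<nu>" unfolding w G'_F'[OF p] ..
  then have "w \<noteq> 0" using \<nu>(1) by auto
  moreover have "\<exists>T>0. \<forall>t. 0 < t \<and> t < T \<longrightarrow> F p + t *\<^sub>R d \<in> F ` sq_open" if d: "0 < w \<bullet> d" for d
  proof -
    define q where "q = ?B d"
    obtain \<kappa> T where \<kappa>: "\<kappa> > 0" "T > 0" "\<And>t. 0 < t \<Longrightarrow> t < T \<Longrightarrow> ball (p + t *\<^sub>R q) (\<kappa> * t) \<subseteq> sq_open"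
      using \<nu>(2)[of q] d unfolding w q_def by blast
    define \<epsilon> where "\<epsilon> = c * \<kappa> / (2 * (norm q + 1))"
    have nq: "0 < norm q + 1" using norm_ge_zero[of q] by linarith
    have \<epsilon>: "\<epsilon> > 0" using c(1) \<kappa>(1) nq by (simp add: \<epsilon>_def)
    obtain \<delta> where \<delta>: "\<delta> > 0" "\<And>y. y \<in> sq_closed \<Longrightarrow> norm (y - p) < \<delta> \<Longrightarrow> norm (F y - F p - F' p (y - p)) \<le> \<epsilon> * norm (y - p)"
      using F'(1)[OF p] \<epsilon> unfolding has_derivative_within_alt by blast
    show ?thesis
    proof (intro exI[of _ "min T (\<delta> / (norm q + 1))"] conjI allI impI; (elim conjE)?)
      show "0 < min T (\<delta> / (norm q + 1))" using \<kappa>(2) \<delta>(1) nq by simp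
      fix t assume t: "0 < t" "t < min T (\<delta> / (norm q + 1))"
      have sub: "ball (p + t *\<^sub>R q) (\<kappa> * t) \<subseteq> sq_open" using \<kappa>(3) t by simp
      have "p + t *\<^sub>R q \<in> ball (p + t *\<^sub>R q) (\<kappa> * t)" using \<kappa>(1) t(1) by simp
      then have y: "p + t *\<^sub>R q \<in> sq_closed" using sub sq_basic(4) by blast
      have "t * norm q \<le> t * (norm q + 1)" using t(1) by simp
      also have "\<dots> < \<delta>" using t(2) nq by (simp add: pos_less_divide_eq)
      finally have "norm (p + t *\<^sub>R q - p) < \<delta>" using t(1) by simp
      from \<delta>(2)[OF y this] have "norm (F (p + t *\<^sub>R q) - F p - F' p (t *\<^sub>R q)) \<le> \<epsilon> * (t * norm q)" using t(1) by simp
      moreover have "F' p (t *\<^sub>R q) = t *\<^sub>R d" unfolding q_def by (simp add: blinfun.scaleR_right F'_G'[OF p])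
      ultimately have "norm (F (p + t *\<^sub>R q) - (F p + t *\<^sub>R d)) \<le> \<epsilon> * (t * norm q)" by (simp add: algebra_simps)
      also have "\<dots> \<le> \<epsilon> * (t * (norm q + 1))" using \<epsilon> t(1) by (intro mult_left_mono) auto
      also have "\<dots> = c * \<kappa> * t / 2"
      proof -
        define Q where "Q = norm q + 1"
        have "Q \<noteq> 0" "\<epsilon> = c * \<kappa> / (2 * Q)" using nq by (simp_all add: Q_def \<epsilon>_def)
        then show ?thesis unfolding Q_def[symmetric] by simp
      qed
      also have "\<dots> < c * (\<kappa> * t)" using c(1) \<kappa>(1) t(1) by simp
      finally have "F p + t *\<^sub>R d \<in> ball (F (p + t *\<^sub>R q)) (c * (\<kappa> * t))" by (simp add: dist_norm)
      also have "\<dots> \<subseteq> F ` ball (p + t *\<^sub>R q) (\<kappa> * t)" by (rule ball_subset_image[OF sub]) (use \<kappa>(1) t(1) in simp)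
      also have "\<dots> \<subseteq> F ` sq_open" using sub by blast
      finally show "F p + t *\<^sub>R d \<in> F ` sq_open" .
    qed
  qed
  ultimately show ?thesis by blast
qed

lemma G_lipschitz: "x \<in> F ` sq_closed \<Longrightarrow> y \<in> F ` sq_closed \<Longrightarrow> norm (G x - G y) \<le> (1 / c) * norm (x - y)"
  using c by (auto simp: field_simps)

lemma G_differentiable: "x \<in> F ` sq_open \<Longrightarrow> G differentiable (at x)"
proof -
  assume x: "x \<in> F ` sq_open"
  then have "x \<in> F ` sq_closed" using sq_basic(4) by blast
  then have "(G has_derivative blinfun_apply (G' x)) (at x within F ` sq_open)"
    using G'(1) sq_basic(4) by (meson has_derivative_subset image_mono)
  then show ?thesis using at_within_open[OF x open_image[OF sq_basic(3) order_refl]] by (auto simp: differentiable_def)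
qed

end

section \<open>Lipschitz domains are locally connected at their boundary\<close>

text \<open>Rescaling the second coordinate makes the strip an image of an open rectangle.\<close>

lemma connected_strip_above_graph:
  fixes m :: "real \<Rightarrow> real"
  assumes "continuous_on {a<..<b} m" "\<And>s. s \<in> {a<..<b} \<Longrightarrow> m s < T"
  shows "connected {z. a < fst z \<and> fst z < b \<and> m (fst z) < snd z \<and> snd z < T}"
proof -
  let ?h = "\<lambda>z. (fst z, m (fst z) + snd z * (T - m (fst z)))"
  have "connected (?h ` ({a<..<b} \<times> {0<..<1}))"
  proof (rule connected_continuous_image)
    show "continuous_on ({a<..<b} \<times> {0<..<1}) ?h"
      by (intro continuous_intros continuous_on_compose2[OF assms(1)]) auto
    show "connected ({a<..<b} \<times> {0<..<1 :: real})" by (intro connected_Times) auto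
  qed
  also have "?h ` ({a<..<b} \<times> {0<..<1}) = {z. a < fst z \<and> fst z < b \<and> m (fst z) < snd z \<and> snd z < T}" (is "?L = ?R")
  proof (intro set_eqI iffI)
    fix z assume "z \<in> ?L"
    then obtain w where w: "w \<in> {a<..<b} \<times> {0<..<1}" "z = ?h w" by blast
    define s \<tau> where "s = fst w" and "\<tau> = snd w"
    have z: "z = (s, m s + \<tau> * (T - m s))" "s \<in> {a<..<b}" "0 < \<tau>" "\<tau> < 1"
      using w by (simp_all add: s_def \<tau>_def mem_Times_iff)
    have p: "0 < T - m s" using assms(2)[OF z(2)] by simp
    have "0 < \<tau> * (T - m s)" "\<tau> * (T - m s) < 1 * (T - m s)" using p z(3,4) by (auto intro: mult_strict_right_mono)
    then show "z \<in> ?R" using z by auto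
  next
    fix z assume z: "z \<in> ?R"
    define s t where "s = fst z" and "t = snd z"
    have s: "s \<in> {a<..<b}" "m s < t" "t < T" using z by (auto simp: s_def t_def)
    have "z = ?h (s, (t - m s) / (T - m s))" using s by (simp add: s_def t_def prod_eq_iff)
    moreover have "(s, (t - m s) / (T - m s)) \<in> {a<..<b} \<times> {0<..<1}" using s by (auto simp: field_simps)
    ultimately show "z \<in> ?L" by blast
  qed
  finally show ?thesis .
qed

text \<open>At an interior point a punctured disc will do. At a boundary point the set above a Lipschitz graph,
within a box that is tall compared with its width, is a connected strip.\<close>

lemma lipschitz_boundary_locally_connected:
  assumes "open S" "lipschitz_boundary S" "v \<in> closure S" "0 < \<epsilon>"
  shows "\<exists>W. open W \<and> v \<in> W \<and> W \<subseteq> ball v \<epsilon> \<and> connected (S \<inter> W - {v})"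
proof (cases "v \<in> S")
  case True
  then obtain e where e: "e > 0" "ball v e \<subseteq> S" using assms(1) by (auto simp: open_contains_ball)
  let ?W = "ball v (min e \<epsilon>)"
  have "aff_dim ?W = 2" using e(1) assms(4) by (subst aff_dim_open) auto
  then have "connected (?W - {v})" by (intro connected_punctured_convex) auto
  moreover have "S \<inter> ?W - {v} = ?W - {v}" using e(2) by (auto simp: min_def)
  ultimately have "connected (S \<inter> ?W - {v})" by (simp only:)
  moreover have "open ?W" "v \<in> ?W" "?W \<subseteq> ball v \<epsilon>" using e(1) assms(4) by (simp, simp, simp add: subset_ball)
  ultimately show ?thesis by blast
next
  case False
  then have "v \<in> frontier S" using assms(1,3) by (simp add: frontier_def interior_open)
  then have "\<exists>U (T :: real \<times> real \<Rightarrow> real \<times> real) (\<psi> :: real \<Rightarrow> real) L.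
     open U \<and> v \<in> U \<and> orthogonal_transformation T \<and> L-lipschitz_on UNIV \<psi> \<and>
     S \<inter> U = {y \<in> U. snd (T y) > \<psi> (fst (T y))}"
    using assms(2) unfolding lipschitz_boundary_def by (rule bspec[rotated])
  then obtain U and T :: "real \<times> real \<Rightarrow> real \<times> real" and \<psi> :: "real \<Rightarrow> real" and L
    where U: "open U" "v \<in> U" and T: "orthogonal_transformation T" and \<psi>: "L-lipschitz_on UNIV \<psi>"
    and SU: "S \<inter> U = {y \<in> U. snd (T y) > \<psi> (fst (T y))}" by blast
  obtain s0 t0 where v: "T v = (s0, t0)" by (cases "T v")
  have c\<psi>: "continuous_on UNIV \<psi>" using \<psi> by (rule lipschitz_on_continuous_on)
  have L: "0 \<le> L" using \<psi> by (rule lipschitz_on_nonneg)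
  have lT: "linear T" using T by (rule orthogonal_transformation_linear)
  have cT: "continuous_on UNIV T" using lT by (simp add: linear_continuous_on linear_conv_bounded_linear)
  have "\<psi> s0 \<le> t0"
  proof (rule ccontr)
    assume n: "\<not> \<psi> s0 \<le> t0"
    let ?O = "U \<inter> {y. snd (T y) < \<psi> (fst (T y))}"
    have "open {y. snd (T y) < \<psi> (fst (T y))}"
      by (intro open_Collect_less continuous_intros cT continuous_on_compose2[OF c\<psi>]) auto
    then have "open ?O" using U(1) by auto
    moreover have "v \<in> ?O" using n U(2) v by auto
    ultimately have "S \<inter> ?O \<noteq> {}" using assms(3) open_Int_closure_eq_empty[of ?O S] by blast
    then obtain y where "y \<in> S" "y \<in> U" "snd (T y) < \<psi> (fst (T y))" by blast
    moreover have "y \<in> S \<inter> U" using \<open>y \<in> S\<close> \<open>y \<in> U\<close> by blast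
    ultimately show False unfolding SU by auto
  qed
  obtain \<eta>0 where \<eta>0: "\<eta>0 > 0" "ball v \<eta>0 \<subseteq> U" using U by (auto simp: open_contains_ball)
  define \<eta> where "\<eta> = min \<eta>0 \<epsilon>"
  have \<eta>: "\<eta> > 0" "ball v \<eta> \<subseteq> U" "ball v \<eta> \<subseteq> ball v \<epsilon>" using \<eta>0 assms(4) by (auto simp: \<eta>_def)
  \<comment> \<open>over this width the graph cannot rise from \<open>t0\<close> to the top of the box\<close>
  define \<delta> where "\<delta> = \<eta> / (2 * (L + 1))"
  have \<delta>: "\<delta> > 0" "\<delta> \<le> \<eta> / 2" "L * \<delta> < \<eta> / 2" using \<eta>(1) L by (auto simp: \<delta>_def field_simps)
  define W where "W = {y. \<bar>fst (T y) - s0\<bar> < \<delta> \<and> \<bar>snd (T y) - t0\<bar> < \<eta> / 2}"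
  have Wo: "open W" unfolding W_def by (intro open_Collect_conj open_Collect_less continuous_intros cT)
  have vW: "v \<in> W" using v \<delta> \<eta> by (simp add: W_def)
  have Wb: "W \<subseteq> ball v \<eta>"
  proof
    fix y assume y: "y \<in> W"
    have "norm (y - v) = norm (T (y - v))" using T unfolding orthogonal_transformation by metis
    also have "T (y - v) = T y - T v" using lT by (rule linear_diff)
    also have "norm (T y - T v) \<le> norm (fst (T y - T v)) + norm (snd (T y - T v))" by (metis norm_Pair_le prod.collapse)
    also have "\<dots> < \<eta>" using y \<delta> by (auto simp: W_def v)
    finally show "y \<in> ball v \<eta>" by (simp add: dist_norm norm_minus_commute)
  qed
  define m where "m s = max (\<psi> s) (t0 - \<eta> / 2)" for s
  let ?E = "{z. s0 - \<delta> < fst z \<and> fst z < s0 + \<delta> \<and> m (fst z) < snd z \<and> snd z < t0 + \<eta> / 2}"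
  have "connected ?E"
  proof (rule connected_strip_above_graph)
    show "continuous_on {s0 - \<delta><..<s0 + \<delta>} m" unfolding m_def
      by (intro continuous_intros continuous_on_subset[OF c\<psi>]) auto
    fix s assume s: "s \<in> {s0 - \<delta><..<s0 + \<delta>}"
    have "dist (\<psi> s) (\<psi> s0) \<le> L * dist s s0" using \<psi> by (rule lipschitz_onD) auto
    also have "\<dots> \<le> L * \<delta>" using s L by (intro mult_left_mono) (auto simp: dist_real_def)
    finally have "\<psi> s < t0 + \<eta> / 2" using \<delta>(3) \<open>\<psi> s0 \<le> t0\<close> by (auto simp: dist_real_def abs_le_iff)
    then show "m s < t0 + \<eta> / 2" using \<eta>(1) by (simp add: m_def)
  qed
  moreover have "S \<inter> W = inv T ` ?E"
  proof -
    have bT: "bij T" using T by (rule orthogonal_transformation_bij)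
    have "S \<inter> W = (S \<inter> U) \<inter> W" using Wb \<eta>(2) by blast
    also have "\<dots> = {y \<in> W. snd (T y) > \<psi> (fst (T y))}" unfolding SU using Wb \<eta>(2) by blast
    also have "\<dots> = T -` ?E"
    proof (intro set_eqI)
      fix y
      have "\<bar>fst (T y) - s0\<bar> < \<delta> \<longleftrightarrow> s0 - \<delta> < fst (T y) \<and> fst (T y) < s0 + \<delta>" by linarith
      moreover have "\<bar>snd (T y) - t0\<bar> < \<eta> / 2 \<longleftrightarrow> t0 - \<eta> / 2 < snd (T y) \<and> snd (T y) < t0 + \<eta> / 2" by linarith
      ultimately show "y \<in> {y \<in> W. \<psi> (fst (T y)) < snd (T y)} \<longleftrightarrow> y \<in> T -` ?E"
        unfolding W_def m_def mem_Collect_eq vimage_eq max_less_iff_conj by blast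
    qed
    also have "\<dots> = inv T ` ?E" using bT by (rule bij_vimage_eq_inv_image)
    finally show ?thesis .
  qed
  moreover have "continuous_on ?E (inv T)"
  proof -
    have "orthogonal_transformation (inv T)" using T by (rule orthogonal_transformation_inv)
    then have "linear (inv T)" by (rule orthogonal_transformation_linear)
    then show ?thesis by (simp add: linear_continuous_on linear_conv_bounded_linear)
  qed
  ultimately have "connected (S \<inter> W)" by (simp add: connected_continuous_image)
  moreover have "S \<inter> W - {v} = S \<inter> W" using False by blast
  ultimately have "connected (S \<inter> W - {v})" by (simp only:)
  moreover have "W \<subseteq> ball v \<epsilon>" using Wb \<eta>(3) by (rule subset_trans)
  ultimately show ?thesis using Wo vW by blast
qed

section \<open>Sides of the square\<close>

text \<open>A common parametrization of the four sides: \<open>b\<close> tells which coordinate runs, and \<open>d\<close> is the value of the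
other one.\<close>

definition side_map :: "bool \<Rightarrow> bool \<Rightarrow> real \<Rightarrow> real \<times> real" where
  "side_map b d t = (if b then (of_bool d, t) else (t, of_bool d))"

definition sides :: "(real \<times> real) set set" where
  "sides = {{0} \<times> {0..1}, {1} \<times> {0..1}, {0..1} \<times> {0}, {0..1} \<times> {1}}"

abbreviation corners :: "(real \<times> real) set" where "corners \<equiv> {0, 1} \<times> {0, 1}"

lemma sides_eq: "s \<in> sides \<longleftrightarrow> (\<exists>b d. s = side_map b d ` {0..1})"
proof -
  have i: "side_map True True ` {0..1} = {1} \<times> {0..1}" "side_map True False ` {0..1} = {0} \<times> {0..1}"
    "side_map False True ` {0..1} = {0..1} \<times> {1}" "side_map False False ` {0..1} = {0..1} \<times> {0}"
    by (auto simp: side_map_def image_def)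
  have "(\<exists>b d. s = side_map b d ` {0..1}) \<longleftrightarrow> s = side_map True True ` {0..1} \<or> s = side_map True False ` {0..1}
     \<or> s = side_map False True ` {0..1} \<or> s = side_map False False ` {0..1}" by (metis (full_types))
  then show ?thesis unfolding i sides_def by blast
qed

lemma side_map_corner: "side_map b d t \<in> corners \<longleftrightarrow> t \<in> {0, 1}"
  by (cases b; cases d) (simp_all add: side_map_def)

lemma side_map_continuous: "continuous_on A (side_map b d)"
  unfolding side_map_def by (cases b) (simp_all add: continuous_on_Pair)

lemma boundary_eq_sides: "sq_closed - sq_open = \<Union>sides"
proof (intro set_eqI)
  fix x :: "real \<times> real"
  show "x \<in> sq_closed - sq_open \<longleftrightarrow> x \<in> \<Union>sides"
    unfolding sq_boundary by (cases x) (auto simp: sides_def sq_closed_def)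
qed

lemma side_subset: "s \<in> sides \<Longrightarrow> s \<subseteq> sq_closed - sq_open"
  unfolding boundary_eq_sides by blast

lemma side_infinite: "s \<in> sides \<Longrightarrow> infinite s"
proof
  assume "s \<in> sides" "finite s"
  then obtain b d where s: "s = side_map b d ` {0..1}" unfolding sides_eq by blast
  have "inj_on (side_map b d) {0..1}" by (rule inj_onI) (simp add: side_map_def split: if_splits)
  then have "finite {0..1 :: real}" using \<open>finite s\<close> unfolding s by (rule finite_imageD[rotated])
  then show False using infinite_Icc[of "0::real" 1] by simp
qed

lemma sides_Int:
  assumes "s \<in> sides" "s' \<in> sides" "s \<noteq> s'" shows "s \<inter> s' \<subseteq> corners"
proof
  fix x assume x: "x \<in> s \<inter> s'"
  obtain b d where s: "s = side_map b d ` {0..1}" using assms(1) unfolding sides_eq by blast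
  obtain b' d' where s': "s' = side_map b' d' ` {0..1}" using assms(2) unfolding sides_eq by blast
  obtain t t' where t: "x = side_map b d t" "x = side_map b' d' t'" using x unfolding s s' by blast
  have "b = b' \<Longrightarrow> d = d'" using t by (simp add: side_map_def of_bool_eq_iff split: if_splits)
  then have "b \<noteq> b'" using assms(3) unfolding s s' by blast
  then have "x = (of_bool d, of_bool d') \<or> x = (of_bool d', of_bool d)"
    using t by (cases b) (simp_all add: side_map_def)
  then show "x \<in> corners" by (cases d; cases d'; simp; blast)
qed

lemma side_subset_eq:
  assumes "s \<in> sides" "s' \<in> sides" "s \<subseteq> s'" shows "s = s'"
proof (rule ccontr)
  assume "s \<noteq> s'"
  then have "s \<subseteq> corners" using sides_Int[OF assms(1,2)] assms(3) by blast
  then have "finite s" by (rule finite_subset) simp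
  then show False using side_infinite[OF assms(1)] by simp
qed

lemma side_minus_corner_connected:
  assumes "s \<in> sides" "c \<in> corners" shows "connected (s - {c})"
proof -
  obtain b d where s: "s = side_map b d ` {0..1}" using assms(1) by (auto simp: sides_eq)
  have "\<exists>I. s - {c} = side_map b d ` I \<and> connected I"
  proof (cases "c \<in> s")
    case False
    then have "s - {c} = side_map b d ` {0..1}" unfolding s by blast
    then show ?thesis using connected_Icc by blast
  next
    case True
    then obtain t where t: "t \<in> {0..1}" "c = side_map b d t" unfolding s by blast
    have inj: "inj (side_map b d)" by (rule injI) (simp add: side_map_def split: if_splits)
    have e: "s - {c} = side_map b d ` ({0..1} - {t})"
      unfolding s t(2) image_set_diff[OF inj] by simp
    have "t = 0 \<or> t = 1" using assms(2) unfolding t(2) side_map_corner by simp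
    then show ?thesis
    proof
      assume "t = 0"
      then have "{0..1} - {t} = {0<..1}" by auto
      then show ?thesis using e connected_Ioc by metis
    next
      assume "t = 1"
      then have "{0..1} - {t} = {0..<1}" by auto
      then show ?thesis using e connected_Ico by metis
    qed
  qed
  then obtain I where I: "s - {c} = side_map b d ` I" "connected I" by blast
  show ?thesis unfolding I(1) by (rule connected_continuous_image[OF side_map_continuous I(2)])
qed

lemma side_minus_noncorner_disconnected:
  assumes "s \<in> sides" "c \<in> s" "connected (s - {c})" shows "c \<in> corners"
proof -
  obtain b d where s: "s = side_map b d ` {0..1}" using assms(1) by (auto simp: sides_eq)
  obtain t where t: "t \<in> {0..1}" "c = side_map b d t" using assms(2) unfolding s by blast
  define \<pi> where "\<pi> z = (if b then snd z else fst z)" for z :: "real \<times> real"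
  have \<pi>: "\<pi> (side_map b d x) = x" for x by (cases b) (simp_all add: \<pi>_def side_map_def)
  have "continuous_on (s - {c}) \<pi>" unfolding \<pi>_def by (cases b; simp; intro continuous_intros)
  then have "connected (\<pi> ` (s - {c}))" using assms(3) by (rule connected_continuous_image)
  moreover have "\<pi> ` (s - {c}) = {0..1} - {t}"
  proof (intro set_eqI iffI)
    fix x assume "x \<in> \<pi> ` (s - {c})"
    then obtain y where y: "y \<in> {0..1}" "side_map b d y \<noteq> side_map b d t" "x = \<pi> (side_map b d y)"
      unfolding s t(2) by blast
    then show "x \<in> {0..1} - {t}" using \<pi>[of y] by auto
  next
    fix x assume x: "x \<in> {0..1} - {t}"
    then have "side_map b d x \<noteq> side_map b d t" using \<pi>[of x] \<pi>[of t] by auto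
    then have "side_map b d x \<in> s - {c}" unfolding s t(2) using x by blast
    then have "\<pi> (side_map b d x) \<in> \<pi> ` (s - {c})" by (rule imageI)
    then show "x \<in> \<pi> ` (s - {c})" unfolding \<pi> .
  qed
  ultimately have c: "connected ({0..1} - {t})" by simp
  have "t = 0 \<or> t = 1"
  proof (rule ccontr)
    assume "\<not> ?thesis"
    then have "0 \<in> {0..1} - {t}" "1 \<in> {0..1} - {t}" "0 < t" "t < 1" using t(1) by auto
    then have "t \<in> {0..1} - {t}" using c unfolding connected_iff_interval by (meson less_imp_le)
    then show False by simp
  qed
  then show ?thesis unfolding t(2) side_map_corner by blast
qed

section \<open>Topology of the multipatch domain\<close>

locale multipatch_geometry =
  fixes D :: multipatch
  assumes domain: "multipatch_domain D"
begin

abbreviation F where "F \<equiv> geo D"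
abbreviation G where "G k \<equiv> inv_into sq_closed (geo D k)"
abbreviation K where "K \<equiv> patches D"
abbreviation cl where "cl k \<equiv> geo D k ` sq_closed"

lemma finite_K: "finite K" by (simp add: patches_def)

lemma patch_map: "k \<in> K \<Longrightarrow> patch_map (F k)"
  using domain by (simp add: multipatch_domain_def patch_map_def)

lemma G_eq: "k \<in> K \<Longrightarrow> patch_map.G (F k) = G k"
  using patch_map.G_def[OF patch_map] by simp

lemma G_F: "k \<in> K \<Longrightarrow> x \<in> sq_closed \<Longrightarrow> G k (F k x) = x"
  using patch_map.F_inj[OF patch_map] by simp
lemma F_G: "x \<in> cl k \<Longrightarrow> F k (G k x) = x" by (rule f_inv_into_f)
lemma G_in: "x \<in> cl k \<Longrightarrow> G k x \<in> sq_closed" by (rule inv_into_into)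
lemma F_inj: "k \<in> K \<Longrightarrow> inj_on (F k) sq_closed" by (rule patch_map.F_inj[OF patch_map])

lemma closure_patch: "k \<in> K \<Longrightarrow> closure (patch D k) = cl k"
  unfolding patch_def by (rule patch_map.closure_image[OF patch_map])
lemma frontier_patch: "k \<in> K \<Longrightarrow> frontier (patch D k) = F k ` (sq_closed - sq_open)"
  unfolding patch_def by (rule patch_map.frontier_image[OF patch_map])
lemma open_patch: "k \<in> K \<Longrightarrow> open (patch D k)"
  unfolding patch_def using patch_map.open_image[OF patch_map] sq_basic by blast
lemma patch_subset: "patch D k \<subseteq> cl k" unfolding patch_def using sq_basic by blast
lemma compact_cl: "k \<in> K \<Longrightarrow> compact (cl k)" by (rule patch_map.compact_image[OF patch_map])
lemma G_patch: "k \<in> K \<Longrightarrow> x \<in> patch D k \<Longrightarrow> G k x \<in> sq_open"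
  unfolding patch_def using G_F sq_basic(4) by auto

lemma frontier_subset_cl: assumes "k \<in> K" shows "frontier (patch D k) \<subseteq> cl k"
  unfolding frontier_patch[OF assms] by blast

lemma cl_eq: assumes "k \<in> K" shows "cl k = patch D k \<union> frontier (patch D k)"
  unfolding frontier_patch[OF assms] unfolding patch_def using sq_basic(4) by blast

lemma patch_frontier_disjoint: "k \<in> K \<Longrightarrow> patch D k \<inter> frontier (patch D k) = {}"
  using open_patch by (simp add: frontier_def interior_open)

lemma patches_disjoint: "k \<in> K \<Longrightarrow> k' \<in> K \<Longrightarrow> k \<noteq> k' \<Longrightarrow> patch D k \<inter> patch D k' = {}"
  using domain by (auto simp: multipatch_domain_def disjoint_family_on_def)

lemma patch_cl_disjoint: "k \<in> K \<Longrightarrow> k' \<in> K \<Longrightarrow> k \<noteq> k' \<Longrightarrow> patch D k \<inter> cl k' = {}"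
  using open_Int_closure_eq_empty[OF open_patch, of k "patch D k'"] patches_disjoint closure_patch by simp

lemma cl_Int:
  assumes "k1 \<in> K" "k2 \<in> K" "k1 \<noteq> k2"
  shows "cl k1 \<inter> cl k2 = {} \<or> (\<exists>v \<in> patch_vertices D k1 \<inter> patch_vertices D k2. cl k1 \<inter> cl k2 = {v}) \<or>
     cl k1 \<inter> cl k2 \<in> patch_edges D k1 \<inter> patch_edges D k2"
proof -
  have "\<forall>k1\<in>K. \<forall>k2\<in>K. k1 \<noteq> k2 \<longrightarrow> closure (patch D k1) \<inter> closure (patch D k2) = {} \<or>
     (\<exists>v \<in> patch_vertices D k1 \<inter> patch_vertices D k2. closure (patch D k1) \<inter> closure (patch D k2) = {v}) \<or>
     closure (patch D k1) \<inter> closure (patch D k2) \<in> patch_edges D k1 \<inter> patch_edges D k2"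
    using domain unfolding multipatch_domain_def Let_def by (elim conjE)
  from this[rule_format, OF assms] show ?thesis by (simp only: closure_patch[OF assms(1)] closure_patch[OF assms(2)])
qed

lemma patch_edges_eq: "patch_edges D k = (`) (F k) ` sides" by (simp add: patch_edges_def sides_def)
lemma patch_vertices_eq: "patch_vertices D k = F k ` corners" by (simp add: patch_vertices_def)
lemma corners_subset: "corners \<subseteq> sq_closed - sq_open" by (auto simp: sq_closed_def sq_open_def)

lemma patch_edge_subset_frontier:
  assumes "k \<in> K" "e \<in> patch_edges D k" shows "e \<subseteq> frontier (patch D k)"
proof -
  obtain s where s: "s \<in> sides" "e = F k ` s" using assms(2) unfolding patch_edges_eq by (rule imageE)
  show ?thesis unfolding frontier_patch[OF assms(1)] s(2) using side_subset[OF s(1)] by (rule image_mono)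
qed

lemma patch_vertex_in_frontier:
  assumes "k \<in> K" "v \<in> patch_vertices D k" shows "v \<in> frontier (patch D k)"
  using assms(2) image_mono[OF corners_subset, of "F k"] unfolding frontier_patch[OF assms(1)] patch_vertices_eq by blast

lemma image_mono_inj: "k \<in> K \<Longrightarrow> A \<subseteq> sq_closed \<Longrightarrow> B \<subseteq> sq_closed \<Longrightarrow> F k ` A \<subseteq> F k ` B \<Longrightarrow> A \<subseteq> B"
  using F_inj by (meson inj_on_image_subset_iff)

lemma patch_edge_infinite:
  assumes "k \<in> K" "e \<in> patch_edges D k" shows "infinite e"
proof
  assume "finite e"
  obtain s where s: "s \<in> sides" "e = F k ` s" using assms(2) unfolding patch_edges_eq by (rule imageE)
  have "inj_on (F k) s" using F_inj[OF assms(1)] side_subset[OF s(1)] by (meson Diff_subset inj_on_subset subset_trans)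
  with \<open>finite e\<close> have "finite s" unfolding s(2) by (rule finite_imageD)
  then show False using side_infinite[OF s(1)] by contradiction
qed

lemma patch_edge_subset_eq:
  assumes "k \<in> K" "e \<in> patch_edges D k" "e' \<in> patch_edges D k" "e \<subseteq> e'" shows "e = e'"
proof -
  obtain s where s: "s \<in> sides" "e = F k ` s" using assms(2) unfolding patch_edges_eq by (rule imageE)
  obtain s' where s': "s' \<in> sides" "e' = F k ` s'" using assms(3) unfolding patch_edges_eq by (rule imageE)
  have "s \<subseteq> s'" using image_mono_inj[OF assms(1), of s s'] s s' assms(4) side_subset[OF s(1)] side_subset[OF s'(1)] by blast
  then have "s = s'" by (rule side_subset_eq[OF s(1) s'(1)])
  then show ?thesis unfolding s(2) s'(2) by (rule arg_cong)
qed

lemma common_edge: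
  assumes "k \<in> K" "k' \<in> K" "k \<noteq> k'" "e \<in> patch_edges D k'" "e \<subseteq> frontier (patch D k)"
  shows "cl k \<inter> cl k' = e" "e \<in> patch_edges D k"
proof -
  have sub: "e \<subseteq> cl k \<inter> cl k'"
    using assms frontier_subset_cl patch_edge_subset_frontier by blast
  have inf: "infinite e" using assms(2,4) by (rule patch_edge_infinite)
  then have "\<not> cl k \<inter> cl k' \<subseteq> {v}" for v using sub finite_subset by (metis finite.emptyI finite_insert)
  then have "cl k \<inter> cl k' \<in> patch_edges D k \<inter> patch_edges D k'" using cl_Int[OF assms(1-3)] by blast
  then show "cl k \<inter> cl k' = e" "e \<in> patch_edges D k"
    using patch_edge_subset_eq[OF assms(2,4) _ sub] by auto
qed

text \<open>The patches at an edge are defined by inclusion in the boundary; conformity of the partition upgrades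
this to being an edge of the patch.\<close>

lemma edge_patches_edge:
  assumes "e \<in> edges D" "k \<in> edge_patches D e" shows "k \<in> K" "e \<in> patch_edges D k"
proof -
  show k: "k \<in> K" using assms(2) by (simp add: edge_patches_def)
  obtain k' where k': "k' \<in> K" "e \<in> patch_edges D k'" using assms(1) by (auto simp: edges_def)
  then show "e \<in> patch_edges D k" using common_edge(2)[OF k k'(1)] assms(2) by (cases "k = k'") (auto simp: edge_patches_def)
qed

text \<open>If two patches share a whole edge, a corner of one could a priori lie in the middle of a side of the other.
But removing a corner leaves a side connected, removing any other point does not, and the patch maps are
homeomorphisms.\<close>

lemma vertex_patches_vertex:
  assumes "v \<in> vertices D" "k \<in> vertex_patches D v" shows "k \<in> K" "v \<in> patch_vertices D k"
proof -
  show k: "k \<in> K" using assms(2) by (simp add: vertex_patches_def)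
  have vk: "v \<in> frontier (patch D k)" using assms(2) by (simp add: vertex_patches_def)
  obtain k' where k': "k' \<in> K" "v \<in> patch_vertices D k'" using assms(1) by (auto simp: vertices_def)
  show "v \<in> patch_vertices D k"
  proof (cases "k = k'")
    case False
    have v: "v \<in> cl k \<inter> cl k'" using vk k' k frontier_subset_cl patch_vertex_in_frontier by blast
    then consider v' where "v' \<in> patch_vertices D k" "cl k \<inter> cl k' = {v'}" | "cl k \<inter> cl k' \<in> patch_edges D k \<inter> patch_edges D k'"
      using cl_Int[OF k k'(1) False] by blast
    then show ?thesis
    proof cases
      case 1
      have "v = v'" using v unfolding 1(2) by simp
      then show ?thesis using 1(1) by simp
    next
      case 2
      then obtain s s' where s: "s \<in> sides" "cl k \<inter> cl k' = F k ` s" and s': "s' \<in> sides" "cl k \<inter> cl k' = F k' ` s'"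
        unfolding patch_edges_eq by blast
      obtain c' where c': "c' \<in> corners" "v = F k' c'" using k'(2) unfolding patch_vertices_eq by blast
      obtain q where q: "q \<in> s" "v = F k q" using v unfolding s(2) by blast
      have sub: "s \<subseteq> sq_closed" "s' \<subseteq> sq_closed" using side_subset s(1) s'(1) by blast+
      have c's: "c' \<in> sq_closed" using c'(1) corners_subset by blast
      have "F k' ` (s' - {c'}) = F k' ` s' - {v}"
        using inj_on_image_set_diff[OF F_inj[OF k'(1)], of s' "{c'}"] sub(2) c's c'(2) by auto
      moreover have "F k ` (s - {q}) = F k ` s - {v}"
        using inj_on_image_set_diff[OF F_inj[OF k], of s "{q}"] sub(1) q by auto
      ultimately have e: "F k ` (s - {q}) = F k' ` (s' - {c'})" using s(2) s'(2) by simp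
      have "connected (F k' ` (s' - {c'}))"
        using side_minus_corner_connected[OF s'(1) c'(1)] patch_map.F_continuous[OF patch_map[OF k'(1)]] sub(2)
        by (intro connected_continuous_image) (auto intro: continuous_on_subset)
      then have con: "connected (F k ` (s - {q}))" unfolding e .
      have "continuous_on (cl k) (G k)"
        using patch_map.G_continuous[OF patch_map[OF k]] unfolding G_eq[OF k] .
      then have "continuous_on (F k ` (s - {q})) (G k)"
        by (rule continuous_on_subset) (use sub(1) in blast)
      then have "connected (G k ` (F k ` (s - {q})))" using con by (rule connected_continuous_image)
      moreover have "G k ` (F k ` (s - {q})) = s - {q}" using G_F[OF k] sub(1) by (force simp: image_image)
      ultimately have "q \<in> corners" using side_minus_noncorner_disconnected[OF s(1) q(1)] by simp
      then show ?thesis unfolding patch_vertices_eq using q(2) by blast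
    qed
  qed (use k' in simp)
qed

lemma finite_patch_vertices: "finite (patch_vertices D k)" unfolding patch_vertices_eq by simp

text \<open>At a point of the edge that is no vertex each of the patches fills a half plane of directions, and two of
three half planes overlap, whereas patches are disjoint.\<close>

lemma no_three_patches_at_edge:
  assumes "k1 \<in> K" "k2 \<in> K" "k3 \<in> K" "k1 \<noteq> k2" "k1 \<noteq> k3" "k2 \<noteq> k3"
    and e: "infinite e" "e \<subseteq> frontier (patch D k1)" "e \<subseteq> frontier (patch D k2)" "e \<subseteq> frontier (patch D k3)"
  shows False
proof -
  have "infinite (e - (patch_vertices D k1 \<union> patch_vertices D k2 \<union> patch_vertices D k3))"
    using e(1) finite_patch_vertices by (intro Diff_infinite_finite) auto
  then have "e - (patch_vertices D k1 \<union> patch_vertices D k2 \<union> patch_vertices D k3) \<noteq> {}" by (metis finite.emptyI)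
  then obtain x where x: "x \<in> e" "x \<notin> patch_vertices D k1" "x \<notin> patch_vertices D k2" "x \<notin> patch_vertices D k3" by blast
  have cone: "\<exists>w. w \<noteq> 0 \<and> (\<forall>d. 0 < w \<bullet> d \<longrightarrow> (\<exists>T>0. \<forall>t. 0 < t \<and> t < T \<longrightarrow> x + t *\<^sub>R d \<in> patch D k))"
    if k: "k \<in> K" "x \<in> frontier (patch D k)" "x \<notin> patch_vertices D k" for k
  proof -
    obtain p where p: "p \<in> sq_closed - sq_open" "x = F k p" using k(2) unfolding frontier_patch[OF k(1)] by blast
    then have "p \<notin> corners" using k(3) unfolding patch_vertices_eq by blast
    then show ?thesis using patch_map.image_contains_cone[OF patch_map[OF k(1)] p(1)] unfolding p(2) patch_def by blast
  qed
  obtain w1 where w1: "w1 \<noteq> 0" "\<And>d. 0 < w1 \<bullet> d \<Longrightarrow> \<exists>T>0. \<forall>t. 0 < t \<and> t < T \<longrightarrow> x + t *\<^sub>R d \<in> patch D k1"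
    using cone[OF assms(1) _ x(2)] x(1) e by blast
  obtain w2 where w2: "w2 \<noteq> 0" "\<And>d. 0 < w2 \<bullet> d \<Longrightarrow> \<exists>T>0. \<forall>t. 0 < t \<and> t < T \<longrightarrow> x + t *\<^sub>R d \<in> patch D k2"
    using cone[OF assms(2) _ x(3)] x(1) e by blast
  obtain w3 where w3: "w3 \<noteq> 0" "\<And>d. 0 < w3 \<bullet> d \<Longrightarrow> \<exists>T>0. \<forall>t. 0 < t \<and> t < T \<longrightarrow> x + t *\<^sub>R d \<in> patch D k3"
    using cone[OF assms(3) _ x(4)] x(1) e by blast
  have meet: False if m: "a \<in> K" "b \<in> K" "a \<noteq> b"
    "\<exists>T>0. \<forall>t. 0 < t \<and> t < T \<longrightarrow> x + t *\<^sub>R d \<in> patch D a" "\<exists>T>0. \<forall>t. 0 < t \<and> t < T \<longrightarrow> x + t *\<^sub>R d \<in> patch D b" for a b d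
  proof -
    obtain T where T: "T > 0" "\<And>t. 0 < t \<Longrightarrow> t < T \<Longrightarrow> x + t *\<^sub>R d \<in> patch D a" using m(4) by blast
    obtain T' where T': "T' > 0" "\<And>t. 0 < t \<Longrightarrow> t < T' \<Longrightarrow> x + t *\<^sub>R d \<in> patch D b" using m(5) by blast
    have "x + (min T T' / 2) *\<^sub>R d \<in> patch D a \<inter> patch D b" using T T' by (intro IntI T(2) T'(2)) (auto simp: min_def)
    then show False using patches_disjoint[OF m(1-3)] by blast
  qed
  show False using three_half_planes_meet[OF w1(1) w2(1) w3(1)]
  proof (elim disjE exE conjE)
    fix d assume "0 < w1 \<bullet> d" "0 < w2 \<bullet> d" then show False using meet[OF assms(1,2,4) w1(2) w2(2)] by blast
  next
    fix d assume "0 < w1 \<bullet> d" "0 < w3 \<bullet> d" then show False using meet[OF assms(1,3,5) w1(2) w3(2)] by blast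
  next
    fix d assume "0 < w2 \<bullet> d" "0 < w3 \<bullet> d" then show False using meet[OF assms(2,3,6) w2(2) w3(2)] by blast
  qed
qed

lemma common_edge_interior:
  assumes "k1 \<in> K" "k2 \<in> K" "k1 \<noteq> k2" "e \<in> patch_edges D k1" "e \<in> patch_edges D k2"
  shows "interior_edge D e" "edge_patches D e = {k1, k2}"
proof -
  have f: "e \<subseteq> frontier (patch D k1)" "e \<subseteq> frontier (patch D k2)" using assms patch_edge_subset_frontier by blast+
  have "k \<in> {k1, k2}" if "k \<in> edge_patches D e" for k
    using no_three_patches_at_edge[OF assms(1,2) _ assms(3) _ _ patch_edge_infinite[OF assms(1,4)] f, of k] that
    by (auto simp: edge_patches_def)
  then show eq: "edge_patches D e = {k1, k2}" using assms(1,2) f by (auto simp: edge_patches_def)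
  show "interior_edge D e" unfolding interior_edge_def eq using assms by (auto simp: edges_def)
qed

lemma patch_subset_Omega: "k \<in> K \<Longrightarrow> patch D k \<subseteq> Omega D"
  unfolding Omega_def by (intro interior_maximal open_patch) (auto simp: closure_patch patch_subset[THEN subsetD])

lemma Omega_subset: "Omega D \<subseteq> (\<Union>k\<in>K. cl k)"
  unfolding Omega_def using interior_subset closure_patch by fastforce

lemma Omega_props: "open (Omega D)" "bounded (Omega D)" "lipschitz_boundary (Omega D)"
  using domain by (auto simp: multipatch_domain_def)

lemma cl_subset_closure_Omega: "k \<in> K \<Longrightarrow> cl k \<subseteq> closure (Omega D)"
  using closure_mono[OF patch_subset_Omega] closure_patch by simp

lemma vertex_in_cl: "v \<in> vertices D \<Longrightarrow> k \<in> K \<Longrightarrow> v \<in> cl k \<longleftrightarrow> k \<in> vertex_patches D v"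
proof
  assume v: "v \<in> vertices D" and k: "k \<in> K" "v \<in> cl k"
  obtain k' where k': "k' \<in> K" "v \<in> patch_vertices D k'" using v by (auto simp: vertices_def)
  then have vf: "v \<in> frontier (patch D k')" using patch_vertex_in_frontier by blast
  then have "v \<notin> patch D k"
    using patch_frontier_disjoint[OF k'(1)] patch_cl_disjoint[OF k(1) k'(1)] frontier_subset_cl[OF k'(1)] by (cases "k = k'") blast+
  then show "k \<in> vertex_patches D v" using k cl_eq[OF k(1)] by (auto simp: vertex_patches_def)
next
  assume "k \<in> K" "k \<in> vertex_patches D v"
  then show "v \<in> cl k" using frontier_subset_cl by (auto simp: vertex_patches_def)
qed

text \<open>Any quantity \<open>f\<close> that agrees across the interior edges through a vertex is the same for all patches at the
vertex. Otherwise the patches at \<open>v\<close> split into two classes, and patches of different classes meet in \<open>v\<close>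
only. So the classes would separate the domain near \<open>v\<close> with \<open>v\<close> removed, which is connected.\<close>

lemma vertex_patches_linked:
  assumes v: "v \<in> vertices D" and
    step: "\<And>e k k'. interior_edge D e \<Longrightarrow> v \<in> e \<Longrightarrow> k \<in> edge_patches D e \<Longrightarrow> k' \<in> edge_patches D e \<Longrightarrow> f k = f k'"
    and k: "k1 \<in> vertex_patches D v" "k2 \<in> vertex_patches D v"
  shows "f k1 = f k2"
proof (rule ccontr)
  assume ne: "f k1 \<noteq> f k2"
  define A where "A = {k \<in> vertex_patches D v. f k = f k1}"
  define B where "B = {k \<in> vertex_patches D v. f k \<noteq> f k1}"
  have ABK: "A \<subseteq> K" "B \<subseteq> K" by (auto simp: A_def B_def vertex_patches_def)
  have fin: "finite A" "finite B" using ABK finite_K finite_subset by blast+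
  have sep: "cl a \<inter> cl b \<subseteq> {v}" if ab: "a \<in> A" "b \<in> B" for a b
  proof -
    have abK: "a \<in> K" "b \<in> K" "a \<noteq> b" and fab: "f a \<noteq> f b" using ab ABK by (auto simp: A_def B_def)
    have vab: "v \<in> cl a \<inter> cl b" using ab abK vertex_in_cl[OF v] by (auto simp: A_def B_def)
    have "cl a \<inter> cl b \<notin> patch_edges D a \<inter> patch_edges D b"
    proof
      assume e: "cl a \<inter> cl b \<in> patch_edges D a \<inter> patch_edges D b"
      then have "interior_edge D (cl a \<inter> cl b)" "edge_patches D (cl a \<inter> cl b) = {a, b}"
        using common_edge_interior[OF abK] by blast+
      then have "f a = f b" using step[of "cl a \<inter> cl b" a b] vab by blast
      then show False using fab by contradiction
    qed
    moreover have "cl a \<inter> cl b \<noteq> {}" using vab by (metis emptyE)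
    ultimately obtain v' where v': "cl a \<inter> cl b = {v'}" using cl_Int[OF abK] by metis
    have "v = v'" using vab unfolding v' by simp
    then show ?thesis unfolding v' by simp
  qed
  \<comment> \<open>near the vertex no other patch interferes\<close>
  define Z where "Z = (\<Union>k\<in>K - vertex_patches D v. cl k)"
  have "closed Z" unfolding Z_def using finite_K compact_cl by (intro closed_UN) (auto intro: compact_imp_closed)
  moreover have "v \<notin> Z" using vertex_in_cl[OF v] by (auto simp: Z_def)
  ultimately have "open (- Z)" "v \<in> - Z" by auto
  then obtain \<epsilon> where \<epsilon>: "\<epsilon> > 0" "ball v \<epsilon> \<subseteq> - Z" by (meson open_contains_ball)
  have "v \<in> closure (Omega D)"
  proof -
    have k1K: "k1 \<in> K" using k(1) by (simp add: vertex_patches_def)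
    then have "v \<in> cl k1" using vertex_in_cl[OF v k1K] k(1) by simp
    then show ?thesis by (rule subsetD[OF cl_subset_closure_Omega[OF k1K]])
  qed
  then obtain W where W: "open W" "v \<in> W" "W \<subseteq> ball v \<epsilon>" "connected (Omega D \<inter> W - {v})"
    using lipschitz_boundary_locally_connected[OF Omega_props(1,3) _ \<epsilon>(1)] by blast
  define XA where "XA = (\<Union>k\<in>A. cl k)"
  define XB where "XB = (\<Union>k\<in>B. cl k)"
  have cl: "closed XA" "closed XB"
    unfolding XA_def XB_def using fin ABK compact_cl by (auto intro!: closed_UN compact_imp_closed)
  have "Omega D \<inter> W - {v} \<subseteq> XA \<union> XB"
  proof
    fix x assume x: "x \<in> Omega D \<inter> W - {v}"
    then obtain k where k: "k \<in> K" "x \<in> cl k" using Omega_subset by blast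
    have "x \<notin> Z" using x W(3) \<epsilon>(2) by blast
    then have "k \<in> vertex_patches D v" using k by (auto simp: Z_def)
    then have "k \<in> A \<or> k \<in> B" by (auto simp: A_def B_def)
    then show "x \<in> XA \<union> XB" using k(2) by (auto simp: XA_def XB_def)
  qed
  moreover have "XA \<inter> XB \<inter> (Omega D \<inter> W - {v}) = {}"
    using sep unfolding XA_def XB_def by blast
  moreover have meets: "cl a \<inter> (Omega D \<inter> W - {v}) \<noteq> {}" if a: "a \<in> vertex_patches D v" for a
  proof -
    have aK: "a \<in> K" and va: "v \<in> frontier (patch D a)" using a by (auto simp: vertex_patches_def)
    have "v \<in> closure (patch D a)" using va by (simp add: frontier_def)
    then have "W \<inter> closure (patch D a) \<noteq> {}" using W(2) by blast
    then have "W \<inter> patch D a \<noteq> {}" unfolding open_Int_closure_eq_empty[OF W(1)] .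
    then obtain x where x: "x \<in> patch D a" "x \<in> W" by blast
    have "x \<noteq> v" using x(1) va patch_frontier_disjoint[OF aK] by (metis disjoint_iff)
    then have "x \<in> cl a \<inter> (Omega D \<inter> W - {v})"
      using x(2) subsetD[OF patch_subset x(1)] subsetD[OF patch_subset_Omega[OF aK] x(1)] by simp
    then show ?thesis by (metis emptyE)
  qed
  have "cl k1 \<subseteq> XA" unfolding XA_def by (rule UN_upper) (use k(1) in \<open>simp add: A_def\<close>)
  then have "cl k1 \<inter> (Omega D \<inter> W - {v}) \<subseteq> XA \<inter> (Omega D \<inter> W - {v})" by (rule Int_mono[OF _ subset_refl])
  then have "XA \<inter> (Omega D \<inter> W - {v}) \<noteq> {}" using meets[OF k(1)] by (metis subset_empty)
  moreover have "cl k2 \<subseteq> XB" unfolding XB_def by (rule UN_upper) (use k(2) ne in \<open>simp add: B_def\<close>)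
  then have "cl k2 \<inter> (Omega D \<inter> W - {v}) \<subseteq> XB \<inter> (Omega D \<inter> W - {v})" by (rule Int_mono[OF _ subset_refl])
  then have "XB \<inter> (Omega D \<inter> W - {v}) \<noteq> {}" using meets[OF k(2)] by (metis subset_empty)
  ultimately show False using W(4) cl unfolding connected_closed by blast
qed

lemma card_vertex_patches: "v \<in> vertices D \<Longrightarrow> finite (vertex_patches D v) \<and> 0 < card (vertex_patches D v)"
proof -
  assume v: "v \<in> vertices D"
  have f: "finite (vertex_patches D v)" using finite_K by (auto simp: vertex_patches_def)
  obtain k where "k \<in> K" "v \<in> patch_vertices D k" using v by (auto simp: vertices_def)
  then have "k \<in> vertex_patches D v" using patch_vertex_in_frontier by (auto simp: vertex_patches_def)
  then show ?thesis using f card_gt_0_iff by blast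
qed

end

section \<open>Tensor-product splines\<close>

text \<open>Reflection of the unit interval, applied if the flag is set.\<close>

definition flip :: "bool \<Rightarrow> (real \<Rightarrow> real) \<Rightarrow> real \<Rightarrow> real" where
  "flip r f x = (if r then f (1 - x) else f x)"

lemma tensor_square_sym:
  "(f \<otimes>\<^sub>t g) (square_sym (sw, r1, r2) x) = (if sw then (flip r2 g \<otimes>\<^sub>t flip r1 f) x else (flip r1 f \<otimes>\<^sub>t flip r2 g) x)"
  by (cases x) (simp add: tensor_def square_sym_def flip_def Let_def)

context spline_patch
begin

lemma tensor_splines_lincomb:
  assumes "\<phi> \<in> tensor_splines D k" "\<psi> \<in> tensor_splines D k"
  shows "(\<lambda>x. a * \<phi> x + b * \<psi> x) \<in> tensor_splines D k"
proof -
  obtain c where c: "\<phi> = (\<lambda>x. \<Sum>i\<le>n. \<Sum>j\<le>n. c i j * (lam D k i \<otimes>\<^sub>t lam D k j) x)"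
    using assms(1) unfolding tensor_splines_def by blast
  obtain d where d: "\<psi> = (\<lambda>x. \<Sum>i\<le>n. \<Sum>j\<le>n. d i j * (lam D k i \<otimes>\<^sub>t lam D k j) x)"
    using assms(2) unfolding tensor_splines_def by blast
  show ?thesis unfolding tensor_splines_def c d
    by (intro CollectI exI[of _ "\<lambda>i j. a * c i j + b * d i j"] ext)
       (simp add: distrib_right sum.distrib sum_distrib_left mult.assoc)
qed

lemma tensor_splines_0: "(\<lambda>x. 0) \<in> tensor_splines D k"
  unfolding tensor_splines_def by (intro CollectI exI[of _ "\<lambda>_ _. 0"]) auto

lemma tensor_splines_add: "\<phi> \<in> tensor_splines D k \<Longrightarrow> \<psi> \<in> tensor_splines D k \<Longrightarrow> (\<lambda>x. \<phi> x + \<psi> x) \<in> tensor_splines D k"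
  using tensor_splines_lincomb[of \<phi> \<psi> 1 1] by simp
lemma tensor_splines_diff: "\<phi> \<in> tensor_splines D k \<Longrightarrow> \<psi> \<in> tensor_splines D k \<Longrightarrow> (\<lambda>x. \<phi> x - \<psi> x) \<in> tensor_splines D k"
  using tensor_splines_lincomb[of \<phi> \<psi> 1 "-1"] by simp
lemma tensor_splines_mult: "\<phi> \<in> tensor_splines D k \<Longrightarrow> (\<lambda>x. a * \<phi> x) \<in> tensor_splines D k"
  using tensor_splines_lincomb[of \<phi> \<phi> a 0] by simp
lemma tensor_splines_sum: "(\<And>i. i \<in> I \<Longrightarrow> f i \<in> tensor_splines D k) \<Longrightarrow> (\<lambda>x. \<Sum>i\<in>I. f i x) \<in> tensor_splines D k"
  by (induction I rule: infinite_finite_induct) (auto simp: tensor_splines_0 tensor_splines_add)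

lemma tensor_in_tensor_splines:
  assumes "f \<in> splines D k" "g \<in> splines D k" shows "(f \<otimes>\<^sub>t g) \<in> tensor_splines D k"
proof -
  obtain c where c: "f = (\<lambda>x. \<Sum>i\<le>n. c i * lam D k i x)" using assms(1) unfolding splines_def by blast
  obtain d where d: "g = (\<lambda>x. \<Sum>i\<le>n. d i * lam D k i x)" using assms(2) unfolding splines_def by blast
  show ?thesis unfolding tensor_splines_def c d
    by (intro CollectI exI[of _ "\<lambda>i j. c i * d j"] ext)
       (simp add: tensor_def sum_product mult_ac)
qed

lemma flip_splines: "f \<in> splines D k \<Longrightarrow> flip r f \<in> splines D k"
proof (cases r)
  case True
  assume "f \<in> splines D k"
  then obtain c where c: "f = (\<lambda>x. \<Sum>i\<le>n. c i * lam D k i x)" unfolding splines_def by blast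
  have "flip r f = (\<lambda>x. \<Sum>i\<le>n. c i * lam D k (n - i) x)"
    unfolding c using True by (intro ext) (simp add: flip_def lam_reflect)
  then show ?thesis by (auto intro!: splines_sum splines_mult splines_lam)
next
  case False
  assume "f \<in> splines D k"
  moreover have "flip r f = f" using False by (auto simp: flip_def)
  ultimately show ?thesis by simp
qed

lemma tensor_splines_square_sym:
  assumes "\<phi> \<in> tensor_splines D k" shows "(\<lambda>x. \<phi> (square_sym \<sigma> x)) \<in> tensor_splines D k"
proof -
  obtain sw r1 r2 where \<sigma>: "\<sigma> = (sw, r1, r2)" by (metis prod.exhaust)
  obtain c where c: "\<phi> = (\<lambda>x. \<Sum>i\<le>n. \<Sum>j\<le>n. c i j * (lam D k i \<otimes>\<^sub>t lam D k j) x)"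
    using assms unfolding tensor_splines_def by blast
  have "(\<lambda>x. (lam D k i \<otimes>\<^sub>t lam D k j) (square_sym \<sigma> x)) \<in> tensor_splines D k" if "i \<le> n" "j \<le> n" for i j
    unfolding \<sigma> tensor_square_sym using that
    by (cases sw) (simp_all add: tensor_in_tensor_splines flip_splines splines_lam)
  then show ?thesis unfolding c by (intro tensor_splines_sum tensor_splines_mult) auto
qed

lemma lam_bounded: "\<exists>B. \<forall>x. \<bar>lam D k i x\<bar> \<le> B"
proof -
  have "compact (lam D k i ` {0..1})" by (intro compact_continuous_image lam_continuous) auto
  then obtain B where B: "\<And>x. x \<in> {0..1} \<Longrightarrow> \<bar>lam D k i x\<bar> \<le> B" by (force dest!: compact_imp_bounded simp: bounded_iff)
  have "\<bar>lam D k i x\<bar> \<le> max B 0" for x using B[of x] lam_outside[of x i] by (cases "x \<in> {0..1}") auto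
  then show ?thesis by blast
qed

lemma tensor_splines_induct [consumes 1, case_names basis lincomb]:
  assumes "\<phi> \<in> tensor_splines D k"
    and basis: "\<And>i j. i \<le> n \<Longrightarrow> j \<le> n \<Longrightarrow> P (lam D k i \<otimes>\<^sub>t lam D k j)"
    and lin: "\<And>f g a. P f \<Longrightarrow> P g \<Longrightarrow> P (\<lambda>x. a * f x + g x)"
  shows "P \<phi>"
proof -
  obtain c where c: "\<phi> = (\<lambda>x. \<Sum>i\<le>n. \<Sum>j\<le>n. c i j * (lam D k i \<otimes>\<^sub>t lam D k j) x)"
    using assms(1) unfolding tensor_splines_def by blast
  let ?b = "\<lambda>z. lam D k (fst z) \<otimes>\<^sub>t lam D k (snd z)"
  have 0: "P (\<lambda>x. 0)"
    using lin[OF basis[of 0 0] basis[of 0 0], of "-1"] by simp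
  have "P (\<lambda>x. \<Sum>z\<in>I. c (fst z) (snd z) * ?b z x)" if "finite I" "I \<subseteq> {..n} \<times> {..n}" for I
    using that
  proof (induction I)
    case (insert z I)
    have "P (\<lambda>x. c (fst z) (snd z) * ?b z x + (\<Sum>z\<in>I. c (fst z) (snd z) * ?b z x))"
      using insert by (intro lin basis) auto
    then show ?case using insert by simp
  qed (simp add: 0)
  from this[of "{..n} \<times> {..n}"] show ?thesis unfolding c by (simp add: sum.cartesian_product case_prod_beta)
qed

text \<open>The four properties are proved together because each of them passes from basis functions to linear
combinations.\<close>

lemma tensor_splines_regular:
  assumes "\<phi> \<in> tensor_splines D k"
  shows "(\<exists>B. \<forall>x. \<bar>\<phi> x\<bar> \<le> B) \<and> (\<exists>L. \<forall>x\<in>sq_closed. \<forall>y\<in>sq_closed. \<bar>\<phi> x - \<phi> y\<bar> \<le> L * norm (x - y)) \<and>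
    (\<forall>x\<in>sq_open. fst x \<notin> breaks \<and> snd x \<notin> breaks \<longrightarrow> \<phi> differentiable (at x)) \<and> (\<forall>x. x \<notin> sq_closed \<longrightarrow> \<phi> x = 0)"
  using assms
proof (induction rule: tensor_splines_induct)
  case (basis i j)
  obtain B B' where B: "\<And>x. \<bar>lam D k i x\<bar> \<le> B" "\<And>x. \<bar>lam D k j x\<bar> \<le> B'" using lam_bounded by metis
  have B0: "0 \<le> B" "0 \<le> B'" using B[of 0] by linarith+
  obtain L where L: "L-lipschitz_on {0..1} (lam D k i)" using lam_lipschitz by blast
  obtain L' where L': "L'-lipschitz_on {0..1} (lam D k j)" using lam_lipschitz by blast
  have bd: "\<bar>(lam D k i \<otimes>\<^sub>t lam D k j) x\<bar> \<le> B * B'" for x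
    unfolding tensor_def abs_mult using B B0 by (intro mult_mono) auto
  have lip: "\<bar>(lam D k i \<otimes>\<^sub>t lam D k j) x - (lam D k i \<otimes>\<^sub>t lam D k j) y\<bar> \<le> (L * B' + B * L') * norm (x - y)"
    if xy: "x \<in> sq_closed" "y \<in> sq_closed" for x y
  proof -
    have in01: "fst x \<in> {0..1}" "snd x \<in> {0..1}" "fst y \<in> {0..1}" "snd y \<in> {0..1}" using xy by (auto simp: sq_closed_def)
    have 1: "\<bar>lam D k i (fst x) - lam D k i (fst y)\<bar> \<le> L * norm (x - y)"
    proof -
      have "dist (lam D k i (fst x)) (lam D k i (fst y)) \<le> L * dist (fst x) (fst y)" using L in01 by (intro lipschitz_onD) auto
      also have "\<dots> \<le> L * norm (x - y)" using lipschitz_on_nonneg[OF L] dist_fst_le[of x y] by (intro mult_left_mono) (auto simp: dist_norm)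
      finally show ?thesis by (simp add: dist_real_def)
    qed
    have 2: "\<bar>lam D k j (snd x) - lam D k j (snd y)\<bar> \<le> L' * norm (x - y)"
    proof -
      have "dist (lam D k j (snd x)) (lam D k j (snd y)) \<le> L' * dist (snd x) (snd y)" using L' in01 by (intro lipschitz_onD) auto
      also have "\<dots> \<le> L' * norm (x - y)" using lipschitz_on_nonneg[OF L'] dist_snd_le[of x y] by (intro mult_left_mono) (auto simp: dist_norm)
      finally show ?thesis by (simp add: dist_real_def)
    qed
    have "(lam D k i \<otimes>\<^sub>t lam D k j) x - (lam D k i \<otimes>\<^sub>t lam D k j) y =
      (lam D k i (fst x) - lam D k i (fst y)) * lam D k j (snd x) + lam D k i (fst y) * (lam D k j (snd x) - lam D k j (snd y))"
      by (simp add: tensor_def left_diff_distrib right_diff_distrib)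
    also have "\<bar>\<dots>\<bar> \<le> \<bar>lam D k i (fst x) - lam D k i (fst y)\<bar> * \<bar>lam D k j (snd x)\<bar> + \<bar>lam D k i (fst y)\<bar> * \<bar>lam D k j (snd x) - lam D k j (snd y)\<bar>"
      by (metis abs_mult abs_triangle_ineq)
    also have "\<dots> \<le> (L * norm (x - y)) * B' + B * (L' * norm (x - y))"
      using 1 2 B B0 lipschitz_on_nonneg[OF L] by (intro add_mono mult_mono) auto
    finally show ?thesis by (simp add: algebra_simps)
  qed
  have dif: "(lam D k i \<otimes>\<^sub>t lam D k j) differentiable (at x)" if x: "x \<in> sq_open" "fst x \<notin> breaks" "snd x \<notin> breaks" for x
  proof -
    have d: "lam D k i differentiable (at (fst x))" "lam D k j differentiable (at (snd x))"
      using x by (auto intro!: lam_differentiable simp: sq_open_def)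
    have "(lam D k i \<circ> fst) differentiable (at x)"
      by (rule differentiable_chain_at[OF bounded_linear_imp_differentiable[OF bounded_linear_fst] d(1)])
    moreover have "(lam D k j \<circ> snd) differentiable (at x)"
      by (rule differentiable_chain_at[OF bounded_linear_imp_differentiable[OF bounded_linear_snd] d(2)])
    ultimately have "(\<lambda>x. lam D k i (fst x)) differentiable (at x)" "(\<lambda>x. lam D k j (snd x)) differentiable (at x)" by (simp_all add: o_def)
    then show ?thesis unfolding tensor_def[abs_def] by (rule differentiable_mult)
  qed
  have "(lam D k i \<otimes>\<^sub>t lam D k j) x = 0" if "x \<notin> sq_closed" for x
    using that lam_outside[of "fst x" i] lam_outside[of "snd x" j] by (cases x) (auto simp: tensor_def sq_closed_def)
  then show ?case using bd lip dif by blast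
next
  case (lincomb f g a)
  obtain B where B: "\<And>x. \<bar>f x\<bar> \<le> B" using lincomb by blast
  obtain B' where B': "\<And>x. \<bar>g x\<bar> \<le> B'" using lincomb by blast
  obtain L where L: "\<And>x y. x \<in> sq_closed \<Longrightarrow> y \<in> sq_closed \<Longrightarrow> \<bar>f x - f y\<bar> \<le> L * norm (x - y)" using lincomb by blast
  obtain L' where L': "\<And>x y. x \<in> sq_closed \<Longrightarrow> y \<in> sq_closed \<Longrightarrow> \<bar>g x - g y\<bar> \<le> L' * norm (x - y)" using lincomb by blast
  have 1: "\<bar>a * f x + g x\<bar> \<le> \<bar>a\<bar> * B + B'" for x
  proof -
    have "\<bar>a * f x + g x\<bar> \<le> \<bar>a\<bar> * \<bar>f x\<bar> + \<bar>g x\<bar>" by (metis abs_mult abs_triangle_ineq)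
    also have "\<dots> \<le> \<bar>a\<bar> * B + B'" using B B' by (intro add_mono mult_left_mono) auto
    finally show ?thesis .
  qed
  have 2: "\<bar>(a * f x + g x) - (a * f y + g y)\<bar> \<le> (\<bar>a\<bar> * L + L') * norm (x - y)" if "x \<in> sq_closed" "y \<in> sq_closed" for x y
  proof -
    have "(a * f x + g x) - (a * f y + g y) = a * (f x - f y) + (g x - g y)" by (simp add: right_diff_distrib)
    also have "\<bar>\<dots>\<bar> \<le> \<bar>a\<bar> * \<bar>f x - f y\<bar> + \<bar>g x - g y\<bar>" by (metis abs_mult abs_triangle_ineq)
    also have "\<dots> \<le> \<bar>a\<bar> * (L * norm (x - y)) + L' * norm (x - y)" using L L' that by (intro add_mono mult_left_mono) auto
    finally show ?thesis by (simp add: algebra_simps)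
  qed
  have 3: "(\<lambda>x. a * f x + g x) differentiable (at x)" if "x \<in> sq_open" "fst x \<notin> breaks" "snd x \<notin> breaks" for x
  proof -
    have "f differentiable (at x)" "g differentiable (at x)" using lincomb that by blast+
    then show ?thesis by (intro differentiable_add differentiable_mult differentiable_const)
  qed
  have 4: "a * f x + g x = 0" if "x \<notin> sq_closed" for x
  proof -
    have "f x = 0" "g x = 0" using lincomb that by blast+
    then show ?thesis by simp
  qed
  show ?case using 1 2 3 4 by blast
qed

lemma tensor_splines_continuous:
  assumes "\<phi> \<in> tensor_splines D k" shows "continuous_on sq_closed \<phi>"
proof -
  obtain L where L: "\<And>x y. x \<in> sq_closed \<Longrightarrow> y \<in> sq_closed \<Longrightarrow> \<bar>\<phi> x - \<phi> y\<bar> \<le> L * norm (x - y)"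
    using tensor_splines_regular[OF assms] by blast
  have "(max L 0)-lipschitz_on sq_closed \<phi>"
  proof (rule lipschitz_onI)
    fix x y assume xy: "x \<in> sq_closed" "y \<in> sq_closed"
    have "L * norm (x - y) \<le> max L 0 * norm (x - y)" by (intro mult_right_mono) auto
    then show "dist (\<phi> x) (\<phi> y) \<le> max L 0 * dist x y" using L[OF xy] by (simp add: dist_norm)
  qed simp
  then show ?thesis by (rule lipschitz_on_continuous_on)
qed

lemma tensor_splines_eqI:
  assumes "\<phi> \<in> tensor_splines D k" "\<psi> \<in> tensor_splines D k" "\<And>x. x \<in> sq_open \<Longrightarrow> \<phi> x = \<psi> x"
  shows "\<phi> = \<psi>"
proof
  fix x
  show "\<phi> x = \<psi> x"
  proof (cases "x \<in> sq_closed")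
    case True
    have "continuous_on (closure sq_open) (\<lambda>x. \<phi> x - \<psi> x)" unfolding sq_basic(5)
      by (intro continuous_on_diff tensor_splines_continuous assms)
    then have "\<phi> x - \<psi> x = 0"
      by (rule continuous_constant_on_closure) (use assms(3) True sq_basic(5) in auto)
    then show ?thesis by simp
  next
    case False
    then show ?thesis using tensor_splines_regular[OF assms(1)] tensor_splines_regular[OF assms(2)] by metis
  qed
qed

end

section \<open>The broken space\<close>

lemma negligible_UN_finite:
  assumes "finite I" "\<And>i. i \<in> I \<Longrightarrow> negligible (A i)" shows "negligible (\<Union>i\<in>I. A i)"
  using assms by (induction I) auto

locale multipatch_splines = multipatch_geometry +
  assumes spline_assms: "spline_assumptions D"
begin

lemma spline_patch: "k \<in> K \<Longrightarrow> spline_patch D k"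
  using spline_assms by (simp add: spline_assumptions_def spline_patch_def)

lemma bounded_on_Omega_in_L2:
  assumes "f \<in> borel_measurable borel" "\<And>x. \<bar>f x\<bar> \<le> B"
  shows "f \<in> L2_on (Omega D)"
proof -
  have S: "Omega D \<in> sets lebesgue" using Omega_props(1) by auto
  have m: "f \<in> borel_measurable lebesgue" using assms(1) by (rule borel_imp_lebesgue_measurable)
  have mi: "(\<lambda>x. indicat_real (Omega D) x * f x) \<in> borel_measurable lebesgue"
    by (intro borel_measurable_times borel_measurable_indicator S m)
  have m2: "(\<lambda>x. indicat_real (Omega D) x * (f x)\<^sup>2) \<in> borel_measurable lebesgue"
    by (intro borel_measurable_times borel_measurable_indicator borel_measurable_power S m)
  have "integrable lebesgue (\<lambda>x. indicat_real (Omega D) x * (f x)\<^sup>2)"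
  proof (rule bounded_imp_integrable[OF m2 Omega_props(2) S, where B = "B\<^sup>2"])
    fix x
    have "(f x)\<^sup>2 \<le> B\<^sup>2" using assms(2)[of x] by (metis abs_ge_zero abs_le_square_iff abs_of_nonneg order_trans)
    then show "\<bar>indicat_real (Omega D) x * (f x)\<^sup>2\<bar> \<le> B\<^sup>2" by (simp add: indicator_def)
  qed simp
  then show ?thesis using mi by (simp add: L2_on_def set_borel_measurable_def set_integrable_def)
qed

lemma pushfwd_F: "k \<in> K \<Longrightarrow> x \<in> sq_open \<Longrightarrow> pushfwd D k \<phi> (F k x) = \<phi> x"
  using G_F[of k x] sq_basic(4) by (auto simp: pushfwd_def patch_def)

lemma pushfwd_other: "k \<in> K \<Longrightarrow> k' \<in> K \<Longrightarrow> k \<noteq> k' \<Longrightarrow> x \<in> patch D k' \<Longrightarrow> pushfwd D k \<phi> x = 0"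
  using patches_disjoint[of k k'] by (auto simp: pushfwd_def)

lemma G_continuous: assumes "k \<in> K" shows "continuous_on (cl k) (G k)"
  using patch_map.G_continuous[OF patch_map[OF assms]] unfolding G_eq[OF assms] .

lemma pushfwd_measurable:
  assumes "k \<in> K" "continuous_on sq_closed \<phi>" shows "pushfwd D k \<phi> \<in> borel_measurable borel"
proof -
  have "continuous_on (patch D k) (\<lambda>x. \<phi> (G k x))"
  proof (rule continuous_on_compose2[OF assms(2)])
    show "continuous_on (patch D k) (G k)" using G_continuous[OF assms(1)] patch_subset by (rule continuous_on_subset)
    show "G k ` patch D k \<subseteq> sq_closed" using G_patch[OF assms(1)] sq_basic(4) by blast
  qed
  then have "(\<lambda>x. indicator (patch D k) x *\<^sub>R \<phi> (G k x)) \<in> borel_measurable borel"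
    using open_patch[OF assms(1)] by (intro borel_measurable_continuous_on_indicator) auto
  moreover have "(\<lambda>x. indicator (patch D k) x *\<^sub>R \<phi> (G k x)) = pushfwd D k \<phi>"
    by (auto simp: pushfwd_def indicator_def fun_eq_iff)
  ultimately show ?thesis by simp
qed

lemma L2_on_lincomb:
  assumes "u \<in> L2_on S" "v \<in> L2_on S" shows "(\<lambda>x. a * u x + b * v x) \<in> L2_on S"
proof -
  have mu: "(\<lambda>x. indicat_real S x * u x) \<in> borel_measurable lebesgue" and mv: "(\<lambda>x. indicat_real S x * v x) \<in> borel_measurable lebesgue"
    and iu: "integrable lebesgue (\<lambda>x. indicat_real S x * (u x)\<^sup>2)" and iv: "integrable lebesgue (\<lambda>x. indicat_real S x * (v x)\<^sup>2)"
    using assms by (simp_all add: L2_on_def set_borel_measurable_def set_integrable_def)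
  have e: "indicat_real S x * (a * u x + b * v x) = a * (indicat_real S x * u x) + b * (indicat_real S x * v x)" for x by (simp add: algebra_simps)
  have m: "(\<lambda>x. indicat_real S x * (a * u x + b * v x)) \<in> borel_measurable lebesgue"
    unfolding e by (intro borel_measurable_add borel_measurable_times borel_measurable_const mu mv)
  have "(\<lambda>x. indicat_real S x * (a * u x + b * v x)\<^sup>2) = (\<lambda>x. (indicat_real S x * (a * u x + b * v x))\<^sup>2)"
    by (auto simp: indicator_def fun_eq_iff)
  then have m2: "(\<lambda>x. indicat_real S x * (a * u x + b * v x)\<^sup>2) \<in> borel_measurable lebesgue"
    using m by (metis borel_measurable_power)
  have "integrable lebesgue (\<lambda>x. indicat_real S x * (a * u x + b * v x)\<^sup>2)"
  proof (rule Bochner_Integration.integrable_bound[where f = "\<lambda>x. (2 * a\<^sup>2) * (indicat_real S x * (u x)\<^sup>2) + (2 * b\<^sup>2) * (indicat_real S x * (v x)\<^sup>2)"])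
    show "integrable lebesgue (\<lambda>x. (2 * a\<^sup>2) * (indicat_real S x * (u x)\<^sup>2) + (2 * b\<^sup>2) * (indicat_real S x * (v x)\<^sup>2))"
      by (intro Bochner_Integration.integrable_add integrable_mult_right iu iv)
    show "AE x in lebesgue. norm (indicat_real S x * (a * u x + b * v x)\<^sup>2) \<le> norm ((2 * a\<^sup>2) * (indicat_real S x * (u x)\<^sup>2) + (2 * b\<^sup>2) * (indicat_real S x * (v x)\<^sup>2))"
    proof (intro always_eventually allI)
      fix x
      have "0 \<le> (a * u x - b * v x)\<^sup>2" by simp
      then have "(a * u x + b * v x)\<^sup>2 \<le> 2 * a\<^sup>2 * (u x)\<^sup>2 + 2 * b\<^sup>2 * (v x)\<^sup>2"
        by (simp add: power2_sum power2_diff power_mult_distrib)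
      then show "norm (indicat_real S x * (a * u x + b * v x)\<^sup>2) \<le> norm ((2 * a\<^sup>2) * (indicat_real S x * (u x)\<^sup>2) + (2 * b\<^sup>2) * (indicat_real S x * (v x)\<^sup>2))"
        by (simp add: indicator_def)
    qed
  qed (rule m2)
  then show ?thesis using m by (simp add: L2_on_def set_borel_measurable_def set_integrable_def)
qed

lemma pushfwd_in_Vpw:
  assumes "k \<in> K" "\<phi> \<in> tensor_splines D k" shows "pushfwd D k \<phi> \<in> Vpw D"
proof -
  interpret sp: spline_patch D k using assms(1) by (rule spline_patch)
  obtain B where B: "\<And>x. \<bar>\<phi> x\<bar> \<le> B" using sp.tensor_splines_regular[OF assms(2)] by blast
  have "0 \<le> B" using B[of 0] by linarith
  then have "\<bar>pushfwd D k \<phi> x\<bar> \<le> B" for x using B[of "G k x"] by (simp add: pushfwd_def)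
  then have "pushfwd D k \<phi> \<in> L2_on (Omega D)"
    by (intro bounded_on_Omega_in_L2 pushfwd_measurable assms(1) sp.tensor_splines_continuous assms(2))
  moreover have "\<exists>\<psi>\<in>tensor_splines D k'. \<forall>x\<in>patch D k'. pushfwd D k \<phi> x = pushfwd D k' \<psi> x" if "k' \<in> K" for k'
  proof (cases "k' = k")
    case False
    interpret sp': spline_patch D k' using that by (rule spline_patch)
    have "pushfwd D k \<phi> x = pushfwd D k' (\<lambda>x. 0) x" if "x \<in> patch D k'" for x
      using pushfwd_other[OF assms(1) \<open>k' \<in> K\<close> _ that] False by (simp add: pushfwd_def)
    then show ?thesis using sp'.tensor_splines_0 by blast
  qed (use assms(2) in blast)
  moreover have "pushfwd D k \<phi> x = 0" if "x \<notin> (\<Union>k\<in>K. patch D k)" for x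
    using that assms(1) by (simp add: pushfwd_def)
  ultimately show ?thesis unfolding Vpw_def by blast
qed

lemma Vpw_D:
  assumes "u \<in> Vpw D"
  shows "u \<in> L2_on (Omega D)" "x \<notin> (\<Union>k\<in>K. patch D k) \<Longrightarrow> u x = 0"
    "k \<in> K \<Longrightarrow> \<exists>\<phi>\<in>tensor_splines D k. \<forall>x\<in>patch D k. u x = pushfwd D k \<phi> x"
  using assms unfolding Vpw_def by blast+

lemma Vpw_lincomb:
  assumes "u \<in> Vpw D" "v \<in> Vpw D" shows "(\<lambda>x. a * u x + b * v x) \<in> Vpw D"
proof -
  have "(\<lambda>x. a * u x + b * v x) \<in> L2_on (Omega D)" using assms by (intro L2_on_lincomb Vpw_D(1))
  moreover have "\<exists>\<psi>\<in>tensor_splines D k. \<forall>x\<in>patch D k. a * u x + b * v x = pushfwd D k \<psi> x" if k: "k \<in> K" for k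
  proof -
    interpret sp: spline_patch D k using k by (rule spline_patch)
    obtain \<phi> where \<phi>: "\<phi> \<in> tensor_splines D k" "\<forall>x\<in>patch D k. u x = pushfwd D k \<phi> x" using Vpw_D(3)[OF assms(1) k] by blast
    obtain \<psi> where \<psi>: "\<psi> \<in> tensor_splines D k" "\<forall>x\<in>patch D k. v x = pushfwd D k \<psi> x" using Vpw_D(3)[OF assms(2) k] by blast
    have "a * u x + b * v x = pushfwd D k (\<lambda>x. a * \<phi> x + b * \<psi> x) x" if "x \<in> patch D k" for x
      using \<phi>(2) \<psi>(2) that by (simp add: pushfwd_def)
    then show ?thesis using sp.tensor_splines_lincomb[OF \<phi>(1) \<psi>(1), of a b] by blast
  qed
  moreover have "a * u x + b * v x = 0" if "x \<notin> (\<Union>k\<in>K. patch D k)" for x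
    using Vpw_D(2)[OF assms(1) that] Vpw_D(2)[OF assms(2) that] by simp
  ultimately show ?thesis unfolding Vpw_def by blast
qed

lemma Vpw_add: "u \<in> Vpw D \<Longrightarrow> v \<in> Vpw D \<Longrightarrow> (\<lambda>x. u x + v x) \<in> Vpw D"
  using Vpw_lincomb[of u v 1 1] by simp
lemma Vpw_mult: "u \<in> Vpw D \<Longrightarrow> (\<lambda>x. a * u x) \<in> Vpw D"
  using Vpw_lincomb[of u u a 0] by simp
lemma Vpw_0: "(\<lambda>x. 0) \<in> Vpw D"
proof -
  have "1 \<le> npatch D" using domain unfolding multipatch_domain_def by (elim conjE)
  then have "1 \<in> K" by (simp add: patches_def)
  then interpret sp: spline_patch D 1 by (rule spline_patch)
  show ?thesis using Vpw_mult[OF pushfwd_in_Vpw[OF \<open>1 \<in> K\<close> sp.tensor_splines_0], of 0] by simp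
qed
lemma Vpw_sum: "finite I \<Longrightarrow> (\<And>i. i \<in> I \<Longrightarrow> f i \<in> Vpw D) \<Longrightarrow> (\<lambda>x. \<Sum>i\<in>I. f i x) \<in> Vpw D"
  by (induction I rule: finite_induct) (auto simp: Vpw_0 Vpw_add)

text \<open>The tensor-product spline that represents a broken function on a patch. It also has values on the
boundary of the square and thus supplies the traces.\<close>

definition pull :: "nat \<Rightarrow> (real \<times> real \<Rightarrow> real) \<Rightarrow> real \<times> real \<Rightarrow> real" where
  "pull k u = (SOME \<phi>. \<phi> \<in> tensor_splines D k \<and> (\<forall>x\<in>sq_open. u (F k x) = \<phi> x))"

lemma pull:
  assumes "u \<in> Vpw D" "k \<in> K"
  shows "pull k u \<in> tensor_splines D k" "x \<in> sq_open \<Longrightarrow> u (F k x) = pull k u x"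
proof -
  obtain \<phi> where \<phi>: "\<phi> \<in> tensor_splines D k" "\<And>x. x \<in> patch D k \<Longrightarrow> u x = pushfwd D k \<phi> x" using Vpw_D(3)[OF assms] by blast
  have "u (F k x) = \<phi> x" if "x \<in> sq_open" for x
    using \<phi>(2)[of "F k x"] that pushfwd_F[OF assms(2) that] by (simp add: patch_def)
  then have "\<exists>\<phi>. \<phi> \<in> tensor_splines D k \<and> (\<forall>x\<in>sq_open. u (F k x) = \<phi> x)" using \<phi>(1) by blast
  from someI_ex[OF this, folded pull_def]
  show "pull k u \<in> tensor_splines D k" "x \<in> sq_open \<Longrightarrow> u (F k x) = pull k u x" by auto
qed

lemma pull_eqI:
  assumes "u \<in> Vpw D" "k \<in> K" "\<phi> \<in> tensor_splines D k" "\<And>x. x \<in> sq_open \<Longrightarrow> u (F k x) = \<phi> x"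
  shows "pull k u = \<phi>"
  by (rule spline_patch.tensor_splines_eqI[OF spline_patch[OF assms(2)] pull(1)[OF assms(1,2)] assms(3)])
     (simp only: pull(2)[OF assms(1,2), symmetric] assms(4))

lemma pull_lincomb:
  assumes "u \<in> Vpw D" "v \<in> Vpw D" "k \<in> K"
  shows "pull k (\<lambda>x. a * u x + b * v x) = (\<lambda>x. a * pull k u x + b * pull k v x)"
  by (rule pull_eqI[OF Vpw_lincomb[OF assms(1,2)] assms(3) spline_patch.tensor_splines_lincomb[OF spline_patch[OF assms(3)] pull(1)[OF assms(1,3)] pull(1)[OF assms(2,3)]]])
     (simp only: pull(2)[OF assms(1,3)] pull(2)[OF assms(2,3)])

lemma pull_mult: "u \<in> Vpw D \<Longrightarrow> k \<in> K \<Longrightarrow> pull k (\<lambda>x. a * u x) = (\<lambda>x. a * pull k u x)"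
  using pull_lincomb[of u u k a 0] by simp

lemma pull_sum:
  assumes "k \<in> K" "finite I" "\<And>i. i \<in> I \<Longrightarrow> f i \<in> Vpw D"
  shows "pull k (\<lambda>x. \<Sum>i\<in>I. f i x) = (\<lambda>x. \<Sum>i\<in>I. pull k (f i) x)"
  using assms(2,3)
proof (induction I)
  case empty
  have "pull k (\<lambda>x. 0) = (\<lambda>x. 0)" by (rule pull_eqI[OF Vpw_0 assms(1) spline_patch.tensor_splines_0[OF spline_patch[OF assms(1)]]]) simp
  then show ?case by simp
next
  case (insert i I)
  have "pull k (\<lambda>x. 1 * f i x + 1 * (\<Sum>i\<in>I. f i x)) = (\<lambda>x. 1 * pull k (f i) x + 1 * pull k (\<lambda>x. \<Sum>i\<in>I. f i x) x)"
    using insert by (intro pull_lincomb Vpw_sum assms(1)) auto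
  then show ?case using insert by simp
qed

lemma pull_pushfwd:
  assumes "k \<in> K" "k' \<in> K" "\<phi> \<in> tensor_splines D k'"
  shows "pull k (pushfwd D k' \<phi>) = (if k = k' then \<phi> else (\<lambda>x. 0))"
proof (rule pull_eqI[OF pushfwd_in_Vpw[OF assms(2,3)] assms(1)])
  show "(if k = k' then \<phi> else (\<lambda>x. 0)) \<in> tensor_splines D k"
    using assms spline_patch.tensor_splines_0[OF spline_patch[OF assms(1)]] by simp
  fix x assume x: "x \<in> sq_open"
  then have "F k x \<in> patch D k" by (simp add: patch_def)
  then show "pushfwd D k' \<phi> (F k x) = (if k = k' then \<phi> else (\<lambda>x. 0)) x"
    using pushfwd_F[OF assms(2) x] pushfwd_other[OF assms(2,1)] by (cases "k = k'") auto
qed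

lemma Vpw_on_patch: "u \<in> Vpw D \<Longrightarrow> k \<in> K \<Longrightarrow> x \<in> patch D k \<Longrightarrow> u x = pull k u (G k x)"
  using pull(2)[of u k "G k x"] G_patch[of k x] F_G[of x k] patch_subset[of k] by auto

lemma Vpw_off_patches: "u \<in> Vpw D \<Longrightarrow> x \<notin> (\<Union>k\<in>K. patch D k) \<Longrightarrow> u x = 0"
  by (rule Vpw_D(2))

lemma Vpw_eqI:
  assumes "u \<in> Vpw D" "v \<in> Vpw D" "\<And>k. k \<in> K \<Longrightarrow> pull k u = pull k v"
  shows "u = v"
proof
  fix x
  show "u x = v x"
  proof (cases "x \<in> (\<Union>k\<in>K. patch D k)")
    case True
    then obtain k where "k \<in> K" "x \<in> patch D k" by blast
    then show ?thesis using Vpw_on_patch assms by metis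
  next
    case False
    then show ?thesis using Vpw_off_patches assms(1,2) by metis
  qed
qed

text \<open>The limit of \<open>u\<close> at a point of the closed patch, taken from inside the patch.\<close>

definition val :: "(real \<times> real \<Rightarrow> real) \<Rightarrow> nat \<Rightarrow> real \<times> real \<Rightarrow> real" where
  "val u k x = pull k u (G k x)"

definition vertex_matched :: "real \<times> real \<Rightarrow> (real \<times> real \<Rightarrow> real) \<Rightarrow> bool" where
  "vertex_matched v u \<longleftrightarrow> (\<forall>k\<in>vertex_patches D v. \<forall>k'\<in>vertex_patches D v. val u k v = val u k' v)"

definition edge_matched :: "(real \<times> real) set \<Rightarrow> (real \<times> real \<Rightarrow> real) \<Rightarrow> bool" where
  "edge_matched e u \<longleftrightarrow> (\<forall>x\<in>e. \<forall>k\<in>edge_patches D e. \<forall>k'\<in>edge_patches D e. val u k x = val u k' x)"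

definition conforming :: "(real \<times> real \<Rightarrow> real) \<Rightarrow> bool" where
  "conforming u \<longleftrightarrow> (\<forall>v\<in>vertices D. vertex_matched v u) \<and> (\<forall>e. interior_edge D e \<longrightarrow> edge_matched e u)"

lemma val_regular:
  assumes "u \<in> Vpw D" "k \<in> K"
  shows "\<exists>L. 0 \<le> L \<and> (\<forall>x\<in>sq_closed. \<forall>y\<in>sq_closed. \<bar>pull k u x - pull k u y\<bar> \<le> L * norm (x - y)) \<and>
    (\<forall>x\<in>cl k. \<forall>y\<in>cl k. \<bar>val u k x - val u k y\<bar> \<le> L * norm (x - y)) \<and> (\<forall>x. \<bar>val u k x\<bar> \<le> L)"
proof -
  interpret sp: spline_patch D k using assms(2) by (rule spline_patch)
  interpret pm: patch_map "F k" using assms(2) by (rule patch_map)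
  note reg = sp.tensor_splines_regular[OF pull(1)[OF assms]]
  obtain B where B: "\<And>x. \<bar>pull k u x\<bar> \<le> B" using reg by blast
  obtain L where L: "\<And>x y. x \<in> sq_closed \<Longrightarrow> y \<in> sq_closed \<Longrightarrow> \<bar>pull k u x - pull k u y\<bar> \<le> L * norm (x - y)" using reg by blast
  define L1 where "L1 = max L 0"
  have L1: "\<bar>pull k u x - pull k u y\<bar> \<le> L1 * norm (x - y)" if "x \<in> sq_closed" "y \<in> sq_closed" for x y
    using L[OF that] mult_right_mono[of L L1 "norm (x - y)"] by (simp add: L1_def)
  define M where "M = L1 + L1 * (1 / pm.c) + \<bar>B\<bar>"
  have pos: "0 \<le> L1" "0 \<le> L1 * (1 / pm.c)" using pm.c(1) by (auto simp: L1_def)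
  have "0 \<le> M" using pos by (simp add: M_def)
  moreover have "\<bar>pull k u x - pull k u y\<bar> \<le> M * norm (x - y)" if "x \<in> sq_closed" "y \<in> sq_closed" for x y
    using L1[OF that] mult_right_mono[of L1 M "norm (x - y)"] pos by (simp add: M_def)
  moreover have "\<bar>val u k x - val u k y\<bar> \<le> M * norm (x - y)" if "x \<in> cl k" "y \<in> cl k" for x y
  proof -
    have "\<bar>val u k x - val u k y\<bar> \<le> L1 * norm (G k x - G k y)" unfolding val_def using L1 G_in that by blast
    also have "\<dots> \<le> L1 * (1 / pm.c * norm (x - y))"
      using pm.G_lipschitz[OF that] pos(1) unfolding G_eq[OF assms(2)] by (rule mult_left_mono)
    also have "\<dots> = (L1 * (1 / pm.c)) * norm (x - y)" by simp
    also have "\<dots> \<le> M * norm (x - y)" using pos by (intro mult_right_mono) (auto simp: M_def)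
    finally show ?thesis .
  qed
  moreover have "\<bar>val u k x\<bar> \<le> M" for x using B[of "G k x"] pos by (simp add: val_def M_def)
  ultimately show ?thesis by (intro exI[of _ M] conjI ballI allI)
qed

lemma val_continuous: "u \<in> Vpw D \<Longrightarrow> k \<in> K \<Longrightarrow> continuous_on (cl k) (val u k)"
  unfolding val_def
  by (rule continuous_on_compose2[OF spline_patch.tensor_splines_continuous[OF spline_patch pull(1)] G_continuous])
     (assumption | rule image_subsetI, erule G_in)+

section \<open>Conforming functions are the weakly differentiable ones\<close>

lemma conforming_consistent:
  assumes "conforming u" "k1 \<in> K" "k2 \<in> K" "x \<in> cl k1" "x \<in> cl k2"
  shows "val u k1 x = val u k2 x"
proof (cases "k1 = k2")
  case False
  have x: "x \<in> cl k1 \<inter> cl k2" using assms(4,5) by simp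
  then have "cl k1 \<inter> cl k2 \<noteq> {}" by (metis emptyE)
  with cl_Int[OF assms(2,3) False]
  have "(\<exists>v \<in> patch_vertices D k1 \<inter> patch_vertices D k2. cl k1 \<inter> cl k2 = {v}) \<or> cl k1 \<inter> cl k2 \<in> patch_edges D k1 \<inter> patch_edges D k2"
    by simp
  then show ?thesis
  proof
    assume "\<exists>v \<in> patch_vertices D k1 \<inter> patch_vertices D k2. cl k1 \<inter> cl k2 = {v}"
    then obtain v where v: "v \<in> patch_vertices D k1" "cl k1 \<inter> cl k2 = {v}" by blast
    have vx: "v = x" using x unfolding v(2) by simp
    have V: "x \<in> vertices D" using v(1) assms(2) unfolding vx vertices_def by blast
    then have "k1 \<in> vertex_patches D x" "k2 \<in> vertex_patches D x" using vertex_in_cl assms by blast+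
    then show ?thesis using assms(1) V unfolding conforming_def vertex_matched_def by blast
  next
    assume e: "cl k1 \<inter> cl k2 \<in> patch_edges D k1 \<inter> patch_edges D k2"
    define e' where "e' = cl k1 \<inter> cl k2"
    have "interior_edge D e'" "edge_patches D e' = {k1, k2}" using common_edge_interior[OF assms(2,3) False] e unfolding e'_def by blast+
    moreover have "x \<in> e'" using x unfolding e'_def .
    ultimately show ?thesis using assms(1) unfolding conforming_def edge_matched_def by blast
  qed
qed simp

text \<open>A conforming function is Lipschitz along segments inside the domain: cut a segment into the closed sets
where it runs in a given patch. It is differentiable except at images of knot lines, a null set.\<close>

lemma conforming_imp_H1:
  assumes u: "u \<in> Vpw D" and c: "conforming u"
  shows "u \<in> H1_on (Omega D)"
proof -
  \<comment> \<open>the continuous representative; the choice of the patch does not matter\<close>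
  define w where "w x = (if x \<in> Omega D then val u (SOME k. k \<in> K \<and> x \<in> cl k) x else 0)" for x
  have w: "w x = val u k x" if "x \<in> Omega D" "k \<in> K" "x \<in> cl k" for x k
  proof -
    define \<kappa> where "\<kappa> = (SOME k. k \<in> K \<and> x \<in> cl k)"
    have \<kappa>: "\<kappa> \<in> K" "x \<in> cl \<kappa>"
      using someI[of "\<lambda>k. k \<in> K \<and> x \<in> cl k", OF conjI[OF that(2,3)]] unfolding \<kappa>_def by simp_all
    have "w x = val u \<kappa> x" using that(1) by (simp only: w_def \<kappa>_def if_True)
    then show ?thesis using conforming_consistent[OF c \<kappa>(1) that(2) \<kappa>(2) that(3)] by simp
  qed
  have ex: "\<exists>k\<in>K. x \<in> cl k" if "x \<in> Omega D" for x using Omega_subset that by blast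
  have "\<forall>k\<in>K. \<exists>L. 0 \<le> L \<and> (\<forall>x\<in>sq_closed. \<forall>y\<in>sq_closed. \<bar>pull k u x - pull k u y\<bar> \<le> L * norm (x - y)) \<and>
    (\<forall>x\<in>cl k. \<forall>y\<in>cl k. \<bar>val u k x - val u k y\<bar> \<le> L * norm (x - y)) \<and> (\<forall>x. \<bar>val u k x\<bar> \<le> L)"
    by (rule ballI) (rule val_regular[OF u])
  from bchoice[OF this] obtain L where L0: "\<forall>k\<in>K. 0 \<le> L k \<and> (\<forall>x\<in>sq_closed. \<forall>y\<in>sq_closed. \<bar>pull k u x - pull k u y\<bar> \<le> L k * norm (x - y)) \<and>
    (\<forall>x\<in>cl k. \<forall>y\<in>cl k. \<bar>val u k x - val u k y\<bar> \<le> L k * norm (x - y)) \<and> (\<forall>x. \<bar>val u k x\<bar> \<le> L k)" by (rule exE)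
  have L1: "0 \<le> L k" if "k \<in> K" for k using bspec[OF L0 that] by (rule conjunct1)
  have L2: "\<bar>val u k x - val u k y\<bar> \<le> L k * norm (x - y)" if "k \<in> K" "x \<in> cl k" "y \<in> cl k" for k x y
    using bspec[OF bspec[OF conjunct1[OF conjunct2[OF conjunct2[OF bspec[OF L0 that(1)]]]] that(2)] that(3)] .
  have L3: "\<bar>val u k x\<bar> \<le> L k" if "k \<in> K" for k x
    using conjunct2[OF conjunct2[OF conjunct2[OF bspec[OF L0 that]]]] by (rule spec)
  note L = L1 L2 L3
  define M where "M = (\<Sum>k\<in>K. L k)"
  have LM: "L k \<le> M" if "k \<in> K" for k unfolding M_def by (rule member_le_sum) (use that L finite_K in auto)
  have M0: "0 \<le> M" unfolding M_def by (rule sum_nonneg) (rule L(1))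
  have lip: "\<bar>w x - w y\<bar> \<le> M * norm (x - y)" if seg: "closed_segment x y \<subseteq> Omega D" for x y
  proof -
    let ?\<gamma> = "\<lambda>t. x + t *\<^sub>R (y - x)"
    have \<gamma>O: "?\<gamma> t \<in> Omega D" if "t \<in> {0..1}" for t
    proof -
      have "?\<gamma> t = (1 - t) *\<^sub>R x + t *\<^sub>R y" by (simp add: algebra_simps)
      then have "?\<gamma> t \<in> closed_segment x y" using that unfolding closed_segment_def by auto
      then show ?thesis using seg by blast
    qed
    have "(M * norm (y - x))-lipschitz_on {0..1} (w \<circ> ?\<gamma>)"
    proof (rule lipschitz_on_closed_Union[where I = K and U = "\<lambda>k. {t \<in> {0..1}. ?\<gamma> t \<in> cl k}"])
      fix k assume k: "k \<in> K"
      have "closed (cl k)" using compact_cl[OF k] by (rule compact_imp_closed)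
      then have "closed ({0..1} \<inter> ?\<gamma> -` cl k)"
        by (intro continuous_closed_preimage) (auto intro!: continuous_intros)
      then show "closed {t \<in> {0..1}. ?\<gamma> t \<in> cl k}" by (simp add: Int_def vimage_def)
      show "(M * norm (y - x))-lipschitz_on {t \<in> {0..1}. ?\<gamma> t \<in> cl k} (w \<circ> ?\<gamma>)"
      proof (rule lipschitz_onI)
        fix s t assume st: "s \<in> {t \<in> {0..1}. ?\<gamma> t \<in> cl k}" "t \<in> {t \<in> {0..1}. ?\<gamma> t \<in> cl k}"
        then have "\<bar>w (?\<gamma> s) - w (?\<gamma> t)\<bar> = \<bar>val u k (?\<gamma> s) - val u k (?\<gamma> t)\<bar>" using w[OF \<gamma>O k] by simp
        also have "\<dots> \<le> L k * norm (?\<gamma> s - ?\<gamma> t)" using L(2)[OF k] st by blast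
        also have "?\<gamma> s - ?\<gamma> t = (s - t) *\<^sub>R (y - x)" by (simp add: algebra_simps)
        also have "L k * norm ((s - t) *\<^sub>R (y - x)) \<le> M * norm ((s - t) *\<^sub>R (y - x))" using LM[OF k] by (rule mult_right_mono) simp
        finally show "dist ((w \<circ> ?\<gamma>) s) ((w \<circ> ?\<gamma>) t) \<le> M * norm (y - x) * dist s t" by (simp add: dist_real_def mult_ac)
      qed (use M0 in simp)
    next
      show "{0..1} \<subseteq> (\<Union>k\<in>K. {t \<in> {0..1}. ?\<gamma> t \<in> cl k})"
      proof
        fix t :: real assume t: "t \<in> {0..1}"
        obtain k where "k \<in> K" "?\<gamma> t \<in> cl k" using ex[OF \<gamma>O[OF t]] by (rule bexE)
        then show "t \<in> (\<Union>k\<in>K. {t \<in> {0..1}. ?\<gamma> t \<in> cl k})" using t by (intro UN_I[of k] CollectI conjI)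
      qed
    qed (use finite_K M0 in auto)
    then have "dist ((w \<circ> ?\<gamma>) 0) ((w \<circ> ?\<gamma>) 1) \<le> M * norm (y - x) * dist (0::real) 1" by (rule lipschitz_onD) auto
    then show ?thesis by (simp add: dist_real_def norm_minus_commute)
  qed
  have wb: "\<bar>w x\<bar> \<le> M" for x
  proof (cases "x \<in> Omega D")
    case True
    then obtain k where k: "k \<in> K" "x \<in> cl k" using ex by blast
    show ?thesis using w[OF True k] L(3)[OF k(1), of x] LM[OF k(1)] by simp
  qed (simp add: w_def M0)
  have wc: "continuous_on (Omega D) w"
  proof (rule continuous_at_imp_continuous_on, rule ballI)
    fix x assume x: "x \<in> Omega D"
    then obtain e where e: "e > 0" "ball x e \<subseteq> Omega D" using Omega_props(1) by (auto simp: open_contains_ball)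
    have "M-lipschitz_on (ball x e) w"
    proof (rule lipschitz_onI[OF _ M0])
      fix a b assume "a \<in> ball x e" "b \<in> ball x e"
      then have "closed_segment a b \<subseteq> ball x e" by (simp add: closed_segment_subset)
      then show "dist (w a) (w b) \<le> M * dist a b" using lip[of a b] e(2) by (simp add: dist_norm)
    qed
    then have "continuous_on (ball x e) w" by (rule lipschitz_on_continuous_on)
    then show "isCont w x" using e(1) by (simp add: continuous_on_eq_continuous_at)
  qed
  have wm: "w \<in> borel_measurable borel"
  proof -
    have "(\<lambda>x. indicator (Omega D) x *\<^sub>R w x) \<in> borel_measurable borel"
      using Omega_props(1) wc by (intro borel_measurable_continuous_on_indicator) auto
    moreover have "(\<lambda>x. indicator (Omega D) x *\<^sub>R w x) = w" by (auto simp: w_def indicator_def fun_eq_iff)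
    ultimately show ?thesis by simp
  qed
  \<comment> \<open>the boundary of the square is included, so that the complement consists of points inside patches\<close>
  define lines where "lines k = sq_closed \<inter> ({x. fst x \<in> spline_patch.breaks D k \<union> {0, 1}} \<union> {x. snd x \<in> spline_patch.breaks D k \<union> {0, 1}})" for k
  define N where "N = (\<Union>k\<in>K. F k ` lines k)"
  have negN: "negligible N" unfolding N_def
  proof (rule negligible_UN_finite[OF finite_K])
    fix k assume k: "k \<in> K"
    interpret sp: spline_patch D k using k by (rule spline_patch)
    have "negligible {x :: real \<times> real. x \<bullet> (1, 0) = a}" "negligible {x :: real \<times> real. x \<bullet> (0, 1) = a}" for a
      by (auto intro!: negligible_standard_hyperplane simp: Basis_prod_def)
    then have "negligible (\<Union>a\<in>sp.breaks \<union> {0, 1}. {x :: real \<times> real. x \<bullet> (1, 0) = a} \<union> {x. x \<bullet> (0, 1) = a})"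
      using sp.finite_breaks by (intro negligible_UN_finite negligible_Un) auto
    moreover have "lines k \<subseteq> (\<Union>a\<in>sp.breaks \<union> {0, 1}. {x :: real \<times> real. x \<bullet> (1, 0) = a} \<union> {x. x \<bullet> (0, 1) = a})"
      unfolding lines_def by (auto simp: inner_prod_def)
    ultimately have "negligible (lines k)" by (rule negligible_subset)
    then show "negligible (F k ` lines k)" by (rule patch_map.negligible_image[OF patch_map[OF k]]) (simp add: lines_def)
  qed
  have offN: "\<exists>k\<in>K. x \<in> patch D k \<and> fst (G k x) \<notin> spline_patch.breaks D k \<and> snd (G k x) \<notin> spline_patch.breaks D k"
    if x: "x \<in> Omega D" "x \<notin> N" for x
  proof -
    obtain k where k: "k \<in> K" "x \<in> cl k" using ex x(1) by blast
    have q: "G k x \<in> sq_closed" "F k (G k x) = x" using G_in[OF k(2)] F_G[OF k(2)] .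
    have "G k x \<notin> lines k"
    proof
      assume "G k x \<in> lines k"
      then have "F k (G k x) \<in> F k ` lines k" by (rule imageI)
      then show False using x(2) k(1) unfolding q(2) N_def by blast
    qed
    then have "fst (G k x) \<notin> spline_patch.breaks D k \<union> {0, 1}" "snd (G k x) \<notin> spline_patch.breaks D k \<union> {0, 1}"
      using q(1) unfolding lines_def by blast+
    moreover from this have "G k x \<in> sq_open" using sq_boundary[of "G k x"] q(1) by blast
    then have "F k (G k x) \<in> patch D k" unfolding patch_def by (rule imageI)
    ultimately show ?thesis using k(1) unfolding q(2) by blast
  qed
  have AEN: "AE x in lebesgue. x \<notin> N" using negN by (simp add: negligible_iff_null_sets AE_not_in)
  have uw: "u x = w x" if xx: "x \<in> Omega D" "x \<notin> N" for x
  proof -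
    obtain k where k: "k \<in> K" "x \<in> patch D k" using offN[OF xx] by blast
    have "x \<in> cl k" by (rule subsetD[OF patch_subset k(2)])
    then show ?thesis using w[OF xx(1) k(1)] Vpw_on_patch[OF u k] by (simp add: val_def)
  qed
  have conv: "AE x in lebesgue. x \<in> Omega D \<longrightarrow>
       convergent (\<lambda>n. (w (x + inverse (real (Suc n)) *\<^sub>R b) - w x) / inverse (real (Suc n)))" for b
    using AEN
  proof eventually_elim
    case (elim x)
    show ?case
    proof
      assume x: "x \<in> Omega D"
      obtain k where k: "k \<in> K" "x \<in> patch D k" "fst (G k x) \<notin> spline_patch.breaks D k" "snd (G k x) \<notin> spline_patch.breaks D k"
        using offN[OF x elim] by blast
      interpret sp: spline_patch D k using k(1) by (rule spline_patch)
      interpret pm: patch_map "F k" using k(1) by (rule patch_map)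
      have "pull k u differentiable (at (G k x))"
        using sp.tensor_splines_regular[OF pull(1)[OF u k(1)]] G_patch[OF k(1,2)] k(3,4) by blast
      moreover have "G k differentiable (at x)" using pm.G_differentiable k(2) unfolding G_eq[OF k(1)] patch_def by blast
      ultimately have "(pull k u \<circ> G k) differentiable (at x)" by (intro differentiable_chain_at)
      then obtain f' where "((pull k u \<circ> G k) has_derivative f') (at x)" unfolding differentiable_def by blast
      then have "(w has_derivative f') (at x)"
      proof (rule has_derivative_transform_within_open[OF _ open_patch[OF k(1)] k(2)])
        fix y assume y: "y \<in> patch D k"
        have "y \<in> Omega D" "y \<in> cl k" by (rule subsetD[OF patch_subset_Omega[OF k(1)] y], rule subsetD[OF patch_subset y])
        then show "(pull k u \<circ> G k) y = w y" using w[OF _ k(1)] by (simp add: val_def)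
      qed
      then have wd: "w differentiable (at x)" unfolding differentiable_def by blast
      have "(\<lambda>n. (w (x + inverse (real (Suc n)) *\<^sub>R b) - w x) / inverse (real (Suc n))) \<longlonglongrightarrow> frechet_derivative w (at x) b"
        by (rule difference_quotient_tendsto[OF wd LIMSEQ_inverse_real_of_nat]) simp
      then show "convergent (\<lambda>n. (w (x + inverse (real (Suc n)) *\<^sub>R b) - w x) / inverse (real (Suc n)))"
        by (rule convergentI)
    qed
  qed
  have uL2: "u \<in> L2_on (Omega D)" using u by (rule Vpw_D(1))
  have "\<exists>g\<in>L2_on (Omega D). weak_partial (Omega D) b u g" if b: "b \<in> Basis" for b
  proof -
    have "\<exists>g\<in>L2_on (Omega D). weak_partial (Omega D) b w g"
      by (rule weak_partial_if_lipschitz[OF Omega_props(1,2) wm _ wb lip conv]) (simp add: w_def)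
    then obtain g where g: "g \<in> L2_on (Omega D)" "weak_partial (Omega D) b w g" by blast
    have "weak_partial (Omega D) b u g"
      unfolding weak_partial_def
    proof
      fix \<phi> assume \<phi>: "\<phi> \<in> test_functions (Omega D)"
      have md: "(\<lambda>x. frechet_derivative \<phi> (at x) b) \<in> borel_measurable lebesgue"
        using test_functions_D(3)[OF \<phi> b] by (rule continuous_imp_lebesgue_measurable)
      have mu: "(\<lambda>x. indicat_real (Omega D) x * u x) \<in> borel_measurable lebesgue"
        using uL2 by (simp add: L2_on_def set_borel_measurable_def)
      have mw: "(\<lambda>x. indicat_real (Omega D) x * w x) \<in> borel_measurable lebesgue"
        using Omega_props(1) by (intro borel_measurable_times borel_measurable_indicator borel_imp_lebesgue_measurable[OF wm]) auto
      have "(LINT x|lebesgue. (indicat_real (Omega D) x * u x) * frechet_derivative \<phi> (at x) b) =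
         (LINT x|lebesgue. (indicat_real (Omega D) x * w x) * frechet_derivative \<phi> (at x) b)"
      proof (rule integral_cong_AE)
        show "AE x in lebesgue. (indicat_real (Omega D) x * u x) * frechet_derivative \<phi> (at x) b =
           (indicat_real (Omega D) x * w x) * frechet_derivative \<phi> (at x) b"
          using AEN by eventually_elim (use uw in \<open>auto simp: indicator_def\<close>)
      qed (rule borel_measurable_times[OF mu md], rule borel_measurable_times[OF mw md])
      then show "(LINT x:Omega D|lebesgue. u x * frechet_derivative \<phi> (at x) b) = - (LINT x:Omega D|lebesgue. g x * \<phi> x)"
        using g(2) \<phi> unfolding weak_partial_def set_lebesgue_integral_def by (simp add: mult.assoc)
    qed
    then show ?thesis using g(1) by blast
  qed
  then show ?thesis using uL2 by (simp add: H1_on_def)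
qed

text \<open>The trace at \<open>x0\<close> is approximated on discs that shrink towards \<open>x0\<close> inside the patch with radius
proportional to their distance from it, also when \<open>x0\<close> is a boundary point. In the square, contract the
inscribed disc towards the preimage of \<open>x0\<close>; the patch map is Lipschitz in both directions.\<close>

lemma patch_balls:
  assumes u: "u \<in> Vpw D" and k: "k \<in> K" and x0: "x0 \<in> cl k"
  shows "\<exists>c>0. \<exists>C\<ge>0. \<exists>L\<ge>0. \<forall>\<rho>. 0 < \<rho> \<and> \<rho> < 1 \<longrightarrow> (\<exists>y. norm (y - x0) \<le> C * \<rho> \<and>
    (\<forall>x\<in>ball y (c * \<rho>). \<bar>u x - val u k x0\<bar> \<le> L * \<rho>))"
proof -
  interpret pm: patch_map "F k" using k by (rule patch_map)
  obtain L where L: "0 \<le> L" "\<And>x y. x \<in> sq_closed \<Longrightarrow> y \<in> sq_closed \<Longrightarrow> \<bar>pull k u x - pull k u y\<bar> \<le> L * norm (x - y)"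
    using val_regular[OF u k] by (elim exE conjE) (rule that, assumption, (drule (1) bspec)+, assumption)
  obtain M where M: "0 < M" "\<And>x y. x \<in> sq_closed \<Longrightarrow> y \<in> sq_closed \<Longrightarrow> norm (F k x - F k y) \<le> M * norm (x - y)"
    using pm.F_lipschitz by blast
  define p where "p = G k x0"
  have p: "p \<in> sq_closed" "F k p = x0" unfolding p_def using G_in[OF x0] F_G[OF x0] .
  define m :: "real \<times> real" where "m = (1 / 2, 1 / 2)"
  have m: "m \<in> sq_closed" by (simp add: m_def sq_closed_def)
  have half: "ball m (1 / 2) \<subseteq> sq_open"
  proof
    fix z assume "z \<in> ball m (1 / 2)"
    then have "dist (1 / 2) (fst z) < 1 / 2" "dist (1 / 2) (snd z) < 1 / 2"
      using dist_fst_le[of m z] dist_snd_le[of m z] by (simp_all add: m_def)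
    then have "0 < fst z \<and> fst z < 1 \<and> 0 < snd z \<and> snd z < 1" unfolding dist_real_def abs_less_iff by linarith
    then show "z \<in> sq_open" by (simp add: sq_open_def mem_Times_iff)
  qed
  show ?thesis
  proof (rule exI[of _ "pm.c / 2"], intro conjI, use pm.c(1) in simp, rule exI[of _ "M * norm (m - p)"], intro conjI, use M(1) in simp,
      rule exI[of _ "L * (norm (m - p) + 1 / 2)"], intro conjI, use L(1) in simp, intro allI impI, elim conjE)
    fix \<rho> :: real assume \<rho>: "0 < \<rho>" "\<rho> < 1"
    define q where "q = p + \<rho> *\<^sub>R (m - p)"
    have sub: "ball q (\<rho> / 2) \<subseteq> sq_open"
    proof
      fix z assume z: "z \<in> ball q (\<rho> / 2)"
      define z' where "z' = m + (1 / \<rho>) *\<^sub>R (z - q)"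
      have "norm ((1 / \<rho>) *\<^sub>R (z - q)) < 1 / 2" using z \<rho> by (simp add: dist_norm norm_minus_commute divide_less_eq)
      then have "z' \<in> ball m (1 / 2)" by (simp add: z'_def dist_norm)
      then have z': "z' \<in> sq_open" using half by blast
      have "z = (1 - \<rho>) *\<^sub>R p + \<rho> *\<^sub>R z'" using \<rho> by (simp add: z'_def q_def algebra_simps)
      moreover have "0 < (1 - \<rho>) * a + \<rho> * b \<and> (1 - \<rho>) * a + \<rho> * b < 1" if "0 \<le> a" "a \<le> 1" "0 < b" "b < 1" for a b
      proof -
        have "0 \<le> (1 - \<rho>) * a" "(1 - \<rho>) * a \<le> 1 - \<rho>" "0 < \<rho> * b" "\<rho> * b < \<rho>"
          using \<rho> that by (simp_all add: mult_left_le)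
        then have "0 < (1 - \<rho>) * a + \<rho> * b" "(1 - \<rho>) * a + \<rho> * b < 1" by linarith+
        then show ?thesis ..
      qed
      ultimately show "z \<in> sq_open" using z' p(1) by (cases p; cases z') (auto simp: sq_open_def sq_closed_def)
    qed
    have qin: "q \<in> sq_closed" using sub \<rho> sq_basic(4) by (meson centre_in_ball half_gt_zero subsetD)
    have np: "norm (q - p) = \<rho> * norm (m - p)" using \<rho> by (simp add: q_def)
    show "\<exists>y. norm (y - x0) \<le> M * norm (m - p) * \<rho> \<and> (\<forall>x\<in>ball y (pm.c / 2 * \<rho>). \<bar>u x - val u k x0\<bar> \<le> L * (norm (m - p) + 1 / 2) * \<rho>)"
    proof (rule exI[of _ "F k q"], intro conjI ballI)
      show "norm (F k q - x0) \<le> M * norm (m - p) * \<rho>"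
        using M(2)[OF qin p(1)] unfolding p(2) np by (simp add: mult_ac)
      fix x assume "x \<in> ball (F k q) (pm.c / 2 * \<rho>)"
      then have "x \<in> ball (F k q) (pm.c * (\<rho> / 2))" by simp
      then have "x \<in> F k ` ball q (\<rho> / 2)" using pm.ball_subset_image[OF sub] \<rho>(1) by (meson half_gt_zero subsetD)
      then obtain z where z: "z \<in> ball q (\<rho> / 2)" "x = F k z" by blast
      have zo: "z \<in> sq_open" using z(1) sub by blast
      have "\<bar>u x - val u k x0\<bar> = \<bar>pull k u z - pull k u p\<bar>"
        unfolding z(2) pull(2)[OF u k zo] val_def p_def ..
      also have "\<dots> \<le> L * norm (z - p)" using L(2) zo p(1) sq_basic(4) by blast
      also have "\<dots> \<le> L * (\<rho> / 2 + \<rho> * norm (m - p))"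
      proof (rule mult_left_mono[OF _ L(1)])
        have "norm (z - p) \<le> norm (z - q) + norm (q - p)" using norm_triangle_ineq[of "z - q" "q - p"] by simp
        then show "norm (z - p) \<le> \<rho> / 2 + \<rho> * norm (m - p)" using z(1) unfolding np by (simp add: dist_norm norm_minus_commute)
      qed
      finally show "\<bar>u x - val u k x0\<bar> \<le> L * (norm (m - p) + 1 / 2) * \<rho>" by (simp add: algebra_simps)
    qed
  qed
qed

lemma H1_traces_agree:
  assumes u: "u \<in> Vpw D" "u \<in> H1_on (Omega D)" and x0: "x0 \<in> Omega D"
    and k: "k1 \<in> K" "k2 \<in> K" "x0 \<in> cl k1" "x0 \<in> cl k2"
  shows "val u k1 x0 = val u k2 x0"
proof -
  obtain c1 C1 L1 where 1: "c1 > 0" "C1 \<ge> 0" "L1 \<ge> 0" "\<And>\<rho>. 0 < \<rho> \<Longrightarrow> \<rho> < 1 \<Longrightarrow> \<exists>y. norm (y - x0) \<le> C1 * \<rho> \<and>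
    (\<forall>x\<in>ball y (c1 * \<rho>). \<bar>u x - val u k1 x0\<bar> \<le> L1 * \<rho>)"
    using patch_balls[OF u(1) k(1,3)] by blast
  obtain c2 C2 L2 where 2: "c2 > 0" "C2 \<ge> 0" "L2 \<ge> 0" "\<And>\<rho>. 0 < \<rho> \<Longrightarrow> \<rho> < 1 \<Longrightarrow> \<exists>y. norm (y - x0) \<le> C2 * \<rho> \<and>
    (\<forall>x\<in>ball y (c2 * \<rho>). \<bar>u x - val u k2 x0\<bar> \<le> L2 * \<rho>)"
    using patch_balls[OF u(1) k(2,4)] by blast
  have *: "\<exists>y1 y2. norm (y1 - x0) \<le> max C1 C2 * \<rho> \<and> norm (y2 - x0) \<le> max C1 C2 * \<rho> \<and>
       (\<forall>x\<in>ball y1 (min c1 c2 * \<rho>). \<bar>u x - val u k1 x0\<bar> \<le> max L1 L2 * \<rho>) \<and> (\<forall>x\<in>ball y2 (min c1 c2 * \<rho>). \<bar>u x - val u k2 x0\<bar> \<le> max L1 L2 * \<rho>)"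
    if \<rho>: "0 < \<rho>" "\<rho> < 1" for \<rho>
  proof -
    obtain y1 where y1: "norm (y1 - x0) \<le> C1 * \<rho>" "\<And>x. x \<in> ball y1 (c1 * \<rho>) \<Longrightarrow> \<bar>u x - val u k1 x0\<bar> \<le> L1 * \<rho>" using 1(4)[OF \<rho>] by blast
    obtain y2 where y2: "norm (y2 - x0) \<le> C2 * \<rho>" "\<And>x. x \<in> ball y2 (c2 * \<rho>) \<Longrightarrow> \<bar>u x - val u k2 x0\<bar> \<le> L2 * \<rho>" using 2(4)[OF \<rho>] by blast
    have m: "C1 * \<rho> \<le> max C1 C2 * \<rho>" "C2 * \<rho> \<le> max C1 C2 * \<rho>" "L1 * \<rho> \<le> max L1 L2 * \<rho>" "L2 * \<rho> \<le> max L1 L2 * \<rho>"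
      "min c1 c2 * \<rho> \<le> c1 * \<rho>" "min c1 c2 * \<rho> \<le> c2 * \<rho>" using \<rho>(1) by (auto intro!: mult_right_mono)
    show ?thesis
    proof (rule exI[of _ y1], rule exI[of _ y2], intro conjI ballI)
      show "norm (y1 - x0) \<le> max C1 C2 * \<rho>" "norm (y2 - x0) \<le> max C1 C2 * \<rho>" using y1(1) y2(1) m by linarith+
      fix x assume "x \<in> ball y1 (min c1 c2 * \<rho>)"
      then have "x \<in> ball y1 (c1 * \<rho>)" using m(5) by simp
      then show "\<bar>u x - val u k1 x0\<bar> \<le> max L1 L2 * \<rho>" using y1(2) m(3) by fastforce
    next
      fix x assume "x \<in> ball y2 (min c1 c2 * \<rho>)"
      then have "x \<in> ball y2 (c2 * \<rho>)" using m(6) by simp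
      then show "\<bar>u x - val u k2 x0\<bar> \<le> max L1 L2 * \<rho>" using y2(2) m(4) by fastforce
    qed
  qed
  have "0 < min c1 c2" "0 \<le> max C1 C2" using 1(1,2) 2(1,2) by auto
  from H1_no_jump[OF Omega_props(1,2) u(2) x0 this zero_less_one *] show ?thesis by blast
qed

text \<open>By invariance of domain the edge parametrization maps the open rectangle to an open set.\<close>

lemma edge_frame_interior:
  assumes "edge_frame D e km kp Fe" "0 < s" "s < 1"
  shows "Fe (s, 0) \<in> Omega D"
proof -
  let ?X = "closure (patch D km) \<union> closure (patch D kp)"
  have kk: "km \<in> K" "kp \<in> K" using assms(1) by (auto simp: edge_frame_def edge_patches_def)
  have h: "homeomorphism edge_rect (closure (interior ?X)) Fe (inv_into edge_rect Fe)" using assms(1) by (simp add: edge_frame_def)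
  let ?T = "{0<..<1} \<times> {-1<..<1} :: (real \<times> real) set"
  have sub: "?T \<subseteq> edge_rect" by (auto simp: edge_rect_def)
  have "inj_on Fe edge_rect" using h unfolding homeomorphism_def by (metis inj_onI)
  moreover have "continuous_on edge_rect Fe" using h by (simp add: homeomorphism_def)
  ultimately have "open (Fe ` ?T)" using sub
    by (intro invariance_of_domain) (auto intro: continuous_on_subset inj_on_subset open_Times)
  moreover have "Fe ` ?T \<subseteq> (\<Union>k\<in>K. closure (patch D k))"
  proof -
    have "Fe ` ?T \<subseteq> Fe ` edge_rect" using sub by (rule image_mono)
    also have "Fe ` edge_rect = closure (interior ?X)" using h by (simp add: homeomorphism_def)
    also have "closure (interior ?X) \<subseteq> ?X" by (rule closure_minimal[OF interior_subset]) (intro closed_Un closed_closure)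
    also have "?X \<subseteq> (\<Union>k\<in>K. closure (patch D k))" using kk by blast
    finally show ?thesis .
  qed
  ultimately have "Fe ` ?T \<subseteq> Omega D" unfolding Omega_def by (rule interior_maximal[rotated])
  moreover have "Fe (s, 0) \<in> Fe ` ?T" using assms(2,3) by (intro imageI) auto
  ultimately show ?thesis by (rule subsetD)
qed

text \<open>Inner points of an edge lie in the domain, so the traces agree there and by continuity on the whole edge.
From edges agreement passes to vertices along the patches around the vertex.\<close>

lemma H1_imp_conforming:
  assumes u: "u \<in> Vpw D" "u \<in> H1_on (Omega D)"
  shows "conforming u"
proof -
  have e: "edge_matched e u" if ie: "interior_edge D e" for e
  proof -
    obtain km kp Fe where fr: "edge_frame D e km kp Fe" using spline_assms ie unfolding spline_assumptions_def by blast
    have kk: "km \<in> K" "kp \<in> K" and ep: "edge_patches D e = {km, kp}" using fr by (auto simp: edge_frame_def edge_patches_def)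
    have eF: "Fe ` ({0..1} \<times> {0}) = e" using fr by (simp add: edge_frame_def)
    have "km \<in> edge_patches D e" "kp \<in> edge_patches D e" unfolding ep by simp_all
    then have "e \<subseteq> frontier (patch D km)" "e \<subseteq> frontier (patch D kp)" by (simp_all add: edge_patches_def)
    then have ecl: "e \<subseteq> cl km" "e \<subseteq> cl kp" using frontier_subset_cl[OF kk(1)] frontier_subset_cl[OF kk(2)] by (simp_all only: subset_trans)
    have cFe: "continuous_on edge_rect Fe" using fr by (auto simp: edge_frame_def homeomorphism_def)
    have c\<gamma>: "continuous_on {0..1} (\<lambda>s. Fe (s, 0))"
      by (intro continuous_on_compose2[OF cFe] continuous_intros) (auto simp: edge_rect_def)
    have in_e: "Fe (s, 0) \<in> e" if "s \<in> {0..1}" for s unfolding eF[symmetric] using that by (intro imageI) auto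
    let ?d = "\<lambda>s. val u km (Fe (s, 0)) - val u kp (Fe (s, 0))"
    have "continuous_on {0..1} ?d"
      by (intro continuous_on_diff continuous_on_compose2[OF val_continuous[OF u(1) kk(1)] c\<gamma>] continuous_on_compose2[OF val_continuous[OF u(1) kk(2)] c\<gamma>])
         (use in_e ecl in blast)+
    moreover have "closure {0<..<1} = {0..1 :: real}" by simp
    ultimately have cd: "continuous_on (closure {0<..<1}) ?d" by simp
    have d0: "?d s = 0" if "s \<in> {0..1}" for s
    proof (rule continuous_constant_on_closure[OF cd])
      fix s :: real assume s: "s \<in> {0<..<1}"
      have "Fe (s, 0) \<in> e" using s by (intro in_e) auto
      then show "?d s = 0"
        using H1_traces_agree[OF u edge_frame_interior[OF fr, of s] kk] s ecl by auto
    qed (use that in simp)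
    have "val u km x = val u kp x" if xe: "x \<in> e" for x
    proof -
      have "x \<in> Fe ` ({0..1} \<times> {0})" using xe unfolding eF .
      then obtain z where z: "z \<in> {0..1} \<times> {0}" "x = Fe z" by blast
      then have "z = (fst z, 0)" "fst z \<in> {0..1}" by (auto simp: prod_eq_iff)
      then show ?thesis using d0[of "fst z"] z(2) by simp
    qed
    then show ?thesis unfolding edge_matched_def ep by auto
  qed
  moreover have "vertex_matched v u" if v: "v \<in> vertices D" for v
    unfolding vertex_matched_def
  proof (intro ballI)
    fix k k' assume k: "k \<in> vertex_patches D v" "k' \<in> vertex_patches D v"
    have step: "val u j v = val u j' v"
      if "interior_edge D a" "v \<in> a" "j \<in> edge_patches D a" "j' \<in> edge_patches D a" for a j j'
      using e[OF that(1)] that(2-4) unfolding edge_matched_def by blast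
    show "val u k v = val u k' v"
      by (rule vertex_patches_linked[where f = "\<lambda>k. val u k v", OF v step k])
  qed
  ultimately show ?thesis by (simp add: conforming_def)
qed

lemma Vh_iff: "u \<in> Vh D \<longleftrightarrow> u \<in> Vpw D \<and> conforming u"
  unfolding Vh_def using H1_imp_conforming conforming_imp_H1 by blast

end

section \<open>Moments of tensor products\<close>

definition test_poly :: "nat \<Rightarrow> (nat \<Rightarrow> nat \<Rightarrow> real) \<Rightarrow> real \<times> real \<Rightarrow> real" where
  "test_poly r c x = (\<Sum>i<r. \<Sum>j<r. c i j * fst x ^ i * snd x ^ j)"

text \<open>Integration over the closed square allows the use of Henstock-Kurzweil integrals of continuous
functions; the open square has the same integral.\<close>

definition moments2_vanish :: "nat \<Rightarrow> (real \<times> real \<Rightarrow> real) \<Rightarrow> bool" where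
  "moments2_vanish r \<phi> \<longleftrightarrow> (\<forall>c. integral sq_closed (\<lambda>x. \<phi> x * test_poly r c x) = 0)"

lemma test_poly_continuous: "continuous_on S (test_poly r c)"
  unfolding test_poly_def by (intro continuous_intros)

lemma times_test_poly_integrable:
  "continuous_on sq_closed \<phi> \<Longrightarrow> (\<lambda>x. \<phi> x * test_poly r c x) integrable_on sq_closed"
  unfolding sq_closed_cbox by (intro integrable_continuous continuous_on_mult test_poly_continuous)

lemma moments2_vanish_lincomb:
  assumes "moments2_vanish r \<phi>" "moments2_vanish r \<psi>" "continuous_on sq_closed \<phi>" "continuous_on sq_closed \<psi>"
  shows "moments2_vanish r (\<lambda>x. a * \<phi> x + b * \<psi> x)"
  unfolding moments2_vanish_def
proof
  fix c
  have "integral sq_closed (\<lambda>x. (a * \<phi> x + b * \<psi> x) * test_poly r c x) =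
    integral sq_closed (\<lambda>x. a * (\<phi> x * test_poly r c x) + b * (\<psi> x * test_poly r c x))"
    by (simp add: distrib_right mult.assoc)
  also have "\<dots> = a * integral sq_closed (\<lambda>x. \<phi> x * test_poly r c x) + b * integral sq_closed (\<lambda>x. \<psi> x * test_poly r c x)"
    using times_test_poly_integrable[OF assms(3), of r c] times_test_poly_integrable[OF assms(4), of r c]
    by (subst integral_add) (auto intro: integrable_on_mult_right)
  finally show "integral sq_closed (\<lambda>x. (a * \<phi> x + b * \<psi> x) * test_poly r c x) = 0"
    using assms(1,2) by (simp add: moments2_vanish_def)
qed

lemma moments2_vanish_cong:
  "(\<And>x. x \<in> sq_closed \<Longrightarrow> \<phi> x = \<psi> x) \<Longrightarrow> moments2_vanish r \<phi> \<longleftrightarrow> moments2_vanish r \<psi>"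
  unfolding moments2_vanish_def by (simp cong: integral_cong)

lemma moments2_vanish_0: "moments2_vanish r (\<lambda>x. 0)" by (simp add: moments2_vanish_def)

lemma tensor_continuous:
  assumes "continuous_on {0..1} f" "continuous_on {0..1} g" shows "continuous_on sq_closed (f \<otimes>\<^sub>t g)"
  unfolding tensor_def
  by (intro continuous_on_mult continuous_on_compose2[OF assms(1)] continuous_on_compose2[OF assms(2)] continuous_intros)
     (auto simp: sq_closed_def)

lemma ip_eq_integral:
  assumes "continuous_on {0..1} f" "continuous_on {0..1} g"
  shows "ip f g = integral {0..1} (\<lambda>x. f x * g x)"
  unfolding ip_def using assms
  by (intro set_borel_integral_eq_integral borel_integrable_atLeastAtMost' continuous_on_mult)

lemma integral_tensor_monomial:
  assumes f: "continuous_on {0..1} f" and g: "continuous_on {0..1} g"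
  shows "integral sq_closed (\<lambda>x. (f \<otimes>\<^sub>t g) x * (fst x ^ i * snd x ^ j)) = ip f (\<lambda>x. x ^ i) * ip g (\<lambda>x. x ^ j)"
proof -
  have c: "continuous_on (cbox (0, 0) (1, 1)) (\<lambda>x. (f \<otimes>\<^sub>t g) x * (fst x ^ i * snd x ^ j))"
    using tensor_continuous[OF f g] unfolding sq_closed_cbox by (intro continuous_intros)
  have p: "continuous_on {0..1 :: real} (\<lambda>x. x ^ i)" "continuous_on {0..1 :: real} (\<lambda>x. x ^ j)" by (intro continuous_intros)+
  have "integral sq_closed (\<lambda>x. (f \<otimes>\<^sub>t g) x * (fst x ^ i * snd x ^ j)) =
    integral {0..1} (\<lambda>x. integral {0..1} (\<lambda>y. (f \<otimes>\<^sub>t g) (x, y) * (fst (x, y) ^ i * snd (x, y) ^ j)))"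
    unfolding sq_closed_cbox using integral_prod_continuous[OF c] by (simp add: cbox_interval)
  also have "\<dots> = integral {0..1} (\<lambda>x. (f x * x ^ i) * integral {0..1} (\<lambda>y. g y * y ^ j))"
    by (intro integral_cong) (simp add: tensor_def mult_ac flip: integral_mult_right)
  also have "\<dots> = integral {0..1} (\<lambda>x. f x * x ^ i) * integral {0..1} (\<lambda>y. g y * y ^ j)"
    by (rule integral_mult_left)
  finally show ?thesis unfolding ip_eq_integral[OF f p(1)] ip_eq_integral[OF g p(2)] .
qed

lemma moments_vanish_monomial: "moments_vanish r f \<Longrightarrow> i < r \<Longrightarrow> ip f (\<lambda>x. x ^ i) = 0"
proof -
  assume f: "moments_vanish r f" and i: "i < r"
  have "degree (monom (1::real) i) < r" using i by (simp add: degree_monom_eq)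
  then have "ip f (poly (monom 1 i)) = 0" using f unfolding moments_vanish_def by blast
  moreover have "poly (monom (1::real) i) = (\<lambda>x. x ^ i)" by (simp add: fun_eq_iff poly_monom)
  ultimately show ?thesis by simp
qed

lemma moments2_vanish_tensor:
  assumes "continuous_on {0..1} f" "continuous_on {0..1} g" "moments_vanish r f \<or> moments_vanish r g"
  shows "moments2_vanish r (f \<otimes>\<^sub>t g)"
  unfolding moments2_vanish_def
proof
  fix c
  let ?t = "\<lambda>i j x. (f \<otimes>\<^sub>t g) x * (fst x ^ i * snd x ^ j)"
  have i: "?t i j integrable_on sq_closed" for i j
    using tensor_continuous[OF assms(1,2)] unfolding sq_closed_cbox by (intro integrable_continuous continuous_intros)
  have z: "integral sq_closed (?t i j) = 0" if "i < r" "j < r" for i j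
    unfolding integral_tensor_monomial[OF assms(1,2)] using assms(3) moments_vanish_monomial that by fastforce
  have "integral sq_closed (\<lambda>x. (f \<otimes>\<^sub>t g) x * test_poly r c x) = integral sq_closed (\<lambda>x. \<Sum>i<r. \<Sum>j<r. c i j * ?t i j x)"
    by (simp add: test_poly_def sum_distrib_left mult_ac)
  also have "\<dots> = (\<Sum>i<r. integral sq_closed (\<lambda>x. \<Sum>j<r. c i j * ?t i j x))"
    by (intro integral_sum integrable_sum integrable_on_mult_right i finite_lessThan)
  also have "\<dots> = (\<Sum>i<r. \<Sum>j<r. integral sq_closed (\<lambda>x. c i j * ?t i j x))"
    by (intro sum.cong refl integral_sum integrable_on_mult_right i finite_lessThan)
  also have "\<dots> = 0" by (intro sum.neutral ballI) (simp add: z)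
  finally show "integral sq_closed (\<lambda>x. (f \<otimes>\<^sub>t g) x * test_poly r c x) = 0" .
qed

lemma flip_continuous: "continuous_on {0..1} f \<Longrightarrow> continuous_on {0..1} (flip r f)"
proof -
  assume f: "continuous_on {0..1} f"
  have "continuous_on {0..1} (\<lambda>x. f (1 - x))" by (intro continuous_on_compose2[OF f] continuous_intros) auto
  then show ?thesis using f by (cases r) (simp_all add: flip_def[abs_def])
qed

lemma flip_moments: "moments_vanish r f \<Longrightarrow> moments_vanish r (flip b f)"
  using moments_vanish_reflect[of r f] by (cases b) (simp_all add: flip_def[abs_def])

lemma square_sym_tensor_regular:
  assumes "continuous_on {0..1} f" "continuous_on {0..1} g"
  shows "continuous_on sq_closed (\<lambda>x. (f \<otimes>\<^sub>t g) (square_sym \<sigma> x))"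
    and "moments_vanish r f \<or> moments_vanish r g \<Longrightarrow> moments2_vanish r (\<lambda>x. (f \<otimes>\<^sub>t g) (square_sym \<sigma> x))"
proof -
  obtain sw r1 r2 where \<sigma>: "\<sigma> = (sw, r1, r2)" by (metis prod.exhaust)
  have e: "(\<lambda>x. (f \<otimes>\<^sub>t g) (square_sym \<sigma> x)) = (if sw then flip r2 g \<otimes>\<^sub>t flip r1 f else flip r1 f \<otimes>\<^sub>t flip r2 g)"
    unfolding \<sigma> tensor_square_sym by auto
  show "continuous_on sq_closed (\<lambda>x. (f \<otimes>\<^sub>t g) (square_sym \<sigma> x))" unfolding e
    using assms by (simp add: tensor_continuous flip_continuous)
  assume "moments_vanish r f \<or> moments_vanish r g"
  then have "moments_vanish r (flip r1 f) \<or> moments_vanish r (flip r2 g)" using flip_moments by blast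
  then show "moments2_vanish r (\<lambda>x. (f \<otimes>\<^sub>t g) (square_sym \<sigma> x))" unfolding e
    using assms by (auto intro!: moments2_vanish_tensor flip_continuous)
qed

section \<open>Linear operators on the broken space\<close>

lemma linear_op_on_comp: "linear_op_on V P \<Longrightarrow> linear_op_on V Q \<Longrightarrow> linear_op_on V (P \<circ> Q)"
  unfolding linear_op_on_def by simp

lemma linear_op_on_id: "linear_op_on V id" unfolding linear_op_on_def by simp

context multipatch_splines
begin

lemma lin_closed: "linear_op_on (Vpw D) P \<Longrightarrow> u \<in> Vpw D \<Longrightarrow> P u \<in> Vpw D"
  unfolding linear_op_on_def by blast

lemma lin_lincomb: "linear_op_on (Vpw D) P \<Longrightarrow> u \<in> Vpw D \<Longrightarrow> v \<in> Vpw D \<Longrightarrow>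
   P (\<lambda>x. a * u x + b * v x) = (\<lambda>x. a * P u x + b * P v x)"
  unfolding linear_op_on_def by blast

lemma lin_0: "linear_op_on (Vpw D) P \<Longrightarrow> P (\<lambda>x. 0) = (\<lambda>x. 0)"
  using lin_lincomb[OF _ Vpw_0 Vpw_0, of P 0 0] by simp

lemma lin_sum:
  assumes P: "linear_op_on (Vpw D) P" and "finite I" "\<And>i. i \<in> I \<Longrightarrow> f i \<in> Vpw D"
  shows "P (\<lambda>x. \<Sum>i\<in>I. c i * f i x) = (\<lambda>x. \<Sum>i\<in>I. c i * P (f i) x)"
  using assms(2,3)
proof (induction I)
  case (insert i I)
  have "P (\<lambda>x. c i * f i x + 1 * (\<Sum>i\<in>I. c i * f i x)) = (\<lambda>x. c i * P (f i) x + 1 * P (\<lambda>x. \<Sum>i\<in>I. c i * f i x) x)"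
    by (rule lin_lincomb[OF P]) (use insert in \<open>auto intro!: Vpw_sum Vpw_mult\<close>)
  then show ?case using insert by simp
qed (simp add: lin_0[OF P])

lemma decompose: assumes "u \<in> Vpw D" shows "u = (\<lambda>x. \<Sum>k\<in>K. 1 * pushfwd D k (pull k u) x)"
proof (rule Vpw_eqI[OF assms])
  note pv = pushfwd_in_Vpw[OF _ pull(1)[OF assms]]
  show "(\<lambda>x. \<Sum>k\<in>K. 1 * pushfwd D k (pull k u) x) \<in> Vpw D" by (intro Vpw_sum Vpw_mult finite_K pv)
  fix k assume k: "k \<in> K"
  have "pull k (\<lambda>x. \<Sum>k\<in>K. pushfwd D k (pull k u) x) = (\<lambda>x. \<Sum>k'\<in>K. pull k (pushfwd D k' (pull k' u)) x)"
    by (rule pull_sum[OF k finite_K]) (rule pv)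
  also have "\<dots> = (\<lambda>x. \<Sum>k'\<in>K. if k = k' then pull k u x else 0)"
    by (intro ext sum.cong refl) (simp add: pull_pushfwd[OF k _ pull(1)[OF assms]])
  also have "\<dots> = pull k u" using k finite_K by simp
  finally show "pull k u = pull k (\<lambda>x. \<Sum>k\<in>K. 1 * pushfwd D k (pull k u) x)" by simp
qed

text \<open>Local operators are specified by their values on a basis; this set collects, for one patch, everything
that they fix.\<close>

definition fixed :: "((real \<times> real \<Rightarrow> real) \<Rightarrow> real \<times> real \<Rightarrow> real) \<Rightarrow> nat \<Rightarrow> (real \<times> real \<Rightarrow> real) set" where
  "fixed P k = {\<phi> \<in> tensor_splines D k. P (pushfwd D k \<phi>) = pushfwd D k \<phi>}"

lemma fixed_lincomb:
  assumes P: "linear_op_on (Vpw D) P" and k: "k \<in> K" and "finite I" "\<And>i. i \<in> I \<Longrightarrow> f i \<in> fixed P k"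
  shows "(\<lambda>x. \<Sum>i\<in>I. c i * f i x) \<in> fixed P k"
proof -
  interpret sp: spline_patch D k using k by (rule spline_patch)
  have f: "f i \<in> tensor_splines D k" "P (pushfwd D k (f i)) = pushfwd D k (f i)" if "i \<in> I" for i
    using assms(4)[OF that] by (simp_all add: fixed_def)
  have e: "pushfwd D k (\<lambda>x. \<Sum>i\<in>I. c i * f i x) = (\<lambda>x. \<Sum>i\<in>I. c i * pushfwd D k (f i) x)"
    by (auto simp: pushfwd_def fun_eq_iff)
  have "P (pushfwd D k (\<lambda>x. \<Sum>i\<in>I. c i * f i x)) = (\<lambda>x. \<Sum>i\<in>I. c i * P (pushfwd D k (f i)) x)"
    unfolding e by (rule lin_sum[OF P assms(3)]) (rule pushfwd_in_Vpw[OF k f(1)])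
  also have "\<dots> = pushfwd D k (\<lambda>x. \<Sum>i\<in>I. c i * f i x)" unfolding e using f(2) by (intro ext sum.cong refl) simp
  finally show ?thesis unfolding fixed_def using f(1) by (auto intro!: sp.tensor_splines_sum sp.tensor_splines_mult)
qed

lemma fixed_imp_eq:
  assumes P: "linear_op_on (Vpw D) P" and u: "u \<in> Vpw D" and "\<And>k. k \<in> K \<Longrightarrow> pull k u \<in> fixed P k"
  shows "P u = u"
proof -
  have "P u = P (\<lambda>x. \<Sum>k\<in>K. 1 * pushfwd D k (pull k u) x)" using decompose[OF u] by (rule arg_cong)
  also have "\<dots> = (\<lambda>x. \<Sum>k\<in>K. 1 * P (pushfwd D k (pull k u)) x)"
    by (rule lin_sum[OF P finite_K]) (rule pushfwd_in_Vpw[OF _ pull(1)[OF u]])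
  also have "\<dots> = (\<lambda>x. \<Sum>k\<in>K. 1 * pushfwd D k (pull k u) x)"
    using assms(3) by (intro ext sum.cong refl) (simp add: fixed_def)
  also have "\<dots> = u" using decompose[OF u] by (rule sym)
  finally show ?thesis .
qed

lemma all_fixed:
  assumes P: "linear_op_on (Vpw D) P" and k: "k \<in> K" and "\<phi> \<in> tensor_splines D k"
    and "\<And>i. i \<in> {..nmax D k} \<times> {..nmax D k} \<Longrightarrow> P (Lam D k i) = Lam D k i"
  shows "\<phi> \<in> fixed P k"
proof -
  interpret sp: spline_patch D k using k by (rule spline_patch)
  obtain c where c: "\<phi> = (\<lambda>x. \<Sum>i\<le>nmax D k. \<Sum>j\<le>nmax D k. c i j * (lam D k i \<otimes>\<^sub>t lam D k j) x)"
    using assms(3) unfolding tensor_splines_def by blast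
  have e: "\<phi> = (\<lambda>x. \<Sum>z\<in>{..nmax D k} \<times> {..nmax D k}. c (fst z) (snd z) * (lam D k (fst z) \<otimes>\<^sub>t lam D k (snd z)) x)"
    unfolding c by (simp add: sum.cartesian_product case_prod_beta)
  show ?thesis unfolding e
  proof (rule fixed_lincomb[OF P k])
    fix z assume z: "z \<in> {..nmax D k} \<times> {..nmax D k}"
    then have "P (Lam D k z) = Lam D k z" by (rule assms(4))
    then show "(lam D k (fst z) \<otimes>\<^sub>t lam D k (snd z)) \<in> fixed P k"
      using z by (simp add: fixed_def Lam_def sp.tensor_in_tensor_splines sp.splines_lam mem_Times_iff)
  qed simp
qed

lemma moment_identity:
  assumes u: "u \<in> Vpw D" and w: "w \<in> Vpw D" and k: "k \<in> K"
    and m: "moments2_vanish r (\<lambda>x. pull k w x - pull k u x)"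
  shows "(LINT x:sq_open|lborel. w (F k x) * test_poly r c x) = (LINT x:sq_open|lborel. u (F k x) * test_poly r c x)"
proof -
  have I: "(LINT x:sq_open|lborel. v (F k x) * test_poly r c x) = integral sq_closed (\<lambda>x. pull k v x * test_poly r c x)"
    if v: "v \<in> Vpw D" for v
  proof -
    have cont: "continuous_on sq_closed (\<lambda>x. pull k v x * test_poly r c x)"
      by (intro continuous_on_mult spline_patch.tensor_splines_continuous[OF spline_patch[OF k] pull(1)[OF v k]] test_poly_continuous)
    have "set_integrable lborel sq_closed (\<lambda>x. pull k v x * test_poly r c x)"
      unfolding set_integrable_def by (rule borel_integrable_compact[OF sq_basic(1) cont])
    then have si: "set_integrable lborel sq_open (\<lambda>x. pull k v x * test_poly r c x)"
      by (rule set_integrable_subset) (use sq_basic in auto)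
    have "(LINT x:sq_open|lborel. v (F k x) * test_poly r c x) = (LINT x:sq_open|lborel. pull k v x * test_poly r c x)"
      by (rule set_lebesgue_integral_cong) (use sq_basic(3) pull(2)[OF v k] in auto)
    also have "\<dots> = integral sq_open (\<lambda>x. pull k v x * test_poly r c x)"
      by (rule set_borel_integral_eq_integral(2)[OF si])
    also have "\<dots> = integral sq_closed (\<lambda>x. pull k v x * test_poly r c x)"
      unfolding sq_open_box sq_closed_cbox by (rule integral_open_interval)
    finally show ?thesis .
  qed
  note ti = times_test_poly_integrable[OF spline_patch.tensor_splines_continuous[OF spline_patch[OF k] pull(1)[OF _ k]]]
  have "integral sq_closed (\<lambda>x. (pull k w x - pull k u x) * test_poly r c x) = 0" using m by (simp add: moments2_vanish_def)
  then have "integral sq_closed (\<lambda>x. pull k w x * test_poly r c x) = integral sq_closed (\<lambda>x. pull k u x * test_poly r c x)"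
    using integral_diff[OF ti[OF w] ti[OF u], of r c r c] by (simp add: left_diff_distrib)
  then show ?thesis unfolding I[OF u] I[OF w] .
qed

end

section \<open>Vertex operators\<close>

locale multipatch_operators = multipatch_splines +
  fixes r :: nat and \<gamma> :: "nat \<Rightarrow> nat \<Rightarrow> real"
  assumes r_le: "r \<le> sdeg D + 1" and coeffs: "correction_coeffs D r \<gamma>"
begin

lemma spline_correction: "k \<in> K \<Longrightarrow> spline_correction D k r \<gamma>"
  using spline_patch[of k] r_le coeffs
  by (simp add: spline_correction_def spline_correction_axioms_def correction_coeffs_def)

lemma gamma_eq:
  assumes "v \<in> vertices D" "k \<in> vertex_patches D v" "k' \<in> vertex_patches D v" "m \<in> {1..r}"
  shows "\<gamma> k m = \<gamma> k' m"
  using coeffs assms unfolding correction_coeffs_def by blast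

definition vflag1 where "vflag1 v k \<longleftrightarrow> fst (G k v) \<noteq> 0"
definition vflag2 where "vflag2 v k \<longleftrightarrow> snd (G k v) \<noteq> 0"

text \<open>The basis function on the square with indices counted from the corner that is mapped to \<open>v\<close>.\<close>

definition vlam :: "real \<times> real \<Rightarrow> nat \<Rightarrow> nat \<times> nat \<Rightarrow> real \<times> real \<Rightarrow> real" where
  "vlam v k i = lam D k (end_idx (vflag1 v k) (nmax D k) (fst i)) \<otimes>\<^sub>t lam D k (end_idx (vflag2 v k) (nmax D k) (snd i))"

text \<open>The double sum of correction terms of the vertex operator, which factorizes.\<close>

definition vcorr :: "real \<times> real \<Rightarrow> nat \<Rightarrow> real \<times> real \<Rightarrow> real" where
  "vcorr v k = mu_p D r \<gamma> k (vflag1 v k) \<otimes>\<^sub>t mu_p D r \<gamma> k (vflag2 v k)"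

lemma vLam_eq: "vLam D v k i = pushfwd D k (vlam v k i)"
  by (simp add: vLam_def Lam_def vlam_def Let_def end_idx_def vflag1_def vflag2_def)

lemma vlam_tensor_splines:
  assumes "k \<in> K" "fst i \<le> nmax D k" "snd i \<le> nmax D k" shows "vlam v k i \<in> tensor_splines D k"
proof -
  interpret sp: spline_patch D k using assms(1) by (rule spline_patch)
  show ?thesis unfolding vlam_def
    by (intro sp.tensor_in_tensor_splines sp.splines_lam) (use assms in \<open>auto simp: end_idx_def\<close>)
qed

lemma vcorr_eq_sum: "(\<Sum>m1=1..r. \<Sum>m2=1..r. \<gamma> k m1 * \<gamma> k m2 * vlam v k (m1, m2) x) = vcorr v k x"
  unfolding vcorr_def vlam_def tensor_def mu_p_def sum_product by (simp add: mult_ac)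

lemma corner_of_vertex:
  assumes "v \<in> vertices D" "k \<in> vertex_patches D v"
  shows "k \<in> K" "G k v \<in> corners" "F k (G k v) = v"
proof -
  show k: "k \<in> K" using vertex_patches_vertex[OF assms] by blast
  obtain c where c: "c \<in> corners" "v = F k c"
    using vertex_patches_vertex(2)[OF assms] unfolding patch_vertices_eq by (rule imageE)
  have "c \<in> sq_closed" using c(1) corners_subset by blast
  then have "G k v = c" unfolding c(2) using G_F[OF k] by simp
  then show "G k v \<in> corners" "F k (G k v) = v" using c by simp_all
qed

lemma end_lam_at_corner:
  assumes k: "k \<in> K" and z: "z \<in> {0, 1}" and i: "i \<le> nmax D k"
  shows "lam D k (end_idx b (nmax D k) i) z = (if i = 0 \<and> z = of_bool b \<or> i = nmax D k \<and> z = of_bool (\<not> b) then 1 else 0)"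
proof -
  interpret sp: spline_patch D k using k by (rule spline_patch)
  have "nmax D k > 0" using sp.nmax_gt by linarith
  then show ?thesis using z i by (cases b) (auto simp: end_idx_def sp.lam_0 sp.lam_1)
qed

lemma vlam_at_corner:
  assumes v: "v \<in> vertices D" "k \<in> vertex_patches D v" and i: "fst i \<le> nmax D k" "snd i \<le> nmax D k"
  shows "vlam v k i (G k v) = (if i = (0, 0) then 1 else 0)"
proof -
  note c = corner_of_vertex[OF v]
  have "nmax D k > 0" using spline_patch.nmax_gt[OF spline_patch[OF c(1)]] by linarith
  moreover have "fst (G k v) \<in> {0, 1}" "snd (G k v) \<in> {0, 1}" using c(2) unfolding mem_Times_iff by blast+
  moreover from this have "fst (G k v) = of_bool (vflag1 v k)" "snd (G k v) = of_bool (vflag2 v k)"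
    by (auto simp: vflag1_def vflag2_def)
  ultimately show ?thesis unfolding vlam_def tensor_def using i
    by (simp add: end_lam_at_corner[OF c(1)] prod_eq_iff of_bool_def)
qed

lemma vcorrection_at_corner:
  assumes v: "v \<in> vertices D" "k \<in> vertex_patches D v" and z: "z \<in> corners"
  shows "vlam v k (0, 0) z - vcorr v k z = (if z = G k v then 1 else 0)"
proof -
  note c = corner_of_vertex[OF v]
  interpret sc: spline_correction D k r \<gamma> using c(1) by (rule spline_correction)
  have z01: "fst z \<in> {0, 1}" "snd z \<in> {0, 1}" using z unfolding mem_Times_iff by blast+
  have n: "nmax D k > 0" using sc.nmax_gt by linarith
  have "fst (G k v) \<in> {0, 1}" "snd (G k v) \<in> {0, 1}" using c(2) unfolding mem_Times_iff by blast+
  then have G: "fst (G k v) = of_bool (vflag1 v k)" "snd (G k v) = of_bool (vflag2 v k)"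
    by (auto simp: vflag1_def vflag2_def)
  have "vcorr v k z = 0" unfolding vcorr_def tensor_def using z01 sc.mu_ends by auto
  then show ?thesis using n unfolding vlam_def tensor_def
    by (simp add: end_lam_at_corner[OF c(1) z01(1)] end_lam_at_corner[OF c(1) z01(2)] prod_eq_iff G)
qed

text \<open>Write \<open>a \<otimes> b - \<mu> \<otimes> \<mu>'\<close> as \<open>(a - \<mu>) \<otimes> b + \<mu> \<otimes> (b - \<mu>')\<close>; each summand has a factor with vanishing
moments.\<close>

lemma vcorrection_moments:
  assumes "k \<in> K"
  shows "moments2_vanish r (\<lambda>x. vlam v k (0, 0) x - vcorr v k x)"
    "continuous_on sq_closed (\<lambda>x. vlam v k (0, 0) x - vcorr v k x)"
proof -
  interpret sc: spline_correction D k r \<gamma> using assms by (rule spline_correction)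
  define a b where "a = lam D k (end_idx (vflag1 v k) (nmax D k) 0)" and "b = lam D k (end_idx (vflag2 v k) (nmax D k) 0)"
  define ma mb where "ma = mu_p D r \<gamma> k (vflag1 v k)" and "mb = mu_p D r \<gamma> k (vflag2 v k)"
  have c: "continuous_on {0..1} a" "continuous_on {0..1} b" "continuous_on {0..1} ma" "continuous_on {0..1} mb"
    unfolding a_def b_def ma_def mb_def by (auto intro: sc.lam_continuous sc.splines_continuous sc.mu_splines)
  have ca: "continuous_on {0..1} (\<lambda>x. a x - ma x)" and cb: "continuous_on {0..1} (\<lambda>x. b x - mb x)"
    using c by (auto intro: continuous_on_diff)
  have ma: "moments_vanish r (\<lambda>x. a x - ma x)" and mb: "moments_vanish r (\<lambda>x. b x - mb x)"
    unfolding a_def b_def ma_def mb_def by (rule sc.end_moments)+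
  have e: "(\<lambda>x. vlam v k (0, 0) x - vcorr v k x) =
     (\<lambda>x. 1 * ((\<lambda>x. a x - ma x) \<otimes>\<^sub>t b) x + 1 * (ma \<otimes>\<^sub>t (\<lambda>x. b x - mb x)) x)"
    by (simp add: fun_eq_iff vlam_def vcorr_def tensor_def a_def b_def ma_def mb_def left_diff_distrib right_diff_distrib)
  show "moments2_vanish r (\<lambda>x. vlam v k (0, 0) x - vcorr v k x)" unfolding e
    by (intro moments2_vanish_lincomb moments2_vanish_tensor tensor_continuous c ca cb) (use ma mb in simp_all)
  show "continuous_on sq_closed (\<lambda>x. vlam v k (0, 0) x - vcorr v k x)" unfolding e
    by (intro continuous_intros tensor_continuous c ca cb)
qed

text \<open>In a function with value zero at the corner the one basis function that the operator moves has
coefficient zero.\<close>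

lemma vanishing_at_vertex_fixed:
  assumes P: "vertex_operator D r \<gamma> v P" and v: "v \<in> vertices D" "k \<in> vertex_patches D v"
    and \<phi>: "\<phi> \<in> tensor_splines D k" "\<phi> (G k v) = 0"
  shows "\<phi> \<in> fixed P k"
proof -
  note c = corner_of_vertex[OF v]
  let ?n = "nmax D k"
  obtain a where a: "\<phi> = (\<lambda>x. \<Sum>i\<le>?n. \<Sum>j\<le>?n. a i j * (lam D k i \<otimes>\<^sub>t lam D k j) x)"
    using \<phi>(1) unfolding tensor_splines_def by blast
  have reidx: "(\<Sum>i\<le>?n. h i) = (\<Sum>i\<le>?n. h (end_idx b ?n i))" for h :: "nat \<Rightarrow> real" and b
    by (rule sum.reindex_bij_witness[of _ "end_idx b ?n" "end_idx b ?n"]) (auto simp: end_idx_def)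
  define d where "d z = a (end_idx (vflag1 v k) ?n (fst z)) (end_idx (vflag2 v k) ?n (snd z))" for z
  have e: "\<phi> x = (\<Sum>z\<in>{..?n} \<times> {..?n}. d z * vlam v k z x)" for x
  proof -
    have "\<phi> x = (\<Sum>i\<le>?n. \<Sum>j\<le>?n. a (end_idx (vflag1 v k) ?n i) (end_idx (vflag2 v k) ?n j) *
       (lam D k (end_idx (vflag1 v k) ?n i) \<otimes>\<^sub>t lam D k (end_idx (vflag2 v k) ?n j)) x)"
      unfolding a
      by (rule trans[OF reidx[of "\<lambda>i. \<Sum>j\<le>?n. a i j * (lam D k i \<otimes>\<^sub>t lam D k j) x" "vflag1 v k"]])
         (rule sum.cong[OF refl], rule reidx)
    then show ?thesis by (simp add: sum.cartesian_product case_prod_beta d_def vlam_def)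
  qed
  have fin: "finite ({..?n} \<times> {..?n})" by simp
  have "0 = (\<Sum>z\<in>{..?n} \<times> {..?n}. d z * vlam v k z (G k v))" using \<phi>(2) e by simp
  also have "\<dots> = (\<Sum>z\<in>{..?n} \<times> {..?n}. if z = (0, 0) then d z else 0)"
    by (intro sum.cong refl) (simp add: vlam_at_corner[OF v] mem_Times_iff)
  also have "\<dots> = d (0, 0)" by (simp add: sum.delta[OF fin])
  finally have d0: "d (0, 0) = 0" by simp
  have e': "\<phi> = (\<lambda>x. \<Sum>z\<in>{..?n} \<times> {..?n} - {(0, 0)}. d z * vlam v k z x)"
  proof
    fix x show "\<phi> x = (\<Sum>z\<in>{..?n} \<times> {..?n} - {(0, 0)}. d z * vlam v k z x)"
      unfolding e using d0 by (intro sum.mono_neutral_right) auto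
  qed
  show ?thesis unfolding e'
  proof (rule fixed_lincomb[OF _ c(1)])
    show "linear_op_on (Vpw D) P" using P by (simp add: vertex_operator_def)
    fix z assume z: "z \<in> {..?n} \<times> {..?n} - {(0, 0)}"
    then have "P (vLam D v k z) = vLam D v k z" using P v(2) unfolding vertex_operator_def by blast
    moreover have "vlam v k z \<in> tensor_splines D k" using z by (intro vlam_tensor_splines c(1)) auto
    ultimately show "vlam v k z \<in> fixed P k" by (simp add: fixed_def vLam_eq)
  qed simp
qed

definition vmean :: "real \<times> real \<Rightarrow> (real \<times> real \<Rightarrow> real) \<Rightarrow> real" where
  "vmean v u = (\<Sum>k\<in>vertex_patches D v. val u k v) / real (card (vertex_patches D v))"

text \<open>Subtracting the corner basis functions times the vertex values leaves a function that is fixed, so only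
the images of these basis functions contribute. Since \<open>\<gamma>\<close> is the same on all patches at the vertex, the
correction terms in a patch combine to one multiple of \<open>vcorr\<close>.\<close>

lemma vertex_operator_pull:
  assumes P: "vertex_operator D r \<gamma> v P" and v: "v \<in> vertices D" and u: "u \<in> Vpw D" and k: "k \<in> K"
  shows "pull k (P u) = (\<lambda>x. pull k u x +
    (if k \<in> vertex_patches D v then (vmean v u - val u k v) * (vlam v k (0, 0) x - vcorr v k x) else 0))"
proof -
  let ?V = "vertex_patches D v"
  let ?N = "real (card ?V)"
  have fV: "finite ?V" and cV: "0 < ?N" using card_vertex_patches[OF v] by auto
  have VK: "j \<in> K" if "j \<in> ?V" for j using corner_of_vertex[OF v that] by blast
  have lin: "linear_op_on (Vpw D) P" using P by (simp add: vertex_operator_def)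
  have n: "r \<le> nmax D j" if "j \<in> K" for j using spline_correction.r_less[OF spline_correction[OF that]] by simp
  have vL: "vLam D v j i \<in> Vpw D" if "j \<in> ?V" "fst i \<le> nmax D j" "snd i \<le> nmax D j" for j i
    unfolding vLam_eq by (intro pushfwd_in_Vpw vlam_tensor_splines VK that)
  \<comment> \<open>the factors \<open>1\<close> and \<open>- 1\<close> match the shape of the linearity lemmas\<close>
  define w where "w x = 1 * u x + (- 1) * (\<Sum>j\<in>?V. val u j v * vLam D v j (0, 0) x)" for x
  have sV: "(\<lambda>x. \<Sum>j\<in>?V. val u j v * vLam D v j (0, 0) x) \<in> Vpw D"
    by (intro Vpw_sum fV Vpw_mult vL) auto
  have w: "w \<in> Vpw D" unfolding w_def[abs_def] by (rule Vpw_lincomb[OF u sV])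
  have pL: "pull k (vLam D v j i) = (if k = j then vlam v j i else (\<lambda>x. 0))" if "j \<in> ?V" "k \<in> K" "fst i \<le> nmax D j" "snd i \<le> nmax D j" for j i k
    unfolding vLam_eq by (rule pull_pushfwd) (intro that VK vlam_tensor_splines)+
  have psV: "pull k (\<lambda>x. \<Sum>j\<in>?V. val u j v * vLam D v j (0, 0) x) = (\<lambda>x. if k \<in> ?V then val u k v * vlam v k (0, 0) x else 0)" if k: "k \<in> K" for k
  proof -
    have "pull k (\<lambda>x. \<Sum>j\<in>?V. val u j v * vLam D v j (0, 0) x) = (\<lambda>x. \<Sum>j\<in>?V. pull k (\<lambda>x. val u j v * vLam D v j (0, 0) x) x)"
      by (rule pull_sum[OF k fV]) (intro Vpw_mult vL; simp)
    also have "\<dots> = (\<lambda>x. \<Sum>j\<in>?V. if k = j then val u k v * vlam v k (0, 0) x else 0)"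
      by (intro ext sum.cong refl) (simp add: pull_mult[OF vL k] pL[OF _ k])
    also have "\<dots> = (\<lambda>x. if k \<in> ?V then val u k v * vlam v k (0, 0) x else 0)" using fV by (simp add: sum.delta)
    finally show ?thesis .
  qed
  have "P w = w"
  proof (rule fixed_imp_eq[OF lin w])
    fix k assume k: "k \<in> K"
    have pw: "pull k w = (\<lambda>x. pull k u x - (if k \<in> ?V then val u k v * vlam v k (0, 0) x else 0))"
      unfolding w_def[abs_def] pull_lincomb[OF u sV k] psV[OF k] by simp
    show "pull k w \<in> fixed P k"
    proof (cases "k \<in> ?V")
      case True
      have "pull k w (G k v) = 0" unfolding pw using True vlam_at_corner[OF v True, of "(0, 0)"] by (simp add: val_def)
      then show ?thesis by (rule vanishing_at_vertex_fixed[OF P v True pull(1)[OF w k]])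
    next
      case False
      have "P (Lam D k i) = Lam D k i" if "i \<in> {..nmax D k} \<times> {..nmax D k}" for i
        using P k False that unfolding vertex_operator_def by blast
      then show ?thesis by (rule all_fixed[OF lin k pull(1)[OF w k]])
    qed
  qed
  moreover have "u = (\<lambda>x. 1 * w x + 1 * (\<Sum>j\<in>?V. val u j v * vLam D v j (0, 0) x))" by (simp add: w_def)
  then have "P u = (\<lambda>x. 1 * P w x + 1 * P (\<lambda>x. \<Sum>j\<in>?V. val u j v * vLam D v j (0, 0) x) x)"
    using lin_lincomb[OF lin w sV, of 1 1] by simp
  moreover have "P (\<lambda>x. \<Sum>j\<in>?V. val u j v * vLam D v j (0, 0) x) = (\<lambda>x. \<Sum>j\<in>?V. val u j v * P (vLam D v j (0, 0)) x)"
    by (rule lin_sum[OF lin fV]) (intro vL; simp)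
  ultimately have Pu: "P u = (\<lambda>x. 1 * u x + 1 * (\<Sum>j\<in>?V. val u j v * (1 * P (vLam D v j (0, 0)) x + (- 1) * vLam D v j (0, 0) x)))"
    by (simp add: w_def fun_eq_iff right_diff_distrib sum_subtractf)
  have PL: "P (vLam D v j (0, 0)) \<in> Vpw D" if "j \<in> ?V" for j by (rule lin_closed[OF lin]) (intro vL that; simp)
  have dV: "(\<lambda>x. 1 * P (vLam D v j (0, 0)) x + (- 1) * vLam D v j (0, 0) x) \<in> Vpw D" if "j \<in> ?V" for j
    by (intro Vpw_lincomb PL vL that) simp_all
  have avg: "vertex_avg D v i \<in> Vpw D \<and> pull k (vertex_avg D v i) = (\<lambda>x. if k \<in> ?V then vlam v k i x / ?N else 0)"
    if i: "\<And>j. j \<in> ?V \<Longrightarrow> fst i \<le> nmax D j \<and> snd i \<le> nmax D j" for i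
  proof -
    have e: "vertex_avg D v i = (\<lambda>x. \<Sum>j\<in>?V. (1 / ?N) * vLam D v j i x)"
      by (simp add: fun_eq_iff vertex_avg_def sum_divide_distrib)
    have "pull k (vertex_avg D v i) = (\<lambda>x. \<Sum>j\<in>?V. pull k (\<lambda>x. (1 / ?N) * vLam D v j i x) x)"
      unfolding e by (rule pull_sum[OF k fV]) (intro Vpw_mult vL; simp add: i)
    also have "\<dots> = (\<lambda>x. \<Sum>j\<in>?V. if k = j then (1 / ?N) * vlam v k i x else 0)"
      by (intro ext sum.cong refl) (simp only: pull_mult[OF vL k] i, simp add: pL[OF _ k] i)
    also have "\<dots> = (\<lambda>x. if k \<in> ?V then vlam v k i x / ?N else 0)" using fV by (simp add: sum.delta fun_eq_iff)
    finally have "pull k (vertex_avg D v i) = (\<lambda>x. if k \<in> ?V then vlam v k i x / ?N else 0)" .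
    moreover have "vertex_avg D v i \<in> Vpw D" unfolding e by (intro Vpw_sum Vpw_mult fV vL) (simp_all add: i)
    ultimately show ?thesis by (rule conjI[rotated])
  qed
  have ev: "vertex_avg D v i (F k x) = (if k \<in> ?V then vlam v k i x / ?N else 0)" if "x \<in> sq_open"
    "\<And>j. j \<in> ?V \<Longrightarrow> fst i \<le> nmax D j \<and> snd i \<le> nmax D j" for x i
    using pull(2)[OF conjunct1[OF avg[OF that(2)]] k that(1)] conjunct2[OF avg[OF that(2)]] by simp
  have eL: "vLam D v j i (F k x) = (if k = j then vlam v k i x else 0)" if "j \<in> ?V" "x \<in> sq_open" "fst i \<le> nmax D j" "snd i \<le> nmax D j" for j i x
    using pull(2)[OF vL[OF that(1,3,4)] k that(2)] pL[OF that(1) k that(3,4)] by simp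
  have step: "P (vLam D v j (0, 0)) (F k x) - vLam D v j (0, 0) (F k x) =
     (if k \<in> ?V then (1 / ?N - (if k = j then 1 else 0)) * (vlam v k (0, 0) x - vcorr v k x) else 0)"
    if j: "j \<in> ?V" and x: "x \<in> sq_open" for j x
  proof -
    have rj: "m \<le> nmax D i" if "m \<in> {1..r}" "i \<in> ?V" for m i using n[OF VK[OF that(2)]] that(1) by simp
    have "P (vLam D v j (0, 0)) (F k x) = vertex_avg D v (0, 0) (F k x) +
           (\<Sum>m1=1..r. \<Sum>m2=1..r. \<gamma> j m1 * \<gamma> j m2 * (vLam D v j (m1, m2) (F k x) - vertex_avg D v (m1, m2) (F k x)))"
      using P j unfolding vertex_operator_def by simp
    also have "vertex_avg D v (0, 0) (F k x) = (if k \<in> ?V then vlam v k (0, 0) x / ?N else 0)" by (rule ev[OF x]) simp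
    also have "(\<Sum>m1=1..r. \<Sum>m2=1..r. \<gamma> j m1 * \<gamma> j m2 * (vLam D v j (m1, m2) (F k x) - vertex_avg D v (m1, m2) (F k x))) =
      (\<Sum>m1=1..r. \<Sum>m2=1..r. if k \<in> ?V then ((if k = j then 1 else 0) - 1 / ?N) * (\<gamma> k m1 * \<gamma> k m2 * vlam v k (m1, m2) x) else 0)"
    proof (intro sum.cong refl)
      fix m1 m2 assume m: "m1 \<in> {1..r}" "m2 \<in> {1..r}"
      have 1: "vertex_avg D v (m1, m2) (F k x) = (if k \<in> ?V then vlam v k (m1, m2) x / ?N else 0)"
        by (rule ev[OF x]) (use rj m in simp)
      have 2: "vLam D v j (m1, m2) (F k x) = (if k = j then vlam v k (m1, m2) x else 0)"
        by (rule eL[OF j x]) (use rj m j in simp_all)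
      show "\<gamma> j m1 * \<gamma> j m2 * (vLam D v j (m1, m2) (F k x) - vertex_avg D v (m1, m2) (F k x)) =
        (if k \<in> ?V then ((if k = j then 1 else 0) - 1 / ?N) * (\<gamma> k m1 * \<gamma> k m2 * vlam v k (m1, m2) x) else 0)"
      proof (cases "k \<in> ?V")
        case True
        then have g: "\<gamma> j m1 = \<gamma> k m1" "\<gamma> j m2 = \<gamma> k m2" using gamma_eq[OF v j True] m by blast+
        show ?thesis unfolding 1 2 g using True by (simp add: left_diff_distrib right_diff_distrib)
      next
        case False
        then have "k \<noteq> j" using j by blast
        then show ?thesis unfolding 1 2 using False by simp
      qed
    qed
    also have "\<dots> = (if k \<in> ?V then ((if k = j then 1 else 0) - 1 / ?N) * vcorr v k x else 0)"
      by (simp add: sum_distrib_left[symmetric] vcorr_eq_sum[symmetric])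
    finally have "P (vLam D v j (0, 0)) (F k x) = (if k \<in> ?V then vlam v k (0, 0) x / ?N else 0) +
      (if k \<in> ?V then ((if k = j then 1 else 0) - 1 / ?N) * vcorr v k x else 0)" .
    moreover have "vLam D v j (0, 0) (F k x) = (if k = j then vlam v k (0, 0) x else 0)" by (rule eL[OF j x]) simp_all
    ultimately show ?thesis using j by (auto simp: left_diff_distrib right_diff_distrib)
  qed
  show ?thesis
  proof (rule pull_eqI[OF lin_closed[OF lin u] k])
    interpret sp: spline_patch D k using k by (rule spline_patch)
    have "(\<lambda>x. vlam v k (0, 0) x - vcorr v k x) \<in> tensor_splines D k"
      unfolding vcorr_def
      by (intro sp.tensor_splines_diff vlam_tensor_splines k sp.tensor_in_tensor_splines spline_correction.mu_splines[OF spline_correction[OF k]]) simp_all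
    then have "(\<lambda>x. if k \<in> ?V then (vmean v u - val u k v) * (vlam v k (0, 0) x - vcorr v k x) else 0) \<in> tensor_splines D k"
      using sp.tensor_splines_0 by (cases "k \<in> ?V") (simp_all add: sp.tensor_splines_mult)
    then show "(\<lambda>x. pull k u x + (if k \<in> ?V then (vmean v u - val u k v) * (vlam v k (0, 0) x - vcorr v k x) else 0)) \<in> tensor_splines D k"
      by (intro sp.tensor_splines_add pull(1)[OF u k])
    fix x assume x: "x \<in> sq_open"
    have "P u (F k x) = u (F k x) + (\<Sum>j\<in>?V. val u j v * (P (vLam D v j (0, 0)) (F k x) - vLam D v j (0, 0) (F k x)))"
      by (subst Pu) simp
    also have "(\<Sum>j\<in>?V. val u j v * (P (vLam D v j (0, 0)) (F k x) - vLam D v j (0, 0) (F k x))) =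
      (\<Sum>j\<in>?V. val u j v * (if k \<in> ?V then (1 / ?N - (if k = j then 1 else 0)) * (vlam v k (0, 0) x - vcorr v k x) else 0))"
      by (intro sum.cong refl) (simp only: step[OF _ x])
    also have "\<dots> = (if k \<in> ?V then (vmean v u - val u k v) * (vlam v k (0, 0) x - vcorr v k x) else 0)"
    proof (cases "k \<in> ?V")
      case True
      have "(\<Sum>j\<in>?V. val u j v * ((1 / ?N - (if k = j then 1 else 0)) * (vlam v k (0, 0) x - vcorr v k x))) =
        (\<Sum>j\<in>?V. val u j v / ?N - (if k = j then val u k v else 0)) * (vlam v k (0, 0) x - vcorr v k x)"
        unfolding sum_distrib_right by (intro sum.cong refl) (simp add: right_diff_distrib left_diff_distrib)
      also have "(\<Sum>j\<in>?V. val u j v / ?N - (if k = j then val u k v else 0)) = vmean v u - val u k v"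
        using True fV by (simp add: sum_subtractf vmean_def sum_divide_distrib sum.delta)
      finally show ?thesis using True by simp
    qed simp
    finally show "P u (F k x) = pull k u x + (if k \<in> ?V then (vmean v u - val u k v) * (vlam v k (0, 0) x - vcorr v k x) else 0)"
      using pull(2)[OF u k x] by simp
  qed
qed

lemma vertex_operator_val:
  assumes P: "vertex_operator D r \<gamma> v P" and v: "v \<in> vertices D" and u: "u \<in> Vpw D" and v': "v' \<in> vertices D" "k \<in> vertex_patches D v'"
  shows "val (P u) k v' = (if v' = v then vmean v u else val u k v')"
proof -
  note c = corner_of_vertex[OF v']
  show ?thesis
  proof (cases "k \<in> vertex_patches D v")
    case True
    have "G k v' = G k v \<longleftrightarrow> v' = v" using c(3) corner_of_vertex(3)[OF v True] by metis
    then show ?thesis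
      unfolding val_def vertex_operator_pull[OF P v u c(1)] using vcorrection_at_corner[OF v True c(2)] True
      by (simp add: val_def)
  next
    case False
    then have "v' \<noteq> v" using v'(2) by blast
    then show ?thesis unfolding val_def vertex_operator_pull[OF P v u c(1)] using False by simp
  qed
qed

lemma vertex_operator_matches:
  assumes "vertex_operator D r \<gamma> v P" "v \<in> vertices D" "u \<in> Vpw D"
  shows "vertex_matched v (P u)"
    and "v' \<in> vertices D \<Longrightarrow> vertex_matched v' u \<Longrightarrow> vertex_matched v' (P u)"
proof -
  show 1: "vertex_matched v (P u)" unfolding vertex_matched_def
    using vertex_operator_val[OF assms assms(2)] by simp
  show "vertex_matched v' (P u)" if v': "v' \<in> vertices D" "vertex_matched v' u"
  proof (cases "v' = v")
    case False
    show ?thesis unfolding vertex_matched_def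
    proof (intro ballI)
      fix j k assume j: "j \<in> vertex_patches D v'" "k \<in> vertex_patches D v'"
      have "val u j v' = val u k v'" using v'(2) j unfolding vertex_matched_def by blast
      then show "val (P u) j v' = val (P u) k v'"
        unfolding vertex_operator_val[OF assms v'(1) j(1)] vertex_operator_val[OF assms v'(1) j(2)] by simp
    qed
  qed (use 1 in simp)
qed

lemma vertex_operator_fixes:
  assumes P: "vertex_operator D r \<gamma> v P" and v: "v \<in> vertices D" and u: "u \<in> Vpw D" "vertex_matched v u"
  shows "P u = u"
proof (rule Vpw_eqI[OF _ u(1)])
  show "P u \<in> Vpw D" using P u(1) by (auto simp: vertex_operator_def intro: lin_closed)
  fix k assume k: "k \<in> K"
  have "vmean v u = val u k v" if "k \<in> vertex_patches D v"
  proof -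
    have "(\<Sum>j\<in>vertex_patches D v. val u j v) = (\<Sum>j\<in>vertex_patches D v. val u k v)"
      using u(2) that unfolding vertex_matched_def by (intro sum.cong refl) blast
    then have "vmean v u = real (card (vertex_patches D v)) * val u k v / real (card (vertex_patches D v))" by (simp add: vmean_def)
    also have "\<dots> = val u k v" by (rule nonzero_mult_div_cancel_left) (use card_vertex_patches[OF v] in linarith)
    finally show ?thesis .
  qed
  then show "pull k (P u) = pull k u" unfolding vertex_operator_pull[OF P v u(1) k] by auto
qed

lemma vertex_operator_moments:
  assumes "vertex_operator D r \<gamma> v P" "v \<in> vertices D" "u \<in> Vpw D" "k \<in> K"
  shows "moments2_vanish r (\<lambda>x. pull k (P u) x - pull k u x)"
proof (cases "k \<in> vertex_patches D v")
  case True
  have "moments2_vanish r (\<lambda>x. (vmean v u - val u k v) * (vlam v k (0, 0) x - vcorr v k x) + 0 * 0)"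
    by (rule moments2_vanish_lincomb[OF vcorrection_moments(1)[OF assms(4)] moments2_vanish_0 vcorrection_moments(2)[OF assms(4)]])
       (rule continuous_on_const)
  then show ?thesis unfolding vertex_operator_pull[OF assms] using True by simp
qed (simp add: vertex_operator_pull[OF assms] moments2_vanish_0)

end

section \<open>Edge operators\<close>

definition sym_inv :: "bool \<times> bool \<times> bool \<Rightarrow> bool \<times> bool \<times> bool" where
  "sym_inv \<sigma> = (case \<sigma> of (sw, r1, r2) \<Rightarrow> if sw then (sw, r2, r1) else (sw, r1, r2))"

lemma square_sym_inv [simp]:
  "square_sym (sym_inv \<sigma>) (square_sym \<sigma> x) = x" "square_sym \<sigma> (square_sym (sym_inv \<sigma>) x) = x"
  by (cases \<sigma>, cases x, simp add: square_sym_def sym_inv_def Let_def)+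

lemma square_sym_in [simp]:
  "square_sym \<sigma> x \<in> sq_open \<longleftrightarrow> x \<in> sq_open" "square_sym \<sigma> x \<in> sq_closed \<longleftrightarrow> x \<in> sq_closed"
proof -
  obtain sw r1 r2 where \<sigma>: "\<sigma> = (sw, r1, r2)" by (metis prod.exhaust)
  show "square_sym \<sigma> x \<in> sq_open \<longleftrightarrow> x \<in> sq_open" "square_sym \<sigma> x \<in> sq_closed \<longleftrightarrow> x \<in> sq_closed"
    by (cases x; cases sw; cases r1; cases r2; simp add: \<sigma> square_sym_def sq_open_def sq_closed_def mem_Times_iff conj_ac)+
qed

lemma square_sym_corners: "x \<in> corners \<Longrightarrow> square_sym \<sigma> x \<in> corners"
proof -
  obtain sw r1 r2 where \<sigma>: "\<sigma> = (sw, r1, r2)" by (metis prod.exhaust)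
  assume "x \<in> corners"
  then have "fst x \<in> {0, 1}" "snd x \<in> {0, 1}" unfolding mem_Times_iff by blast+
  then show ?thesis unfolding mem_Times_iff
    by (cases sw; cases r1; cases r2; cases x; simp add: \<sigma> square_sym_def; argo)
qed

text \<open>From the coordinates of an edge, in which the edge is the bottom side, back to the coordinates of the patch.\<close>

definition untwist :: "bool \<times> bool \<times> bool \<Rightarrow> (real \<times> real \<Rightarrow> real) \<Rightarrow> real \<times> real \<Rightarrow> real" where
  "untwist \<sigma> \<phi> x = \<phi> (square_sym (sym_inv \<sigma>) x)"

lemma untwist_square_sym [simp]: "untwist \<sigma> \<phi> (square_sym \<sigma> x) = \<phi> x" by (simp add: untwist_def)

context spline_patch
begin

lemma untwist_tensor_splines: "\<phi> \<in> tensor_splines D k \<Longrightarrow> untwist \<sigma> \<phi> \<in> tensor_splines D k"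
  unfolding untwist_def[abs_def] by (rule tensor_splines_square_sym)

lemma bottom_trace_splines:
  assumes "\<phi> \<in> tensor_splines D k" shows "(\<lambda>s. \<phi> (square_sym \<sigma> (s, 0))) \<in> splines D k"
proof -
  obtain c where c: "(\<lambda>x. \<phi> (square_sym \<sigma> x)) = (\<lambda>x. \<Sum>i\<le>n. \<Sum>j\<le>n. c i j * (lam D k i \<otimes>\<^sub>t lam D k j) x)"
    using tensor_splines_square_sym[OF assms, of \<sigma>] unfolding tensor_splines_def by blast
  have "\<phi> (square_sym \<sigma> (s, 0)) = (\<Sum>i\<le>n. c i 0 * lam D k i s)" for s
  proof -
    have "(\<Sum>j\<le>n. c i j * (lam D k i \<otimes>\<^sub>t lam D k j) (s, 0)) = c i 0 * lam D k i s" for i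
    proof -
      have "(\<Sum>j\<le>n. c i j * (lam D k i \<otimes>\<^sub>t lam D k j) (s, 0)) = (\<Sum>j\<le>n. (c i j * lam D k i s) * lam D k j 0)"
        by (simp add: tensor_def mult.assoc)
      then show ?thesis unfolding sum_lam_0 .
    qed
    then show ?thesis using fun_cong[OF c, of "(s, 0)"] by simp
  qed
  then have "(\<lambda>s. \<phi> (square_sym \<sigma> (s, 0))) = (\<lambda>s. \<Sum>i\<le>n. c i 0 * lam D k i s)" by (rule ext)
  then show ?thesis unfolding splines_def by (intro CollectI exI)
qed

text \<open>At the bottom side all functions across but the first vanish, so the first row of coefficients carries the
trace. If the trace is zero, this row as a whole contributes nothing.\<close>

lemma zero_bottom_trace:
  assumes \<phi>: "\<phi> \<in> tensor_splines D k" and z: "\<And>s. \<phi> (square_sym \<sigma> (s, 0)) = 0"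
  obtains c where "\<phi> = (\<lambda>x. \<Sum>z\<in>{..n} \<times> {1..n}. c z * untwist \<sigma> (lam D k (fst z) \<otimes>\<^sub>t lam D k (snd z)) x)"
proof -
  obtain c where c: "(\<lambda>x. \<phi> (square_sym \<sigma> x)) = (\<lambda>x. \<Sum>i\<le>n. \<Sum>j\<le>n. c i j * (lam D k i \<otimes>\<^sub>t lam D k j) x)"
    using tensor_splines_square_sym[OF \<phi>, of \<sigma>] unfolding tensor_splines_def by blast
  let ?L = "\<lambda>i j. lam D k i \<otimes>\<^sub>t lam D k j"
  have t: "(\<Sum>i\<le>n. c i 0 * lam D k i s) = 0" for s
  proof -
    have "(\<Sum>j\<le>n. c i j * ?L i j (s, 0)) = c i 0 * lam D k i s" for i
    proof -
      have "(\<Sum>j\<le>n. c i j * ?L i j (s, 0)) = (\<Sum>j\<le>n. (c i j * lam D k i s) * lam D k j 0)"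
        by (simp add: tensor_def mult.assoc)
      then show ?thesis unfolding sum_lam_0 .
    qed
    then show ?thesis using fun_cong[OF c, of "(s, 0)"] z by simp
  qed
  have "\<phi> x = (\<Sum>z\<in>{..n} \<times> {1..n}. (\<lambda>z. c (fst z) (snd z)) z * untwist \<sigma> (?L (fst z) (snd z)) x)" for x
  proof -
    let ?y = "square_sym (sym_inv \<sigma>) x"
    have set: "{..n} = insert 0 {1..n}" by auto
    have "(\<Sum>j\<le>n. c i j * ?L i j ?y) = c i 0 * lam D k i (fst ?y) * lam D k 0 (snd ?y) + (\<Sum>j\<in>{1..n}. c i j * ?L i j ?y)" for i
      by (subst set) (simp add: tensor_def mult.assoc)
    then have "\<phi> x = (\<Sum>i\<le>n. c i 0 * lam D k i (fst ?y) * lam D k 0 (snd ?y)) + (\<Sum>i\<le>n. \<Sum>j\<in>{1..n}. c i j * ?L i j ?y)"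
      using fun_cong[OF c, of ?y] by (simp add: sum.distrib)
    also have "(\<Sum>i\<le>n. c i 0 * lam D k i (fst ?y) * lam D k 0 (snd ?y)) = 0"
      unfolding sum_distrib_right[symmetric] t by simp
    finally show ?thesis by (simp add: sum.cartesian_product case_prod_beta untwist_def)
  qed
  then show thesis by (rule that[OF ext])
qed

end

context multipatch_splines
begin

text \<open>For candidates that are known to be continuous only: on the fine side of an edge the correction is built
from coarse splines.\<close>

lemma pull_eq_on_closed:
  assumes "u \<in> Vpw D" "k \<in> K" "continuous_on sq_closed \<psi>" "\<And>x. x \<in> sq_open \<Longrightarrow> u (F k x) = \<psi> x" "x \<in> sq_closed"
  shows "pull k u x = \<psi> x"
proof -
  have "continuous_on (closure sq_open) (\<lambda>x. pull k u x - \<psi> x)" unfolding sq_basic(5)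
    by (intro continuous_on_diff spline_patch.tensor_splines_continuous[OF spline_patch pull(1)] assms)
  then have "pull k u x - \<psi> x = 0"
    by (rule continuous_constant_on_closure) (use assms(4,5) pull(2)[OF assms(1,2)] sq_basic(5) in auto)
  then show ?thesis by simp
qed

end

text \<open>Separates the special images of the two end functions from the regular pattern.\<close>

lemma sum_with_ends:
  fixes a :: "nat \<Rightarrow> real"
  assumes "0 < n"
  shows "(\<Sum>j\<le>n. a j * (if j = 0 then x else if j = n then y else z j)) =
    (\<Sum>j\<le>n. a j * z j) + a 0 * (x - z 0) + a n * (y - z n)"
proof -
  have "(\<Sum>j\<le>n. a j * (if j = 0 then x else if j = n then y else z j)) =
    (\<Sum>j\<le>n. a j * z j + ((if j = 0 then a 0 * (x - z 0) else 0) + (if j = n then a n * (y - z n) else 0)))"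
    using assms by (intro sum.cong refl) (auto simp: right_diff_distrib)
  then show ?thesis by (simp add: sum.distrib)
qed

text \<open>An interior edge with its frame; the symmetries \<open>\<sigma>m\<close> and \<open>\<sigma>p\<close> turn edge coordinates into the coordinates
of the two patches.\<close>

locale edge_setting = multipatch_operators +
  fixes e km kp Fe \<sigma>m \<sigma>p
  assumes frame: "edge_frame D e km kp Fe" and inner: "interior_edge D e"
    and Fm: "\<And>x. x \<in> {0..1} \<times> {-1..0} \<Longrightarrow> Fe x = F km (square_sym \<sigma>m (fst x, - snd x))"
    and Fp: "\<And>x. x \<in> {0..1} \<times> {0..1} \<Longrightarrow> Fe x = F kp (square_sym \<sigma>p x)"
begin

lemma kmp: "km \<in> K" "kp \<in> K" "km \<noteq> kp" "edge_patches D e = {km, kp}"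
  using frame by (auto simp: edge_frame_def edge_patches_def)

sublocale ed: spline_edge D km kp r \<gamma>
  using spline_correction[OF kmp(1)] spline_correction[OF kmp(2)] by (rule spline_edge.intro)

abbreviation R where "R \<equiv> restr D r \<gamma> km kp"
abbreviation push where "push \<equiv> edge_push D km kp Fe"
abbreviation at_m where "at_m z \<equiv> F km (square_sym \<sigma>m z)"
abbreviation at_p where "at_p z \<equiv> F kp (square_sym \<sigma>p z)"

lemma Fe_inj: "inj_on Fe edge_rect"
proof -
  have "homeomorphism edge_rect (closure (interior (closure (patch D km) \<union> closure (patch D kp)))) Fe (inv_into edge_rect Fe)"
    using frame by (simp add: edge_frame_def)
  then show ?thesis unfolding homeomorphism_def by (metis inj_onI)
qed

lemma e_eq: "e = Fe ` ({0..1} \<times> {0})" using frame by (simp add: edge_frame_def)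

lemma push_at:
  assumes "(s, t) \<in> sq_open"
  shows "push \<phi> (at_m (s, t)) = \<phi> (s, - t)" "push \<phi> (at_p (s, t)) = \<phi> (s, t)"
proof -
  have st: "0 < s" "s < 1" "0 < t" "t < 1" using assms by (auto simp: sq_open_def)
  have "at_m (s, t) = Fe (s, - t)" using Fm[of "(s, - t)"] st by simp
  moreover have "inv_into edge_rect Fe (Fe (s, - t)) = (s, - t)"
    by (rule inv_into_f_f[OF Fe_inj]) (use st in \<open>simp add: edge_rect_def\<close>)
  moreover have "at_m (s, t) \<in> patch D km" using assms by (simp add: patch_def)
  ultimately show "push \<phi> (at_m (s, t)) = \<phi> (s, - t)" by (simp add: edge_push_def)
  have "at_p (s, t) = Fe (s, t)" using Fp[of "(s, t)"] st by simp
  moreover have "inv_into edge_rect Fe (Fe (s, t)) = (s, t)"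
    by (rule inv_into_f_f[OF Fe_inj]) (use st in \<open>simp add: edge_rect_def\<close>)
  moreover have "at_p (s, t) \<in> patch D kp" using assms by (simp add: patch_def)
  ultimately show "push \<phi> (at_p (s, t)) = \<phi> (s, t)" by (simp add: edge_push_def)
qed

lemma push_off: "x \<notin> patch D km \<union> patch D kp \<Longrightarrow> push \<phi> x = 0" by (simp add: edge_push_def)

lemma patch_points:
  assumes "x \<in> patch D km" obtains s t where "(s, t) \<in> sq_open" "x = at_m (s, t)"
proof -
  obtain y where y: "y \<in> sq_open" "x = F km y" using assms unfolding patch_def by blast
  obtain s t where st: "square_sym (sym_inv \<sigma>m) y = (s, t)" by (cases "square_sym (sym_inv \<sigma>m) y")
  then have y': "y = square_sym \<sigma>m (s, t)" by (metis square_sym_inv(2))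
  have "(s, t) \<in> sq_open" using y(1) unfolding y' square_sym_in .
  then show thesis by (rule that) (simp add: y(2) y')
qed

lemma patch_points':
  assumes "x \<in> patch D kp" obtains s t where "(s, t) \<in> sq_open" "x = at_p (s, t)"
proof -
  obtain y where y: "y \<in> sq_open" "x = F kp y" using assms unfolding patch_def by blast
  obtain s t where st: "square_sym (sym_inv \<sigma>p) y = (s, t)" by (cases "square_sym (sym_inv \<sigma>p) y")
  then have y': "y = square_sym \<sigma>p (s, t)" by (metis square_sym_inv(2))
  have "(s, t) \<in> sq_open" using y(1) unfolding y' square_sym_in .
  then show thesis by (rule that) (simp add: y(2) y')
qed

lemma push_m: "push (f \<otimes>\<^sub>t perp_m D km i) = pushfwd D km (untwist \<sigma>m (f \<otimes>\<^sub>t lam D km i))"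
proof
  fix x
  show "push (f \<otimes>\<^sub>t perp_m D km i) x = pushfwd D km (untwist \<sigma>m (f \<otimes>\<^sub>t lam D km i)) x"
  proof (cases "x \<in> patch D km")
    case True
    then obtain s t where st: "(s, t) \<in> sq_open" "x = at_m (s, t)" by (rule patch_points)
    then have "0 < t" "t < 1" by (simp_all add: sq_open_def)
    moreover have "square_sym \<sigma>m (s, t) \<in> sq_open" using st(1) by simp
    ultimately show ?thesis unfolding st(2) push_at(1)[OF st(1)] pushfwd_F[OF kmp(1)] untwist_square_sym
      by (simp add: tensor_def perp_m_def pushfwd_F[OF kmp(1)])
  next
    case False
    have "push (f \<otimes>\<^sub>t perp_m D km i) x = 0"
    proof (cases "x \<in> patch D kp")
      case True
      then obtain s t where st: "(s, t) \<in> sq_open" "x = at_p (s, t)" by (rule patch_points')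
      then have "0 < t" "t < 1" by (simp_all add: sq_open_def)
      then show ?thesis unfolding st(2) push_at(2)[OF st(1)] by (simp add: tensor_def perp_m_def)
    qed (use False in \<open>simp add: push_off\<close>)
    then show ?thesis using False by (simp add: pushfwd_def)
  qed
qed

lemma push_p: "push (f \<otimes>\<^sub>t perp_p D kp i) = pushfwd D kp (untwist \<sigma>p (f \<otimes>\<^sub>t lam D kp i))"
proof
  fix x
  show "push (f \<otimes>\<^sub>t perp_p D kp i) x = pushfwd D kp (untwist \<sigma>p (f \<otimes>\<^sub>t lam D kp i)) x"
  proof (cases "x \<in> patch D kp")
    case True
    then obtain s t where st: "(s, t) \<in> sq_open" "x = at_p (s, t)" by (rule patch_points')
    then have "0 < t" "t < 1" by (simp_all add: sq_open_def)
    moreover have "square_sym \<sigma>p (s, t) \<in> sq_open" using st(1) by simp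
    ultimately show ?thesis unfolding st(2) push_at(2)[OF st(1)] pushfwd_F[OF kmp(2)] untwist_square_sym
      by (simp add: tensor_def perp_p_def pushfwd_F[OF kmp(2)])
  next
    case False
    have "push (f \<otimes>\<^sub>t perp_p D kp i) x = 0"
    proof (cases "x \<in> patch D km")
      case True
      then obtain s t where st: "(s, t) \<in> sq_open" "x = at_m (s, t)" by (rule patch_points)
      then have "0 < t" "t < 1" by (simp_all add: sq_open_def)
      then show ?thesis unfolding st(2) push_at(1)[OF st(1)] by (simp add: tensor_def perp_p_def)
    qed (use False in \<open>simp add: push_off\<close>)
    then show ?thesis using False by (simp add: pushfwd_def)
  qed
qed

definition trace_m where "trace_m u s = pull km u (square_sym \<sigma>m (s, 0))"
definition trace_p where "trace_p u s = pull kp u (square_sym \<sigma>p (s, 0))"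

lemma trace_splines: "u \<in> Vpw D \<Longrightarrow> trace_m u \<in> splines D km" "u \<in> Vpw D \<Longrightarrow> trace_p u \<in> splines D kp"
  unfolding trace_m_def[abs_def] trace_p_def[abs_def]
  by (rule spline_patch.bottom_trace_splines[OF spline_patch[OF kmp(1)] pull(1)[OF _ kmp(1)]], assumption)
     (rule spline_patch.bottom_trace_splines[OF spline_patch[OF kmp(2)] pull(1)[OF _ kmp(2)]])

lemma edge_points:
  assumes "s \<in> {0..1}" shows "at_m (s, 0) = Fe (s, 0)" "at_p (s, 0) = Fe (s, 0)" "Fe (s, 0) \<in> e"
proof -
  show "at_m (s, 0) = Fe (s, 0)" "at_p (s, 0) = Fe (s, 0)" using Fm[of "(s, 0)"] Fp[of "(s, 0)"] assms by simp_all
  show "Fe (s, 0) \<in> e" unfolding e_eq using assms by (intro imageI) simp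
qed

lemma val_trace:
  assumes "s \<in> {0..1}"
  shows "val u km (Fe (s, 0)) = trace_m u s" "val u kp (Fe (s, 0)) = trace_p u s"
proof -
  have q: "(s, 0) \<in> sq_closed" using assms by (simp add: sq_closed_def)
  show "val u km (Fe (s, 0)) = trace_m u s"
    unfolding edge_points(1)[OF assms, symmetric] val_def trace_m_def using q by (simp add: G_F[OF kmp(1)])
  show "val u kp (Fe (s, 0)) = trace_p u s"
    unfolding edge_points(2)[OF assms, symmetric] val_def trace_p_def using q by (simp add: G_F[OF kmp(2)])
qed

lemma edge_matched_iff: "edge_matched e u \<longleftrightarrow> (\<forall>s\<in>{0..1}. trace_m u s = trace_p u s)"
proof
  assume m: "edge_matched e u"
  show "\<forall>s\<in>{0..1}. trace_m u s = trace_p u s"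
  proof
    fix s :: real assume s: "s \<in> {0..1}"
    have "val u km (Fe (s, 0)) = val u kp (Fe (s, 0))"
      using m edge_points(3)[OF s] kmp(4) unfolding edge_matched_def by blast
    then show "trace_m u s = trace_p u s" unfolding val_trace[OF s] .
  qed
next
  assume h: "\<forall>s\<in>{0..1}. trace_m u s = trace_p u s"
  have "val u km x = val u kp x" if xe: "x \<in> e" for x
  proof -
    obtain z where z: "z \<in> {0..1} \<times> {0}" "x = Fe z" using xe unfolding e_eq by blast
    then have "z = (fst z, 0)" "fst z \<in> {0..1}" by (auto simp: prod_eq_iff)
    then show ?thesis using val_trace[of "fst z" u] z(2) h by simp
  qed
  then show "edge_matched e u" unfolding edge_matched_def kmp(4) by simp
qed

lemma edge_end_vertex:
  assumes "s \<in> {0, 1}" shows "Fe (s, 0) \<in> vertices D" "km \<in> vertex_patches D (Fe (s, 0))" "kp \<in> vertex_patches D (Fe (s, 0))"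
proof -
  have s: "s \<in> {0..1}" using assms by auto
  have c: "(s, 0) \<in> corners" using assms by simp
  have m: "Fe (s, 0) \<in> patch_vertices D km" unfolding edge_points(1)[OF s, symmetric] patch_vertices_eq
    by (intro imageI square_sym_corners c)
  have p: "Fe (s, 0) \<in> patch_vertices D kp" unfolding edge_points(2)[OF s, symmetric] patch_vertices_eq
    by (intro imageI square_sym_corners c)
  show "Fe (s, 0) \<in> vertices D" using m kmp(1) unfolding vertices_def by blast
  show "km \<in> vertex_patches D (Fe (s, 0))" "kp \<in> vertex_patches D (Fe (s, 0))"
    unfolding vertex_patches_def using kmp patch_vertex_in_frontier m p by blast+
qed

lemma trace_ends:
  assumes "\<And>v. v \<in> vertices D \<Longrightarrow> vertex_matched v u" "s \<in> {0, 1}" shows "trace_m u s = trace_p u s"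
proof -
  have s: "s \<in> {0..1}" using assms(2) by auto
  have "val u km (Fe (s, 0)) = val u kp (Fe (s, 0))"
    using assms(1)[OF edge_end_vertex(1)[OF assms(2)]] edge_end_vertex(2,3)[OF assms(2)] unfolding vertex_matched_def by blast
  then show ?thesis unfolding val_trace[OF s] .
qed

lemma gamma_mp: "m \<in> {1..r} \<Longrightarrow> \<gamma> km m = \<gamma> kp m"
  using gamma_eq[OF edge_end_vertex(1,2,3)] by blast

text \<open>In terms of the two traces \<open>t\<^sub>-\<close> and \<open>t\<^sub>+\<close>, these are \<open>t\<^sub>- - R t\<^sub>+\<close> and \<open>R t\<^sub>+ - t\<^sub>+\<close>, followed by
\<open>\<lambda>\<^sub>0 - \<mu>\<close> on either side.\<close>

definition jump where "jump u s = trace_m u s - R (trace_p u) s"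
definition defect where "defect u s = R (trace_p u) s - trace_p u s"
definition end_m where "end_m t = lam D km 0 t - mu_p D r \<gamma> km False t"
definition end_p where "end_p t = lam D kp 0 t - mu_p D r \<gamma> kp False t"

text \<open>The profiles along the edge that multiply the correction \<open>C\<close> in the images of the basis functions on the
edge, with the two end functions included.\<close>

definition prof_m where
  "prof_m j = (if j = 0 then mu_m D r \<gamma> km kp False else if j = nmax D km then mu_m D r \<gamma> km kp True else lam D km j)"
definition prof_p where
  "prof_p j = (if j = 0 then R (mu_p D r \<gamma> kp False) else if j = nmax D kp then R (mu_p D r \<gamma> kp True) else R (lam D kp j))"

text \<open>The end functions deviate from the regular pattern by the same two splines on the coarse and on the fine
side. As the end values of both traces agree, the deviations cancel in the difference.\<close>

lemma profiles_combine:
  assumes "trace_m u = (\<lambda>s. \<Sum>j\<le>nmax D km. a j * lam D km j s)" "trace_p u = (\<lambda>s. \<Sum>j\<le>nmax D kp. b j * lam D kp j s)"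
    and v: "\<And>v. v \<in> vertices D \<Longrightarrow> vertex_matched v u"
  shows "(\<Sum>j\<le>nmax D km. a j * prof_m j s) - (\<Sum>j\<le>nmax D kp. b j * prof_p j s) = jump u s"
proof -
  have n: "0 < nmax D km" "0 < nmax D kp" using ed.cm.r_less ed.cp.r_less by auto
  have Rtp: "R (trace_p u) s = (\<Sum>j\<le>nmax D kp. b j * R (lam D kp j) s)"
    unfolding assms(2) by (subst ed.R_sum) (auto intro: ed.cp.splines_lam)
  have tm: "trace_m u s = (\<Sum>j\<le>nmax D km. a j * lam D km j s)" unfolding assms(1) ..
  have "a 0 = trace_m u 0" "a (nmax D km) = trace_m u 1" "b 0 = trace_p u 0" "b (nmax D kp) = trace_p u 1"
    unfolding assms(1,2) ed.cm.sum_lam_0 ed.cm.sum_lam_1 ed.cp.sum_lam_0 ed.cp.sum_lam_1 by simp_all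
  then have ab: "a 0 = b 0" "a (nmax D km) = b (nmax D kp)" using trace_ends[OF v] by simp_all
  have mu: "mu_m D r \<gamma> km kp q s = lam D km (end_idx q (nmax D km) 0) s + (R (mu_p D r \<gamma> kp q) s - R (lam D kp (end_idx q (nmax D kp) 0)) s)" for q
  proof -
    have "R (\<lambda>y. 1 * mu_p D r \<gamma> kp q y + (- 1) * lam D kp (end_idx q (nmax D kp) 0) y) =
      (\<lambda>y. 1 * R (mu_p D r \<gamma> kp q) y + (- 1) * R (lam D kp (end_idx q (nmax D kp) 0)) y)"
      by (intro ed.R_lincomb ed.cp.mu_splines ed.cp.splines_lam) (simp add: end_idx_def)
    then show ?thesis by (simp add: mu_m_def)
  qed
  have m: "(\<Sum>j\<le>nmax D km. a j * prof_m j s) = (\<Sum>j\<le>nmax D km. a j * lam D km j s)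
    + a 0 * (mu_m D r \<gamma> km kp False s - lam D km 0 s) + a (nmax D km) * (mu_m D r \<gamma> km kp True s - lam D km (nmax D km) s)"
    using sum_with_ends[OF n(1), of a "mu_m D r \<gamma> km kp False s" "mu_m D r \<gamma> km kp True s" "\<lambda>j. lam D km j s"]
    by (simp add: prof_m_def if_distrib[of "\<lambda>f. f s"] cong: if_cong)
  have p: "(\<Sum>j\<le>nmax D kp. b j * prof_p j s) = (\<Sum>j\<le>nmax D kp. b j * R (lam D kp j) s)
    + b 0 * (R (mu_p D r \<gamma> kp False) s - R (lam D kp 0) s) + b (nmax D kp) * (R (mu_p D r \<gamma> kp True) s - R (lam D kp (nmax D kp)) s)"
    using sum_with_ends[OF n(2), of b "R (mu_p D r \<gamma> kp False) s" "R (mu_p D r \<gamma> kp True) s" "\<lambda>j. R (lam D kp j) s"]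
    by (simp add: prof_p_def if_distrib[of "\<lambda>f. f s"] cong: if_cong)
  show ?thesis unfolding m p jump_def Rtp tm mu by (simp add: end_idx_def ab algebra_simps)
qed

lemma perp_at:
  assumes "0 < t" "t < 1"
  shows "perp_avg D km kp (- t) = lam D km 0 t / 2" "perp_avg D km kp t = lam D kp 0 t / 2"
    "perp_corr D r \<gamma> km kp (- t) = mu_p D r \<gamma> km False t / 2" "perp_corr D r \<gamma> km kp t = - mu_p D r \<gamma> kp False t / 2"
proof -
  show "perp_avg D km kp (- t) = lam D km 0 t / 2" "perp_avg D km kp t = lam D kp 0 t / 2"
    using assms by (simp_all add: perp_avg_def perp_m_def perp_p_def)
  show "perp_corr D r \<gamma> km kp (- t) = mu_p D r \<gamma> km False t / 2"
    using assms by (simp add: perp_corr_def perp_m_def perp_p_def mu_p_def end_idx_def)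
  have "(\<Sum>m=1..r. \<gamma> km m * (perp_m D km m t - perp_p D kp m t)) = (\<Sum>m=1..r. - (\<gamma> kp m * lam D kp m t))"
    using assms by (intro sum.cong refl) (simp add: perp_m_def perp_p_def gamma_mp)
  then show "perp_corr D r \<gamma> km kp t = - mu_p D r \<gamma> kp False t / 2"
    by (simp add: perp_corr_def mu_p_def end_idx_def sum_negf)
qed

context
  fixes P
  assumes P: "edge_operator_for D r \<gamma> km kp Fe P"
begin

lemma P_linear: "linear_op_on (Vpw D) P"
  using P by (simp add: edge_operator_for_def Let_def)

lemma P_edge_m:
  assumes "j \<le> nmax D km"
  shows "P (push (lam D km j \<otimes>\<^sub>t perp_m D km 0)) =
    push (\<lambda>x. (lam D km j \<otimes>\<^sub>t perp_avg D km kp) x + (prof_m j \<otimes>\<^sub>t perp_corr D r \<gamma> km kp) x)"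
proof -
  have n: "0 < nmax D km" using ed.cm.r_less by auto
  have ends: "P (push (lam D km (end_idx b (nmax D km) 0) \<otimes>\<^sub>t perp_m D km 0)) =
     push (\<lambda>x. (lam D km (end_idx b (nmax D km) 0) \<otimes>\<^sub>t perp_avg D km kp) x + (mu_m D r \<gamma> km kp b \<otimes>\<^sub>t perp_corr D r \<gamma> km kp) x)" for b
    using P unfolding edge_operator_for_def Let_def by blast
  consider "j = 0" | "j = nmax D km" | "j \<in> {0<..<nmax D km}" using assms by force
  then show ?thesis
  proof cases
    case 1 then show ?thesis using ends[of False] by (simp add: end_idx_def prof_m_def)
  next
    case 2 then show ?thesis using ends[of True] n by (simp add: end_idx_def prof_m_def)
  next
    case 3
    then have "P (push (lam D km j \<otimes>\<^sub>t perp_m D km 0)) = push (lam D km j \<otimes>\<^sub>t (\<lambda>t. perp_avg D km kp t + perp_corr D r \<gamma> km kp t))"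
      using P unfolding edge_operator_for_def Let_def by blast
    also have "lam D km j \<otimes>\<^sub>t (\<lambda>t. perp_avg D km kp t + perp_corr D r \<gamma> km kp t) =
      (\<lambda>x. (lam D km j \<otimes>\<^sub>t perp_avg D km kp) x + (prof_m j \<otimes>\<^sub>t perp_corr D r \<gamma> km kp) x)"
      using 3 by (simp add: fun_eq_iff tensor_def prof_m_def distrib_left)
    finally show ?thesis .
  qed
qed

lemma P_edge_p:
  assumes "j \<le> nmax D kp"
  shows "P (push (lam D kp j \<otimes>\<^sub>t perp_p D kp 0)) =
    push (\<lambda>x. (R (lam D kp j) \<otimes>\<^sub>t perp_avg D km kp) x - (prof_p j \<otimes>\<^sub>t perp_corr D r \<gamma> km kp) x)"
proof -
  have n: "0 < nmax D kp" using ed.cp.r_less by auto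
  have ends: "P (push (lam D kp (end_idx b (nmax D kp) 0) \<otimes>\<^sub>t perp_p D kp 0)) =
     push (\<lambda>x. (R (lam D kp (end_idx b (nmax D kp) 0)) \<otimes>\<^sub>t perp_avg D km kp) x - (R (mu_p D r \<gamma> kp b) \<otimes>\<^sub>t perp_corr D r \<gamma> km kp) x)" for b
    using P unfolding edge_operator_for_def Let_def by blast
  consider "j = 0" | "j = nmax D kp" | "j \<in> {0<..<nmax D kp}" using assms by force
  then show ?thesis
  proof cases
    case 1 then show ?thesis using ends[of False] by (simp add: end_idx_def prof_p_def)
  next
    case 2 then show ?thesis using ends[of True] n by (simp add: end_idx_def prof_p_def)
  next
    case 3
    then have "P (push (lam D kp j \<otimes>\<^sub>t perp_p D kp 0)) = push (R (lam D kp j) \<otimes>\<^sub>t (\<lambda>t. perp_avg D km kp t - perp_corr D r \<gamma> km kp t))"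
      using P unfolding edge_operator_for_def Let_def by blast
    also have "R (lam D kp j) \<otimes>\<^sub>t (\<lambda>t. perp_avg D km kp t - perp_corr D r \<gamma> km kp t) =
      (\<lambda>x. (R (lam D kp j) \<otimes>\<^sub>t perp_avg D km kp) x - (prof_p j \<otimes>\<^sub>t perp_corr D r \<gamma> km kp) x)"
      using 3 by (simp add: fun_eq_iff tensor_def prof_p_def right_diff_distrib)
    finally show ?thesis .
  qed
qed

lemma P_fixed_m:
  assumes "\<phi> \<in> tensor_splines D km" "\<And>s. \<phi> (square_sym \<sigma>m (s, 0)) = 0" shows "\<phi> \<in> fixed P km"
proof -
  obtain c where c: "\<phi> = (\<lambda>x. \<Sum>z\<in>{..nmax D km} \<times> {1..nmax D km}. c z * untwist \<sigma>m (lam D km (fst z) \<otimes>\<^sub>t lam D km (snd z)) x)"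
    using ed.cm.zero_bottom_trace[OF assms] by blast
  show ?thesis unfolding c
  proof (rule fixed_lincomb[OF P_linear kmp(1)])
    fix z assume z: "z \<in> {..nmax D km} \<times> {1..nmax D km}"
    then have z': "fst z \<in> {..nmax D km}" "snd z \<in> {1..nmax D km}" unfolding mem_Times_iff by blast+
    have "\<forall>j1\<in>{..nmax D km}. \<forall>j2\<in>{1..nmax D km}. P (push (lam D km j1 \<otimes>\<^sub>t perp_m D km j2)) = push (lam D km j1 \<otimes>\<^sub>t perp_m D km j2)"
      using P unfolding edge_operator_for_def Let_def by (elim conjE)
    then have "P (push (lam D km (fst z) \<otimes>\<^sub>t perp_m D km (snd z))) = push (lam D km (fst z) \<otimes>\<^sub>t perp_m D km (snd z))"
      using z' by blast
    then show "untwist \<sigma>m (lam D km (fst z) \<otimes>\<^sub>t lam D km (snd z)) \<in> fixed P km"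
      unfolding fixed_def push_m using z'
      by (auto intro!: ed.cm.untwist_tensor_splines ed.cm.tensor_in_tensor_splines ed.cm.splines_lam)
  qed simp
qed

lemma P_fixed_p:
  assumes "\<phi> \<in> tensor_splines D kp" "\<And>s. \<phi> (square_sym \<sigma>p (s, 0)) = 0" shows "\<phi> \<in> fixed P kp"
proof -
  obtain c where c: "\<phi> = (\<lambda>x. \<Sum>z\<in>{..nmax D kp} \<times> {1..nmax D kp}. c z * untwist \<sigma>p (lam D kp (fst z) \<otimes>\<^sub>t lam D kp (snd z)) x)"
    using ed.cp.zero_bottom_trace[OF assms] by blast
  show ?thesis unfolding c
  proof (rule fixed_lincomb[OF P_linear kmp(2)])
    fix z assume z: "z \<in> {..nmax D kp} \<times> {1..nmax D kp}"
    then have z': "fst z \<in> {..nmax D kp}" "snd z \<in> {1..nmax D kp}" unfolding mem_Times_iff by blast+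
    have "\<forall>j1\<in>{..nmax D kp}. \<forall>j2\<in>{1..nmax D kp}. P (push (lam D kp j1 \<otimes>\<^sub>t perp_p D kp j2)) = push (lam D kp j1 \<otimes>\<^sub>t perp_p D kp j2)"
      using P unfolding edge_operator_for_def Let_def by (elim conjE)
    then have "P (push (lam D kp (fst z) \<otimes>\<^sub>t perp_p D kp (snd z))) = push (lam D kp (fst z) \<otimes>\<^sub>t perp_p D kp (snd z))"
      using z' by blast
    then show "untwist \<sigma>p (lam D kp (fst z) \<otimes>\<^sub>t lam D kp (snd z)) \<in> fixed P kp"
      unfolding fixed_def push_p using z'
      by (auto intro!: ed.cp.untwist_tensor_splines ed.cp.tensor_in_tensor_splines ed.cp.splines_lam)
  qed simp
qed

text \<open>After removal of the traces on the edge, extended by the first basis function across it, the function has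
zero trace from both sides and is therefore fixed.\<close>

lemma P_reduced:
  assumes u: "u \<in> Vpw D"
  defines "Tm \<equiv> pushfwd D km (untwist \<sigma>m (trace_m u \<otimes>\<^sub>t lam D km 0))"
    and "Tp \<equiv> pushfwd D kp (untwist \<sigma>p (trace_p u \<otimes>\<^sub>t lam D kp 0))"
  shows "P u = (\<lambda>x. u x + (P Tm x - Tm x) + (P Tp x - Tp x))"
proof -
  have tm: "untwist \<sigma>m (trace_m u \<otimes>\<^sub>t lam D km 0) \<in> tensor_splines D km"
    by (intro ed.cm.untwist_tensor_splines ed.cm.tensor_in_tensor_splines trace_splines u ed.cm.splines_lam) simp
  have tp: "untwist \<sigma>p (trace_p u \<otimes>\<^sub>t lam D kp 0) \<in> tensor_splines D kp"
    by (intro ed.cp.untwist_tensor_splines ed.cp.tensor_in_tensor_splines trace_splines u ed.cp.splines_lam) simp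
  have Tm: "Tm \<in> Vpw D" and Tp: "Tp \<in> Vpw D" unfolding Tm_def Tp_def by (intro pushfwd_in_Vpw kmp tm tp)+
  define v where "v = (\<lambda>x. 1 * u x + (- 1) * Tm x)"
  define w where "w = (\<lambda>x. 1 * v x + (- 1) * Tp x)"
  have v: "v \<in> Vpw D" unfolding v_def by (rule Vpw_lincomb[OF u Tm])
  have w: "w \<in> Vpw D" unfolding w_def by (rule Vpw_lincomb[OF v Tp])
  have pw: "pull k w = (\<lambda>x. pull k u x - pull k Tm x - pull k Tp x)" if k: "k \<in> K" for k
    unfolding w_def pull_lincomb[OF v Tp k] unfolding v_def pull_lincomb[OF u Tm k] by simp
  have pTm: "pull k Tm = (if k = km then untwist \<sigma>m (trace_m u \<otimes>\<^sub>t lam D km 0) else (\<lambda>x. 0))" if k: "k \<in> K" for k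
    unfolding Tm_def by (rule pull_pushfwd[OF k kmp(1) tm])
  have pTp: "pull k Tp = (if k = kp then untwist \<sigma>p (trace_p u \<otimes>\<^sub>t lam D kp 0) else (\<lambda>x. 0))" if k: "k \<in> K" for k
    unfolding Tp_def by (rule pull_pushfwd[OF k kmp(2) tp])
  have "P w = w"
  proof (rule fixed_imp_eq[OF P_linear w])
    fix k assume k: "k \<in> K"
    consider "k = km" | "k = kp" | "k \<in> K - {km, kp}" using k by blast
    then show "pull k w \<in> fixed P k"
    proof cases
      case 1
      have "pull km w (square_sym \<sigma>m (s, 0)) = 0" for s
        unfolding pw[OF kmp(1)] pTm[OF kmp(1)] pTp[OF kmp(1)] using kmp(3)
        by (simp add: trace_m_def tensor_def ed.cm.lam_0)
      then show ?thesis unfolding 1 by (rule P_fixed_m[OF pull(1)[OF w kmp(1)]])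
    next
      case 2
      have "pull kp w (square_sym \<sigma>p (s, 0)) = 0" for s
        unfolding pw[OF kmp(2)] pTm[OF kmp(2)] pTp[OF kmp(2)] using kmp(3)
        by (simp add: trace_p_def tensor_def ed.cp.lam_0)
      then show ?thesis unfolding 2 by (rule P_fixed_p[OF pull(1)[OF w kmp(2)]])
    next
      case 3
      have "\<forall>k \<in> patches D - {km, kp}. \<forall>i \<in> {..nmax D k} \<times> {..nmax D k}. P (Lam D k i) = Lam D k i"
        using P unfolding edge_operator_for_def Let_def by (elim conjE)
      then have "P (Lam D k i) = Lam D k i" if "i \<in> {..nmax D k} \<times> {..nmax D k}" for i using 3 that by blast
      then show ?thesis by (rule all_fixed[OF P_linear k pull(1)[OF w k]])
    qed
  qed
  have "P v = P (\<lambda>x. 1 * w x + 1 * Tp x)" by (simp add: w_def)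
  also have "\<dots> = (\<lambda>x. 1 * w x + 1 * P Tp x)" unfolding lin_lincomb[OF P_linear w Tp] \<open>P w = w\<close> ..
  finally have Pv: "P v = (\<lambda>x. 1 * w x + 1 * P Tp x)" .
  have "P u = P (\<lambda>x. 1 * v x + 1 * Tm x)" by (simp add: v_def)
  also have "\<dots> = (\<lambda>x. 1 * P v x + 1 * P Tm x)" by (rule lin_lincomb[OF P_linear v Tm])
  finally show ?thesis unfolding Pv by (simp add: w_def v_def fun_eq_iff)
qed

lemma P_traces:
  assumes u: "u \<in> Vpw D"
    and a: "trace_m u = (\<lambda>s. \<Sum>j\<le>nmax D km. a j * lam D km j s)" and b: "trace_p u = (\<lambda>s. \<Sum>j\<le>nmax D kp. b j * lam D kp j s)"
  shows "P (pushfwd D km (untwist \<sigma>m (trace_m u \<otimes>\<^sub>t lam D km 0))) = push (\<lambda>x. (trace_m u \<otimes>\<^sub>t perp_avg D km kp) x +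
      ((\<lambda>s. \<Sum>j\<le>nmax D km. a j * prof_m j s) \<otimes>\<^sub>t perp_corr D r \<gamma> km kp) x)"
    and "P (pushfwd D kp (untwist \<sigma>p (trace_p u \<otimes>\<^sub>t lam D kp 0))) = push (\<lambda>x. (R (trace_p u) \<otimes>\<^sub>t perp_avg D km kp) x -
      ((\<lambda>s. \<Sum>j\<le>nmax D kp. b j * prof_p j s) \<otimes>\<^sub>t perp_corr D r \<gamma> km kp) x)"
proof -
  have sm: "pushfwd D km (untwist \<sigma>m (trace_m u \<otimes>\<^sub>t lam D km 0)) = (\<lambda>x. \<Sum>j\<le>nmax D km. a j * push (lam D km j \<otimes>\<^sub>t perp_m D km 0) x)"
    unfolding push_m a by (simp add: fun_eq_iff pushfwd_def untwist_def tensor_def sum_distrib_right mult.assoc)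
  have "P (pushfwd D km (untwist \<sigma>m (trace_m u \<otimes>\<^sub>t lam D km 0))) = (\<lambda>x. \<Sum>j\<le>nmax D km. a j * P (push (lam D km j \<otimes>\<^sub>t perp_m D km 0)) x)"
    unfolding sm by (rule lin_sum[OF P_linear]) (auto simp: push_m intro!: pushfwd_in_Vpw kmp ed.cm.untwist_tensor_splines ed.cm.tensor_in_tensor_splines ed.cm.splines_lam)
  also have "\<dots> = (\<lambda>x. \<Sum>j\<le>nmax D km. a j * push (\<lambda>x. (lam D km j \<otimes>\<^sub>t perp_avg D km kp) x + (prof_m j \<otimes>\<^sub>t perp_corr D r \<gamma> km kp) x) x)"
    by (intro ext sum.cong refl) (simp add: P_edge_m)
  also have "\<dots> = push (\<lambda>x. (trace_m u \<otimes>\<^sub>t perp_avg D km kp) x + ((\<lambda>s. \<Sum>j\<le>nmax D km. a j * prof_m j s) \<otimes>\<^sub>t perp_corr D r \<gamma> km kp) x)"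
    by (simp add: fun_eq_iff edge_push_def tensor_def a sum_distrib_right distrib_left mult.assoc sum.distrib)
  finally show "P (pushfwd D km (untwist \<sigma>m (trace_m u \<otimes>\<^sub>t lam D km 0))) = push (\<lambda>x. (trace_m u \<otimes>\<^sub>t perp_avg D km kp) x +
      ((\<lambda>s. \<Sum>j\<le>nmax D km. a j * prof_m j s) \<otimes>\<^sub>t perp_corr D r \<gamma> km kp) x)" .
  have Rb: "R (trace_p u) = (\<lambda>s. \<Sum>j\<le>nmax D kp. b j * R (lam D kp j) s)"
    unfolding b by (rule ed.R_sum) (auto intro: ed.cp.splines_lam)
  have sp: "pushfwd D kp (untwist \<sigma>p (trace_p u \<otimes>\<^sub>t lam D kp 0)) = (\<lambda>x. \<Sum>j\<le>nmax D kp. b j * push (lam D kp j \<otimes>\<^sub>t perp_p D kp 0) x)"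
    unfolding push_p b by (simp add: fun_eq_iff pushfwd_def untwist_def tensor_def sum_distrib_right mult.assoc)
  have "P (pushfwd D kp (untwist \<sigma>p (trace_p u \<otimes>\<^sub>t lam D kp 0))) = (\<lambda>x. \<Sum>j\<le>nmax D kp. b j * P (push (lam D kp j \<otimes>\<^sub>t perp_p D kp 0)) x)"
    unfolding sp by (rule lin_sum[OF P_linear]) (auto simp: push_p intro!: pushfwd_in_Vpw kmp ed.cp.untwist_tensor_splines ed.cp.tensor_in_tensor_splines ed.cp.splines_lam)
  also have "\<dots> = (\<lambda>x. \<Sum>j\<le>nmax D kp. b j * push (\<lambda>x. (R (lam D kp j) \<otimes>\<^sub>t perp_avg D km kp) x - (prof_p j \<otimes>\<^sub>t perp_corr D r \<gamma> km kp) x) x)"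
    by (intro ext sum.cong refl) (simp add: P_edge_p)
  also have "\<dots> = push (\<lambda>x. (R (trace_p u) \<otimes>\<^sub>t perp_avg D km kp) x - ((\<lambda>s. \<Sum>j\<le>nmax D kp. b j * prof_p j s) \<otimes>\<^sub>t perp_corr D r \<gamma> km kp) x)"
    unfolding Rb by (simp add: fun_eq_iff edge_push_def tensor_def sum_distrib_right right_diff_distrib mult.assoc sum_subtractf)
  finally show "P (pushfwd D kp (untwist \<sigma>p (trace_p u \<otimes>\<^sub>t lam D kp 0))) = push (\<lambda>x. (R (trace_p u) \<otimes>\<^sub>t perp_avg D km kp) x -
      ((\<lambda>s. \<Sum>j\<le>nmax D kp. b j * prof_p j s) \<otimes>\<^sub>t perp_corr D r \<gamma> km kp) x)" .
qed

end

end

section \<open>Effect of an edge operator\<close>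

lemma tensor_vanishes:
  "f 0 = 0 \<Longrightarrow> f 1 = 0 \<Longrightarrow> g 1 = 0 \<Longrightarrow> fst z \<in> {0, 1} \<or> snd z = 1 \<Longrightarrow> (f \<otimes>\<^sub>t g) z = 0"
  by (auto simp: tensor_def)

context edge_setting
begin

context
  fixes P u
  assumes P: "edge_operator_for D r \<gamma> km kp Fe P" and u: "u \<in> Vpw D"
    and v: "\<forall>v\<in>vertices D. vertex_matched v u"
begin

lemma Pu: "P u \<in> Vpw D" using P_linear[OF P] u by (rule lin_closed)

lemma P_difference:
  obtains A B where
    "\<And>s t. (s, t) \<in> sq_open \<Longrightarrow> P u (at_m (s, t)) = u (at_m (s, t))
      + (trace_m u s * perp_avg D km kp (- t) + A s * perp_corr D r \<gamma> km kp (- t) - trace_m u s * lam D km 0 t)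
      + (R (trace_p u) s * perp_avg D km kp (- t) - B s * perp_corr D r \<gamma> km kp (- t))"
    "\<And>s t. (s, t) \<in> sq_open \<Longrightarrow> P u (at_p (s, t)) = u (at_p (s, t))
      + (trace_m u s * perp_avg D km kp t + A s * perp_corr D r \<gamma> km kp t)
      + (R (trace_p u) s * perp_avg D km kp t - B s * perp_corr D r \<gamma> km kp t - trace_p u s * lam D kp 0 t)"
    "\<And>x. x \<notin> patch D km \<union> patch D kp \<Longrightarrow> P u x = u x"
    "\<And>s. A s - B s = jump u s"
proof -
  obtain a where a: "trace_m u = (\<lambda>s. \<Sum>j\<le>nmax D km. a j * lam D km j s)"
    using trace_splines(1)[OF u] unfolding splines_def by blast
  obtain b where b: "trace_p u = (\<lambda>s. \<Sum>j\<le>nmax D kp. b j * lam D kp j s)"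
    using trace_splines(2)[OF u] unfolding splines_def by blast
  define A where "A s = (\<Sum>j\<le>nmax D km. a j * prof_m j s)" for s
  define B where "B s = (\<Sum>j\<le>nmax D kp. b j * prof_p j s)" for s
  have Px: "P u x = u x + (push (\<lambda>x. (trace_m u \<otimes>\<^sub>t perp_avg D km kp) x + (A \<otimes>\<^sub>t perp_corr D r \<gamma> km kp) x) x - push (trace_m u \<otimes>\<^sub>t perp_m D km 0) x)
      + (push (\<lambda>x. (R (trace_p u) \<otimes>\<^sub>t perp_avg D km kp) x - (B \<otimes>\<^sub>t perp_corr D r \<gamma> km kp) x) x - push (trace_p u \<otimes>\<^sub>t perp_p D kp 0) x)" for x
    unfolding push_m push_p fun_cong[OF P_reduced[OF P u], of x] P_traces[OF P u a b] A_def[abs_def] B_def[abs_def] ..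
  have 1: "P u (at_m (s, t)) = u (at_m (s, t))
      + (trace_m u s * perp_avg D km kp (- t) + A s * perp_corr D r \<gamma> km kp (- t) - trace_m u s * lam D km 0 t)
      + (R (trace_p u) s * perp_avg D km kp (- t) - B s * perp_corr D r \<gamma> km kp (- t))"
    if st: "(s, t) \<in> sq_open" for s t
  proof -
    have "0 < t" "t < 1" using st by (simp_all add: sq_open_def)
    then show ?thesis unfolding Px push_at(1)[OF st] by (simp add: tensor_def perp_m_def perp_p_def)
  qed
  have 2: "P u (at_p (s, t)) = u (at_p (s, t))
      + (trace_m u s * perp_avg D km kp t + A s * perp_corr D r \<gamma> km kp t)
      + (R (trace_p u) s * perp_avg D km kp t - B s * perp_corr D r \<gamma> km kp t - trace_p u s * lam D kp 0 t)"
    if st: "(s, t) \<in> sq_open" for s t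
  proof -
    have "0 < t" "t < 1" using st by (simp_all add: sq_open_def)
    then show ?thesis unfolding Px push_at(2)[OF st] by (simp add: tensor_def perp_m_def perp_p_def)
  qed
  have 3: "P u x = u x" if "x \<notin> patch D km \<union> patch D kp" for x
    unfolding Px push_off[OF that] by simp
  have 4: "A s - B s = jump u s" for s unfolding A_def B_def by (rule profiles_combine[OF a b bspec[OF v]])
  show thesis by (rule that[OF 1 2 3 4])
qed

lemma jump_regular: "continuous_on {0..1} (jump u)" "continuous_on {0..1} (defect u)" "continuous_on {0..1} end_m" "continuous_on {0..1} end_p"
  unfolding jump_def[abs_def] defect_def[abs_def] end_m_def[abs_def] end_p_def[abs_def]
  by (intro continuous_on_diff ed.cm.splines_continuous ed.cp.splines_continuous ed.R_splines trace_splines u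
      ed.cm.splines_lam ed.cp.splines_lam ed.cm.mu_splines ed.cp.mu_splines; simp)+

lemma end_values: "end_m 0 = 1" "end_m 1 = 0" "end_p 0 = 1" "end_p 1 = 0" "lam D kp 0 1 = 0" "lam D kp 0 0 = 1"
  using ed.cm.r_less ed.cp.r_less
  by (simp_all add: end_m_def end_p_def ed.cm.lam_0 ed.cm.lam_1 ed.cp.lam_0 ed.cp.lam_1 ed.cm.mu_ends ed.cp.mu_ends)

lemma jump_ends: "s \<in> {0, 1} \<Longrightarrow> jump u s = 0 \<and> defect u s = 0"
  using ed.R_ends[OF trace_splines(2)[OF u]] trace_ends[OF bspec[OF v], of s] by (auto simp: jump_def defect_def)

text \<open>Evaluate the images of both traces at an inner point; the average \<open>A\<close> and the correction \<open>C\<close> contribute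
half of \<open>\<lambda>\<^sub>0\<close> and half of \<open>\<mu>\<close>. The factor \<open>1\<close> keeps the shape of a linear combination.\<close>

lemma pull_m:
  assumes "x \<in> sq_closed"
  shows "pull km (P u) x = 1 * pull km u x + (- 1 / 2) * untwist \<sigma>m (jump u \<otimes>\<^sub>t end_m) x"
proof (rule pull_eq_on_closed[OF Pu kmp(1) _ _ assms])
  show "continuous_on sq_closed (\<lambda>x. 1 * pull km u x + (- 1 / 2) * untwist \<sigma>m (jump u \<otimes>\<^sub>t end_m) x)"
    unfolding untwist_def
    by (intro continuous_intros ed.cm.tensor_splines_continuous pull(1) u kmp square_sym_tensor_regular(1) jump_regular)
  fix x assume x: "x \<in> sq_open"
  obtain A B where d: "\<And>s t. (s, t) \<in> sq_open \<Longrightarrow> P u (at_m (s, t)) = u (at_m (s, t))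
      + (trace_m u s * perp_avg D km kp (- t) + A s * perp_corr D r \<gamma> km kp (- t) - trace_m u s * lam D km 0 t)
      + (R (trace_p u) s * perp_avg D km kp (- t) - B s * perp_corr D r \<gamma> km kp (- t))" and j: "\<And>s. A s - B s = jump u s"
    using P_difference by metis
  obtain s t where st: "square_sym (sym_inv \<sigma>m) x = (s, t)" by (cases "square_sym (sym_inv \<sigma>m) x")
  have x': "x = square_sym \<sigma>m (s, t)" unfolding st[symmetric] by simp
  have o: "(s, t) \<in> sq_open" using x unfolding x' square_sym_in .
  then have t: "0 < t" "t < 1" by (simp_all add: sq_open_def)
  have A: "A s = B s + jump u s" using j[of s] by simp
  show "P u (F km x) = 1 * pull km u x + (- 1 / 2) * untwist \<sigma>m (jump u \<otimes>\<^sub>t end_m) x"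
    unfolding pull(2)[OF u kmp(1) x, symmetric] unfolding x' untwist_square_sym d[OF o] perp_at[OF t] A
    by (simp add: tensor_def end_m_def jump_def field_simps)
qed

text \<open>The same evaluation on the fine side, where the trace itself is replaced by its restriction as well.\<close>

lemma pull_p:
  assumes "x \<in> sq_closed"
  shows "pull kp (P u) x = 1 * pull kp u x + 1 * (1 / 2 * untwist \<sigma>p (jump u \<otimes>\<^sub>t end_p) x + 1 * untwist \<sigma>p (defect u \<otimes>\<^sub>t lam D kp 0) x)"
proof (rule pull_eq_on_closed[OF Pu kmp(2) _ _ assms])
  show "continuous_on sq_closed (\<lambda>x. 1 * pull kp u x + 1 * (1 / 2 * untwist \<sigma>p (jump u \<otimes>\<^sub>t end_p) x + 1 * untwist \<sigma>p (defect u \<otimes>\<^sub>t lam D kp 0) x))"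
    unfolding untwist_def
    by (intro continuous_intros ed.cp.tensor_splines_continuous pull(1) u kmp square_sym_tensor_regular(1) jump_regular ed.cp.lam_continuous)
  fix x assume x: "x \<in> sq_open"
  obtain A B where d: "\<And>s t. (s, t) \<in> sq_open \<Longrightarrow> P u (at_p (s, t)) = u (at_p (s, t))
      + (trace_m u s * perp_avg D km kp t + A s * perp_corr D r \<gamma> km kp t)
      + (R (trace_p u) s * perp_avg D km kp t - B s * perp_corr D r \<gamma> km kp t - trace_p u s * lam D kp 0 t)" and j: "\<And>s. A s - B s = jump u s"
    using P_difference by metis
  obtain s t where st: "square_sym (sym_inv \<sigma>p) x = (s, t)" by (cases "square_sym (sym_inv \<sigma>p) x")
  have x': "x = square_sym \<sigma>p (s, t)" unfolding st[symmetric] by simp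
  have o: "(s, t) \<in> sq_open" using x unfolding x' square_sym_in .
  then have t: "0 < t" "t < 1" by (simp_all add: sq_open_def)
  have A: "A s = B s + jump u s" using j[of s] by simp
  show "P u (F kp x) = 1 * pull kp u x + 1 * (1 / 2 * untwist \<sigma>p (jump u \<otimes>\<^sub>t end_p) x + 1 * untwist \<sigma>p (defect u \<otimes>\<^sub>t lam D kp 0) x)"
    unfolding pull(2)[OF u kmp(2) x, symmetric] unfolding x' untwist_square_sym d[OF o] perp_at[OF t] A
    by (simp add: tensor_def end_p_def jump_def defect_def field_simps)
qed

lemma pull_other:
  assumes "k \<in> K" "k \<noteq> km" "k \<noteq> kp" shows "pull k (P u) = pull k u"
proof (rule pull_eqI[OF Pu assms(1) pull(1)[OF u assms(1)]])
  fix x assume x: "x \<in> sq_open"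
  then have "F k x \<in> patch D k" by (simp add: patch_def)
  then have "F k x \<notin> patch D km \<union> patch D kp" using patches_disjoint[OF assms(1)] kmp assms by blast
  then have "P u (F k x) = u (F k x)" using P_difference by metis
  then show "P u (F k x) = pull k u x" using pull(2)[OF u assms(1) x] by simp
qed

text \<open>The corrections vanish on the three other sides of each of the two patches: their profiles along the edge
vanish at its ends, and their profiles across the edge vanish on the opposite side.\<close>

lemma val_unchanged:
  assumes k: "k \<in> K" and x: "x \<in> frontier (patch D k)" and off: "k \<in> {km, kp} \<Longrightarrow> x \<in> e \<Longrightarrow> x \<in> patch_vertices D k"
  shows "val (P u) k x = val u k x"
proof -
  obtain y where y: "y \<in> sq_closed - sq_open" "x = F k y" using x unfolding frontier_patch[OF k] by blast
  have yc: "y \<in> sq_closed" using y(1) by blast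
  have G: "G k x = y" unfolding y(2) by (rule G_F[OF k yc])
  have key: "fst z \<in> {0, 1} \<or> snd z = 1" if z: "z = square_sym (sym_inv \<sigma>) y" and kk: "k \<in> {km, kp}"
    and bottom: "\<And>s. s \<in> {0..1} \<Longrightarrow> F k (square_sym \<sigma> (s, 0)) \<in> e" for \<sigma> z
  proof (rule ccontr)
    assume h: "\<not> (fst z \<in> {0, 1} \<or> snd z = 1)"
    have zb: "z \<in> sq_closed - sq_open" unfolding z using y(1) by simp
    then have zc: "z \<in> sq_closed" and "snd z = 0" using h unfolding sq_boundary by auto
    then have ze: "z = (fst z, 0)" "fst z \<in> {0..1}" by (auto simp: prod_eq_iff sq_closed_def mem_Times_iff)
    have y': "y = square_sym \<sigma> z" unfolding z by simp
    then have "x \<in> e" using bottom[OF ze(2)] ze(1) y(2) by simp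
    then have "x \<in> patch_vertices D k" by (rule off[OF kk])
    then obtain c where c: "c \<in> corners" "x = F k c" unfolding patch_vertices_eq by (rule imageE)
    have "c \<in> sq_closed" using c(1) corners_subset by blast
    then have "y = c" using c(2) y(2) G_F[OF k] yc by metis
    then have "z \<in> corners" unfolding z using square_sym_corners[OF c(1)] by simp
    then show False using h unfolding mem_Times_iff by blast
  qed
  consider "k = km" | "k = kp" | "k \<noteq> km" "k \<noteq> kp" by blast
  then show ?thesis
  proof cases
    case 1
    have "fst (square_sym (sym_inv \<sigma>m) y) \<in> {0, 1} \<or> snd (square_sym (sym_inv \<sigma>m) y) = 1"
    proof (rule key[OF refl])
      show "k \<in> {km, kp}" using 1 by simp
      show "F k (square_sym \<sigma>m (s, 0)) \<in> e" if "s \<in> {0..1}" for s unfolding 1 edge_points(1)[OF that] by (rule edge_points(3)[OF that])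
    qed
    then have "untwist \<sigma>m (jump u \<otimes>\<^sub>t end_m) y = 0"
      unfolding untwist_def by (rule tensor_vanishes[rotated 3]) (simp_all add: jump_ends end_values)
    then show ?thesis unfolding val_def G using pull_m[OF yc] 1 by simp
  next
    case 2
    have "fst (square_sym (sym_inv \<sigma>p) y) \<in> {0, 1} \<or> snd (square_sym (sym_inv \<sigma>p) y) = 1"
    proof (rule key[OF refl])
      show "k \<in> {km, kp}" using 2 by simp
      show "F k (square_sym \<sigma>p (s, 0)) \<in> e" if "s \<in> {0..1}" for s unfolding 2 edge_points(2)[OF that] by (rule edge_points(3)[OF that])
    qed
    then have "untwist \<sigma>p (jump u \<otimes>\<^sub>t end_p) y = 0" "untwist \<sigma>p (defect u \<otimes>\<^sub>t lam D kp 0) y = 0"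
      unfolding untwist_def by (rule tensor_vanishes[rotated 3]; simp add: jump_ends end_values)+
    then show ?thesis unfolding val_def G using pull_p[OF yc] 2 by simp
  next
    case 3
    then show ?thesis unfolding val_def by (simp add: pull_other[OF k])
  qed
qed

lemma keeps_vertex_matched:
  assumes "w \<in> vertices D" shows "vertex_matched w (P u)"
  unfolding vertex_matched_def
proof (intro ballI)
  have eq: "val (P u) k w = val u k w" if k: "k \<in> vertex_patches D w" for k
    by (rule val_unchanged[OF vertex_patches_vertex(1)[OF assms k]])
       (use k vertex_patches_vertex(2)[OF assms k] in \<open>simp_all add: vertex_patches_def\<close>)
  fix k k' assume kk: "k \<in> vertex_patches D w" "k' \<in> vertex_patches D w"
  have "val u k w = val u k' w" using bspec[OF v assms] kk unfolding vertex_matched_def by blast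
  then show "val (P u) k w = val (P u) k' w" unfolding eq[OF kk(1)] eq[OF kk(2)] .
qed

text \<open>Two edges of a patch meet at vertices of the patch only, where nothing changes.\<close>

lemma keeps_edge_matched:
  assumes e': "interior_edge D e'" "e' \<noteq> e" "edge_matched e' u" shows "edge_matched e' (P u)"
  unfolding edge_matched_def
proof (intro ballI)
  have ed': "e' \<in> edges D" and ed: "e \<in> edges D" using e'(1) inner unfolding interior_edge_def by blast+
  have eq: "val (P u) k x = val u k x" if k: "k \<in> edge_patches D e'" and x: "x \<in> e'" for k x
  proof (rule val_unchanged)
    note kK = edge_patches_edge[OF ed' k]
    show "k \<in> K" by (rule kK)
    show "x \<in> frontier (patch D k)" using x k by (auto simp: edge_patches_def)
    assume kk: "k \<in> {km, kp}" and xe: "x \<in> e"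
    have "e \<in> patch_edges D k" by (rule edge_patches_edge(2)[OF ed]) (use kk kmp(4) in simp)
    then obtain S where S: "S \<in> sides" "e = F k ` S" unfolding patch_edges_eq by (rule imageE)
    obtain S' where S': "S' \<in> sides" "e' = F k ` S'" using kK(2) unfolding patch_edges_eq by (rule imageE)
    have "S \<noteq> S'" using e'(2) S(2) S'(2) by metis
    obtain y where y: "y \<in> S" "x = F k y" using xe unfolding S(2) by (rule imageE)
    obtain y' where y': "y' \<in> S'" "x = F k y'" using x unfolding S'(2) by (rule imageE)
    have "y \<in> sq_closed" "y' \<in> sq_closed" using y(1) y'(1) side_subset[OF S(1)] side_subset[OF S'(1)] by blast+
    then have "y = y'" using G_F[OF kK(1)] y(2) y'(2) by metis
    then have "y \<in> corners" using sides_Int[OF S(1) S'(1) \<open>S \<noteq> S'\<close>] y(1) y'(1) by blast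
    then show "x \<in> patch_vertices D k" unfolding patch_vertices_eq y(2) by (rule imageI)
  qed
  fix x k k' assume x: "x \<in> e'" and kk: "k \<in> edge_patches D e'" "k' \<in> edge_patches D e'"
  have "val u k x = val u k' x" using e'(3) x kk unfolding edge_matched_def by blast
  then show "val (P u) k x = val (P u) k' x" unfolding eq[OF kk(1) x] eq[OF kk(2) x] .
qed

text \<open>Both traces become \<open>(t\<^sub>- + R t\<^sub>+) / 2\<close>.\<close>

lemma makes_edge_matched: "edge_matched e (P u)"
  unfolding edge_matched_iff
proof
  fix s :: real assume s: "s \<in> {0..1}"
  then have "(s, 0) \<in> sq_closed" by (simp add: sq_closed_def)
  then have q: "square_sym \<sigma>m (s, 0) \<in> sq_closed" "square_sym \<sigma>p (s, 0) \<in> sq_closed" by simp_all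
  show "trace_m (P u) s = trace_p (P u) s"
    unfolding trace_m_def[of "P u"] trace_p_def[of "P u"] pull_m[OF q(1)] pull_p[OF q(2)] untwist_square_sym
    by (simp add: tensor_def end_values jump_def defect_def trace_m_def[of u, symmetric] trace_p_def[of u, symmetric] field_simps)
qed

text \<open>If the two traces agree, the fine one is a coarse spline and \<open>R\<close> leaves it unchanged, so that all
corrections are zero.\<close>

lemma fixes_edge_matched:
  assumes "edge_matched e u" shows "P u = u"
proof -
  have "trace_m u = trace_p u"
  proof
    fix s show "trace_m u s = trace_p u s"
    proof (cases "s \<in> {0..1}")
      case True then show ?thesis using assms unfolding edge_matched_iff by blast
    next
      case False
      show ?thesis unfolding ed.cm.splines_outside[OF trace_splines(1)[OF u] False] ed.cp.splines_outside[OF trace_splines(2)[OF u] False] ..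
    qed
  qed
  moreover from this have "R (trace_p u) = trace_p u" using ed.R_id[OF trace_splines(2)[OF u]] trace_splines(1)[OF u] by simp
  ultimately have z: "jump u s = 0" "defect u s = 0" for s by (simp_all add: jump_def defect_def)
  show ?thesis
  proof (rule Vpw_eqI[OF Pu u])
    fix k assume k: "k \<in> K"
    show "pull k (P u) = pull k u"
    proof (rule spline_patch.tensor_splines_eqI[OF spline_patch[OF k] pull(1)[OF Pu k] pull(1)[OF u k]])
      fix x assume "x \<in> sq_open"
      then have x: "x \<in> sq_closed" using sq_basic(4) by blast
      consider "k = km" | "k = kp" | "k \<noteq> km" "k \<noteq> kp" by blast
      then show "pull k (P u) x = pull k u x"
      proof cases
        case 1 then show ?thesis using pull_m[OF x] z by (simp add: untwist_def tensor_def)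
      next
        case 2 then show ?thesis using pull_p[OF x] z by (simp add: untwist_def tensor_def)
      next
        case 3 then show ?thesis by (simp add: pull_other[OF k])
      qed
    qed
  qed
qed

lemma keeps_moments:
  assumes k: "k \<in> K" shows "moments2_vanish r (\<lambda>x. pull k (P u) x - pull k u x)"
proof -
  have mm: "moments_vanish r end_m" "moments_vanish r end_p"
    using ed.cm.end_moments[of False] ed.cp.end_moments[of False] by (simp_all add: end_m_def[abs_def] end_p_def[abs_def] end_idx_def)
  have md: "moments_vanish r (defect u)" unfolding defect_def[abs_def] by (rule ed.R_moments[OF trace_splines(2)[OF u]])
  note c = jump_regular ed.cp.lam_continuous
  have m1: "moments2_vanish r (untwist \<sigma>m (jump u \<otimes>\<^sub>t end_m))" and m2: "moments2_vanish r (untwist \<sigma>p (jump u \<otimes>\<^sub>t end_p))"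
    and m3: "moments2_vanish r (untwist \<sigma>p (defect u \<otimes>\<^sub>t lam D kp 0))"
    unfolding untwist_def[abs_def]
    by (rule square_sym_tensor_regular(2)[OF c(1) c(3)], rule disjI2, rule mm)
       (rule square_sym_tensor_regular(2)[OF c(1) c(4)], rule disjI2, rule mm,
        rule square_sym_tensor_regular(2)[OF c(2) c(5)], rule disjI1, rule md)
  have cc: "continuous_on sq_closed (untwist \<sigma>m (jump u \<otimes>\<^sub>t end_m))" "continuous_on sq_closed (untwist \<sigma>p (jump u \<otimes>\<^sub>t end_p))"
    "continuous_on sq_closed (untwist \<sigma>p (defect u \<otimes>\<^sub>t lam D kp 0))"
    unfolding untwist_def[abs_def] by (intro square_sym_tensor_regular(1) c)+
  consider "k = km" | "k = kp" | "k \<noteq> km" "k \<noteq> kp" by blast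
  then show ?thesis
  proof cases
    case 1
    have "moments2_vanish r (\<lambda>x. (- 1 / 2) * untwist \<sigma>m (jump u \<otimes>\<^sub>t end_m) x + 0 * 0)"
      by (rule moments2_vanish_lincomb[OF m1 moments2_vanish_0 cc(1) continuous_on_const])
    moreover have "moments2_vanish r (\<lambda>x. pull km (P u) x - pull km u x) \<longleftrightarrow> moments2_vanish r (\<lambda>x. (- 1 / 2) * untwist \<sigma>m (jump u \<otimes>\<^sub>t end_m) x + 0 * 0)"
      by (rule moments2_vanish_cong) (simp add: pull_m)
    ultimately show ?thesis unfolding 1 by blast
  next
    case 2
    have "moments2_vanish r (\<lambda>x. 1 / 2 * untwist \<sigma>p (jump u \<otimes>\<^sub>t end_p) x + 1 * untwist \<sigma>p (defect u \<otimes>\<^sub>t lam D kp 0) x)"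
      by (rule moments2_vanish_lincomb[OF m2 m3 cc(2,3)])
    moreover have "moments2_vanish r (\<lambda>x. pull kp (P u) x - pull kp u x) \<longleftrightarrow>
      moments2_vanish r (\<lambda>x. 1 / 2 * untwist \<sigma>p (jump u \<otimes>\<^sub>t end_p) x + 1 * untwist \<sigma>p (defect u \<otimes>\<^sub>t lam D kp 0) x)"
      by (rule moments2_vanish_cong) (simp add: pull_p)
    ultimately show ?thesis unfolding 2 by blast
  next
    case 3
    then show ?thesis by (simp add: pull_other[OF k] moments2_vanish_0)
  qed
qed

end

end

section \<open>Composition of the local operators\<close>

context multipatch_operators
begin

text \<open>Collects what the composition needs, for interior and boundary edges alike. Linearity at a boundary edge
holds because the operator is the identity on the broken space.\<close>

lemma edge_operator_properties:
  assumes "edge_operator D r \<gamma> e P"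
  shows "linear_op_on (Vpw D) P"
    and "u \<in> Vpw D \<Longrightarrow> \<forall>v\<in>vertices D. vertex_matched v u \<Longrightarrow> \<forall>v\<in>vertices D. vertex_matched v (P u)"
    and "u \<in> Vpw D \<Longrightarrow> \<forall>v\<in>vertices D. vertex_matched v u \<Longrightarrow> interior_edge D e' \<Longrightarrow> edge_matched e' u \<or> e' = e \<Longrightarrow> edge_matched e' (P u)"
    and "u \<in> Vpw D \<Longrightarrow> conforming u \<Longrightarrow> P u = u"
    and "u \<in> Vpw D \<Longrightarrow> \<forall>v\<in>vertices D. vertex_matched v u \<Longrightarrow> k \<in> K \<Longrightarrow> moments2_vanish r (\<lambda>x. pull k (P u) x - pull k u x)"
proof -
  have "linear_op_on (Vpw D) P \<and> (\<forall>u\<in>Vpw D. (\<forall>v\<in>vertices D. vertex_matched v u) \<longrightarrow>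
    (\<forall>v\<in>vertices D. vertex_matched v (P u)) \<and>
    (\<forall>e'. interior_edge D e' \<longrightarrow> edge_matched e' u \<or> e' = e \<longrightarrow> edge_matched e' (P u)) \<and>
    (conforming u \<longrightarrow> P u = u) \<and> (\<forall>k\<in>K. moments2_vanish r (\<lambda>x. pull k (P u) x - pull k u x)))"
    (is "?L \<and> (\<forall>u\<in>Vpw D. ?M u \<longrightarrow> ?A u)")
  proof (cases "interior_edge D e")
    case True
    then obtain km kp Fe where fr: "edge_frame D e km kp Fe" and P: "edge_operator_for D r \<gamma> km kp Fe P"
      using assms unfolding edge_operator_def by auto
    obtain \<sigma>m \<sigma>p where sg: "\<forall>x \<in> {0..1} \<times> {-1..0}. Fe x = F km (square_sym \<sigma>m (fst x, - snd x))"
      "\<forall>x \<in> {0..1} \<times> {0..1}. Fe x = F kp (square_sym \<sigma>p x)"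
      using fr unfolding edge_frame_def by (elim conjE exE)
    have es: "edge_setting D r \<gamma> e km kp Fe \<sigma>m \<sigma>p"
      by (intro edge_setting.intro edge_setting_axioms.intro multipatch_operators_axioms fr True)
         (use sg in blast)+
    have "?A u" if u: "u \<in> Vpw D" and m: "?M u" for u
    proof -
      note v = m
      show ?thesis
      proof (intro conjI ballI allI impI)
        fix w assume "w \<in> vertices D" then show "vertex_matched w (P u)" by (rule edge_setting.keeps_vertex_matched[OF es P u v])
      next
        fix e' assume e': "interior_edge D e'" "edge_matched e' u \<or> e' = e"
        show "edge_matched e' (P u)"
        proof (cases "e' = e")
          case True
          show ?thesis unfolding True by (rule edge_setting.makes_edge_matched[OF es P u v])
        next
          case False
          then have "edge_matched e' u" using e'(2) by blast
          then show ?thesis by (rule edge_setting.keeps_edge_matched[OF es P u v e'(1) False])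
        qed
      next
        assume "conforming u"
        then have "edge_matched e u" using True unfolding conforming_def by blast
        then show "P u = u" by (rule edge_setting.fixes_edge_matched[OF es P u v])
      next
        fix k assume "k \<in> K"
        then show "moments2_vanish r (\<lambda>x. pull k (P u) x - pull k u x)" by (rule edge_setting.keeps_moments[OF es P u v])
      qed
    qed
    then show ?thesis using edge_setting.P_linear[OF es P] by blast
  next
    case False
    then have id: "P u = u" if "u \<in> Vpw D" for u using assms that unfolding edge_operator_def by simp
    have "linear_op_on (Vpw D) P" unfolding linear_op_on_def
      by (simp add: id Vpw_lincomb)
    moreover have "edge_matched e' u" if "interior_edge D e'" "edge_matched e' u \<or> e' = e" for e' u
      using that False by blast
    ultimately show ?thesis using False by (simp add: id moments2_vanish_0)
  qed
  then show "linear_op_on (Vpw D) P"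
    and "u \<in> Vpw D \<Longrightarrow> \<forall>v\<in>vertices D. vertex_matched v u \<Longrightarrow> \<forall>v\<in>vertices D. vertex_matched v (P u)"
    and "u \<in> Vpw D \<Longrightarrow> \<forall>v\<in>vertices D. vertex_matched v u \<Longrightarrow> interior_edge D e' \<Longrightarrow> edge_matched e' u \<or> e' = e \<Longrightarrow> edge_matched e' (P u)"
    and "u \<in> Vpw D \<Longrightarrow> conforming u \<Longrightarrow> P u = u"
    and "u \<in> Vpw D \<Longrightarrow> \<forall>v\<in>vertices D. vertex_matched v u \<Longrightarrow> k \<in> K \<Longrightarrow> moments2_vanish r (\<lambda>x. pull k (P u) x - pull k u x)"
    unfolding conforming_def by blast+
qed

lemma moments_trans:
  assumes "u \<in> Vpw D" "v \<in> Vpw D" "w \<in> Vpw D" "k \<in> K"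
    and "moments2_vanish r (\<lambda>x. pull k v x - pull k u x)" "moments2_vanish r (\<lambda>x. pull k w x - pull k v x)"
  shows "moments2_vanish r (\<lambda>x. pull k w x - pull k u x)"
proof -
  have "continuous_on sq_closed (\<lambda>x. pull k b x - pull k a x)" if "a \<in> Vpw D" "b \<in> Vpw D" for a b
    by (intro continuous_on_diff spline_patch.tensor_splines_continuous[OF spline_patch pull(1)] that assms(4))
  from moments2_vanish_lincomb[OF assms(5,6) this[OF assms(1,2)] this[OF assms(2,3)], of 1 1]
  show ?thesis by simp
qed

text \<open>Each further operator makes its own vertex match and keeps the vertices that match already.\<close>

lemma vertex_stage:
  assumes "\<And>v. v \<in> set vs \<Longrightarrow> vertex_operator D r \<gamma> v (PV v)" "set vs \<subseteq> vertices D"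
  defines "Q \<equiv> foldr (\<circ>) (map PV vs) id"
  shows "linear_op_on (Vpw D) Q \<and> (\<forall>u\<in>Vpw D. (\<forall>v\<in>set vs. vertex_matched v (Q u)) \<and>
    (conforming u \<longrightarrow> Q u = u) \<and> (\<forall>k\<in>K. moments2_vanish r (\<lambda>x. pull k (Q u) x - pull k u x)))"
  using assms(1,2) unfolding Q_def
proof (induction vs)
  case Nil
  show ?case using linear_op_on_id by (simp add: id_def moments2_vanish_0)
next
  case (Cons w vs)
  define R where "R = foldr (\<circ>) (map PV vs) id"
  have P: "vertex_operator D r \<gamma> w (PV w)" and w: "w \<in> vertices D" using Cons.prems by simp_all
  have lP: "linear_op_on (Vpw D) (PV w)" using P unfolding vertex_operator_def by blast
  have IH: "linear_op_on (Vpw D) R \<and> (\<forall>u\<in>Vpw D. (\<forall>v\<in>set vs. vertex_matched v (R u)) \<and>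
    (conforming u \<longrightarrow> R u = u) \<and> (\<forall>k\<in>K. moments2_vanish r (\<lambda>x. pull k (R u) x - pull k u x)))"
    unfolding R_def by (rule Cons.IH) (use Cons.prems in auto)
  have f: "foldr (\<circ>) (map PV (w # vs)) id = PV w \<circ> R" by (simp add: R_def)
  show ?case unfolding f
  proof (intro conjI ballI impI)
    show "linear_op_on (Vpw D) (PV w \<circ> R)" by (rule linear_op_on_comp[OF lP conjunct1[OF IH]])
    fix u assume u: "u \<in> Vpw D"
    have Ru: "R u \<in> Vpw D" using IH u by (blast intro: lin_closed)
    show "vertex_matched v ((PV w \<circ> R) u)" if v: "v \<in> set (w # vs)" for v
    proof (cases "v = w")
      case True
      show ?thesis unfolding True o_apply by (rule vertex_operator_matches(1)[OF P w Ru])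
    next
      case False
      then have "vertex_matched v (R u)" "v \<in> vertices D" using IH u v Cons.prems(2) by auto
      then show ?thesis unfolding o_apply by (intro vertex_operator_matches(2)[OF P w Ru])
    qed
    show "(PV w \<circ> R) u = u" if c: "conforming u"
    proof -
      have "R u = u" using IH u c by blast
      moreover have "vertex_matched w u" using c w unfolding conforming_def by blast
      ultimately show ?thesis using vertex_operator_fixes[OF P w u] by simp
    qed
    fix k assume k: "k \<in> K"
    have "moments2_vanish r (\<lambda>x. pull k (R u) x - pull k u x)" using IH u k by blast
    then show "moments2_vanish r (\<lambda>x. pull k ((PV w \<circ> R) u) x - pull k u x)" unfolding o_apply
      by (rule moments_trans[OF u Ru lin_closed[OF lP Ru] k _ vertex_operator_moments[OF P w Ru k]])
  qed
qed

text \<open>The edge operators need matching vertices from the start and keep them, so the induction carries this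
property along.\<close>

lemma edge_stage:
  assumes "\<And>e. e \<in> set es \<Longrightarrow> edge_operator D r \<gamma> e (PE e)"
  defines "Q \<equiv> foldr (\<circ>) (map PE es) id"
  shows "linear_op_on (Vpw D) Q \<and> (\<forall>u\<in>Vpw D. (conforming u \<longrightarrow> Q u = u) \<and> ((\<forall>v\<in>vertices D. vertex_matched v u) \<longrightarrow>
    (\<forall>v\<in>vertices D. vertex_matched v (Q u)) \<and> (\<forall>e\<in>set es. interior_edge D e \<longrightarrow> edge_matched e (Q u)) \<and>
    (\<forall>k\<in>K. moments2_vanish r (\<lambda>x. pull k (Q u) x - pull k u x))))"
  using assms(1) unfolding Q_def
proof (induction es)
  case Nil
  show ?case using linear_op_on_id by (simp add: id_def moments2_vanish_0)
next
  case (Cons e es)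
  define R where "R = foldr (\<circ>) (map PE es) id"
  have P: "edge_operator D r \<gamma> e (PE e)" using Cons.prems by simp
  note p = edge_operator_properties[OF P]
  have IH: "linear_op_on (Vpw D) R \<and> (\<forall>u\<in>Vpw D. (conforming u \<longrightarrow> R u = u) \<and> ((\<forall>v\<in>vertices D. vertex_matched v u) \<longrightarrow>
    (\<forall>v\<in>vertices D. vertex_matched v (R u)) \<and> (\<forall>e\<in>set es. interior_edge D e \<longrightarrow> edge_matched e (R u)) \<and>
    (\<forall>k\<in>K. moments2_vanish r (\<lambda>x. pull k (R u) x - pull k u x))))"
    unfolding R_def by (rule Cons.IH) (use Cons.prems in auto)
  have f: "foldr (\<circ>) (map PE (e # es)) id = PE e \<circ> R" by (simp add: R_def)
  have lR: "linear_op_on (Vpw D) R" using IH by blast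
  have step: "(conforming u \<longrightarrow> (PE e \<circ> R) u = u) \<and> ((\<forall>v\<in>vertices D. vertex_matched v u) \<longrightarrow>
    (\<forall>v\<in>vertices D. vertex_matched v ((PE e \<circ> R) u)) \<and> (\<forall>e'\<in>set (e # es). interior_edge D e' \<longrightarrow> edge_matched e' ((PE e \<circ> R) u)) \<and>
    (\<forall>k\<in>K. moments2_vanish r (\<lambda>x. pull k ((PE e \<circ> R) u) x - pull k u x)))" if u: "u \<in> Vpw D" for u
    unfolding o_apply
  proof (intro conjI impI)
    have Ru: "R u \<in> Vpw D" by (rule lin_closed[OF lR u])
    show "PE e (R u) = u" if "conforming u" using IH u that p(4)[OF u] by metis
    assume m: "\<forall>v\<in>vertices D. vertex_matched v u"
    have Rm: "\<forall>v\<in>vertices D. vertex_matched v (R u)" and Re: "\<And>e'. e' \<in> set es \<Longrightarrow> interior_edge D e' \<Longrightarrow> edge_matched e' (R u)"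
      and RM: "\<And>k. k \<in> K \<Longrightarrow> moments2_vanish r (\<lambda>x. pull k (R u) x - pull k u x)"
      using IH u m by blast+
    show "\<forall>v\<in>vertices D. vertex_matched v (PE e (R u))" by (rule p(2)[OF Ru Rm])
    show "\<forall>e'\<in>set (e # es). interior_edge D e' \<longrightarrow> edge_matched e' (PE e (R u))"
    proof (intro ballI impI)
      fix e' assume e': "e' \<in> set (e # es)" "interior_edge D e'"
      have "edge_matched e' (R u) \<or> e' = e" using e' Re by auto
      then show "edge_matched e' (PE e (R u))" by (rule p(3)[OF Ru Rm e'(2)])
    qed
    show "\<forall>k\<in>K. moments2_vanish r (\<lambda>x. pull k (PE e (R u)) x - pull k u x)"
    proof
      fix k assume k: "k \<in> K"
      show "moments2_vanish r (\<lambda>x. pull k (PE e (R u)) x - pull k u x)"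
        by (rule moments_trans[OF u Ru lin_closed[OF p(1) Ru] k RM[OF k] p(5)[OF Ru Rm k]])
    qed
  qed
  show ?case unfolding f by (intro conjI[OF linear_op_on_comp[OF p(1) lR]] ballI step)
qed

end

theorem theorem3p3:
  fixes D :: multipatch
    and r :: nat
    and \<gamma> :: "nat \<Rightarrow> nat \<Rightarrow> real"
    and PV :: "real \<times> real \<Rightarrow> (real \<times> real \<Rightarrow> real) \<Rightarrow> real \<times> real \<Rightarrow> real"
    and PE :: "(real \<times> real) set \<Rightarrow> (real \<times> real \<Rightarrow> real) \<Rightarrow> real \<times> real \<Rightarrow> real"
    and vs :: "(real \<times> real) list"
    and es :: "(real \<times> real) set list"
    and P0 :: "(real \<times> real \<Rightarrow> real) \<Rightarrow> real \<times> real \<Rightarrow> real"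
  assumes "multipatch_domain D"
    and "spline_assumptions D"
    and "r \<le> sdeg D + 1"
    and "correction_coeffs D r \<gamma>"
    and "\<And>v. v \<in> vertices D \<Longrightarrow> vertex_operator D r \<gamma> v (PV v)"
    and "\<And>e. e \<in> edges D \<Longrightarrow> edge_operator D r \<gamma> e (PE e)"
    and "distinct vs" and "set vs = vertices D"
    and "distinct es" and "set es = edges D"
    and "P0 = foldr (\<circ>) (map PE es) id \<circ> foldr (\<circ>) (map PV vs) id"
  shows "projection_onto (Vpw D) (Vh D) P0 \<and> moment_preserving D r P0"
proof -
  interpret multipatch_operators D r \<gamma>
    by unfold_locales (fact assms(1-4))+
  define QV where "QV = foldr (\<circ>) (map PV vs) id"
  define QE where "QE = foldr (\<circ>) (map PE es) id"
  have V: "linear_op_on (Vpw D) QV \<and> (\<forall>u\<in>Vpw D. (\<forall>v\<in>set vs. vertex_matched v (QV u)) \<and>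
    (conforming u \<longrightarrow> QV u = u) \<and> (\<forall>k\<in>K. moments2_vanish r (\<lambda>x. pull k (QV u) x - pull k u x)))"
    unfolding QV_def by (rule vertex_stage) (use assms(5,8) in simp_all)
  have E: "linear_op_on (Vpw D) QE \<and> (\<forall>u\<in>Vpw D. (conforming u \<longrightarrow> QE u = u) \<and> ((\<forall>v\<in>vertices D. vertex_matched v u) \<longrightarrow>
    (\<forall>v\<in>vertices D. vertex_matched v (QE u)) \<and> (\<forall>e\<in>set es. interior_edge D e \<longrightarrow> edge_matched e (QE u)) \<and>
    (\<forall>k\<in>K. moments2_vanish r (\<lambda>x. pull k (QE u) x - pull k u x))))"
    unfolding QE_def by (rule edge_stage) (use assms(6,10) in simp_all)
  have P0: "P0 = QE \<circ> QV" unfolding assms(11) QE_def QV_def ..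
  have lV: "linear_op_on (Vpw D) QV" and lE: "linear_op_on (Vpw D) QE" using V E by blast+
  have lin: "linear_op_on (Vpw D) P0" unfolding P0 by (rule linear_op_on_comp[OF lE lV])
  have props: "P0 u \<in> Vh D" "k \<in> K \<Longrightarrow> moments2_vanish r (\<lambda>x. pull k (P0 u) x - pull k u x)" if u: "u \<in> Vpw D" for u k
  proof -
    have Q: "QV u \<in> Vpw D" by (rule lin_closed[OF lV u])
    have m: "\<forall>v\<in>vertices D. vertex_matched v (QV u)" using V u assms(8) by blast
    have ee: "\<forall>v\<in>vertices D. vertex_matched v (QE (QV u))" "\<forall>e\<in>set es. interior_edge D e \<longrightarrow> edge_matched e (QE (QV u))"
      and em: "\<And>k. k \<in> K \<Longrightarrow> moments2_vanish r (\<lambda>x. pull k (QE (QV u)) x - pull k (QV u) x)"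
      using E Q m by blast+
    have "conforming (QE (QV u))" using ee assms(10) unfolding conforming_def interior_edge_def by blast
    then show "P0 u \<in> Vh D" unfolding Vh_iff P0 o_apply using lin_closed[OF lE Q] by blast
    assume k: "k \<in> K"
    have "moments2_vanish r (\<lambda>x. pull k (QV u) x - pull k u x)" using V u k by blast
    then show "moments2_vanish r (\<lambda>x. pull k (P0 u) x - pull k u x)" unfolding P0 o_apply
      by (rule moments_trans[OF u Q lin_closed[OF lE Q] k _ em[OF k]])
  qed
  have fixes_Vh: "P0 u = u" if "u \<in> Vh D" for u
  proof -
    have "u \<in> Vpw D" "conforming u" using that unfolding Vh_iff by blast+
    then show ?thesis using V E unfolding P0 o_apply by metis
  qed
  have "P0 ` Vpw D = Vh D"
  proof
    show "P0 ` Vpw D \<subseteq> Vh D" using props(1) by blast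
    show "Vh D \<subseteq> P0 ` Vpw D" using fixes_Vh by (metis Vh_iff image_eqI subsetI)
  qed
  then have "projection_onto (Vpw D) (Vh D) P0"
    unfolding projection_onto_def using lin fixes_Vh props(1) by blast
  moreover have "moment_preserving D r P0"
    unfolding moment_preserving_def Let_def
  proof (intro ballI allI)
    fix u k c assume u: "u \<in> Vpw D" and k: "k \<in> K"
    show "(LINT x:sq_open|lborel. P0 u (F k x) * (\<Sum>i<r. \<Sum>j<r. c i j * fst x ^ i * snd x ^ j)) =
      (LINT x:sq_open|lborel. u (F k x) * (\<Sum>i<r. \<Sum>j<r. c i j * fst x ^ i * snd x ^ j))"
      by (rule moment_identity[OF u lin_closed[OF lin u] k props(2)[OF u k], of c, unfolded test_poly_def])
  qed
  ultimately show ?thesis ..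
qed

end
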